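(* Let $X$ be a complete simplicial toric variety and let $\varphi:\mathbb P^n\dashrightarrow X$ be a dominant rational map satisfying $\operatorname{codim}(\varphi^{-1}(Sing(X)))\ge 2$. Then $\varphi$ admits a complete polynomial lifting.
   Context: $X$ is the (normal) toric variety over $\mathbb C$ of a fan $\Sigma$; $v_1,\dots,v_m$ are the primitive generators of its rays. $\mathbb C[z_1,\dots,z_m]$ is the homogeneous coordinate (Cox) ring, $I_Z=\langle\prod_{v_i\notin\sigma(1)}z_i:\sigma\in\Sigma\rangle$ the irrelevant ideal, $Z\subset\mathbb C^m$ its zero set, $G=Hom_{\mathbb Z}(Cl(X),\mathbb C^* )$ and $\pi_X:\mathbb C^m\setminus Z\to X$ the geometric quotient by $G$. Let $\pi:\mathbb C^{n+1}\setminus\{0\}\to\mathbb P^n$ be the standard quotient. $Sing(X)$ is the singular locus of $X$. A complete polynomial lifting of $\varphi$ is a tuple $F=(F_1,\dots,F_m)$ of homogeneous polynomials in $\mathbb C[x_0,\dots,x_n]$ such that $\pi_X\circ F=\varphi\circ\pi$ as rational maps and $Reg(\varphi)=\mathbb P^n\setminus\pi(F^{-1}(Z))$, where $Reg(\varphi)$ is the maximal Zariski open subset on which $\varphi$ is well defined as a regular map. *)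

theory Defs
  imports
    "HOL-Analysis.Analysis"
    "HOL-Library.Poly_Mapping"
    "HOL-Library.Function_Algebras"
begin

section \<open>Polynomials and affine space\<close>

text \<open>Polynomials over the complex numbers in variables indexed by the type \<open>'i\<close>: finitely
  supported maps from exponent vectors to coefficients. The points of the affine space with
  coordinates in \<open>I\<close> are the functions that vanish off \<open>I\<close>.\<close>

type_synonym 'i mpoly = "('i \<Rightarrow>\<^sub>0 nat) \<Rightarrow>\<^sub>0 complex"

definition polys :: "'i set \<Rightarrow> 'i mpoly set" where
  "polys I = {p. \<forall>m\<in>Poly_Mapping.keys p. Poly_Mapping.keys m \<subseteq> I}"

definition mono_eval :: "('i \<Rightarrow>\<^sub>0 nat) \<Rightarrow> ('i \<Rightarrow> complex) \<Rightarrow> complex" where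
  "mono_eval m x = (\<Prod>i\<in>Poly_Mapping.keys m. x i ^ Poly_Mapping.lookup m i)"

definition poly_eval :: "'i mpoly \<Rightarrow> ('i \<Rightarrow> complex) \<Rightarrow> complex" where
  "poly_eval p x = (\<Sum>m\<in>Poly_Mapping.keys p. Poly_Mapping.lookup p m * mono_eval m x)"

definition poly_var :: "'i \<Rightarrow> 'i mpoly" where
  "poly_var i = Poly_Mapping.single (Poly_Mapping.single i 1) 1"

definition homogeneous :: "nat \<Rightarrow> 'i mpoly \<Rightarrow> bool" where
  "homogeneous k p \<longleftrightarrow>
     (\<forall>m\<in>Poly_Mapping.keys p. (\<Sum>i\<in>Poly_Mapping.keys m. Poly_Mapping.lookup m i) = k)"

definition affine_space :: "'i set \<Rightarrow> ('i \<Rightarrow> complex) set" where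
  "affine_space I = {x. \<forall>i. i \<notin> I \<longrightarrow> x i = 0}"

definition zariski_affine :: "'i set \<Rightarrow> ('i \<Rightarrow> complex) topology" where
  "zariski_affine I =
     topology_generated_by {{x \<in> affine_space I. poly_eval p x \<noteq> 0} | p. p \<in> polys I}"

section \<open>Projective space\<close>

text \<open>Homogeneous coordinates are indexed by \<open>{..n}\<close>; a point of projective space is the set of
  all nonzero multiples of a nonzero vector.\<close>

definition punctured_space :: "nat \<Rightarrow> (nat \<Rightarrow> complex) set" where
  "punctured_space n = affine_space {..n} - {\<lambda>_. 0}"

definition proj_pt :: "(nat \<Rightarrow> complex) \<Rightarrow> (nat \<Rightarrow> complex) set" where
  "proj_pt x = {(\<lambda>i. c * x i) | c. c \<noteq> 0}"

definition proj_space :: "nat \<Rightarrow> (nat \<Rightarrow> complex) set set" where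
  "proj_space n = proj_pt ` punctured_space n"

definition zariski_proj :: "nat \<Rightarrow> (nat \<Rightarrow> complex) set topology" where
  "zariski_proj n = topology_generated_by
     {proj_pt ` {x \<in> punctured_space n. poly_eval p x \<noteq> 0} | p.
        p \<in> polys {..n} \<and> (\<exists>k. homogeneous k p)}"

definition regular_fun_proj ::
  "nat \<Rightarrow> (nat \<Rightarrow> complex) set set \<Rightarrow> ((nat \<Rightarrow> complex) set \<Rightarrow> complex) \<Rightarrow> bool" where
  "regular_fun_proj n U g \<longleftrightarrow> openin (zariski_proj n) U \<and>
     (\<forall>P\<in>U. \<exists>W a b k. openin (zariski_proj n) W \<and> P \<in> W \<and> W \<subseteq> U \<and>
        a \<in> polys {..n} \<and> b \<in> polys {..n} \<and> homogeneous k a \<and> homogeneous k b \<and>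
        (\<forall>x\<in>punctured_space n. proj_pt x \<in> W \<longrightarrow>
           poly_eval b x \<noteq> 0 \<and> g (proj_pt x) = poly_eval a x / poly_eval b x))"

section \<open>Lattices, cones and fans\<close>

text \<open>The lattice \<open>N\<close> sits in a Euclidean space and may have any rank, including 0; the real vector
  space it generates is \<open>span N\<close>. The dual lattice \<open>M\<close> is realised in \<open>span N\<close> by the inner product.\<close>

definition is_lattice :: "'a::euclidean_space set \<Rightarrow> bool" where
  "is_lattice N \<longleftrightarrow>
     (\<exists>B. independent B \<and> N = {(\<Sum>b\<in>B. of_int (c b) *\<^sub>R b) | c :: 'a \<Rightarrow> int. True})"

definition dual_lattice :: "'a::euclidean_space set \<Rightarrow> 'a set" where
  "dual_lattice N = {u \<in> span N. \<forall>v\<in>N. u \<bullet> v \<in> \<int>}"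

definition rational_cone :: "'a::euclidean_space set \<Rightarrow> 'a set \<Rightarrow> bool" where
  "rational_cone N \<sigma> \<longleftrightarrow> (\<exists>S. finite S \<and> S \<noteq> {} \<and> S \<subseteq> N \<and> \<sigma> = conic hull (convex hull S))"

definition strongly_convex :: "'a::euclidean_space set \<Rightarrow> bool" where
  "strongly_convex \<sigma> \<longleftrightarrow> (\<forall>v. v \<in> \<sigma> \<and> - v \<in> \<sigma> \<longrightarrow> v = 0)"

definition cone_face :: "'a::euclidean_space set \<Rightarrow> 'a set \<Rightarrow> bool" where
  "cone_face \<tau> \<sigma> \<longleftrightarrow> (\<exists>u. (\<forall>v\<in>\<sigma>. 0 \<le> u \<bullet> v) \<and> \<tau> = {v \<in> \<sigma>. u \<bullet> v = 0})"

definition is_fan :: "'a::euclidean_space set \<Rightarrow> 'a set set \<Rightarrow> bool" where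
  "is_fan N \<Sigma> \<longleftrightarrow> finite \<Sigma> \<and> \<Sigma> \<noteq> {} \<and>
     (\<forall>\<sigma>\<in>\<Sigma>. rational_cone N \<sigma> \<and> strongly_convex \<sigma>) \<and>
     (\<forall>\<sigma>\<in>\<Sigma>. \<forall>\<tau>. cone_face \<tau> \<sigma> \<longrightarrow> \<tau> \<in> \<Sigma>) \<and>
     (\<forall>\<sigma>\<in>\<Sigma>. \<forall>\<tau>\<in>\<Sigma>. cone_face (\<sigma> \<inter> \<tau>) \<sigma> \<and> cone_face (\<sigma> \<inter> \<tau>) \<tau>)"

definition primitive :: "'a::euclidean_space set \<Rightarrow> 'a \<Rightarrow> bool" where
  "primitive N v \<longleftrightarrow> v \<in> N \<and> v \<noteq> 0 \<and> (\<forall>w\<in>N. \<forall>k::int. v = of_int k *\<^sub>R w \<longrightarrow> \<bar>k\<bar> = 1)"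

text \<open>Rays are represented by their primitive generators: \<open>ray_gens N \<Sigma>\<close> is the set of all
  $v_1,\dots,v_m$, and \<open>cone_gens N \<sigma>\<close> is $\sigma(1)$.\<close>

definition ray_gens :: "'a::euclidean_space set \<Rightarrow> 'a set set \<Rightarrow> 'a set" where
  "ray_gens N \<Sigma> = {v. primitive N v \<and> conic hull {v} \<in> \<Sigma>}"

definition cone_gens :: "'a::euclidean_space set \<Rightarrow> 'a set \<Rightarrow> 'a set" where
  "cone_gens N \<sigma> = {v. primitive N v \<and> cone_face (conic hull {v}) \<sigma>}"

definition simplicial_fan :: "'a::euclidean_space set \<Rightarrow> 'a set set \<Rightarrow> bool" where
  "simplicial_fan N \<Sigma> \<longleftrightarrow> (\<forall>\<sigma>\<in>\<Sigma>. independent (cone_gens N \<sigma>))"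

section \<open>The toric variety of a fan\<close>

text \<open>\<open>dual_semigroup N \<sigma>\<close> is $S_\sigma = \sigma^\vee \cap M$. The points of the affine chart
  $U_\sigma = \mathrm{Spec}\,\mathbb C[S_\sigma]$ are the monoid homomorphisms from $S_\sigma$ to
  $(\mathbb C,\cdot)$. The variety $X_\Sigma$ is obtained by gluing $U_\sigma$ and $U_\tau$ along
  their common open subset $U_{\sigma\cap\tau}$.\<close>

type_synonym 'a toric_pt = "('a set \<times> ('a \<Rightarrow> complex)) set"

definition dual_semigroup :: "'a::euclidean_space set \<Rightarrow> 'a set \<Rightarrow> 'a set" where
  "dual_semigroup N \<sigma> = {u \<in> dual_lattice N. \<forall>v\<in>\<sigma>. 0 \<le> u \<bullet> v}"

definition chart :: "'a::euclidean_space set \<Rightarrow> 'a set \<Rightarrow> ('a \<Rightarrow> complex) set" where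
  "chart N \<sigma> = {\<gamma> \<in> extensional (dual_semigroup N \<sigma>). \<gamma> 0 = 1 \<and>
     (\<forall>u\<in>dual_semigroup N \<sigma>. \<forall>u'\<in>dual_semigroup N \<sigma>. \<gamma> (u + u') = \<gamma> u * \<gamma> u')}"

definition glue :: "'a::euclidean_space set \<Rightarrow> 'a set set \<Rightarrow>
    (('a set \<times> ('a \<Rightarrow> complex)) \<times> ('a set \<times> ('a \<Rightarrow> complex))) set" where
  "glue N \<Sigma> = {((\<sigma>, \<gamma>), (\<tau>, \<beta>)). \<sigma> \<in> \<Sigma> \<and> \<tau> \<in> \<Sigma> \<and> (\<exists>\<delta>\<in>chart N (\<sigma> \<inter> \<tau>).
     \<gamma> = restrict \<delta> (dual_semigroup N \<sigma>) \<and> \<beta> = restrict \<delta> (dual_semigroup N \<tau>))}"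

definition toric_pt :: "'a::euclidean_space set \<Rightarrow> 'a set set \<Rightarrow> 'a set \<Rightarrow> ('a \<Rightarrow> complex) \<Rightarrow>
    'a toric_pt" where
  "toric_pt N \<Sigma> \<sigma> \<gamma> = glue N \<Sigma> `` {(\<sigma>, \<gamma>)}"

definition toric_variety :: "'a::euclidean_space set \<Rightarrow> 'a set set \<Rightarrow> 'a toric_pt set" where
  "toric_variety N \<Sigma> = (SIGMA \<sigma>:\<Sigma>. chart N \<sigma>) // glue N \<Sigma>"

text \<open>Elements of the coordinate ring $\mathbb C[S_\sigma]$ are the finite linear combinations of
  characters $\chi^u$ with $u \in S_\sigma$, where $\chi^u(\gamma) = \gamma(u)$.\<close>

definition chart_ring :: "'a::euclidean_space set \<Rightarrow> 'a set \<Rightarrow> ('a \<Rightarrow>\<^sub>0 complex) set" where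
  "chart_ring N \<sigma> = {f. Poly_Mapping.keys f \<subseteq> dual_semigroup N \<sigma>}"

definition chart_eval :: "('a \<Rightarrow>\<^sub>0 complex) \<Rightarrow> ('a \<Rightarrow> complex) \<Rightarrow> complex" where
  "chart_eval f \<gamma> = (\<Sum>u\<in>Poly_Mapping.keys f. Poly_Mapping.lookup f u * \<gamma> u)"

definition zariski_toric :: "'a::euclidean_space set \<Rightarrow> 'a set set \<Rightarrow> 'a toric_pt topology" where
  "zariski_toric N \<Sigma> = topology_generated_by
     {toric_pt N \<Sigma> \<sigma> ` {\<gamma> \<in> chart N \<sigma>. chart_eval f \<gamma> \<noteq> 0} | \<sigma> f. \<sigma> \<in> \<Sigma> \<and> f \<in> chart_ring N \<sigma>}"

definition regular_fun_toric ::
  "'a::euclidean_space set \<Rightarrow> 'a set set \<Rightarrow> 'a toric_pt set \<Rightarrow> ('a toric_pt \<Rightarrow> complex) \<Rightarrow> bool" where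
  "regular_fun_toric N \<Sigma> V g \<longleftrightarrow> openin (zariski_toric N \<Sigma>) V \<and>
     (\<forall>x\<in>V. \<exists>W. \<exists>\<sigma>\<in>\<Sigma>. \<exists>a\<in>chart_ring N \<sigma>. \<exists>b\<in>chart_ring N \<sigma>.
        openin (zariski_toric N \<Sigma>) W \<and> x \<in> W \<and> W \<subseteq> V \<and> W \<subseteq> toric_pt N \<Sigma> \<sigma> ` chart N \<sigma> \<and>
        (\<forall>\<gamma>\<in>chart N \<sigma>. toric_pt N \<Sigma> \<sigma> \<gamma> \<in> W \<longrightarrow>
           chart_eval b \<gamma> \<noteq> 0 \<and> g (toric_pt N \<Sigma> \<sigma> \<gamma>) = chart_eval a \<gamma> / chart_eval b \<gamma>))"

text \<open>Completeness as universal closedness: for every \<open>k\<close> the projection of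
  $X_\Sigma\times\mathbb A^k$ to $\mathbb A^k$ is closed. (Closedness of a map is local on the target and
  passes to closed subvarieties of the target, so this gives closedness of the projection
  $X_\Sigma\times Y \to Y$ for every variety $Y$.) The product carries its Zariski topology, not the product
  topology: on $U_\sigma\times\mathbb A^k$ the functions are the elements of
  $\mathbb C[S_\sigma\times\mathbb N^k]$.\<close>

definition prod_ring :: "'a::euclidean_space set \<Rightarrow> 'a set \<Rightarrow> nat \<Rightarrow>
    (('a \<times> (nat \<Rightarrow>\<^sub>0 nat)) \<Rightarrow>\<^sub>0 complex) set" where
  "prod_ring N \<sigma> k =
     {f. Poly_Mapping.keys f \<subseteq> dual_semigroup N \<sigma> \<times> {m. Poly_Mapping.keys m \<subseteq> {..<k}}}"

definition prod_eval :: "(('a \<times> (nat \<Rightarrow>\<^sub>0 nat)) \<Rightarrow>\<^sub>0 complex) \<Rightarrow> ('a \<Rightarrow> complex) \<Rightarrow>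
    (nat \<Rightarrow> complex) \<Rightarrow> complex" where
  "prod_eval f \<gamma> y =
     (\<Sum>(u, m)\<in>Poly_Mapping.keys f. Poly_Mapping.lookup f (u, m) * \<gamma> u * mono_eval m y)"

definition zariski_prod :: "'a::euclidean_space set \<Rightarrow> 'a set set \<Rightarrow> nat \<Rightarrow>
    ('a toric_pt \<times> (nat \<Rightarrow> complex)) topology" where
  "zariski_prod N \<Sigma> k = topology_generated_by
     {{(toric_pt N \<Sigma> \<sigma> \<gamma>, y) | \<gamma> y.
         \<gamma> \<in> chart N \<sigma> \<and> y \<in> affine_space {..<k} \<and> prod_eval f \<gamma> y \<noteq> 0} | \<sigma> f.
      \<sigma> \<in> \<Sigma> \<and> f \<in> prod_ring N \<sigma> k}"

definition complete_variety :: "'a::euclidean_space set \<Rightarrow> 'a set set \<Rightarrow> bool" where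
  "complete_variety N \<Sigma> \<longleftrightarrow>
     (\<forall>k. closed_map (zariski_prod N \<Sigma> k) (zariski_affine {..<k}) snd)"

text \<open>The Zariski tangent space at a point \<open>\<gamma>\<close> of a chart consists of the point derivations of
  $\mathbb C[S_\sigma]$ at \<open>\<gamma>\<close>; a derivation is determined by its values on characters. A point is
  singular if the dimension of this complex vector space is not the dimension of $X_\Sigma$, which is
  the rank of \<open>N\<close>.\<close>

definition tangent_space :: "'a::euclidean_space set \<Rightarrow> 'a set \<Rightarrow> ('a \<Rightarrow> complex) \<Rightarrow>
    ('a \<Rightarrow> complex) set" where
  "tangent_space N \<sigma> \<gamma> = {D. (\<forall>u. u \<notin> dual_semigroup N \<sigma> \<longrightarrow> D u = 0) \<and>
     (\<forall>u\<in>dual_semigroup N \<sigma>. \<forall>u'\<in>dual_semigroup N \<sigma>. D (u + u') = \<gamma> u * D u' + \<gamma> u' * D u)}"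

definition complex_dim :: "('a \<Rightarrow> complex) set \<Rightarrow> nat" where
  "complex_dim = vector_space.dim (\<lambda>(c::complex) D u. c * D u)"

definition singular_locus :: "'a::euclidean_space set \<Rightarrow> 'a set set \<Rightarrow> 'a toric_pt set" where
  "singular_locus N \<Sigma> = {toric_pt N \<Sigma> \<sigma> \<gamma> | \<sigma> \<gamma>.
     \<sigma> \<in> \<Sigma> \<and> \<gamma> \<in> chart N \<sigma> \<and> complex_dim (tangent_space N \<sigma> \<gamma>) \<noteq> dim N}"

section \<open>The Cox ring and the quotient map\<close>

definition irrelevant_ideal :: "'a::euclidean_space set \<Rightarrow> 'a set set \<Rightarrow> 'a mpoly set" where
  "irrelevant_ideal N \<Sigma> =
     {(\<Sum>\<sigma>\<in>\<Sigma>. q \<sigma> * (\<Prod>v\<in>ray_gens N \<Sigma> - cone_gens N \<sigma>. poly_var v)) | q.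
        \<forall>\<sigma>\<in>\<Sigma>. q \<sigma> \<in> polys (ray_gens N \<Sigma>)}"

definition exceptional_set :: "'a::euclidean_space set \<Rightarrow> 'a set set \<Rightarrow> ('a \<Rightarrow> complex) set" where
  "exceptional_set N \<Sigma> =
     {z \<in> affine_space (ray_gens N \<Sigma>). \<forall>p\<in>irrelevant_ideal N \<Sigma>. poly_eval p z = 0}"

text \<open>The quotient map $\pi_X$ from $\mathbb C^m\setminus Z$ to $X$ is the toric morphism induced by
  $\mathbb Z^m\to N$, $e_i\mapsto v_i$. On the open set where $z_i\ne 0$ for all
  $v_i\notin\sigma(1)$ it maps into $U_\sigma$ and pulls $\chi^u$ back to
  $\prod_i z_i^{\langle u,v_i\rangle}$; the result does not depend on the choice of such a $\sigma$.
  Negative exponents only occur where $z_i\neq 0$, and \<open>0 powi 0 = 1\<close>.\<close>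

definition cox_quotient :: "'a::euclidean_space set \<Rightarrow> 'a set set \<Rightarrow> ('a \<Rightarrow> complex) \<Rightarrow>
    'a toric_pt" where
  "cox_quotient N \<Sigma> z =
     (let \<sigma> = (SOME \<sigma>. \<sigma> \<in> \<Sigma> \<and> (\<forall>v\<in>ray_gens N \<Sigma> - cone_gens N \<sigma>. z v \<noteq> 0))
      in toric_pt N \<Sigma> \<sigma> (\<lambda>u\<in>dual_semigroup N \<sigma>. \<Prod>v\<in>ray_gens N \<Sigma>. z v powi \<lfloor>u \<bullet> v\<rfloor>))"

section \<open>Rational maps from projective space\<close>

definition morphism :: "nat \<Rightarrow> 'a::euclidean_space set \<Rightarrow> 'a set set \<Rightarrow>
    (nat \<Rightarrow> complex) set set \<Rightarrow> ((nat \<Rightarrow> complex) set \<Rightarrow> 'a toric_pt) \<Rightarrow> bool" where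
  "morphism n N \<Sigma> U f \<longleftrightarrow> openin (zariski_proj n) U \<and>
     continuous_map (subtopology (zariski_proj n) U) (zariski_toric N \<Sigma>) f \<and>
     (\<forall>V g. regular_fun_toric N \<Sigma> V g \<longrightarrow> regular_fun_proj n {P \<in> U. f P \<in> V} (g \<circ> f))"

text \<open>A rational map is an equivalence class of morphisms defined on nonempty open sets, two of them
  being equivalent if they agree on the intersection of their domains. (Projective space is
  irreducible and \<open>X\<^sub>\<Sigma>\<close> is separated.) The values of a representative \<open>(U, f)\<close> off \<open>U\<close> are
  irrelevant.\<close>

type_synonym 'a map_rep = "(nat \<Rightarrow> complex) set set \<times> ((nat \<Rightarrow> complex) set \<Rightarrow> 'a toric_pt)"

definition map_reps :: "nat \<Rightarrow> 'a::euclidean_space set \<Rightarrow> 'a set set \<Rightarrow> 'a map_rep set" where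
  "map_reps n N \<Sigma> = {(U, f). U \<noteq> {} \<and> morphism n N \<Sigma> U f}"

definition map_equiv :: "nat \<Rightarrow> 'a::euclidean_space set \<Rightarrow> 'a set set \<Rightarrow>
    ('a map_rep \<times> 'a map_rep) set" where
  "map_equiv n N \<Sigma> = {((U, f), (U', f')).
     (U, f) \<in> map_reps n N \<Sigma> \<and> (U', f') \<in> map_reps n N \<Sigma> \<and> (\<forall>P\<in>U \<inter> U'. f P = f' P)}"

definition rational_maps :: "nat \<Rightarrow> 'a::euclidean_space set \<Rightarrow> 'a set set \<Rightarrow>
    'a map_rep set set" where
  "rational_maps n N \<Sigma> = map_reps n N \<Sigma> // map_equiv n N \<Sigma>"

definition Reg :: "'a map_rep set \<Rightarrow> (nat \<Rightarrow> complex) set set" where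
  "Reg \<phi> = (\<Union>(U, f)\<in>\<phi>. U)"

definition rat_preimage :: "'a map_rep set \<Rightarrow> 'a toric_pt set \<Rightarrow> (nat \<Rightarrow> complex) set set" where
  "rat_preimage \<phi> A = (\<Union>(U, f)\<in>\<phi>. {P \<in> U. f P \<in> A})"

definition dominant :: "'a::euclidean_space set \<Rightarrow> 'a set set \<Rightarrow> 'a map_rep set \<Rightarrow> bool" where
  "dominant N \<Sigma> \<phi> \<longleftrightarrow>
     (\<exists>(U, f)\<in>\<phi>. zariski_toric N \<Sigma> closure_of (f ` U) = toric_variety N \<Sigma>)"

section \<open>Codimension\<close>

text \<open>Krull codimension in a topological space; the codimension of a set that is not closed is
  that of its closure, and the empty set has codimension \<open>\<infinity>\<close>.\<close>

definition irreducible_closed :: "'b topology \<Rightarrow> 'b set \<Rightarrow> bool" where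
  "irreducible_closed T Z \<longleftrightarrow> closedin T Z \<and> Z \<noteq> {} \<and>
     (\<forall>A B. closedin T A \<and> closedin T B \<and> Z = A \<union> B \<longrightarrow> Z = A \<or> Z = B)"

definition codim_irreducible :: "'b topology \<Rightarrow> 'b set \<Rightarrow> enat" where
  "codim_irreducible T Z = (SUP k\<in>{k. \<exists>C :: nat \<Rightarrow> 'b set. C 0 = Z \<and>
     (\<forall>i\<le>k. irreducible_closed T (C i)) \<and> (\<forall>i<k. C i \<subset> C (Suc i))}. enat k)"

definition codim :: "'b topology \<Rightarrow> 'b set \<Rightarrow> enat" where
  "codim T A = (INF Z\<in>{Z. irreducible_closed T Z \<and> Z \<subseteq> T closure_of A}. codim_irreducible T Z)"

section \<open>Complete polynomial liftings\<close>

text \<open>The components of \<open>F\<close> are indexed by the primitive ray generators themselves.\<close>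

definition tuple_eval :: "'a::euclidean_space set \<Rightarrow> 'a set set \<Rightarrow> ('a \<Rightarrow> nat mpoly) \<Rightarrow>
    (nat \<Rightarrow> complex) \<Rightarrow> 'a \<Rightarrow> complex" where
  "tuple_eval N \<Sigma> F x = (\<lambda>v. if v \<in> ray_gens N \<Sigma> then poly_eval (F v) x else 0)"

text \<open>Equality of $\pi_X\circ F$ and $\varphi\circ\pi$ as rational maps: both are defined and agree on a
  nonempty Zariski open set.\<close>

definition complete_lifting :: "nat \<Rightarrow> 'a::euclidean_space set \<Rightarrow> 'a set set \<Rightarrow> 'a map_rep set \<Rightarrow>
    ('a \<Rightarrow> nat mpoly) \<Rightarrow> bool" where
  "complete_lifting n N \<Sigma> \<phi> F \<longleftrightarrow>
     (\<forall>v\<in>ray_gens N \<Sigma>. F v \<in> polys {..n} \<and> (\<exists>k. homogeneous k (F v))) \<and>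
     (\<forall>(U, f)\<in>\<phi>. \<exists>W. openin (zariski_affine {..n}) W \<and> W \<noteq> {} \<and> W \<subseteq> punctured_space n \<and>
        (\<forall>x\<in>W. tuple_eval N \<Sigma> F x \<notin> exceptional_set N \<Sigma> \<and> proj_pt x \<in> U \<and>
           cox_quotient N \<Sigma> (tuple_eval N \<Sigma> F x) = f (proj_pt x))) \<and>
     Reg \<phi> = proj_space n -
       proj_pt ` {x \<in> punctured_space n. tuple_eval N \<Sigma> F x \<in> exceptional_set N \<Sigma>}"

end

theory Submission
  imports
    Defs
    "HOL-Computational_Algebra.Polynomial"
    "HOL-Computational_Algebra.Fundamental_Theorem_Algebra"
begin

text \<open>
  Pulling a character \<open>u\<close> back along a dominant rational map gives a nonzero rational function of degree
  zero, hence a constant times a product of powers of irreducible forms \<open>p\<close>. The exponents are additive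
  in \<open>u\<close>, so for each \<open>p\<close> they are the pairings of \<open>u\<close> with a lattice vector \<open>e p\<close>; the map is
  determined by these vectors and the constants, and it is regular at a point exactly if some cone of
  the fan contains \<open>e p\<close> for all \<open>p\<close> that vanish there. By completeness each \<open>e p\<close> lies in a cone,
  and the generic point of \<open>p = 0\<close> is mapped to the orbit of the smallest such cone. The codimension
  hypothesis makes that orbit nonsingular, so \<open>e p\<close> is a combination of the ray generators \<open>v\<close> of
  that cone with coefficients \<open>a p v\<close> that are natural numbers. Up to constants the lifting is
  \<open>F v = (\<Prod>p. p ^ a p v)\<close>, and the description of the regular locus in terms of the \<open>e p\<close> turns
  into the one in terms of the exceptional set.
\<close>

section \<open>Unique factorization\<close>

text \<open>Dominance makes the image meet the torus, and this is why the pulled-back characters are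
  nonzero. The delicate half of the regularity criterion starts from a map regular at a point x: for
  u in S_sigma the pullback of chi^u is a fraction of forms whose denominator is nonzero at x, so by
  unique factorization no prime vanishing at x has a negative exponent, and nonnegativity for all
  such u puts \<open>e p\<close> into sigma. Nonsingularity enters through a dimension count:
  directions along the orbit and classes of indecomposable elements of S_tau modulo units give
  independent tangent vectors, so a tangent space of dimension rank N leaves room for one class per
  ray, and S_tau is free modulo its units. The constants form a homomorphism from M to the nonzero
  complex numbers. Written as the exponential of a linear form, it can be distributed over the
  components of the lifting because the rays of a complete fan span. Independence of the generators
  of each cone turns separation and face arguments into computations with dual bases.\<close>

definition subring_of :: "'r::idom set \<Rightarrow> bool" where
  "subring_of A \<longleftrightarrow> 0 \<in> A \<and> 1 \<in> A \<and> (\<forall>a\<in>A. \<forall>b\<in>A. a + b \<in> A \<and> a * b \<in> A \<and> - a \<in> A)"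

text \<open>Divisibility is relative to a subset of a fixed integral domain because the induction
  over sets of variables moves between the subrings \<open>polys I\<close> of a single type.\<close>

definition dvd_in :: "'r::idom set \<Rightarrow> 'r \<Rightarrow> 'r \<Rightarrow> bool" where
  "dvd_in A a b \<longleftrightarrow> (\<exists>c\<in>A. b = a * c)"

definition prime_in :: "'r::idom set \<Rightarrow> 'r \<Rightarrow> bool" where
  "prime_in A p \<longleftrightarrow> p \<in> A \<and> p \<noteq> 0 \<and> \<not> dvd_in A p 1 \<and>
     (\<forall>a\<in>A. \<forall>b\<in>A. dvd_in A p (a * b) \<longrightarrow> dvd_in A p a \<or> dvd_in A p b)"

text \<open>Asking for prime rather than irreducible factors makes the factorization essentially
  unique, so existence is the whole condition.\<close>

definition factorial_in :: "'r::idom set \<Rightarrow> bool" where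
  "factorial_in A \<longleftrightarrow> (\<forall>a\<in>A. a \<noteq> 0 \<longrightarrow> (\<exists>u ps. u \<in> A \<and> dvd_in A u 1 \<and>
     (\<forall>p\<in>set ps. prime_in A p) \<and> a = u * prod_list ps))"

definition poly_carrier :: "'r::idom set \<Rightarrow> 'r poly set" where
  "poly_carrier A = {P. \<forall>k. coeff P k \<in> A}"

lemma subring_ofD:
  assumes "subring_of A"
  shows "0 \<in> A" "1 \<in> A" "\<And>a b. a \<in> A \<Longrightarrow> b \<in> A \<Longrightarrow> a + b \<in> A"
    "\<And>a b. a \<in> A \<Longrightarrow> b \<in> A \<Longrightarrow> a * b \<in> A" "\<And>a. a \<in> A \<Longrightarrow> - a \<in> A"
    "\<And>a b. a \<in> A \<Longrightarrow> b \<in> A \<Longrightarrow> a - b \<in> A"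
proof -
  show "\<And>a b. a \<in> A \<Longrightarrow> b \<in> A \<Longrightarrow> a - b \<in> A"
    using assms unfolding subring_of_def by (metis add_uminus_conv_diff)
qed (use assms in \<open>auto simp: subring_of_def\<close>)

lemma subring_of_sum:
  assumes "subring_of A" "\<And>i. i \<in> I \<Longrightarrow> f i \<in> A"
  shows "sum f I \<in> A"
  using assms(2) by (induction I rule: infinite_finite_induct) (auto simp: subring_ofD[OF assms(1)])

lemma subring_of_prod:
  assumes "subring_of A" "\<And>i. i \<in> I \<Longrightarrow> f i \<in> A"
  shows "prod f I \<in> A"
  using assms(2) by (induction I rule: infinite_finite_induct) (auto simp: subring_ofD[OF assms(1)])

lemma subring_of_power:
  assumes "subring_of A" "a \<in> A"
  shows "a ^ k \<in> A"
  by (induction k) (auto simp: subring_ofD[OF assms(1)] assms(2))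

lemma subring_of_prod_list:
  assumes "subring_of A" "set ps \<subseteq> A"
  shows "prod_list ps \<in> A"
  using assms(2) by (induction ps) (auto simp: subring_ofD[OF assms(1)])

lemma dvd_in_refl: "subring_of A \<Longrightarrow> dvd_in A a a"
  unfolding dvd_in_def by (rule bexI[of _ 1]) (auto simp: subring_ofD)

lemma dvd_in_trans:
  assumes "subring_of A" "dvd_in A a b" "dvd_in A b c"
  shows "dvd_in A a c"
proof -
  from assms obtain x y where "x \<in> A" "y \<in> A" "b = a * x" "c = b * y" unfolding dvd_in_def by blast
  then have "c = a * (x * y)" "x * y \<in> A" using subring_ofD[OF assms(1)] by (auto simp: mult.assoc)
  then show ?thesis unfolding dvd_in_def by blast
qed

lemma dvd_in_mult:
  assumes "subring_of A" "dvd_in A a b" "c \<in> A"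
  shows "dvd_in A a (b * c)" "dvd_in A a (c * b)"
proof -
  from assms obtain x where "x \<in> A" "b = a * x" unfolding dvd_in_def by blast
  then have "b * c = a * (x * c)" "c * b = a * (x * c)" "x * c \<in> A"
    using subring_ofD[OF assms(1)] assms(3) by (auto simp: ac_simps)
  then show "dvd_in A a (b * c)" "dvd_in A a (c * b)" unfolding dvd_in_def by blast+
qed

lemma dvd_in_add:
  assumes "subring_of A" "dvd_in A a b" "dvd_in A a c"
  shows "dvd_in A a (b + c)"
proof -
  from assms obtain x y where "x \<in> A" "y \<in> A" "b = a * x" "c = a * y" unfolding dvd_in_def by blast
  then have "b + c = a * (x + y)" "x + y \<in> A"
    using subring_ofD[OF assms(1)] by (auto simp: distrib_left)
  then show ?thesis unfolding dvd_in_def by blast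
qed

lemma dvd_in_zero: "subring_of A \<Longrightarrow> dvd_in A a 0"
  unfolding dvd_in_def by (rule bexI[of _ 0]) (auto simp: subring_ofD)

lemma dvd_in_sum:
  assumes "subring_of A" "\<And>i. i \<in> I \<Longrightarrow> dvd_in A a (f i)"
  shows "dvd_in A a (sum f I)"
  using assms(2)
  by (induction I rule: infinite_finite_induct)
    (auto simp: dvd_in_zero[OF assms(1)] intro: dvd_in_add[OF assms(1)])

lemma dvd_in_diff:
  assumes "subring_of A" "dvd_in A a b" "dvd_in A a c"
  shows "dvd_in A a (b - c)"
proof -
  have "dvd_in A a (- c)"
    using assms(3) subring_ofD(5)[OF assms(1)] unfolding dvd_in_def by (metis mult_minus_right)
  from dvd_in_add[OF assms(1,2) this] show ?thesis by simp
qed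

lemma dvd_in_unit:
  assumes "subring_of A" "dvd_in A a u" "dvd_in A u 1"
  shows "dvd_in A a 1"
  using dvd_in_trans[OF assms] .

lemma unit_mult:
  assumes "subring_of A" "u \<in> A" "v \<in> A" "dvd_in A u 1" "dvd_in A v 1"
  shows "u * v \<in> A" "dvd_in A (u * v) 1"
proof -
  from assms obtain x y where "x \<in> A" "y \<in> A" "1 = u * x" "1 = v * y" unfolding dvd_in_def by blast
  then have "1 = (u * v) * (x * y)" "x * y \<in> A"
    using subring_ofD[OF assms(1)] by (metis mult.assoc mult.left_commute mult_1_right, blast)
  then show "dvd_in A (u * v) 1" unfolding dvd_in_def by blast
  show "u * v \<in> A" using assms subring_ofD[OF assms(1)] by auto
qed

lemma prime_in_prod_list:
  assumes "subring_of A" "prime_in A p" "set qs \<subseteq> A" "dvd_in A p (prod_list qs)"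
  shows "\<exists>q\<in>set qs. dvd_in A p q"
  using assms(3,4)
proof (induction qs)
  case Nil
  then show ?case using assms(2) by (auto simp: prime_in_def)
next
  case (Cons q qs)
  then have "dvd_in A p q \<or> dvd_in A p (prod_list qs)"
    using assms(2) subring_of_prod_list[OF assms(1)] by (auto simp: prime_in_def)
  then show ?case using Cons by auto
qed

lemma prime_in_prod:
  assumes "subring_of A" "prime_in A p" "finite S" "\<And>q. q \<in> S \<Longrightarrow> f q \<in> A" "dvd_in A p (prod f S)"
  shows "\<exists>q\<in>S. dvd_in A p (f q)"
  using assms(3-)
proof (induction S rule: finite_induct)
  case empty
  then show ?case using assms(2) by (auto simp: prime_in_def)
next
  case (insert x F)
  have "f x \<in> A" "prod f F \<in> A" using insert.prems(1) by (auto intro: subring_of_prod[OF assms(1)])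
  then have "dvd_in A p (f x) \<or> dvd_in A p (prod f F)"
    using assms(2) insert by (auto simp: prime_in_def)
  then show ?case using insert by auto
qed

lemma prime_in_power:
  assumes "subring_of A" "prime_in A p" "q \<in> A" "dvd_in A p (q ^ k)"
  shows "dvd_in A p q"
  using assms(4)
proof (induction k)
  case 0
  then show ?case using assms(2) by (auto simp: prime_in_def)
next
  case (Suc k)
  then have "dvd_in A p q \<or> dvd_in A p (q ^ k)"
    using assms(2,3) subring_of_power[OF assms(1)] by (auto simp: prime_in_def)
  then show ?case using Suc by auto
qed

text \<open>If \<open>p\<close> divides one of the two factors, cancelling \<open>p\<close> exhibits
  an inverse of the other.\<close>

lemma prime_in_irreducible:
  assumes "subring_of A" "prime_in A p" "a \<in> A" "b \<in> A" "p = a * b"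
  shows "dvd_in A a 1 \<or> dvd_in A b 1"
proof -
  have 1: "dvd_in A y 1" if xy: "x \<in> A" "y \<in> A" "p = x * y" "dvd_in A p x" for x y
  proof -
    from xy obtain c where c: "c \<in> A" "x = p * c" unfolding dvd_in_def by blast
    then have "p * 1 = p * (y * c)" using xy(3) by (metis mult.assoc mult.commute mult_1_right)
    moreover have "p \<noteq> 0" using assms(2) by (auto simp: prime_in_def)
    ultimately have "1 = y * c" by (metis mult_cancel_left)
    then show ?thesis using c unfolding dvd_in_def by blast
  qed
  have "dvd_in A p (a * b)" using dvd_in_refl[OF assms(1)] assms(5) by auto
  then have "dvd_in A p a \<or> dvd_in A p b" using assms unfolding prime_in_def by blast
  then show ?thesis using 1[of a b] 1[of b a] assms by (auto simp: mult.commute)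
qed

lemma prime_in_dvd_prime:
  assumes "subring_of A" "prime_in A p" "prime_in A q" "dvd_in A p q"
  shows "dvd_in A q p"
proof -
  from assms obtain c where c: "c \<in> A" "q = p * c" unfolding dvd_in_def by blast
  have "dvd_in A p 1 \<or> dvd_in A c 1"
    using prime_in_irreducible[OF assms(1,3) _ c(1,2)] assms(2) by (auto simp: prime_in_def)
  then obtain d where d: "d \<in> A" "1 = c * d" using assms(2) unfolding prime_in_def dvd_in_def by blast
  then have "p = q * d" using c by (metis mult.assoc mult_1_right)
  then show ?thesis using d unfolding dvd_in_def by blast
qed

lemma prod_list_remove1: "p \<in> set ps \<Longrightarrow> p * prod_list (remove1 p ps) = prod_list ps"
  for p :: "'r::comm_monoid_mult"
  by (induction ps) (auto simp: mult.left_commute)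

section \<open>Polynomials in one variable over a factorial ring: Gauss's lemma\<close>

context
  fixes A :: "'r::idom set"
  assumes A: "subring_of A"
begin

lemma poly_carrier_subring: "subring_of (poly_carrier A)"
  unfolding subring_of_def
proof (intro conjI ballI)
  show "0 \<in> poly_carrier A" "1 \<in> poly_carrier A"
    using subring_ofD[OF A] by (auto simp: poly_carrier_def coeff_1)
  fix P Q assume "P \<in> poly_carrier A" "Q \<in> poly_carrier A"
  then show "P + Q \<in> poly_carrier A" "P * Q \<in> poly_carrier A" "- P \<in> poly_carrier A"
    using subring_ofD[OF A] by (auto simp: poly_carrier_def coeff_mult intro!: subring_of_sum[OF A])
qed

lemmas AX = subring_ofD[OF poly_carrier_subring]

lemma const_poly_carrier: "[:a:] \<in> poly_carrier A \<longleftrightarrow> a \<in> A"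
proof
  assume "[:a:] \<in> poly_carrier A"
  then have "coeff [:a:] 0 \<in> A" unfolding poly_carrier_def by blast
  then show "a \<in> A" by simp
qed (use subring_ofD[OF A] in \<open>auto simp: poly_carrier_def coeff_pCons split: nat.split\<close>)

lemma smult_poly_carrier: "a \<in> A \<Longrightarrow> P \<in> poly_carrier A \<Longrightarrow> smult a P \<in> poly_carrier A"
  using subring_ofD(4)[OF A] by (auto simp: poly_carrier_def)

lemma monom_poly_carrier: "a \<in> A \<Longrightarrow> monom a k \<in> poly_carrier A"
  using subring_ofD[OF A] by (auto simp: poly_carrier_def)

lemma const_dvd_in_iff:
  assumes "c \<in> A"
  shows "dvd_in (poly_carrier A) [:c:] P \<longleftrightarrow> (\<forall>k. dvd_in A c (coeff P k))"
proof
  assume "dvd_in (poly_carrier A) [:c:] P"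
  then show "\<forall>k. dvd_in A c (coeff P k)" by (auto simp: dvd_in_def poly_carrier_def)
next
  assume "\<forall>k. dvd_in A c (coeff P k)"
  then obtain f where f: "\<And>k. f k \<in> A" "\<And>k. coeff P k = c * f k" unfolding dvd_in_def by metis
  \<comment> \<open>For \<open>c = 0\<close> the quotients \<open>f k\<close> are arbitrary; forcing
    0 wherever \<open>P\<close> has a zero coefficient keeps the support finite.\<close>
  define Q where "Q = Abs_poly (\<lambda>k. if coeff P k = 0 then 0 else f k)"
  have co: "coeff Q k = (if coeff P k = 0 then 0 else f k)" for k
    unfolding Q_def by (subst coeff_Abs_poly[of "degree P"]) (auto simp: coeff_eq_0)
  have "P = [:c:] * Q" by (rule poly_eqI) (use f co in auto)
  moreover have "Q \<in> poly_carrier A" using f co subring_ofD[OF A] by (auto simp: poly_carrier_def)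
  ultimately show "dvd_in (poly_carrier A) [:c:] P" unfolding dvd_in_def by blast
qed

lemma const_unit_iff:
  "dvd_in (poly_carrier A) [:c:] 1 \<longleftrightarrow> dvd_in A c 1" if "c \<in> A"
  using const_dvd_in_iff[OF that, of 1] dvd_in_zero[OF A] by (auto simp: coeff_1)

lemma unit_poly_carrier:
  assumes "dvd_in (poly_carrier A) U 1" "U \<in> poly_carrier A"
  obtains u where "u \<in> A" "U = [:u:]" "dvd_in A u 1"
proof -
  from assms obtain V where V: "V \<in> poly_carrier A" "1 = U * V" unfolding dvd_in_def by blast
  then have "U \<noteq> 0" "V \<noteq> 0" by auto
  then have "degree U = 0" using V degree_mult_eq[of U V] by (metis add_is_0 degree_1)
  then obtain u where "U = [:u:]" by (auto elim: degree_eq_zeroE)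
  moreover have "u \<in> A" using calculation assms(2) const_poly_carrier by auto
  ultimately show ?thesis using that assms const_unit_iff by auto
qed

text \<open>Let i and j be the least indices at which \<open>P\<close> and \<open>Q\<close> have a
  coefficient not divisible by c. In the coefficient of \<open>P * Q\<close> at i + j every term but
  the one at (i, j) is divisible by c, so the whole is not.\<close>

lemma prime_in_const:
  assumes "prime_in A c"
  shows "prime_in (poly_carrier A) [:c:]"
proof -
  have c: "c \<in> A" using assms by (auto simp: prime_in_def)
  have "dvd_in (poly_carrier A) [:c:] P \<or> dvd_in (poly_carrier A) [:c:] Q"
    if PQ: "P \<in> poly_carrier A" "Q \<in> poly_carrier A" "dvd_in (poly_carrier A) [:c:] (P * Q)" for P Q
  proof (rule ccontr)
    assume no: "\<not> ?thesis"
    define i where "i = (LEAST k. \<not> dvd_in A c (coeff P k))"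
    define j where "j = (LEAST k. \<not> dvd_in A c (coeff Q k))"
    have i: "\<not> dvd_in A c (coeff P i)" "\<And>k. k < i \<Longrightarrow> dvd_in A c (coeff P k)"
      using no const_dvd_in_iff[OF c] unfolding i_def by (metis LeastI) (metis not_less_Least)
    have j: "\<not> dvd_in A c (coeff Q j)" "\<And>k. k < j \<Longrightarrow> dvd_in A c (coeff Q k)"
      using no const_dvd_in_iff[OF c] unfolding j_def by (metis LeastI) (metis not_less_Least)
    have PA: "\<And>k. coeff P k \<in> A" "\<And>k. coeff Q k \<in> A" using PQ by (auto simp: poly_carrier_def)
    have 1: "dvd_in A c (coeff (P * Q) (i + j))" using PQ const_dvd_in_iff[OF c] by auto
    have "dvd_in A c (\<Sum>k\<in>{..i+j} - {i}. coeff P k * coeff Q (i + j - k))"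
    proof (rule dvd_in_sum[OF A])
      fix k assume k: "k \<in> {..i+j} - {i}"
      show "dvd_in A c (coeff P k * coeff Q (i + j - k))"
      proof (cases "k < i")
        case True
        then show ?thesis using i PA dvd_in_mult[OF A] by blast
      next
        case False
        then have "i + j - k < j" using k by auto
        then show ?thesis using j PA dvd_in_mult[OF A] by blast
      qed
    qed
    moreover have "coeff (P * Q) (i + j) = coeff P i * coeff Q j +
        (\<Sum>k\<in>{..i+j} - {i}. coeff P k * coeff Q (i + j - k))"
      unfolding coeff_mult by (subst sum.remove[of _ i]) auto
    ultimately have "dvd_in A c (coeff P i * coeff Q j)"
      using dvd_in_diff[OF A 1, of "\<Sum>k\<in>{..i+j} - {i}. coeff P k * coeff Q (i + j - k)"] by simp
    then show False using i(1) j(1) PA assms unfolding prime_in_def by blast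
  qed
  then show ?thesis using assms const_unit_iff[OF c] const_poly_carrier by (auto simp: prime_in_def)
qed

text \<open>Leading coefficients need not be invertible in \<open>A\<close>, so each reduction
  multiplies the dividend by the leading coefficient of \<open>D\<close>; \<open>a\<close> collects
  these factors.\<close>

lemma pseudo_division:
  assumes "X \<in> poly_carrier A" "D \<in> poly_carrier A" "D \<noteq> 0"
  shows "\<exists>a q r. a \<in> A \<and> a \<noteq> 0 \<and> q \<in> poly_carrier A \<and> r \<in> poly_carrier A \<and>
    [:a:] * X = q * D + r \<and> (r = 0 \<or> degree r < degree D)"
  using assms(1)
proof (induction "degree X" arbitrary: X rule: less_induct)
  case less
  show ?case
  proof (cases "X = 0 \<or> degree X < degree D")
    case True
    then show ?thesis using less.prems AX subring_ofD[OF A]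
      by (intro exI[of _ 1] exI[of _ 0] exI[of _ X]) auto
  next
    case False
    define l where "l = lead_coeff D"
    define T where "T = monom (lead_coeff X) (degree X - degree D)"
    have l: "l \<in> A" "l \<noteq> 0" using assms by (auto simp: l_def poly_carrier_def)
    have T: "T \<in> poly_carrier A" using less.prems unfolding T_def
      by (intro monom_poly_carrier) (auto simp: poly_carrier_def)
    define Y where "Y = [:l:] * X - T * D"
    have Y: "Y \<in> poly_carrier A" unfolding Y_def
      using AX(4,6) T less.prems assms(2) smult_poly_carrier[OF l(1)] by simp
    have Tn: "T \<noteq> 0" using False by (auto simp: T_def)
    have dT: "degree (T * D) = degree X" using False assms Tn
      by (subst degree_mult_eq) (auto simp: T_def degree_monom_eq)
    have dX: "degree ([:l:] * X) = degree X" using l by simp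
    have "coeff (T * D) (degree X) = lead_coeff X * l"
      using lead_coeff_mult[of T D] dT False by (simp add: T_def l_def degree_monom_eq)
    then have c0: "coeff Y (degree X) = 0" unfolding Y_def by simp
    have dY: "degree Y \<le> degree X" unfolding Y_def using dT dX by (intro degree_diff_le) auto
    show ?thesis
    proof (cases "Y = 0")
      case True
      then show ?thesis using l T AX unfolding Y_def
        by (intro exI[of _ l] exI[of _ T] exI[of _ 0]) auto
    next
      case False
      then have "degree Y < degree X" using c0 dY by (metis leading_coeff_0_iff nat_less_le)
      from less.hyps[OF this Y] obtain a q r where aqr: "a \<in> A" "a \<noteq> 0" "q \<in> poly_carrier A"
        "r \<in> poly_carrier A" "[:a:] * Y = q * D + r" "r = 0 \<or> degree r < degree D" by blast
      have "[:a * l:] * X = [:a:] * ([:l:] * X)" by (simp add: mult.commute)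
      also have "\<dots> = [:a:] * Y + [:a:] * T * D" unfolding Y_def by (simp add: algebra_simps)
      also have "\<dots> = (q + [:a:] * T) * D + r" using aqr by (simp add: algebra_simps)
      finally have "[:a * l:] * X = (q + [:a:] * T) * D + r" .
      moreover have "a * l \<in> A" "a * l \<noteq> 0" using aqr l subring_ofD[OF A] by auto
      moreover have "q + [:a:] * T \<in> poly_carrier A" using AX aqr T const_poly_carrier by metis
      ultimately show ?thesis using aqr by blast
    qed
  qed
qed

text \<open>\<open>D\<close> replaces a greatest common divisor over the fraction field: it is a
  nonzero combination of \<open>P\<close> and \<open>Q\<close> of least degree, so pseudo-division
  of any combination by \<open>D\<close> leaves remainder 0.\<close>

lemma common_divisor:
  assumes P: "P \<in> poly_carrier A" "P \<noteq> 0" and Q: "Q \<in> poly_carrier A"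
  obtains D S T a b P' Q' where "D \<noteq> 0" "D = S * P + T * Q" "a \<in> A" "a \<noteq> 0" "b \<in> A" "b \<noteq> 0"
    "[:a:] * P = D * P'" "[:b:] * Q = D * Q'"
    "{D, S, T, P', Q'} \<subseteq> poly_carrier A"
proof -
  define J where "J = {S * P + T * Q | S T. S \<in> poly_carrier A \<and> T \<in> poly_carrier A}"
  have PJ: "P \<in> J" unfolding J_def using AX by (intro CollectI exI[of _ 1] exI[of _ 0]) auto
  have QJ: "Q \<in> J" unfolding J_def using AX by (intro CollectI exI[of _ 0] exI[of _ 1]) auto
  obtain D where D: "D \<in> J" "D \<noteq> 0" "\<And>E. E \<in> J \<Longrightarrow> E \<noteq> 0 \<Longrightarrow> degree D \<le> degree E"
    using ex_has_least_nat[of "\<lambda>D. D \<in> J \<and> D \<noteq> 0" P degree] PJ P by blast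
  then obtain S T where ST: "S \<in> poly_carrier A" "T \<in> poly_carrier A" "D = S * P + T * Q"
    unfolding J_def by blast
  have DA: "D \<in> poly_carrier A" using ST AX P Q by auto
  have JA: "X \<in> poly_carrier A" if "X \<in> J" for X using that AX P Q unfolding J_def by auto
  have div: "\<exists>a q. a \<in> A \<and> a \<noteq> 0 \<and> q \<in> poly_carrier A \<and> [:a:] * X = D * q" if X: "X \<in> J" for X
  proof -
    obtain a q r where aqr: "a \<in> A" "a \<noteq> 0" "q \<in> poly_carrier A"
        "r \<in> poly_carrier A" "[:a:] * X = q * D + r" "r = 0 \<or> degree r < degree D"
      using pseudo_division[OF JA[OF X] DA D(2)] by blast
    obtain S' T' where ST': "S' \<in> poly_carrier A" "T' \<in> poly_carrier A" "X = S' * P + T' * Q"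
      using X unfolding J_def by blast
    have "r = ([:a:] * S' - q * S) * P + ([:a:] * T' - q * T) * Q"
      using aqr(5) ST' ST by (simp add: algebra_simps)
    moreover have "[:a:] * S' - q * S \<in> poly_carrier A" "[:a:] * T' - q * T \<in> poly_carrier A"
      using AX ST' ST aqr const_poly_carrier by metis+
    ultimately have "r \<in> J" unfolding J_def by blast
    then have "r = 0" using D(3)[of r] aqr(6) leD by blast
    then show ?thesis using aqr(1-3,5) by (metis add_0_right mult.commute)
  qed
  from div[OF PJ] div[OF QJ] show ?thesis using that[of D S T] D ST DA by auto
qed

text \<open>Testing against prime constants avoids forming the content as a greatest common divisor
  of the coefficients.\<close>

definition prim_poly :: "'r poly \<Rightarrow> bool" where
  "prim_poly P \<longleftrightarrow> (\<forall>c. prime_in A c \<longrightarrow> \<not> dvd_in (poly_carrier A) [:c:] P)"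

definition irred_poly :: "'r poly \<Rightarrow> bool" where
  "irred_poly P \<longleftrightarrow> P \<in> poly_carrier A \<and> P \<noteq> 0 \<and> \<not> dvd_in (poly_carrier A) P 1 \<and>
     (\<forall>Q\<in>poly_carrier A. \<forall>R\<in>poly_carrier A. P = Q * R \<longrightarrow>
        dvd_in (poly_carrier A) Q 1 \<or> dvd_in (poly_carrier A) R 1)"

context
  assumes fact: "factorial_in A"
begin

text \<open>Divisibility over the fraction field descends to \<open>A\<close>: the prime factors of
  \<open>a\<close> are cancelled one at a time, each of them dividing \<open>R\<close> because it
  cannot divide the primitive \<open>P\<close>. The unit part of \<open>a\<close> is inverted at the
  end.\<close>

lemma prim_strip:
  assumes "P \<in> poly_carrier A" "prim_poly P" "a \<in> A" "a \<noteq> 0" "R \<in> poly_carrier A"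
    "Q \<in> poly_carrier A" "[:a:] * Q = P * R"
  shows "dvd_in (poly_carrier A) P Q"
proof -
  obtain u ps where u: "u \<in> A" "dvd_in A u 1" "\<forall>p\<in>set ps. prime_in A p" "a = u * prod_list ps"
    using fact assms unfolding factorial_in_def by blast
  have "\<forall>p\<in>set ps. prime_in A p \<Longrightarrow> R \<in> poly_carrier A \<Longrightarrow> [:u * prod_list ps:] * Q = P * R \<Longrightarrow>
      dvd_in (poly_carrier A) P Q"
  proof (induction ps arbitrary: R)
    case Nil
    obtain v where v: "v \<in> A" "1 = u * v" using u unfolding dvd_in_def by blast
    have "Q = [:u * v:] * Q" using v by (simp flip: one_pCons)
    also have "\<dots> = [:v:] * ([:u:] * Q)" by (simp add: mult.commute)
    also have "\<dots> = P * ([:v:] * R)" using Nil by (simp add: ac_simps)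
    finally show ?case unfolding dvd_in_def
      using AX(4)[OF const_poly_carrier[THEN iffD2, OF v(1)] Nil.prems(2)] by blast
  next
    case (Cons p ps)
    have pr: "prime_in (poly_carrier A) [:p:]" using Cons.prems prime_in_const by auto
    have "P * R = [:p:] * ([:u * prod_list ps:] * Q)" using Cons.prems by (simp add: ac_simps)
    moreover have wA: "[:u * prod_list ps:] \<in> poly_carrier A"
    proof -
      have "set ps \<subseteq> A" using Cons.prems(1) by (auto simp: prime_in_def)
      then show ?thesis
        using subring_ofD(4)[OF A u(1) subring_of_prod_list[OF A]] const_poly_carrier by blast
    qed
    ultimately have "dvd_in (poly_carrier A) [:p:] (P * R)"
      unfolding dvd_in_def using AX(4)[OF wA assms(6)] by blast
    then have "dvd_in (poly_carrier A) [:p:] P \<or> dvd_in (poly_carrier A) [:p:] R"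
      using pr Cons.prems assms by (auto simp: prime_in_def)
    then obtain R' where R': "R' \<in> poly_carrier A" "R = [:p:] * R'"
      using assms(2) Cons.prems unfolding prim_poly_def dvd_in_def by auto
    have "[:p:] * ([:u * prod_list ps:] * Q) = [:p:] * (P * R')"
      using Cons.prems R' by (simp add: ac_simps)
    then have "[:u * prod_list ps:] * Q = P * R'"
      using pr unfolding prime_in_def by (metis mult_cancel_left)
    then show ?case using Cons R' by auto
  qed
  then show ?thesis using u assms by auto
qed

text \<open>A prime constant dividing \<open>D\<close> divides its leading coefficient and is
  therefore associated to a prime factor of that coefficient. Splitting it off shortens this
  factorization, so the process stops.\<close>

lemma prim_part:
  assumes "D \<in> poly_carrier A" "D \<noteq> 0"
  obtains a E where "a \<in> A" "a \<noteq> 0" "E \<in> poly_carrier A" "prim_poly E" "D = [:a:] * E"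
proof -
  have "\<exists>a E. a \<in> A \<and> a \<noteq> 0 \<and> E \<in> poly_carrier A \<and> prim_poly E \<and> D = [:a:] * E"
    if "u \<in> A" "dvd_in A u 1" "\<forall>p\<in>set ps. prime_in A p" "lead_coeff D = u * prod_list ps"
      "D \<in> poly_carrier A" for u ps D
    using that
  proof (induction "length ps" arbitrary: u ps D)
    case 0
    have "prim_poly D" unfolding prim_poly_def
    proof (intro allI impI notI)
      fix c assume c: "prime_in A c" "dvd_in (poly_carrier A) [:c:] D"
      then have "dvd_in A c (lead_coeff D)" using const_dvd_in_iff by (auto simp: prime_in_def)
      then have "dvd_in A c u" using 0 by auto
      then show False using dvd_in_unit[OF A _ 0(3)] c by (auto simp: prime_in_def)
    qed
    then show ?case using 0 subring_ofD[OF A] by (intro exI[of _ 1] exI[of _ D]) auto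
  next
    case (Suc n)
    show ?case
    proof (cases "prim_poly D")
      case True
      then show ?thesis using Suc subring_ofD[OF A] by (intro exI[of _ 1] exI[of _ D]) auto
    next
      case False
      then obtain c where c: "prime_in A c" "dvd_in (poly_carrier A) [:c:] D"
        unfolding prim_poly_def by blast
      have cA: "c \<in> A" "c \<noteq> 0" using c by (auto simp: prime_in_def)
      have psA: "set ps \<subseteq> A" using Suc by (auto simp: prime_in_def)
      have "dvd_in A c (u * prod_list ps)" using c const_dvd_in_iff[OF cA(1)] Suc by metis
      then have "dvd_in A c u \<or> dvd_in A c (prod_list ps)"
        using c Suc subring_of_prod_list[OF A psA] by (auto simp: prime_in_def)
      moreover have "\<not> dvd_in A c u" using dvd_in_unit[OF A _ Suc.prems(2)] c by (auto simp: prime_in_def)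
      ultimately obtain p where p: "p \<in> set ps" "dvd_in A c p"
        using prime_in_prod_list[OF A c(1) psA] by blast
      then obtain w where w: "w \<in> A" "p = c * w" unfolding dvd_in_def by blast
      have wu: "dvd_in A w 1"
        using prime_in_irreducible[OF A _ cA(1) w] p Suc.prems c by (auto simp: prime_in_def)
      obtain E where E: "E \<in> poly_carrier A" "D = [:c:] * E" using c unfolding dvd_in_def by blast
      have "c * lead_coeff E = lead_coeff D" using E cA by (simp add: lead_coeff_mult)
      also have "\<dots> = u * (p * prod_list (remove1 p ps))"
        using Suc.prems p by (simp add: prod_list_remove1)
      also have "\<dots> = c * ((u * w) * prod_list (remove1 p ps))" using w by (simp add: ac_simps)
      finally have lE: "lead_coeff E = (u * w) * prod_list (remove1 p ps)" using cA by simp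
      have "n = length (remove1 p ps)" using Suc p by (simp add: length_remove1)
      from Suc.hyps(1)[OF this _ _ _ lE E(1)] unit_mult[OF A Suc.prems(1) w(1) Suc.prems(2) wu]
      obtain a F where F: "a \<in> A" "a \<noteq> 0" "F \<in> poly_carrier A" "prim_poly F" "E = [:a:] * F"
        using Suc.prems(3) by (meson notin_set_remove1)
      then have "D = [:c * a:] * F" using E by (simp add: mult.commute)
      moreover have "c * a \<in> A" "c * a \<noteq> 0" using F cA subring_ofD[OF A] by auto
      ultimately show ?thesis using F by blast
    qed
  qed
  moreover have "lead_coeff D \<in> A" "lead_coeff D \<noteq> 0" using assms by (auto simp: poly_carrier_def)
  then obtain u ps where "u \<in> A" "dvd_in A u 1" "\<forall>p\<in>set ps. prime_in A p" "lead_coeff D = u * prod_list ps"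
    using fact unfolding factorial_in_def by blast
  ultimately show ?thesis using that assms by metis
qed

lemma irred_prim:
  assumes "irred_poly P" "degree P > 0"
  shows "prim_poly P"
  unfolding prim_poly_def
proof (intro allI impI notI)
  fix c assume c: "prime_in A c" "dvd_in (poly_carrier A) [:c:] P"
  then obtain R where R: "R \<in> poly_carrier A" "P = [:c:] * R" unfolding dvd_in_def by blast
  have cA: "c \<in> A" using c by (auto simp: prime_in_def)
  have "\<not> dvd_in (poly_carrier A) [:c:] 1" using const_unit_iff[OF cA] c by (auto simp: prime_in_def)
  then have "dvd_in (poly_carrier A) R 1"
    using assms R cA const_poly_carrier unfolding irred_poly_def by blast
  then obtain u where "R = [:u:]" using unit_poly_carrier R by metis
  then show False using assms R by auto
qed

text \<open>The primitive part \<open>E\<close> of the common divisor divides \<open>P\<close> and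
  \<open>Q\<close>. By irreducibility \<open>E\<close> is a unit or associated to \<open>P\<close>,
  and the latter would make \<open>P\<close> divide \<open>Q\<close>; hence the common divisor is a
  constant. This gives primality below and eliminates a variable in the Nullstellensatz.\<close>

lemma elimination:
  assumes P: "irred_poly P" "degree P > 0" and Q: "Q \<in> poly_carrier A"
    and ndvd: "\<not> dvd_in (poly_carrier A) P Q"
  obtains d S T where "d \<in> A" "d \<noteq> 0" "S \<in> poly_carrier A" "T \<in> poly_carrier A"
    "[:d:] = S * P + T * Q"
proof -
  have PA: "P \<in> poly_carrier A" "P \<noteq> 0" using P by (auto simp: irred_poly_def)
  obtain D S T a b P' Q' where D: "D \<noteq> 0" "D = S * P + T * Q" "a \<in> A" "a \<noteq> 0" "b \<in> A" "b \<noteq> 0"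
    "[:a:] * P = D * P'" "[:b:] * Q = D * Q'" "{D, S, T, P', Q'} \<subseteq> poly_carrier A"
    using common_divisor[OF PA Q] by metis
  obtain c E where E: "c \<in> A" "c \<noteq> 0" "E \<in> poly_carrier A" "prim_poly E" "D = [:c:] * E"
    using prim_part[of D] D by (metis insert_subset)
  have cA: "[:c:] \<in> poly_carrier A" using E const_poly_carrier by auto
  have mem: "[:c:] * P' \<in> poly_carrier A" "[:c:] * Q' \<in> poly_carrier A" using D(9) AX(4)[OF cA] by auto
  have "[:a:] * P = E * ([:c:] * P')" "[:b:] * Q = E * ([:c:] * Q')"
    unfolding D(7,8) E(5) by (simp_all only: ac_simps)
  then have "dvd_in (poly_carrier A) E P" and EQ: "dvd_in (poly_carrier A) E Q"
    using prim_strip[OF E(3,4) D(3,4) mem(1) PA(1)] prim_strip[OF E(3,4) D(5,6) mem(2) Q] by blast+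
  then obtain Y where Y: "Y \<in> poly_carrier A" "P = E * Y" unfolding dvd_in_def by blast
  have "\<not> dvd_in (poly_carrier A) Y 1"
  proof
    assume "dvd_in (poly_carrier A) Y 1"
    then obtain Z where Z: "Z \<in> poly_carrier A" "1 = Y * Z" unfolding dvd_in_def by blast
    then have "E = P * Z" using Y by (metis mult.assoc mult_1_right)
    then have "dvd_in (poly_carrier A) P E" unfolding dvd_in_def using Z by blast
    then show False using dvd_in_trans[OF poly_carrier_subring _ EQ] ndvd by blast
  qed
  then have "dvd_in (poly_carrier A) E 1" using P Y E unfolding irred_poly_def by blast
  then obtain u where u: "u \<in> A" "E = [:u:]" "dvd_in A u 1" using unit_poly_carrier E by metis
  have "[:c * u:] = S * P + T * Q" using E u D(2) by auto
  moreover have "c * u \<in> A" "c * u \<noteq> 0" using E u subring_ofD[OF A] D by auto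
  ultimately show ?thesis using that D by auto
qed

text \<open>Multiplying \<open>[:d:] = S * P + T * Q\<close> by \<open>R\<close> shows that
  \<open>P\<close> divides \<open>[:d:] * R\<close>; since \<open>P\<close> is primitive, the
  constant can be stripped.\<close>

lemma irred_prime:
  assumes P: "irred_poly P" "degree P > 0"
  shows "prime_in (poly_carrier A) P"
proof -
  have PA: "P \<in> poly_carrier A" "P \<noteq> 0" using P by (auto simp: irred_poly_def)
  have "dvd_in (poly_carrier A) P R"
    if QR: "Q \<in> poly_carrier A" "R \<in> poly_carrier A" "dvd_in (poly_carrier A) P (Q * R)"
      "\<not> dvd_in (poly_carrier A) P Q" for Q R
  proof -
    obtain d S T where d: "d \<in> A" "d \<noteq> 0" "S \<in> poly_carrier A" "T \<in> poly_carrier A"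
      "[:d:] = S * P + T * Q" using elimination[OF P QR(1,4)] by metis
    obtain Y where Y: "Y \<in> poly_carrier A" "Q * R = P * Y" using QR unfolding dvd_in_def by blast
    have "[:d:] * R = S * P * R + T * (Q * R)" using d by (simp add: algebra_simps)
    also have "\<dots> = P * (S * R + T * Y)" using Y by (simp add: algebra_simps)
    finally show ?thesis
      by (rule prim_strip[OF PA(1) irred_prim[OF P] d(1,2) _ QR(2), rotated]) (use d Y QR AX in auto)
  qed
  then show ?thesis using P unfolding prime_in_def irred_poly_def by blast
qed

lemma prim_degree_0_unit:
  assumes "P \<in> poly_carrier A" "P \<noteq> 0" "prim_poly P" "degree P = 0"
  shows "dvd_in (poly_carrier A) P 1"
proof -
  obtain b where b: "P = [:b:]" using assms by (auto elim: degree_eq_zeroE)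
  then have bA: "b \<in> A" "b \<noteq> 0" using assms const_poly_carrier by auto
  then obtain u ps where u: "u \<in> A" "dvd_in A u 1" "\<forall>p\<in>set ps. prime_in A p" "b = u * prod_list ps"
    using fact unfolding factorial_in_def by blast
  show ?thesis
  proof (cases ps)
    case Nil
    then show ?thesis using u b const_unit_iff by auto
  next
    case (Cons p qs)
    then have p: "prime_in A p" "set qs \<subseteq> A" using u by (auto simp: prime_in_def)
    have "P = [:p:] * [:u * prod_list qs:]" using b u Cons by (simp add: ac_simps)
    moreover have "u * prod_list qs \<in> A" using u p subring_of_prod_list[OF A] subring_ofD[OF A] by auto
    ultimately have "dvd_in (poly_carrier A) [:p:] P" unfolding dvd_in_def using const_poly_carrier by blast
    then show ?thesis using assms(3) p unfolding prim_poly_def by blast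
  qed
qed

text \<open>Primitive polynomials are split by induction on the degree: both factors of a reducible
  one are primitive and of positive degree. The constant that makes a polynomial primitive is
  factored in \<open>A\<close>.\<close>

lemma factorial_poly_carrier: "factorial_in (poly_carrier A)"
proof -
  let ?F = "\<lambda>P. \<exists>u ps. u \<in> poly_carrier A \<and> dvd_in (poly_carrier A) u 1 \<and>
     (\<forall>p\<in>set ps. prime_in (poly_carrier A) p) \<and> P = u * prod_list ps"
  note pcs = poly_carrier_subring
  have one: "dvd_in (poly_carrier A) 1 1" using dvd_in_refl[OF pcs] .
  have mult: "?F (P * Q)" if FPQ: "?F P" "?F Q" for P Q
  proof -
    obtain u ps where u: "u \<in> poly_carrier A" "dvd_in (poly_carrier A) u 1"
     "\<forall>p\<in>set ps. prime_in (poly_carrier A) p" "P = u * prod_list ps" using FPQ by blast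
    obtain v qs where v: "v \<in> poly_carrier A" "dvd_in (poly_carrier A) v 1"
     "\<forall>p\<in>set qs. prime_in (poly_carrier A) p" "Q = v * prod_list qs" using FPQ by blast
    show ?thesis
      by (intro exI[of _ "u * v"] exI[of _ "ps @ qs"]) (use u v unit_mult[OF pcs] in \<open>auto simp: ac_simps\<close>)
  qed
  have prim: "?F P" if "P \<in> poly_carrier A" "P \<noteq> 0" "prim_poly P" for P
    using that
  proof (induction "degree P" arbitrary: P rule: less_induct)
    case less
    show ?case
    proof (cases "degree P = 0")
      case True
      then show ?thesis using prim_degree_0_unit[of P] less.prems
        by (intro exI[of _ P] exI[of _ "[]"]) auto
    next
      case False
      show ?thesis
      proof (cases "irred_poly P")
        case True
        then show ?thesis using irred_prime[of P] False one AX
          by (intro exI[of _ 1] exI[of _ "[P]"]) auto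
      next
        case nirr: False
        have "\<not> dvd_in (poly_carrier A) P 1" using unit_poly_carrier[of P] less.prems False by force
        then obtain Q R where QR: "Q \<in> poly_carrier A" "R \<in> poly_carrier A" "P = Q * R"
            "\<not> dvd_in (poly_carrier A) Q 1" "\<not> dvd_in (poly_carrier A) R 1"
          using nirr less.prems unfolding irred_poly_def by blast
        have nz: "Q \<noteq> 0" "R \<noteq> 0" using QR less.prems by auto
        have pr: "prim_poly Q" "prim_poly R"
          using less.prems(3) QR dvd_in_mult[OF pcs] unfolding prim_poly_def by metis+
        have "degree Q \<noteq> 0" "degree R \<noteq> 0" using prim_degree_0_unit QR nz pr by blast+
        then have "degree Q < degree P" "degree R < degree P" using QR nz by (auto simp: degree_mult_eq)
        then have "?F Q" "?F R" using less.hyps QR nz pr by blast+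
        then show ?thesis using mult QR by blast
      qed
    qed
  qed
  have const: "?F [:a:]" if a: "a \<in> A" "a \<noteq> 0" for a
  proof -
    obtain u ps where u: "u \<in> A" "dvd_in A u 1" "\<forall>p\<in>set ps. prime_in A p" "a = u * prod_list ps"
      using fact a unfolding factorial_in_def by blast
    have "prod_list (map (\<lambda>p. [:p:]) ps) = [:prod_list ps:]"
      by (induction ps) (auto simp: one_pCons)
    then show ?thesis using u const_poly_carrier const_unit_iff prime_in_const
      by (intro exI[of _ "[:u:]"] exI[of _ "map (\<lambda>p. [:p:]) ps"]) auto
  qed
  show ?thesis unfolding factorial_in_def
  proof (intro ballI impI)
    fix P assume P: "P \<in> poly_carrier A" "P \<noteq> 0"
    then obtain a E where "a \<in> A" "a \<noteq> 0" "E \<in> poly_carrier A" "prim_poly E" "P = [:a:] * E"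
      using prim_part by metis
    moreover from this have "E \<noteq> 0" using P by auto
    ultimately show "?F P" using mult[OF const prim] by metis
  qed
qed

end

end

section \<open>Polynomials in several variables\<close>

lemma mono_eval_superset:
  assumes "finite S" "Poly_Mapping.keys m \<subseteq> S"
  shows "mono_eval m x = (\<Prod>i\<in>S. x i ^ Poly_Mapping.lookup m i)"
  unfolding mono_eval_def using assms
  by (intro prod.mono_neutral_left) (auto simp: in_keys_iff)

lemma mono_eval_add: "mono_eval (m + m') x = mono_eval m x * mono_eval m' x"
proof -
  let ?S = "Poly_Mapping.keys m \<union> Poly_Mapping.keys m'"
  have "Poly_Mapping.keys (m + m') \<subseteq> ?S" by (rule Poly_Mapping.keys_add)
  then show ?thesis
    by (simp add: mono_eval_superset[of ?S] lookup_add power_add prod.distrib)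
qed

lemma mono_eval_zero [simp]: "mono_eval 0 x = 1"
  by (simp add: mono_eval_def)

lemma poly_eval_superset:
  assumes "finite S" "Poly_Mapping.keys p \<subseteq> S"
  shows "poly_eval p x = (\<Sum>m\<in>S. Poly_Mapping.lookup p m * mono_eval m x)"
  unfolding poly_eval_def using assms
  by (intro sum.mono_neutral_left) (auto simp: in_keys_iff)

lemma poly_eval_add: "poly_eval (p + q) x = poly_eval p x + poly_eval q x"
proof -
  let ?S = "Poly_Mapping.keys p \<union> Poly_Mapping.keys q"
  have "Poly_Mapping.keys (p + q) \<subseteq> ?S" by (rule Poly_Mapping.keys_add)
  then show ?thesis
    by (simp add: poly_eval_superset[of ?S] lookup_add sum.distrib distrib_right)
qed

lemma poly_eval_single: "poly_eval (Poly_Mapping.single m c) x = c * mono_eval m x"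
  by (subst poly_eval_superset[of "{m}"]) (auto split: if_splits)

lemma poly_eval_zero [simp]: "poly_eval 0 x = 0"
  by (simp add: poly_eval_def)

lemma poly_eval_one [simp]: "poly_eval 1 x = 1"
  using poly_eval_single[of 0 1 x] by simp

lemma poly_eval_sum: "poly_eval (sum f S) x = (\<Sum>i\<in>S. poly_eval (f i) x)"
  by (induction S rule: infinite_finite_induct) (auto simp: poly_eval_add)

lemma sum_singles: "(\<Sum>m\<in>Poly_Mapping.keys p. Poly_Mapping.single m (Poly_Mapping.lookup p m)) = p"
  by (rule poly_mapping_eqI)
    (auto simp: lookup_sum lookup_single when_def sum.delta' in_keys_iff)

lemma poly_eval_mult: "poly_eval (p * q) x = poly_eval p x * poly_eval q x"
proof -
  have "p * q = (\<Sum>m\<in>Poly_Mapping.keys p. \<Sum>m'\<in>Poly_Mapping.keys q.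
      Poly_Mapping.single (m + m') (Poly_Mapping.lookup p m * Poly_Mapping.lookup q m'))"
    by (subst (1 2) sum_singles[symmetric]) (simp add: sum_product mult_single)
  then have "poly_eval (p * q) x = (\<Sum>m\<in>Poly_Mapping.keys p. \<Sum>m'\<in>Poly_Mapping.keys q.
      Poly_Mapping.lookup p m * Poly_Mapping.lookup q m' * (mono_eval m x * mono_eval m' x))"
    by (simp only: poly_eval_sum poly_eval_single mono_eval_add)
  also have "\<dots> = poly_eval p x * poly_eval q x"
    unfolding poly_eval_def sum_product by (simp only: ac_simps)
  finally show ?thesis .
qed

lemma poly_eval_uminus: "poly_eval (- p) x = - poly_eval p x"
  using poly_eval_add[of p "- p" x] by (simp add: eq_neg_iff_add_eq_0 add.commute)

lemma poly_eval_diff: "poly_eval (p - q) x = poly_eval p x - poly_eval q x"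
  using poly_eval_add[of p "- q" x] by (simp add: poly_eval_uminus)

lemma poly_eval_power: "poly_eval (p ^ k) x = poly_eval p x ^ k"
  by (induction k) (auto simp: poly_eval_mult)

lemma poly_eval_prod: "poly_eval (prod f S) x = (\<Prod>i\<in>S. poly_eval (f i) x)"
  by (induction S rule: infinite_finite_induct) (auto simp: poly_eval_mult)

lemmas poly_eval_simps = poly_eval_add poly_eval_mult poly_eval_uminus poly_eval_diff poly_eval_power
  poly_eval_prod poly_eval_sum poly_eval_single

lemma poly_eval_poly_var [simp]: "poly_eval (poly_var i) x = x i"
  by (simp add: poly_var_def poly_eval_single mono_eval_def)

abbreviation const_poly :: "complex \<Rightarrow> 'i mpoly" where
  "const_poly c \<equiv> Poly_Mapping.single 0 c"

lemma poly_eval_cong: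
  assumes "p \<in> polys I" "\<And>i. i \<in> I \<Longrightarrow> x i = y i"
  shows "poly_eval p x = poly_eval p y"
proof -
  have "mono_eval m x = mono_eval m y" if "m \<in> Poly_Mapping.keys p" for m
    unfolding mono_eval_def using that assms by (intro prod.cong) (auto simp: polys_def subset_iff)
  then show ?thesis unfolding poly_eval_def by simp
qed

lemma polys_subring: "subring_of (polys I :: 'i::linorder mpoly set)"
  unfolding subring_of_def
proof (intro conjI ballI)
  fix p q :: "'i mpoly" assume pq: "p \<in> polys I" "q \<in> polys I"
  show "p + q \<in> polys I" using pq Poly_Mapping.keys_add[of p q] by (fastforce simp: polys_def)
  show "- p \<in> polys I" using pq by (auto simp: polys_def in_keys_iff)
  show "p * q \<in> polys I" unfolding polys_def
  proof (intro CollectI ballI)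
    fix m assume "m \<in> Poly_Mapping.keys (p * q)"
    then obtain a b where "m = a + b" "a \<in> Poly_Mapping.keys p" "b \<in> Poly_Mapping.keys q"
      using keys_mult[of p q] by blast
    then show "Poly_Mapping.keys m \<subseteq> I"
      using pq Poly_Mapping.keys_add[of a b] by (fastforce simp: polys_def)
  qed
qed (auto simp: polys_def)

lemma polys_mono: "I \<subseteq> J \<Longrightarrow> polys I \<subseteq> polys J"
  by (auto simp: polys_def)

lemma single_in_polys: "Poly_Mapping.keys m \<subseteq> I \<Longrightarrow> Poly_Mapping.single m c \<in> polys I"
  by (auto simp: polys_def)

lemma poly_var_in_polys: "i \<in> I \<Longrightarrow> poly_var i \<in> polys I"
  by (auto simp: poly_var_def intro: single_in_polys)

lemma const_in_polys: "const_poly c \<in> polys I"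
  by (rule single_in_polys) auto

lemma const_dvd_1:
  assumes "c \<noteq> 0"
  shows "dvd_in (polys I :: 'i::linorder mpoly set) (const_poly c) 1"
  unfolding dvd_in_def
  by (rule bexI[of _ "const_poly (inverse c)"]) (use assms in \<open>auto simp: mult_single const_in_polys\<close>)

lemma polys_empty: "p \<in> polys {} \<Longrightarrow> p = const_poly (Poly_Mapping.lookup p 0)"
  by (rule poly_mapping_eqI)
    (auto simp: polys_def lookup_single when_def in_keys_iff)

lemma factorial_polys_empty: "factorial_in (polys {} :: 'i::linorder mpoly set)"
  unfolding factorial_in_def
proof (intro ballI impI)
  fix a :: "'i mpoly" assume a: "a \<in> polys {}" "a \<noteq> 0"
  then have c: "a = const_poly (Poly_Mapping.lookup a 0)" by (simp add: polys_empty)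
  then have "Poly_Mapping.lookup a 0 \<noteq> 0" using a by auto
  then have "dvd_in (polys {}) a 1" using c const_dvd_1 by metis
  then show "\<exists>u ps. u \<in> polys {} \<and> dvd_in (polys {}) u 1 \<and>
     (\<forall>p\<in>set ps. prime_in (polys {}) p) \<and> a = u * prod_list ps"
    using a by (intro exI[of _ a] exI[of _ "[]"]) auto
qed

text \<open>Units, primes and factorizations are described by multiplication, so a multiplicative
  bijection preserving 0 and 1 carries them over.\<close>

locale monoid_iso =
  fixes h :: "'r::idom \<Rightarrow> 's::idom" and A :: "'r set" and B :: "'s set"
  assumes sub: "subring_of A" "subring_of B" and inj: "inj_on h A" and img: "h ` A = B"
    and hmult: "\<And>a b. h (a * b) = h a * h b" and h1: "h 1 = 1" and h0: "h 0 = 0"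
begin

lemma h_in: "a \<in> A \<Longrightarrow> h a \<in> B"
  using img by auto

lemma h_eq_iff: "a \<in> A \<Longrightarrow> b \<in> A \<Longrightarrow> h a = h b \<longleftrightarrow> a = b"
  using inj by (auto simp: inj_on_def)

lemma dvd_iff: "a \<in> A \<Longrightarrow> b \<in> A \<Longrightarrow> dvd_in B (h a) (h b) \<longleftrightarrow> dvd_in A a b"
  unfolding dvd_in_def img[symmetric]
  using h_eq_iff[of b] subring_ofD(4)[OF sub(1)] by (auto simp flip: hmult)

lemma one_in: "1 \<in> A" "0 \<in> A"
  using subring_ofD[OF sub(1)] by auto

lemma prime_iff:
  assumes p: "p \<in> A"
  shows "prime_in B (h p) \<longleftrightarrow> prime_in A p"
proof -
  have 1: "h p \<noteq> 0 \<longleftrightarrow> p \<noteq> 0" using h_eq_iff[OF p one_in(2)] h0 by auto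
  have 2: "dvd_in B (h p) 1 \<longleftrightarrow> dvd_in A p 1" using dvd_iff[OF p one_in(1)] h1 by auto
  have 3: "(\<forall>a\<in>B. \<forall>b\<in>B. dvd_in B (h p) (a * b) \<longrightarrow> dvd_in B (h p) a \<or> dvd_in B (h p) b) \<longleftrightarrow>
     (\<forall>a\<in>A. \<forall>b\<in>A. dvd_in A p (a * b) \<longrightarrow> dvd_in A p a \<or> dvd_in A p b)"
    unfolding img[symmetric] ball_simps(9) hmult[symmetric]
    using dvd_iff[OF p] subring_ofD(4)[OF sub(1)] img by auto
  show ?thesis unfolding prime_in_def 2 3 using 1 p h_in by auto
qed

lemma h_prod_list: "h (prod_list ps) = prod_list (map h ps)"
  by (induction ps) (auto simp: h1 hmult)

lemma factorial: "factorial_in A \<Longrightarrow> factorial_in B"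
  unfolding factorial_in_def
proof (intro ballI impI)
  fix b assume *: "\<forall>a\<in>A. a \<noteq> 0 \<longrightarrow> (\<exists>u ps. u \<in> A \<and> dvd_in A u 1 \<and>
     (\<forall>p\<in>set ps. prime_in A p) \<and> a = u * prod_list ps)" and b: "b \<in> B" "b \<noteq> 0"
  then obtain a where a: "a \<in> A" "b = h a" using img by blast
  then have "a \<noteq> 0" using b h0 by auto
  then obtain u ps where u: "u \<in> A" "dvd_in A u 1" "\<forall>p\<in>set ps. prime_in A p" "a = u * prod_list ps"
    using * a by blast
  have "dvd_in B (h u) 1" using dvd_iff[OF u(1) one_in(1)] u h1 by auto
  moreover have "\<forall>p\<in>set (map h ps). prime_in B p" using u prime_iff by (auto simp: prime_in_def)
  moreover have "b = h u * prod_list (map h ps)" using u a by (simp add: hmult h_prod_list)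
  ultimately show "\<exists>u ps. u \<in> B \<and> dvd_in B u 1 \<and> (\<forall>p\<in>set ps. prime_in B p) \<and> b = u * prod_list ps"
    using h_in[OF u(1)] by blast
qed

end

text \<open>Substituting the variable \<open>X\<^sub>i\<close> identifies $R[X]$, where $R$ is the ring of polynomials in the
  other variables, with the polynomials in all variables.\<close>

definition adjoin :: "'i::linorder \<Rightarrow> 'i mpoly poly \<Rightarrow> 'i mpoly" where
  "adjoin i P = poly P (poly_var i)"

lemma poly_eval_adjoin:
  assumes "P \<in> poly_carrier (polys I)" "i \<notin> I"
  shows "poly_eval (adjoin i P) (x(i := t)) = poly (map_poly (\<lambda>c. poly_eval c x) P) t"
proof -
  have "poly_eval (coeff P k) (x(i := t)) = poly_eval (coeff P k) x" for k
    using assms by (intro poly_eval_cong[of _ I]) (auto simp: poly_carrier_def)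
  then have 1: "poly_eval (adjoin i P) (x(i := t)) = (\<Sum>k\<le>degree P. poly_eval (coeff P k) x * t ^ k)"
    unfolding adjoin_def poly_altdef by (simp add: poly_eval_simps)
  have "poly (map_poly (\<lambda>c. poly_eval c x) P) t = (\<Sum>k\<le>degree P. poly_eval (coeff P k) x * t ^ k)"
  proof -
    have "degree (map_poly (\<lambda>c. poly_eval c x) P) \<le> degree P"
      by (rule degree_le) (auto simp: coeff_map_poly coeff_eq_0)
    then show ?thesis unfolding poly_altdef
      by (intro sum.mono_neutral_cong_left) (auto simp: coeff_map_poly intro: le_degree)
  qed
  with 1 show ?thesis by simp
qed

lemma poly_var_power: "poly_var i ^ k = Poly_Mapping.single (Poly_Mapping.single i k) 1"
  by (induction k) (auto simp: poly_var_def mult_single simp flip: single_add)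

lemma adjoin_surj:
  assumes "p \<in> polys (insert i I)"
  obtains P where "P \<in> poly_carrier (polys I)" "adjoin i P = p"
proof -
  have 1: "\<exists>P. P \<in> poly_carrier (polys I) \<and> adjoin i P = Poly_Mapping.single m c"
    if m: "Poly_Mapping.keys m \<subseteq> insert i I" for m c
  proof -
    define k where "k = Poly_Mapping.lookup m i"
    define m' where "m' = m - Poly_Mapping.single i k"
    have mm: "m = m' + Poly_Mapping.single i k"
      by (rule poly_mapping_eqI) (auto simp: m'_def k_def lookup_add lookup_minus lookup_single when_def)
    have "Poly_Mapping.lookup m' i = 0" by (simp add: m'_def k_def lookup_minus)
    moreover have "Poly_Mapping.lookup m' j = Poly_Mapping.lookup m j" if "j \<noteq> i" for j
      using that by (auto simp: m'_def lookup_minus lookup_single when_def)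
    ultimately have "Poly_Mapping.keys m' \<subseteq> I"
      using m unfolding subset_iff in_keys_iff by (metis insertE)
    then have "monom (Poly_Mapping.single m' c) k \<in> poly_carrier (polys I)"
      by (intro monom_poly_carrier polys_subring single_in_polys)
    moreover have "adjoin i (monom (Poly_Mapping.single m' c) k) = Poly_Mapping.single m c"
      by (simp add: adjoin_def poly_monom poly_var_power mult_single mm)
    ultimately show ?thesis by blast
  qed
  have "\<forall>m\<in>Poly_Mapping.keys p. \<exists>P. P \<in> poly_carrier (polys I) \<and>
     adjoin i P = Poly_Mapping.single m (Poly_Mapping.lookup p m)"
    using 1 assms by (auto simp: polys_def)
  then obtain f where f: "\<And>m. m \<in> Poly_Mapping.keys p \<Longrightarrow> f m \<in> poly_carrier (polys I) \<and>
     adjoin i (f m) = Poly_Mapping.single m (Poly_Mapping.lookup p m)"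
    by metis
  have "(\<Sum>m\<in>Poly_Mapping.keys p. f m) \<in> poly_carrier (polys I)"
    using f by (intro subring_of_sum poly_carrier_subring polys_subring) auto
  moreover have "adjoin i (\<Sum>m\<in>Poly_Mapping.keys p. f m) = p"
  proof -
    have "adjoin i (\<Sum>m\<in>Poly_Mapping.keys p. f m) = (\<Sum>m\<in>Poly_Mapping.keys p. adjoin i (f m))"
      by (simp add: adjoin_def poly_sum)
    also have "\<dots> = p" using f by (subst (2) sum_singles[symmetric]) (auto intro: sum.cong)
    finally show ?thesis .
  qed
  ultimately show ?thesis using that by blast
qed

lemma affine_space_update: "x \<in> affine_space I \<Longrightarrow> x(i := t) \<in> affine_space (insert i I)"
  by (auto simp: affine_space_def)

text \<open>With the other variables fixed, a univariate polynomial vanishes on all complex numbers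
  and is zero, so its coefficients vanish at every point and the induction hypothesis applies.
  Polynomial identities can thus be checked on values.\<close>

theorem poly_eval_eq_0_imp:
  assumes "finite I" "p \<in> polys I" "\<And>x. x \<in> affine_space I \<Longrightarrow> poly_eval p x = 0"
  shows "p = (0 :: 'i::linorder mpoly)"
  using assms
proof (induction I arbitrary: p rule: finite_induct)
  case empty
  then obtain c where c: "p = const_poly c" using polys_empty by blast
  have "poly_eval p (\<lambda>_. 0) = 0" by (rule empty.prems(2)) (simp add: affine_space_def)
  then have "c = 0" unfolding c by (simp add: poly_eval_single)
  then show ?case using c by simp
next
  case (insert i I)
  obtain P where P: "P \<in> poly_carrier (polys I)" "adjoin i P = p"
    using adjoin_surj[OF insert.prems(1)] by blast
  have "coeff P k = 0" for k
  proof (rule insert.IH)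
    show "coeff P k \<in> polys I" using P by (auto simp: poly_carrier_def)
    fix x assume x: "x \<in> affine_space I"
    have "poly (map_poly (\<lambda>c. poly_eval c x) P) t = 0" for t
      using poly_eval_adjoin[OF P(1) insert.hyps(2), of x t] P(2) insert.prems(2) affine_space_update[OF x]
      by metis
    then have "map_poly (\<lambda>c. poly_eval c x) P = 0" using poly_all_0_iff_0 by blast
    then have "coeff (map_poly (\<lambda>c. poly_eval c x) P) k = 0" by simp
    then show "poly_eval (coeff P k) x = 0" by (simp add: coeff_map_poly)
  qed
  then have "P = 0" by (auto intro: poly_eqI)
  then show ?case using P by (simp add: adjoin_def)
qed

lemma nonzero_point:
  assumes "finite I" "p \<in> polys I" "p \<noteq> (0 :: 'i::linorder mpoly)"
  obtains x where "x \<in> affine_space I" "poly_eval p x \<noteq> 0"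
  using poly_eval_eq_0_imp assms by blast

text \<open>Injectivity is checked on values: a polynomial sent to 0 has coefficients that vanish at
  every point.\<close>

lemma adjoin_iso:
  assumes "finite I" "i \<notin> I"
  shows "monoid_iso (adjoin i) (poly_carrier (polys I)) (polys (insert i I))"
proof
  let ?A = "poly_carrier (polys I)"
  show "subring_of ?A" by (intro poly_carrier_subring polys_subring)
  show "subring_of (polys (insert i I))" by (rule polys_subring)
  show hm: "adjoin i (a * b) = adjoin i a * adjoin i b" for a b by (simp add: adjoin_def)
  show "adjoin i 1 = 1" "adjoin i 0 = 0" by (auto simp: adjoin_def)
  have z: "P = 0" if P: "P \<in> ?A" "adjoin i P = 0" for P
  proof -
    have "coeff P k = 0" for k
    proof (rule poly_eval_eq_0_imp[OF assms(1)])
      show "coeff P k \<in> polys I" using P by (auto simp: poly_carrier_def)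
      fix x assume x: "x \<in> affine_space I"
      have "poly (map_poly (\<lambda>c. poly_eval c x) P) t = 0" for t
        using poly_eval_adjoin[OF P(1) assms(2), of x t] P(2) by simp
      then have "map_poly (\<lambda>c. poly_eval c x) P = 0" using poly_all_0_iff_0 by blast
      then have "coeff (map_poly (\<lambda>c. poly_eval c x) P) k = 0" by simp
      then show "poly_eval (coeff P k) x = 0" by (simp add: coeff_map_poly)
    qed
    then show ?thesis by (auto intro: poly_eqI)
  qed
  show "inj_on (adjoin i) ?A"
  proof (rule inj_onI)
    fix P Q assume PQ: "P \<in> ?A" "Q \<in> ?A" "adjoin i P = adjoin i Q"
    then have "adjoin i (P - Q) = 0" by (simp add: adjoin_def)
    moreover have "P - Q \<in> ?A" using PQ subring_ofD(6)[OF poly_carrier_subring[OF polys_subring]] by blast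
    ultimately show "P = Q" using z[of "P - Q"] by simp
  qed
  show "adjoin i ` ?A = polys (insert i I)"
  proof
    show "polys (insert i I) \<subseteq> adjoin i ` ?A" using adjoin_surj by (metis image_eqI subsetI)
    show "adjoin i ` ?A \<subseteq> polys (insert i I)"
    proof
      fix p assume "p \<in> adjoin i ` ?A"
      then obtain P where P: "P \<in> ?A" "p = adjoin i P" by blast
      have "coeff P k * poly_var i ^ k \<in> polys (insert i I)" for k
      proof -
        have "coeff P k \<in> polys (insert i I)"
          using P polys_mono[of I "insert i I"] by (auto simp: poly_carrier_def)
        then show ?thesis
          by (intro subring_ofD(4)[OF polys_subring] subring_of_power[OF polys_subring])
            (auto intro: poly_var_in_polys)
      qed
      then show "p \<in> polys (insert i I)" unfolding P adjoin_def poly_altdef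
        by (intro subring_of_sum polys_subring)
    qed
  qed
qed

theorem factorial_polys: "finite I \<Longrightarrow> factorial_in (polys I :: 'i::linorder mpoly set)"
proof (induction I rule: finite_induct)
  case empty
  then show ?case by (rule factorial_polys_empty)
next
  case (insert i I)
  interpret monoid_iso "adjoin i" "poly_carrier (polys I)" "polys (insert i I)"
    by (rule adjoin_iso) (use insert in auto)
  show ?case using factorial factorial_poly_carrier[OF polys_subring insert.IH] by blast
qed

text \<open>Eliminating a variable that occurs in \<open>p\<close> reduces this to the existence of roots of univariate
  polynomials.\<close>

theorem hypersurface_nullstellensatz:
  assumes J: "finite J" and p: "prime_in (polys J) p" and q: "q \<in> polys J"
    and ndvd: "\<not> dvd_in (polys J) p (q :: 'i::linorder mpoly)"
  obtains x where "x \<in> affine_space J" "poly_eval p x = 0" "poly_eval q x \<noteq> 0"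
proof -
  have pJ: "p \<in> polys J" "p \<noteq> 0" "\<not> dvd_in (polys J) p 1" using p by (auto simp: prime_in_def)
  have "\<exists>m\<in>Poly_Mapping.keys p. m \<noteq> 0"
  proof (rule ccontr)
    assume "\<not> ?thesis"
    then have "p \<in> polys {}" by (auto simp: polys_def)
    then have "p = const_poly (Poly_Mapping.lookup p 0)" by (rule polys_empty)
    moreover from this have "Poly_Mapping.lookup p 0 \<noteq> 0" using pJ(2) by auto
    ultimately show False using const_dvd_1 pJ(3) by metis
  qed
  then obtain m i where m: "m \<in> Poly_Mapping.keys p" "i \<in> Poly_Mapping.keys m"
    by (metis all_not_in_conv keys_eq_empty)
  then have iJ: "i \<in> J" using pJ by (auto simp: polys_def)
  define I where "I = J - {i}"
  have I: "finite I" "i \<notin> I" "J = insert i I" using J iJ by (auto simp: I_def)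
  let ?A = "polys I" and ?AX = "poly_carrier (polys I)"
  interpret monoid_iso "adjoin i" ?AX "polys J"
    unfolding I(3) by (rule adjoin_iso) (use I in auto)
  obtain P where P: "P \<in> ?AX" "adjoin i P = p" using adjoin_surj pJ I by metis
  obtain Q where Q: "Q \<in> ?AX" "adjoin i Q = q" using adjoin_surj q I by metis
  have pP: "prime_in ?AX P" using prime_iff[OF P(1)] P p by simp
  have P0: "P \<noteq> 0" using pP by (auto simp: prime_in_def)
  have dP: "degree P > 0"
  proof (rule ccontr)
    assume "\<not> ?thesis"
    then obtain c where c: "P = [:c:]" by (auto elim: degree_eq_zeroE)
    then have "p = c" using P by (simp add: adjoin_def)
    then have "p \<in> polys I" using P c const_poly_carrier[OF polys_subring] by metis
    then show False using m I by (auto simp: polys_def)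
  qed
  have "irred_poly ?A P" unfolding irred_poly_def[OF polys_subring]
    using pP prime_in_irreducible[OF sub(1) pP] by (auto simp: prime_in_def)
  moreover have "\<not> dvd_in ?AX P Q" using dvd_iff[OF P(1) Q(1)] ndvd P Q by simp
  ultimately obtain d S T where d: "d \<in> ?A" "d \<noteq> 0" "S \<in> ?AX" "T \<in> ?AX" "[:d:] = S * P + T * Q"
    using elimination[OF polys_subring factorial_polys[OF I(1)] _ dP Q(1)] by metis
  have lA: "lead_coeff P \<in> ?A" "lead_coeff P \<noteq> 0" using P P0 by (auto simp: poly_carrier_def)
  then have "d * lead_coeff P \<in> ?A" "d * lead_coeff P \<noteq> 0" using d subring_ofD(4)[OF polys_subring] by auto
  \<comment> \<open>At \<open>y\<close> the leading coefficient survives, so the specialization of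
    \<open>P\<close> keeps positive degree and has a root; since \<open>d\<close> survives as well,
    \<open>q\<close> cannot vanish at that root.\<close>
  then obtain y where y: "y \<in> affine_space I" "poly_eval (d * lead_coeff P) y \<noteq> 0"
    using nonzero_point[OF I(1)] by metis
  define f where "f = map_poly (\<lambda>c. poly_eval c y) P"
  have "coeff f (degree P) \<noteq> 0" using y by (simp add: f_def coeff_map_poly poly_eval_mult)
  then have "degree f > 0" using dP le_degree by (metis gr_zeroI le_zero_eq less_irrefl)
  then obtain t where t: "poly f t = 0"
    using fundamental_theorem_of_algebra constant_degree by (metis less_irrefl)
  have ev: "poly_eval (adjoin i R) (y(i := t)) = poly (map_poly (\<lambda>c. poly_eval c y) R) t" if "R \<in> ?AX" for R
    using poly_eval_adjoin[OF that I(2)] .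
  have pt: "poly_eval p (y(i := t)) = 0" using ev[OF P(1)] P t by (simp add: f_def)
  have "poly_eval (adjoin i [:d:]) (y(i := t)) = poly_eval d y"
    using ev[of "[:d:]"] d(1) const_poly_carrier[OF polys_subring, of d I] by (simp add: map_poly_pCons)
  moreover have "adjoin i [:d:] = adjoin i S * p + adjoin i T * q"
    unfolding d(5) using P Q by (simp add: adjoin_def)
  ultimately have "poly_eval d y = poly_eval (adjoin i T) (y(i := t)) * poly_eval q (y(i := t))"
    using pt by (simp add: poly_eval_simps)
  then have "poly_eval q (y(i := t)) \<noteq> 0" using y by (auto simp: poly_eval_mult)
  moreover have "y(i := t) \<in> affine_space J" using affine_space_update[OF y(1)] I by auto
  ultimately show ?thesis using that pt by blast
qed

section \<open>Homogeneous polynomials\<close>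

definition mono_deg :: "('i \<Rightarrow>\<^sub>0 nat) \<Rightarrow> nat" where
  "mono_deg m = (\<Sum>i\<in>Poly_Mapping.keys m. Poly_Mapping.lookup m i)"

lemma homogeneous_iff: "homogeneous k p \<longleftrightarrow> (\<forall>m\<in>Poly_Mapping.keys p. mono_deg m = k)"
  by (simp add: homogeneous_def mono_deg_def)

lemma mono_deg_add: "mono_deg (m + m') = mono_deg m + mono_deg m'"
proof -
  let ?S = "Poly_Mapping.keys m \<union> Poly_Mapping.keys m'"
  have 1: "mono_deg k = (\<Sum>i\<in>?S. Poly_Mapping.lookup k i)" if "Poly_Mapping.keys k \<subseteq> ?S" for k
    unfolding mono_deg_def using that by (intro sum.mono_neutral_left) (auto simp: in_keys_iff)
  show ?thesis
    using 1[of m] 1[of m'] 1[of "m + m'"] Poly_Mapping.keys_add[of m m']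
    by (simp add: lookup_add sum.distrib)
qed

lemma mono_deg_0 [simp]: "mono_deg 0 = 0"
  by (simp add: mono_deg_def)

lemma mono_deg_eq_0: "mono_deg m = 0 \<longleftrightarrow> m = 0"
  by (auto simp: mono_deg_def in_keys_iff intro!: poly_mapping_eqI)

lemma mono_eval_scale: "mono_eval m (\<lambda>i. c * x i) = c ^ mono_deg m * mono_eval m x"
  by (simp add: mono_eval_def mono_deg_def power_mult_distrib prod.distrib power_sum)

lemma homogeneous_0 [simp]: "homogeneous k 0"
  by (simp add: homogeneous_def)

lemma homogeneous_single: "homogeneous (mono_deg m) (Poly_Mapping.single m c)"
  by (auto simp: homogeneous_iff split: if_splits)

lemma homogeneous_const: "homogeneous 0 (const_poly c)"
  using homogeneous_single[of 0 c] by simp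

lemma homogeneous_1: "homogeneous 0 1"
  using homogeneous_const[of 1] by simp

lemma homogeneous_add: "homogeneous k p \<Longrightarrow> homogeneous k q \<Longrightarrow> homogeneous k (p + q)"
  using Poly_Mapping.keys_add[of p q] by (auto simp: homogeneous_iff)

lemma homogeneous_sum: "(\<And>i. i \<in> S \<Longrightarrow> homogeneous k (f i)) \<Longrightarrow> homogeneous k (sum f S)"
  by (induction S rule: infinite_finite_induct) (auto intro: homogeneous_add)

lemma homogeneous_mult: "homogeneous k p \<Longrightarrow> homogeneous l q \<Longrightarrow> homogeneous (k + l) (p * q)"
  using keys_mult[of p q] by (fastforce simp: homogeneous_iff mono_deg_add)

lemma homogeneous_const_mult: "homogeneous k p \<Longrightarrow> homogeneous k (const_poly c * p)"
  using homogeneous_mult[OF homogeneous_const] by fastforce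

lemma homogeneous_power: "homogeneous k p \<Longrightarrow> homogeneous (j * k) (p ^ j)"
  by (induction j) (auto simp: homogeneous_1 intro: homogeneous_mult)

lemma homogeneous_prod:
  "(\<And>i. i \<in> S \<Longrightarrow> homogeneous (k i) (f i)) \<Longrightarrow> homogeneous (\<Sum>i\<in>S. k i) (\<Prod>i\<in>S. f i)"
  by (induction S rule: infinite_finite_induct) (auto simp: homogeneous_1 intro: homogeneous_mult)

lemma homogeneous_unique: "homogeneous k p \<Longrightarrow> homogeneous l p \<Longrightarrow> p \<noteq> 0 \<Longrightarrow> k = l"
  by (metis homogeneous_iff keys_eq_empty equals0I)

lemma poly_eval_homogeneous_scale:
  "homogeneous k p \<Longrightarrow> poly_eval p (\<lambda>i. c * x i) = c ^ k * poly_eval p x"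
  by (simp add: poly_eval_def mono_eval_scale homogeneous_iff sum_distrib_left mult.left_commute)

lemma homogeneous_0_const:
  assumes "homogeneous 0 p"
  shows "p = const_poly (Poly_Mapping.lookup p 0)"
proof -
  have "p \<in> polys {}" using assms by (auto simp: homogeneous_iff polys_def mono_deg_eq_0)
  then show ?thesis by (rule polys_empty)
qed

lemma poly_eval_homogeneous_zero:
  assumes "homogeneous k p" "k > 0"
  shows "poly_eval p (\<lambda>_. 0) = 0"
  using poly_eval_homogeneous_scale[OF assms(1), of 0 "\<lambda>_. 0"] assms(2) by (simp add: zero_power)

text \<open>The orders of \<open>f\<close> and \<open>g\<close> at 0 add up to at least k, which is
  also the sum of their degrees. Hence the order of \<open>f\<close> equals its degree and
  \<open>f\<close> has a single term.\<close>

lemma factor_of_monom: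
  fixes f g :: "complex poly"
  assumes "f * g = monom a k" "a \<noteq> 0" "coeff f i \<noteq> 0" "coeff f j \<noteq> 0"
  shows "i = j"
proof -
  have nz: "f \<noteq> 0" "g \<noteq> 0" using assms by auto
  have "monom 1 k dvd monom a k" by (metis assms(2) dvd_refl dvd_smult smult_monom mult.right_neutral)
  then have "k \<le> order 0 (f * g)" using assms by (metis monom_1_dvd_iff monom_eq_0_iff)
  also have "\<dots> = order 0 f + order 0 g" using nz by (intro order_mult) auto
  also have "order 0 g \<le> degree g" using nz order_degree by blast
  finally have "k \<le> order 0 f + degree g" by simp
  moreover have "degree f + degree g = k"
    using degree_mult_eq[OF nz] assms(1,2) by (simp add: degree_monom_eq)
  ultimately have "degree f \<le> order 0 f" by simp
  moreover have "monom 1 (order 0 f) dvd f" using nz monom_1_dvd_iff by blast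
  ultimately have "coeff f l = 0" if "l < degree f" for l
    using monom_1_dvd_iff'[of "order 0 f" f] that by auto
  then have "i = degree f" "j = degree f" using assms(3,4) by (metis le_degree nat_less_le)+
  then show ?thesis by simp
qed

text \<open>If \<open>p\<close> had terms of two degrees, there would be a point x at which both
  homogeneous components and \<open>p * q\<close> are nonzero. On the line through x the product is
  a monomial in the scale factor, whereas its factor from \<open>p\<close> has two terms.\<close>

lemma homogeneous_factor:
  fixes p q :: "'i::linorder mpoly"
  assumes I: "finite I" and pq: "p \<in> polys I" "q \<in> polys I" "p * q \<noteq> 0" "homogeneous k (p * q)"
  obtains j where "homogeneous j p"
proof (rule ccontr)
  assume no: "\<not> thesis"
  note hom_thesis = that
  have p0: "p \<noteq> 0" using pq by auto
  then obtain m1 where m1: "m1 \<in> Poly_Mapping.keys p" by (metis keys_eq_empty all_not_in_conv)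
  then obtain m2 where m2: "m2 \<in> Poly_Mapping.keys p" "mono_deg m2 \<noteq> mono_deg m1"
    using no hom_thesis[of "mono_deg m1"] by (auto simp: homogeneous_iff)
  define comp where "comp d = (\<Sum>m\<in>{m\<in>Poly_Mapping.keys p. mono_deg m = d}.
    Poly_Mapping.single m (Poly_Mapping.lookup p m))" for d
  have lc: "Poly_Mapping.lookup (comp (mono_deg m)) m \<noteq> 0" if "m \<in> Poly_Mapping.keys p" for m
    using that by (auto simp: comp_def lookup_sum lookup_single when_def sum.delta' in_keys_iff)
  have cp: "comp d \<in> polys I" for d unfolding comp_def
    using pq by (intro subring_of_sum polys_subring single_in_polys) (auto simp: polys_def)
  have c0: "comp (mono_deg m1) \<noteq> 0" "comp (mono_deg m2) \<noteq> 0" using lc m1 m2 by force+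
  let ?h = "p * q * (comp (mono_deg m1) * comp (mono_deg m2))"
  have "?h \<in> polys I" using pq cp subring_ofD(4)[OF polys_subring] by blast
  moreover have "?h \<noteq> 0" using c0 pq by simp
  ultimately obtain x where x: "poly_eval ?h x \<noteq> 0" using nonzero_point[OF I] by blast
  \<comment> \<open>\<open>f r\<close> is the restriction of \<open>r\<close> to the line through x,
    as a polynomial in the scale factor; its coefficients are the values at x of the homogeneous
    components of \<open>r\<close>.\<close>
  define f where "f r = (\<Sum>m\<in>Poly_Mapping.keys r. monom (Poly_Mapping.lookup r m * mono_eval m x) (mono_deg m))"
    for r :: "'i mpoly"
  have ev: "poly (f r) c = poly_eval r (\<lambda>i. c * x i)" for r c
    by (simp add: f_def poly_sum poly_monom poly_eval_def mono_eval_scale ac_simps)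
  have "poly (f p * f q) = poly (monom (poly_eval (p * q) x) k)"
    by (rule ext) (use ev poly_eval_homogeneous_scale[OF pq(4)] in
      \<open>auto simp: poly_monom poly_eval_mult[symmetric] mult.commute\<close>)
  then have "f p * f q = monom (poly_eval (p * q) x) k" using poly_eq_poly_eq_iff by blast
  moreover have "coeff (f p) d = poly_eval (comp d) x" for d
  proof -
    have "coeff (f p) d = (\<Sum>m\<in>Poly_Mapping.keys p.
        if mono_deg m = d then Poly_Mapping.lookup p m * mono_eval m x else 0)"
      by (simp add: f_def coeff_sum)
    also have "\<dots> = (\<Sum>m\<in>{m\<in>Poly_Mapping.keys p. mono_deg m = d}. Poly_Mapping.lookup p m * mono_eval m x)"
      by (simp add: sum.inter_filter)
    also have "\<dots> = poly_eval (comp d) x" by (simp add: comp_def poly_eval_simps)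
    finally show ?thesis .
  qed
  moreover have "poly_eval (p * q) x \<noteq> 0" "poly_eval (comp (mono_deg m1)) x \<noteq> 0"
    "poly_eval (comp (mono_deg m2)) x \<noteq> 0" using x by (auto simp: poly_eval_mult)
  ultimately show False using factor_of_monom m2(2) by metis
qed

text \<open>A unit is a factor of the homogeneous polynomial 1, so it is homogeneous, and degrees
  force degree 0.\<close>

lemma polys_unit_const:
  fixes u :: "'i::linorder mpoly"
  assumes I: "finite I" and u: "u \<in> polys I" "dvd_in (polys I) u 1"
  obtains c where "c \<noteq> 0" "u = const_poly c"
proof -
  obtain v where v: "v \<in> polys I" "1 = u * v" using u unfolding dvd_in_def by blast
  then have nz: "u * v \<noteq> 0" "homogeneous 0 (u * v)" using homogeneous_1 by (metis zero_neq_one, metis)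
  obtain i where i: "homogeneous i u" using homogeneous_factor[OF I u(1) v(1) nz] by blast
  obtain j where j: "homogeneous j v"
    using homogeneous_factor[OF I v(1) u(1)] nz by (metis mult.commute)
  have "i + j = 0" using homogeneous_unique[OF homogeneous_mult[OF i j] nz(2,1)] .
  then have "homogeneous 0 u" using i by simp
  then have c: "u = const_poly (Poly_Mapping.lookup u 0)" by (rule homogeneous_0_const)
  moreover have "Poly_Mapping.lookup u 0 \<noteq> 0" using c nz by (metis mult_zero_left single_zero)
  ultimately show ?thesis using that by blast
qed

lemma prime_homogeneous_pos:
  fixes p :: "'i::linorder mpoly"
  assumes "prime_in (polys I) p" "homogeneous k p"
  shows "k > 0"
proof (rule ccontr)
  assume "\<not> ?thesis"
  then have "p = const_poly (Poly_Mapping.lookup p 0)" using assms homogeneous_0_const by auto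
  moreover from this have "Poly_Mapping.lookup p 0 \<noteq> 0" using assms by (auto simp: prime_in_def)
  ultimately show False using assms const_dvd_1 unfolding prime_in_def by metis
qed

lemma prime_in_const_mult:
  fixes p :: "'i::linorder mpoly"
  assumes "prime_in (polys I) p" "c \<noteq> 0"
  shows "prime_in (polys I) (const_poly c * p)"
proof -
  have e: "dvd_in (polys I) (const_poly c * p) a \<longleftrightarrow> dvd_in (polys I) p a" for a
  proof
    assume "dvd_in (polys I) (const_poly c * p) a"
    then obtain b where "b \<in> polys I" "a = const_poly c * p * b" unfolding dvd_in_def by blast
    then have "a = p * (const_poly c * b)" "const_poly c * b \<in> polys I"
      using subring_ofD(4)[OF polys_subring const_in_polys] by (auto simp: ac_simps)
    then show "dvd_in (polys I) p a" unfolding dvd_in_def by blast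
  next
    assume "dvd_in (polys I) p a"
    then obtain b where b: "b \<in> polys I" "a = p * b" unfolding dvd_in_def by blast
    have "a = (const_poly c * const_poly (inverse c)) * (p * b)" using b assms(2) by (simp add: mult_single)
    then have "a = const_poly c * p * (const_poly (inverse c) * b)" by (simp only: ac_simps)
    moreover have "const_poly (inverse c) * b \<in> polys I"
      using subring_ofD(4)[OF polys_subring const_in_polys] b by blast
    ultimately show "dvd_in (polys I) (const_poly c * p) a" unfolding dvd_in_def by blast
  qed
  have "const_poly c * p \<noteq> 0" using assms by (metis (no_types) prime_in_def mult_eq_0_iff lookup_single_eq lookup_zero)
  moreover have "const_poly c * p \<in> polys I"
    using assms subring_ofD(4)[OF polys_subring const_in_polys] unfolding prime_in_def by blast
  ultimately show ?thesis using assms e unfolding prime_in_def by blast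
qed

lemma prod_list_count:
  assumes "finite P" "set xs \<subseteq> P"
  shows "prod_list xs = (\<Prod>p\<in>P. p ^ count_list xs p)"
  using assms(2)
proof (induction xs)
  case (Cons x xs)
  have "(\<Prod>p\<in>P. p ^ count_list (x # xs) p) = (\<Prod>p\<in>P. (if p = x then x else 1) * p ^ count_list xs p)"
    by (intro prod.cong) auto
  also have "\<dots> = x * (\<Prod>p\<in>P. p ^ count_list xs p)"
    using Cons.prems assms(1) by (simp add: prod.distrib prod.delta)
  finally show ?case using Cons by simp
qed auto

text \<open>One set \<open>P\<close> serves the whole family, so that exponents of different members
  can be compared prime by prime. It consists of one representative from each class of associated
  primes, which costs only constants because units are constants.\<close>

lemma homogeneous_factorization:
  fixes a :: "'s \<Rightarrow> 'i::linorder mpoly"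
  assumes I: "finite I" and S: "finite S"
    and a: "\<And>s. s \<in> S \<Longrightarrow> a s \<in> polys I \<and> a s \<noteq> 0 \<and> (\<exists>k. homogeneous k (a s))"
  obtains P c m where "finite P" "\<And>p. p \<in> P \<Longrightarrow> prime_in (polys I) p \<and> (\<exists>k. homogeneous k p)"
    "\<And>p q. p \<in> P \<Longrightarrow> q \<in> P \<Longrightarrow> dvd_in (polys I) p q \<Longrightarrow> p = q"
    "\<And>s. s \<in> S \<Longrightarrow> c s \<noteq> 0 \<and> a s = const_poly (c s) * (\<Prod>p\<in>P. p ^ m s p)"
proof -
  let ?A = "polys I :: 'i mpoly set"
  note sr = polys_subring[of I]
  have "\<forall>s\<in>S. \<exists>u ps. u \<in> ?A \<and> dvd_in ?A u 1 \<and> (\<forall>p\<in>set ps. prime_in ?A p) \<and> a s = u * prod_list ps"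
    using factorial_polys[OF I] a unfolding factorial_in_def by blast
  then obtain u ps where ups: "\<And>s. s \<in> S \<Longrightarrow> u s \<in> ?A \<and> dvd_in ?A (u s) 1 \<and>
      (\<forall>p\<in>set (ps s). prime_in ?A p) \<and> a s = u s * prod_list (ps s)" by metis
  define assoc where "assoc p q \<longleftrightarrow> dvd_in ?A p q \<and> dvd_in ?A q p" for p q
  define rep where "rep p = (SOME q. assoc p q)" for p
  have assoc_refl: "assoc p p" for p using dvd_in_refl[OF sr] by (auto simp: assoc_def)
  have assoc_rep: "assoc p (rep p)" for p unfolding rep_def using assoc_refl by (rule someI)
  \<comment> \<open>Associated elements define the same predicate \<open>assoc p\<close>, so the
    choice operator picks the same representative for both.\<close>
  have rep_eq: "rep p = rep q" if "assoc p q" for p q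
  proof -
    have "assoc p r \<longleftrightarrow> assoc q r" for r
      using that dvd_in_trans[OF sr, of p q r] dvd_in_trans[OF sr, of q p r]
        dvd_in_trans[OF sr, of r p q] dvd_in_trans[OF sr, of r q p] unfolding assoc_def by blast
    then have "assoc p = assoc q" by blast
    then show ?thesis by (simp add: rep_def)
  qed
  have rep_const: "\<exists>c. c \<noteq> 0 \<and> p = const_poly c * rep p" if p: "prime_in ?A p" for p
  proof -
    obtain x y where xy: "x \<in> ?A" "y \<in> ?A" "p = rep p * x" "rep p = p * y"
      using assoc_rep[of p] unfolding assoc_def dvd_in_def by blast
    have "p = p * y * x" by (subst xy(4)[symmetric]) (rule xy(3))
    then have "p * 1 = p * (x * y)" by (simp add: ac_simps)
    moreover have "p \<noteq> 0" using p by (auto simp: prime_in_def)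
    ultimately have "1 = x * y" by (metis mult_cancel_left)
    then have "dvd_in ?A x 1" using xy unfolding dvd_in_def by blast
    then obtain c where "c \<noteq> 0" "x = const_poly c" using polys_unit_const[OF I xy(1)] by blast
    then show ?thesis using xy by (metis mult.commute)
  qed
  have rep_prime: "prime_in ?A (rep p)" if p: "prime_in ?A p" for p
  proof -
    obtain c where c: "c \<noteq> 0" "p = const_poly c * rep p" using rep_const[OF p] by blast
    have "const_poly (inverse c) * p = (const_poly (inverse c) * const_poly c) * rep p"
      using c by (metis mult.assoc)
    then have "rep p = const_poly (inverse c) * p" using c by (simp add: mult_single)
    then show ?thesis using prime_in_const_mult[OF p, of "inverse c"] c by simp
  qed
  have hom: "\<exists>k. homogeneous k (rep p)" if s: "s \<in> S" "p \<in> set (ps s)" for s p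
  proof -
    have pr: "prime_in ?A p" using ups s by blast
    obtain c where c: "c \<noteq> 0" "p = const_poly c * rep p" using rep_const[OF pr] by blast
    have psA: "set (remove1 p (ps s)) \<subseteq> ?A" using ups[OF s(1)] set_remove1_subset[of p "ps s"]
      by (auto simp: prime_in_def)
    define r where "r = const_poly c * (u s * prod_list (remove1 p (ps s)))"
    have "a s = u s * (p * prod_list (remove1 p (ps s)))"
      using ups[OF s(1)] prod_list_remove1[OF s(2)] by simp
    also have "\<dots> = rep p * r" unfolding r_def by (subst c(2)) (simp only: ac_simps)
    finally have as: "a s = rep p * r" .
    have "r \<in> ?A" unfolding r_def
      using ups[OF s(1)] subring_of_prod_list[OF sr psA] subring_ofD(4)[OF sr] const_in_polys by blast
    moreover have "rep p \<in> ?A" using rep_prime[OF pr] by (auto simp: prime_in_def)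
    ultimately show ?thesis using homogeneous_factor[OF I] a[OF s(1)] unfolding as by metis
  qed
  define P where "P = (\<Union>s\<in>S. rep ` set (ps s))"
  have finP: "finite P" unfolding P_def using S by auto
  have 1: "prime_in ?A p \<and> (\<exists>k. homogeneous k p)" if "p \<in> P" for p
    using that hom rep_prime ups unfolding P_def by blast
  have 2: "p = q" if "p \<in> P" "q \<in> P" "dvd_in ?A p q" for p q
  proof -
    have pr: "prime_in ?A p" "prime_in ?A q" using that rep_prime ups unfolding P_def by blast+
    have "assoc p q" using prime_in_dvd_prime[OF sr pr that(3)] that(3) by (auto simp: assoc_def)
    then have "rep p = rep q" by (rule rep_eq)
    moreover have "rep p = p" "rep q = q" using that(1,2) rep_eq[OF assoc_rep] unfolding P_def by auto
    ultimately show ?thesis by simp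
  qed
  have "\<exists>c m. c \<noteq> 0 \<and> a s = const_poly c * (\<Prod>p\<in>P. p ^ m p)" if s: "s \<in> S" for s
  proof -
    obtain c0 where c0: "c0 \<noteq> 0" "u s = const_poly c0"
      using polys_unit_const[OF I] ups[OF s] by metis
    have "\<exists>c. c \<noteq> 0 \<and> prod_list qs = const_poly c * prod_list (map rep qs)"
      if "\<forall>p\<in>set qs. prime_in ?A p" for qs
      using that
    proof (induction qs)
      case Nil
      then show ?case by (intro exI[of _ 1]) auto
    next
      case (Cons q qs)
      then obtain c d where cd: "c \<noteq> 0" "prod_list qs = const_poly c * prod_list (map rep qs)"
        "d \<noteq> 0" "q = const_poly d * rep q" using rep_const[of q] by auto
      have "prod_list (q # qs) = (const_poly d * rep q) * (const_poly c * prod_list (map rep qs))"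
        using cd by simp
      also have "\<dots> = (const_poly d * const_poly c) * prod_list (map rep (q # qs))"
        by (simp only: ac_simps list.map prod_list.Cons)
      finally show ?case using cd by (intro exI[of _ "d * c"]) (simp add: mult_single)
    qed
    then obtain c where c: "c \<noteq> 0" "prod_list (ps s) = const_poly c * prod_list (map rep (ps s))"
      using ups[OF s] by blast
    have "prod_list (map rep (ps s)) = (\<Prod>p\<in>P. p ^ count_list (map rep (ps s)) p)"
      by (rule prod_list_count) (use finP s in \<open>auto simp: P_def\<close>)
    then have "a s = (const_poly c0 * const_poly c) * (\<Prod>p\<in>P. p ^ count_list (map rep (ps s)) p)"
      using ups[OF s] c0 c by (simp add: mult.assoc)
    then show ?thesis using c0 c
      by (intro exI[of _ "c0 * c"] exI[of _ "count_list (map rep (ps s))"]) (simp add: mult_single)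
  qed
  then obtain c m where "\<And>s. s \<in> S \<Longrightarrow> c s \<noteq> 0 \<and> a s = const_poly (c s) * (\<Prod>p\<in>P. p ^ m s p)"
    by metis
  then show ?thesis using that[OF finP 1 2] by blast
qed

section \<open>Zariski topologies\<close>

lemma proj_pt_eq_iff: "proj_pt x = proj_pt y \<longleftrightarrow> (\<exists>c. c \<noteq> 0 \<and> x = (\<lambda>i. c * y i))"
proof
  assume "proj_pt x = proj_pt y"
  moreover have "x \<in> proj_pt x" unfolding proj_pt_def by (intro CollectI exI[of _ 1]) auto
  ultimately have "x \<in> proj_pt y" by simp
  then show "\<exists>c. c \<noteq> 0 \<and> x = (\<lambda>i. c * y i)" by (auto simp: proj_pt_def)
next
  assume "\<exists>c. c \<noteq> 0 \<and> x = (\<lambda>i. c * y i)"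
  then obtain c where c: "c \<noteq> 0" "x = (\<lambda>i. c * y i)" by blast
  show "proj_pt x = proj_pt y" unfolding proj_pt_def
  proof (intro set_eqI iffI; clarsimp)
    fix d :: complex assume "d \<noteq> 0"
    then show "\<exists>e. (\<lambda>i. d * x i) = (\<lambda>i. e * y i) \<and> e \<noteq> 0"
      using c by (intro exI[of _ "d * c"]) (auto simp: mult.assoc)
  next
    fix d :: complex assume "d \<noteq> 0"
    then show "\<exists>e. (\<lambda>i. d * y i) = (\<lambda>i. e * x i) \<and> e \<noteq> 0"
      using c by (intro exI[of _ "d / c"]) auto
  qed
qed

lemma poly_eval_proj_pt_cong:
  assumes "homogeneous k p" "proj_pt x = proj_pt y"
  shows "poly_eval p x = 0 \<longleftrightarrow> poly_eval p y = 0"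
  using assms poly_eval_homogeneous_scale[OF assms(1)] by (auto simp: proj_pt_eq_iff)

definition hom_polys :: "nat \<Rightarrow> nat mpoly set" where
  "hom_polys n = {p \<in> polys {..n}. \<exists>k. homogeneous k p}"

lemma hom_polys_mult: "p \<in> hom_polys n \<Longrightarrow> q \<in> hom_polys n \<Longrightarrow> p * q \<in> hom_polys n"
  using subring_ofD(4)[OF polys_subring] homogeneous_mult by (fastforce simp: hom_polys_def)

lemma hom_polys_prod: "(\<And>i. i \<in> S \<Longrightarrow> f i \<in> hom_polys n) \<Longrightarrow> prod f S \<in> hom_polys n"
proof (induction S rule: infinite_finite_induct)
  case (insert x F)
  then show ?case using hom_polys_mult by simp
qed (use subring_ofD(2)[OF polys_subring] homogeneous_1 in \<open>auto simp: hom_polys_def\<close>)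

lemma hom_polys_1: "1 \<in> hom_polys n"
  using hom_polys_prod[of "{}"] by simp

lemma topspace_zariski_proj: "topspace (zariski_proj n) = proj_space n"
proof -
  have "proj_space n = proj_pt ` {x \<in> punctured_space n. poly_eval 1 x \<noteq> 0}"
    by (simp add: proj_space_def)
  then have "proj_space n \<in> {proj_pt ` {x \<in> punctured_space n. poly_eval p x \<noteq> 0} | p.
        p \<in> polys {..n} \<and> (\<exists>k. homogeneous k p)}"
    using hom_polys_1[of n] unfolding hom_polys_def by blast
  then show ?thesis unfolding zariski_proj_def topology_generated_by_topspace
    by (auto simp: proj_space_def)
qed

text \<open>The generating sets already form a basis, since the product of two forms is a form.
  Openness thus becomes a condition on homogeneous coordinates, which is how it is used from here
  on.\<close>

lemma openin_zariski_proj: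
  "openin (zariski_proj n) U \<longleftrightarrow> U \<subseteq> proj_space n \<and>
     (\<forall>x\<in>punctured_space n. proj_pt x \<in> U \<longrightarrow> (\<exists>p\<in>hom_polys n. poly_eval p x \<noteq> 0 \<and>
        (\<forall>y\<in>punctured_space n. poly_eval p y \<noteq> 0 \<longrightarrow> proj_pt y \<in> U)))"
  (is "?L \<longleftrightarrow> _ \<and> ?R U")
proof
  let ?B = "{proj_pt ` {x \<in> punctured_space n. poly_eval p x \<noteq> 0} | p.
        p \<in> polys {..n} \<and> (\<exists>k. homogeneous k p)}"
  assume L: ?L
  then have "generate_topology_on ?B U" by (simp add: zariski_proj_def openin_topology_generated_by_iff)
  then have "?R U"
  proof induction
    case Empty
    then show ?case by simp
  next
    case (Int a b)
    show ?case
    proof (intro ballI impI)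
      fix x assume x: "x \<in> punctured_space n" "proj_pt x \<in> a \<inter> b"
      from Int x obtain p where p: "p\<in>hom_polys n" "poly_eval p x \<noteq> 0"
        "\<forall>y\<in>punctured_space n. poly_eval p y \<noteq> 0 \<longrightarrow> proj_pt y \<in> a" by blast
      from Int x obtain q where q: "q\<in>hom_polys n" "poly_eval q x \<noteq> 0"
        "\<forall>y\<in>punctured_space n. poly_eval q y \<noteq> 0 \<longrightarrow> proj_pt y \<in> b" by blast
      show "\<exists>p\<in>hom_polys n. poly_eval p x \<noteq> 0 \<and>
          (\<forall>y\<in>punctured_space n. poly_eval p y \<noteq> 0 \<longrightarrow> proj_pt y \<in> a \<inter> b)"
        by (rule bexI[of _ "p * q"]) (use p q hom_polys_mult in \<open>auto simp: poly_eval_mult\<close>)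
    qed
  next
    case (UN K)
    show ?case
    proof (intro ballI impI)
      fix x assume x: "x \<in> punctured_space n" "proj_pt x \<in> \<Union> K"
      then obtain k where k: "k \<in> K" "proj_pt x \<in> k" by blast
      from UN(2)[OF k(1)] x k obtain p where "p\<in>hom_polys n" "poly_eval p x \<noteq> 0"
        "\<forall>y\<in>punctured_space n. poly_eval p y \<noteq> 0 \<longrightarrow> proj_pt y \<in> k" by blast
      then show "\<exists>p\<in>hom_polys n. poly_eval p x \<noteq> 0 \<and>
          (\<forall>y\<in>punctured_space n. poly_eval p y \<noteq> 0 \<longrightarrow> proj_pt y \<in> \<Union> K)" using k by blast
    qed
  next
    case (Basis s)
    then obtain p k where p: "s = proj_pt ` {x \<in> punctured_space n. poly_eval p x \<noteq> 0}"
      "p \<in> polys {..n}" "homogeneous k p" by blast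
    show ?case
    proof (intro ballI impI bexI[of _ p] conjI)
      fix x assume "x \<in> punctured_space n" "proj_pt x \<in> s"
      then obtain y where "poly_eval p y \<noteq> 0" "proj_pt x = proj_pt y" using p by auto
      then show "poly_eval p x \<noteq> 0" using poly_eval_proj_pt_cong[OF p(3)] by blast
    qed (use p in \<open>auto simp: hom_polys_def\<close>)
  qed
  moreover have "U \<subseteq> proj_space n" using openin_subset[OF L] topspace_zariski_proj by simp
  ultimately show "U \<subseteq> proj_space n \<and> ?R U" by blast
next
  assume R: "U \<subseteq> proj_space n \<and> ?R U"
  show ?L
  proof (subst openin_subopen, intro ballI)
    fix P assume P: "P \<in> U"
    then obtain x where x: "x \<in> punctured_space n" "P = proj_pt x" using R by (auto simp: proj_space_def)
    then obtain p where p: "p\<in>hom_polys n" "poly_eval p x \<noteq> 0"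
      "\<forall>y\<in>punctured_space n. poly_eval p y \<noteq> 0 \<longrightarrow> proj_pt y \<in> U" using R P by blast
    show "\<exists>T. openin (zariski_proj n) T \<and> P \<in> T \<and> T \<subseteq> U"
    proof (intro exI[of _ "proj_pt ` {x \<in> punctured_space n. poly_eval p x \<noteq> 0}"] conjI)
      show "openin (zariski_proj n) (proj_pt ` {x \<in> punctured_space n. poly_eval p x \<noteq> 0})"
        unfolding zariski_proj_def by (rule topology_generated_by_Basis) (use p in \<open>auto simp: hom_polys_def\<close>)
    qed (use x p in auto)
  qed
qed

lemma zariski_affine_nbhd:
  assumes "openin (zariski_affine I) U" "x \<in> (U :: ('i::linorder \<Rightarrow> complex) set)"
  shows "\<exists>p\<in>polys I. poly_eval p x \<noteq> 0 \<and> {y \<in> affine_space I. poly_eval p y \<noteq> 0} \<subseteq> U"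
proof -
  have "generate_topology_on {{x \<in> affine_space I. poly_eval p x \<noteq> 0} | p. p \<in> polys I} U"
    using assms by (simp add: zariski_affine_def openin_topology_generated_by_iff)
  then show ?thesis using assms(2)
  proof (induction arbitrary: x)
    case (Int a b)
    from Int.IH(1)[of x] Int.IH(2)[of x] Int.prems obtain p q where
      "p\<in>polys I" "poly_eval p x \<noteq> 0" "{y \<in> affine_space I. poly_eval p y \<noteq> 0} \<subseteq> a"
      "q\<in>polys I" "poly_eval q x \<noteq> 0" "{y \<in> affine_space I. poly_eval q y \<noteq> 0} \<subseteq> b" by blast
    then show ?case using subring_ofD(4)[OF polys_subring]
      by (intro bexI[of _ "p * q"]) (auto simp: poly_eval_mult)
  next
    case (UN K)
    then obtain k where k: "k \<in> K" "x \<in> k" by blast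
    from UN.IH[OF this] show ?case using k by blast
  qed auto
qed

section \<open>Lattices\<close>

lemma Ints_floor: "x \<in> \<int> \<Longrightarrow> of_int \<lfloor>x\<rfloor> = (x :: real)"
  by (auto elim: Ints_cases)

lemma span_eq_by_inner:
  fixes x y :: "'a::euclidean_space"
  assumes "x \<in> span B" "y \<in> span B" "\<And>b. b \<in> B \<Longrightarrow> x \<bullet> b = y \<bullet> b"
  shows "x = y"
proof -
  have "(x - y) \<bullet> z = 0" if "z \<in> span B" for z
    using that
  proof (induction rule: span_induct_alt)
    case (step c b z)
    then show ?case using assms(3) by (simp add: inner_add_right inner_diff_left)
  qed simp
  then have "(x - y) \<bullet> (x - y) = 0" using assms span_diff by blast
  then show ?thesis by simp
qed

lemma inner_representation:
  fixes B :: "'a::euclidean_space set"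
  assumes "independent B"
  obtains w where "w \<in> span B" "\<And>b. b \<in> B \<Longrightarrow> w \<bullet> b = f b"
proof -
  obtain g :: "'a \<Rightarrow> real" where g: "linear g" "\<forall>x\<in>B. g x = f x"
    using linear_independent_extend[OF assms] by blast
  \<comment> \<open>\<open>adjoint g 1\<close> represents the functional \<open>g\<close>; its
    orthogonal projection to \<open>span B\<close> has the same pairings with
    \<open>B\<close>.\<close>
  obtain y z where yz: "y \<in> span B" "\<And>w. w \<in> span B \<Longrightarrow> orthogonal z w" "adjoint g 1 = y + z"
    using orthogonal_subspace_decomp_exists[of B "adjoint g 1"] by metis
  have "y \<bullet> b = f b" if "b \<in> B" for b
  proof -
    have "z \<bullet> b = 0" using yz(2)[OF span_base[OF that]] by (simp add: orthogonal_def)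
    then have "y \<bullet> b = b \<bullet> adjoint g 1" using yz(3) by (simp add: inner_add_right inner_commute)
    also have "\<dots> = f b" using adjoint_works[OF g(1), of b 1] g(2) that by simp
    finally show ?thesis .
  qed
  then show ?thesis using that yz(1) by blast
qed

lemma dual_basis:
  fixes B :: "'a::euclidean_space set"
  assumes "independent B"
  obtains w where "\<And>b. b \<in> B \<Longrightarrow> w b \<in> span B"
    "\<And>b b'. b \<in> B \<Longrightarrow> b' \<in> B \<Longrightarrow> w b \<bullet> b' = (if b = b' then 1 else 0)"
proof -
  have "\<exists>w. w \<in> span B \<and> (\<forall>b'\<in>B. w \<bullet> b' = (if b = b' then 1 else 0))" for b
    by (rule inner_representation[OF assms, of "\<lambda>b'. if b = b' then 1 else 0"]) blast
  then obtain w where "\<forall>b. w b \<in> span B \<and> (\<forall>b'\<in>B. w b \<bullet> b' = (if b = b' then 1 else 0))" by metis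
  then show ?thesis using that[of w] by blast
qed

lemma dual_basis_expansion:
  fixes B :: "'a::euclidean_space set"
  assumes "independent B" "\<And>b. b \<in> B \<Longrightarrow> w b \<in> span B"
    "\<And>b b'. b \<in> B \<Longrightarrow> b' \<in> B \<Longrightarrow> w b \<bullet> b' = (if b = b' then 1 else 0)" "x \<in> span B"
  shows "x = (\<Sum>b\<in>B. (x \<bullet> b) *\<^sub>R w b)" "x = (\<Sum>b\<in>B. (w b \<bullet> x) *\<^sub>R b)"
proof -
  have fin: "finite B" using assms(1) by (rule finiteI_independent)
  show "x = (\<Sum>b\<in>B. (x \<bullet> b) *\<^sub>R w b)"
  proof (rule span_eq_by_inner[of _ B])
    show "(\<Sum>b\<in>B. (x \<bullet> b) *\<^sub>R w b) \<in> span B" using assms(2) by (intro span_sum span_mul)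
    fix b' assume b': "b' \<in> B"
    have "(\<Sum>b\<in>B. (x \<bullet> b) *\<^sub>R w b) \<bullet> b' = (\<Sum>b\<in>B. if b = b' then x \<bullet> b else 0)"
      unfolding inner_sum_left using assms(3) b' by (intro sum.cong) auto
    then show "x \<bullet> b' = (\<Sum>b\<in>B. (x \<bullet> b) *\<^sub>R w b) \<bullet> b'" using fin b' by simp
  qed (use assms in auto)
  from assms(4) obtain c where c: "x = (\<Sum>b\<in>B. c b *\<^sub>R b)"
    unfolding span_finite[OF fin] by blast
  have "w b \<bullet> x = c b" if "b \<in> B" for b
  proof -
    have "w b \<bullet> x = (\<Sum>b'\<in>B. if b' = b then c b' else 0)"
      unfolding c inner_sum_right using assms(3) that by (intro sum.cong) auto
    then show ?thesis using fin that by simp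
  qed
  then show "x = (\<Sum>b\<in>B. (w b \<bullet> x) *\<^sub>R b)" using c by simp
qed

context
  fixes N :: "'a::euclidean_space set"
  assumes lat: "is_lattice N"
begin

lemma lattice_basis:
  obtains B w where "independent B" "finite B" "B \<subseteq> N" "span N = span B"
    "\<And>v. v \<in> N \<longleftrightarrow> v \<in> span N \<and> (\<forall>b\<in>B. w b \<bullet> v \<in> \<int>)"
    "\<And>b. b \<in> B \<Longrightarrow> w b \<in> dual_lattice N"
    "\<And>b b'. b \<in> B \<Longrightarrow> b' \<in> B \<Longrightarrow> w b \<bullet> b' = (if b = b' then 1 else 0)"
    "\<And>x. x \<in> span N \<Longrightarrow> x = (\<Sum>b\<in>B. (x \<bullet> b) *\<^sub>R w b)"
    "\<And>x. x \<in> span N \<Longrightarrow> x = (\<Sum>b\<in>B. (w b \<bullet> x) *\<^sub>R b)"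
proof -
  obtain B where B: "independent B" "N = {(\<Sum>b\<in>B. of_int (c b) *\<^sub>R b) | c :: 'a \<Rightarrow> int. True}"
    using lat unfolding is_lattice_def by blast
  have fin: "finite B" using B(1) by (rule finiteI_independent)
  have BN: "B \<subseteq> N"
  proof
    fix b assume b: "b \<in> B"
    have "(\<Sum>b'\<in>B. of_int (if b' = b then 1 else 0) *\<^sub>R b') = (\<Sum>b'\<in>B. if b' = b then b' else 0)"
      by (intro sum.cong) auto
    also have "\<dots> = b" using fin b by simp
    finally have "b = (\<Sum>b'\<in>B. of_int (if b' = b then 1 else 0) *\<^sub>R b')" by simp
    then show "b \<in> N" unfolding B(2) by (intro CollectI exI[of _ "\<lambda>b'. if b' = b then 1 else 0"]) simp
  qed
  have "N \<subseteq> span B" unfolding B(2) by clarify (intro span_sum span_mul span_base)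
  then have sp: "span N = span B" using BN by (metis span_mono span_span subset_antisym)
  obtain w where w: "\<And>b. b \<in> B \<Longrightarrow> w b \<in> span B"
    "\<And>b b'. b \<in> B \<Longrightarrow> b' \<in> B \<Longrightarrow> w b \<bullet> b' = (if b = b' then 1 else 0)"
    using dual_basis[OF B(1)] by metis
  note ex = dual_basis_expansion[OF B(1) w]
  have 1: "v \<in> N \<longleftrightarrow> v \<in> span N \<and> (\<forall>b\<in>B. w b \<bullet> v \<in> \<int>)" for v
  proof
    assume v: "v \<in> N"
    then obtain c where c: "v = (\<Sum>b\<in>B. of_int (c b :: int) *\<^sub>R b)" unfolding B(2) by blast
    have "w b \<bullet> v = of_int (c b)" if "b \<in> B" for b
    proof -
      have "w b \<bullet> v = (\<Sum>b'\<in>B. if b' = b then of_int (c b') else 0)"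
        unfolding c inner_sum_right using w(2) that by (intro sum.cong) auto
      then show ?thesis using fin that by simp
    qed
    then show "v \<in> span N \<and> (\<forall>b\<in>B. w b \<bullet> v \<in> \<int>)" using v by (auto intro: span_base)
  next
    assume v: "v \<in> span N \<and> (\<forall>b\<in>B. w b \<bullet> v \<in> \<int>)"
    then have "w b \<bullet> v = of_int \<lfloor>w b \<bullet> v\<rfloor>" if "b \<in> B" for b using that Ints_floor by metis
    then have "v = (\<Sum>b\<in>B. of_int \<lfloor>w b \<bullet> v\<rfloor> *\<^sub>R b)" using ex(2)[of v] v sp by simp
    then show "v \<in> N" unfolding B(2) by (intro CollectI exI[of _ "\<lambda>b. \<lfloor>w b \<bullet> v\<rfloor>"]) simp
  qed
  have 2: "w b \<in> dual_lattice N" if "b \<in> B" for b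
    unfolding dual_lattice_def using w(1)[OF that] sp 1 that by auto
  show ?thesis using that[OF B(1) fin BN sp 1 2 w(2)] ex sp by simp
qed

lemma lattice_dual_iff:
  "\<exists>W\<subseteq>dual_lattice N. \<forall>v. v \<in> N \<longleftrightarrow> v \<in> span N \<and> (\<forall>w\<in>W. w \<bullet> v \<in> \<int>)"
proof (rule lattice_basis, goal_cases)
  case (1 B w)
  show ?case by (rule exI[of _ "w ` B"]) (use 1(5,6) in auto)
qed

lemma lattice_closed:
  "0 \<in> N" "v \<in> N \<Longrightarrow> v' \<in> N \<Longrightarrow> v + v' \<in> N" "v \<in> N \<Longrightarrow> of_int k *\<^sub>R v \<in> N"
proof -
  obtain W where N: "\<And>v. v \<in> N \<longleftrightarrow> v \<in> span N \<and> (\<forall>w\<in>W. w \<bullet> v \<in> \<int>)"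
    using lattice_dual_iff by blast
  show "0 \<in> N" by (subst N) (simp add: span_zero)
  show "v + v' \<in> N" if "v \<in> N" "v' \<in> N"
    using that N[of v] N[of v'] by (subst N) (simp add: span_add inner_add_right)
  show "of_int k *\<^sub>R v \<in> N" if "v \<in> N"
    using that N[of v] by (subst N) (simp add: span_mul)
qed

lemma dual_closed:
  "0 \<in> dual_lattice N"
  "u \<in> dual_lattice N \<Longrightarrow> u' \<in> dual_lattice N \<Longrightarrow> u + u' \<in> dual_lattice N"
  "u \<in> dual_lattice N \<Longrightarrow> - u \<in> dual_lattice N"
  "u \<in> dual_lattice N \<Longrightarrow> of_int k *\<^sub>R u \<in> dual_lattice N"
  "u \<in> dual_lattice N \<Longrightarrow> of_nat l *\<^sub>R u \<in> dual_lattice N"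
  "u \<in> dual_lattice N \<Longrightarrow> u' \<in> dual_lattice N \<Longrightarrow> u - u' \<in> dual_lattice N"
  by (auto simp: dual_lattice_def inner_add_left inner_diff_left
      intro: span_zero span_add span_neg span_mul span_diff)

lemma dual_sum: "(\<And>i. i \<in> S \<Longrightarrow> f i \<in> dual_lattice N) \<Longrightarrow> sum f S \<in> dual_lattice N"
  by (induction S rule: infinite_finite_induct) (auto simp: dual_closed)

lemma dual_Ints: "u \<in> dual_lattice N \<Longrightarrow> v \<in> N \<Longrightarrow> u \<bullet> v \<in> \<int>"
  by (simp add: dual_lattice_def)

text \<open>The lattice is its own double dual, because the dual basis of a lattice basis already
  detects integrality.\<close>

lemma in_latticeI:
  assumes "v \<in> span N" "\<And>u. u \<in> dual_lattice N \<Longrightarrow> u \<bullet> v \<in> \<int>"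
  shows "v \<in> N"
proof -
  obtain W where N: "\<And>v. v \<in> N \<longleftrightarrow> v \<in> span N \<and> (\<forall>w\<in>W. w \<bullet> v \<in> \<int>)"
    and w: "W \<subseteq> dual_lattice N"
    using lattice_dual_iff by blast
  show ?thesis using assms w by (subst N) blast
qed

text \<open>Over the rationals \<open>A\<close> is still independent and has as many elements as a
  lattice basis, whose rational span contains \<open>N\<close>. Adding a vector of \<open>N\<close>
  outside the rational span of \<open>A\<close> would exceed that dimension.\<close>

lemma rational_combination:
  assumes A: "A \<subseteq> N" "independent A" "span A = span N" and v: "v \<in> N"
  obtains q where "v = (\<Sum>a\<in>A. of_rat (q a) *\<^sub>R a)"
proof -
  interpret Q: vector_space "\<lambda>(q::rat) (v::'a). of_rat q *\<^sub>R v"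
    by unfold_locales (auto simp: scaleR_add_right scaleR_add_left of_rat_add of_rat_mult)
  obtain B w where B: "independent B" "finite B" "B \<subseteq> N" "span N = span B"
    "\<And>v. v \<in> N \<longleftrightarrow> v \<in> span N \<and> (\<forall>b\<in>B. w b \<bullet> v \<in> \<int>)"
    "\<And>x. x \<in> span N \<Longrightarrow> x = (\<Sum>b\<in>B. (w b \<bullet> x) *\<^sub>R b)"
    by (rule lattice_basis) blast
  have finA: "finite A" using A(2) by (rule finiteI_independent)
  have NQ: "N \<subseteq> Q.span B"
  proof
    fix v assume v: "v \<in> N"
    then have "w b \<bullet> v = of_rat (of_int \<lfloor>w b \<bullet> v\<rfloor>)" if "b \<in> B" for b
      using B(5) that Ints_floor by (metis of_rat_of_int_eq)
    then have "v = (\<Sum>b\<in>B. of_rat (of_int \<lfloor>w b \<bullet> v\<rfloor>) *\<^sub>R b)"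
      using B(6)[OF span_base[OF v]] by simp
    then show "v \<in> Q.span B" unfolding Q.span_finite[OF B(2)]
      by (intro range_eqI[of _ _ "\<lambda>b. of_int \<lfloor>w b \<bullet> v\<rfloor>"]) simp
  qed
  have QI: "Q.independent A"
    unfolding Q.dependent_finite[OF finA] using A(2) unfolding dependent_finite[OF finA]
    by (metis of_rat_eq_0_iff)
  have card: "card A = card B"
    using A B(1,4) by (metis basis_card_eq_dim dim_eq_card_independent dim_span)
  have "v \<in> Q.span A"
  proof (rule ccontr)
    assume nv: "v \<notin> Q.span A"
    then have "Q.independent (insert v A)" using QI by (rule Q.independent_insertI)
    then have "card (insert v A) \<le> card B"
      using Q.independent_span_bound[OF B(2)] NQ A(1) v by blast
    moreover have "v \<notin> A" using nv Q.span_base by blast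
    ultimately show False using finA card by simp
  qed
  then show ?thesis using that unfolding Q.span_finite[OF finA] by blast
qed

lemma common_denominator:
  assumes "finite S" "\<And>s. s \<in> S \<Longrightarrow> f s \<in> (\<rat> :: real set)"
  obtains k :: nat where "k > 0" "\<And>s. s \<in> S \<Longrightarrow> of_nat k * f s \<in> \<int>"
proof -
  have "\<exists>k::nat. k > 0 \<and> (\<forall>s\<in>S. of_nat k * f s \<in> \<int>)"
    using assms
  proof (induction S rule: finite_induct)
    case empty
    then show ?case by (intro exI[of _ 1]) auto
  next
    case (insert x F)
    then obtain k :: nat where k: "k > 0" "\<forall>s\<in>F. of_nat k * f s \<in> \<int>" by auto
    obtain a b :: int where ab: "b > 0" "f x = of_int a / of_int b"
      using insert.prems[of x] by (auto elim: Rats_cases')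
    have "of_nat (k * nat b) * f x = of_int (int k * a)" using ab by simp
    then have "of_nat (k * nat b) * f x \<in> \<int>" by (metis Ints_of_int)
    moreover have "of_nat (k * nat b) * f s \<in> \<int>" if "s \<in> F" for s
    proof -
      have "of_nat (k * nat b) * f s = of_nat (nat b) * (of_nat k * f s)" by simp
      then show ?thesis using k(2) that by (metis Ints_mult Ints_of_nat)
    qed
    ultimately show ?case using k ab by (intro exI[of _ "k * nat b"]) auto
  qed
  then show ?thesis using that by blast
qed

text \<open>The real dual basis takes rational values on a lattice basis, so a positive multiple of
  each of its vectors lies in the dual lattice. Clearing denominators turns the diagonal values from
  1 into arbitrary positive numbers.\<close>

lemma rational_dual_basis:
  assumes A: "A \<subseteq> N" "independent A"
  obtains A' w where "A \<subseteq> A'" "A' \<subseteq> N" "independent A'" "span A' = span N"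
    "\<And>a. a \<in> A' \<Longrightarrow> w a \<in> dual_lattice N" "\<And>a. a \<in> A' \<Longrightarrow> w a \<bullet> a > 0"
    "\<And>a a'. a \<in> A' \<Longrightarrow> a' \<in> A' \<Longrightarrow> a \<noteq> a' \<Longrightarrow> w a \<bullet> a' = 0"
proof -
  obtain A' where A': "A \<subseteq> A'" "A' \<subseteq> N" "independent A'" "N \<subseteq> span A'"
    using maximal_independent_subset_extend[OF A] by metis
  have sp: "span A' = span N" using A' by (metis span_mono span_span subset_antisym)
  have fin: "finite A'" using A'(3) by (rule finiteI_independent)
  obtain w0 where w0: "\<And>b. b \<in> A' \<Longrightarrow> w0 b \<in> span A'"
    "\<And>b b'. b \<in> A' \<Longrightarrow> b' \<in> A' \<Longrightarrow> w0 b \<bullet> b' = (if b = b' then 1 else 0)"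
    using dual_basis[OF A'(3)] by metis
  obtain B wB where B: "finite B" "B \<subseteq> N" "span N = span B"
    "\<And>x. x \<in> span N \<Longrightarrow> x = (\<Sum>b\<in>B. (wB b \<bullet> x) *\<^sub>R b)"
    "\<And>v. v \<in> N \<longleftrightarrow> v \<in> span N \<and> (\<forall>b\<in>B. wB b \<bullet> v \<in> \<int>)"
    by (rule lattice_basis) blast
  have "\<exists>w. w \<in> dual_lattice N \<and> w \<bullet> a > 0 \<and> (\<forall>a'\<in>A'. a \<noteq> a' \<longrightarrow> w \<bullet> a' = 0)" if a: "a \<in> A'" for a
  proof -
    have "w0 a \<bullet> b \<in> \<rat>" if b: "b \<in> B" for b
    proof -
      obtain q where q: "b = (\<Sum>a\<in>A'. of_rat (q a) *\<^sub>R a)"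
        using rational_combination[OF A'(2,3) sp] b B by blast
      have "w0 a \<bullet> b = (\<Sum>a'\<in>A'. if a' = a then of_rat (q a') else 0)"
        unfolding q inner_sum_right using w0(2) a by (intro sum.cong) auto
      then show ?thesis using fin a by simp
    qed
    then obtain k :: nat where k: "k > 0" "\<And>b. b \<in> B \<Longrightarrow> of_nat k * (w0 a \<bullet> b) \<in> \<int>"
      using common_denominator[OF B(1), of "\<lambda>b. w0 a \<bullet> b"] by blast
    define w where "w = of_nat k *\<^sub>R w0 a"
    have "w \<bullet> v \<in> \<int>" if v: "v \<in> N" for v
    proof -
      have "w \<bullet> v = (\<Sum>b\<in>B. (wB b \<bullet> v) * (w \<bullet> b))"
        by (subst B(4)[of v]) (use v in \<open>auto simp: inner_sum_right intro: span_base\<close>)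
      also have "\<dots> \<in> \<int>" using k(2) B(5) v by (intro Ints_sum Ints_mult) (auto simp: w_def)
      finally show ?thesis .
    qed
    moreover have "w \<in> span N" using w0(1)[OF a] sp by (simp add: w_def span_mul)
    ultimately have "w \<in> dual_lattice N" by (simp add: dual_lattice_def)
    then show ?thesis using k(1) w0(2) a by (intro exI[of _ w]) (auto simp: w_def)
  qed
  then obtain w where "\<And>a. a \<in> A' \<Longrightarrow> w a \<in> dual_lattice N \<and> w a \<bullet> a > 0 \<and>
      (\<forall>a'\<in>A'. a \<noteq> a' \<longrightarrow> w a \<bullet> a' = 0)" by metis
  then show ?thesis using that[OF A'(1-3) sp] by blast
qed

text \<open>Divide \<open>s\<close> by the largest k that leaves it in the lattice. Such k are
  bounded, since a nonzero integral coordinate of the quotient has absolute value at least 1; a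
  further divisor j of the quotient would contradict maximality.\<close>

lemma primitive_on_ray:
  assumes "s \<in> N" "s \<noteq> 0"
  obtains v k where "primitive N v" "k > (0::nat)" "s = of_nat k *\<^sub>R v"
proof -
  obtain B w where B: "finite B" "\<And>v. v \<in> N \<longleftrightarrow> v \<in> span N \<and> (\<forall>b\<in>B. w b \<bullet> v \<in> \<int>)"
    "\<And>x. x \<in> span N \<Longrightarrow> x = (\<Sum>b\<in>B. (w b \<bullet> x) *\<^sub>R b)" by (rule lattice_basis) blast
  have "\<exists>b\<in>B. w b \<bullet> s \<noteq> 0"
  proof (rule ccontr)
    assume "\<not> ?thesis"
    then have "s = 0" using B(3)[of s] assms(1) by (simp add: span_base)
    then show False using assms by simp
  qed
  then obtain b where b: "b \<in> B" "w b \<bullet> s \<noteq> 0" by blast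
  define K where "K = {k::nat. k > 0 \<and> (1 / of_nat k) *\<^sub>R s \<in> N}"
  have "k \<le> nat \<lceil>\<bar>w b \<bullet> s\<bar>\<rceil>" if "k \<in> K" for k
  proof -
    have k: "k > 0" "(1 / of_nat k) *\<^sub>R s \<in> N" using that by (auto simp: K_def)
    then have "w b \<bullet> ((1 / of_nat k) *\<^sub>R s) \<in> \<int>" using B(2) b by blast
    moreover have "w b \<bullet> ((1 / of_nat k) *\<^sub>R s) \<noteq> 0" using b k by simp
    ultimately have "\<bar>w b \<bullet> ((1 / of_nat k) *\<^sub>R s)\<bar> \<ge> 1" by (rule Ints_nonzero_abs_ge1)
    then have "\<bar>w b \<bullet> s\<bar> \<ge> of_nat k" using k by (simp add: abs_mult field_simps)
    then show ?thesis by linarith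
  qed
  then have fin: "finite K" by (meson finite_nat_set_iff_bounded_le)
  have "1 \<in> K" using assms by (simp add: K_def)
  then have mx: "Max K \<in> K" "\<And>k. k \<in> K \<Longrightarrow> k \<le> Max K" using fin by (auto intro: Max_in)
  define k where "k = Max K"
  define v where "v = (1 / of_nat k) *\<^sub>R s"
  have k: "k > 0" "v \<in> N" using mx by (auto simp: K_def k_def v_def)
  have sv: "s = of_nat k *\<^sub>R v" using k by (simp add: v_def)
  have "primitive N v" unfolding primitive_def
  proof (intro conjI ballI allI impI)
    show "v \<in> N" by (rule k)
    show "v \<noteq> 0" using sv assms by auto
    fix u and j :: int assume u: "u \<in> N" "v = of_int j *\<^sub>R u"
    have j0: "j \<noteq> 0" using u \<open>v \<noteq> 0\<close> by auto
    have "of_int (sgn j) *\<^sub>R u = (1 / of_int \<bar>j\<bar>) *\<^sub>R v"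
      unfolding u(2) using j0 by (simp add: abs_if sgn_if)
    also have "\<dots> = (1 / of_nat (nat \<bar>j\<bar> * k)) *\<^sub>R s" unfolding v_def by simp
    finally have "(1 / of_nat (nat \<bar>j\<bar> * k)) *\<^sub>R s \<in> N" using lattice_closed(3)[OF u(1)] by metis
    then have "nat \<bar>j\<bar> * k \<in> K" using j0 k by (simp add: K_def)
    then have "nat \<bar>j\<bar> * k \<le> k" using mx k_def by blast
    then have "nat \<bar>j\<bar> \<le> 1" using k by simp
    then show "\<bar>j\<bar> = 1" using j0 by linarith
  qed
  then show ?thesis using that k sv by blast
qed

end

section \<open>Cones\<close>

text \<open>The empty set generates \<open>{0}\<close> here, whereas
  \<open>conic hull (convex hull {})\<close> is empty; for finite nonempty sets the two
  agree.\<close>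

definition cone_of :: "'a::real_vector set \<Rightarrow> 'a set" where
  "cone_of S = {(\<Sum>s\<in>S. c s *\<^sub>R s) | c. \<forall>s\<in>S. 0 \<le> c s}"

lemma cone_of_base: "finite S \<Longrightarrow> s \<in> S \<Longrightarrow> s \<in> cone_of S"
  unfolding cone_of_def
  by (intro CollectI exI[of _ "\<lambda>t. if t = s then 1 else 0"]) (auto simp: if_distrib[of "\<lambda>c. c *\<^sub>R _"] cong: if_cong)

lemma cone_of_zero: "0 \<in> cone_of S"
  unfolding cone_of_def by (intro CollectI exI[of _ "\<lambda>t. 0"]) auto

lemma cone_of_add:
  assumes "x \<in> cone_of S" "y \<in> cone_of S" shows "x + y \<in> cone_of S"
proof -
  from assms obtain c d where "x = (\<Sum>s\<in>S. c s *\<^sub>R s)" "\<forall>s\<in>S. 0 \<le> c s" "y = (\<Sum>s\<in>S. d s *\<^sub>R s)" "\<forall>s\<in>S. 0 \<le> d s"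
    unfolding cone_of_def by blast
  then show ?thesis unfolding cone_of_def
    by (intro CollectI exI[of _ "\<lambda>s. c s + d s"]) (auto simp: scaleR_add_left sum.distrib)
qed

lemma cone_of_scale:
  assumes "x \<in> cone_of S" "c \<ge> 0" shows "c *\<^sub>R x \<in> cone_of S"
proof -
  from assms obtain d where "x = (\<Sum>s\<in>S. d s *\<^sub>R s)" "\<forall>s\<in>S. 0 \<le> d s" unfolding cone_of_def by blast
  then show ?thesis unfolding cone_of_def using assms
    by (intro CollectI exI[of _ "\<lambda>s. c * d s"]) (auto simp: scaleR_sum_right)
qed

lemma cone_of_sum: "(\<And>i. i \<in> I \<Longrightarrow> f i \<in> cone_of S) \<Longrightarrow> sum f I \<in> cone_of S"
  by (induction I rule: infinite_finite_induct) (auto simp: cone_of_zero cone_of_add)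

lemma cone_of_least:
  assumes "S \<subseteq> cone_of T" shows "cone_of S \<subseteq> cone_of T"
proof
  fix x assume "x \<in> cone_of S"
  then obtain d where d: "x = (\<Sum>s\<in>S. d s *\<^sub>R s)" "\<forall>s\<in>S. 0 \<le> d s" unfolding cone_of_def by blast
  show "x \<in> cone_of T" unfolding d(1)
    by (intro cone_of_sum cone_of_scale) (use d assms in auto)
qed

lemma cone_of_subset_span: "cone_of S \<subseteq> span S"
  unfolding cone_of_def by clarify (intro span_sum span_mul span_base)

lemma conic_convex_hull:
  assumes "finite S" "S \<noteq> {}"
  shows "conic hull (convex hull S) = cone_of S"
proof
  show "conic hull (convex hull S) \<subseteq> cone_of S"
  proof
    fix x assume "x \<in> conic hull (convex hull S)"
    then obtain c y where cy: "x = c *\<^sub>R y" "0 \<le> c" "y \<in> convex hull S" unfolding conic_hull_explicit by blast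
    then obtain u where "\<forall>x\<in>S. 0 \<le> u x" "y = (\<Sum>x\<in>S. u x *\<^sub>R x)" unfolding convex_hull_finite[OF assms(1)] by blast
    then have "y \<in> cone_of S" unfolding cone_of_def by blast
    then show "x \<in> cone_of S" using cy cone_of_scale by blast
  qed
  show "cone_of S \<subseteq> conic hull (convex hull S)"
  proof
    fix x assume "x \<in> cone_of S"
    then obtain d where d: "x = (\<Sum>s\<in>S. d s *\<^sub>R s)" "\<forall>s\<in>S. 0 \<le> d s" unfolding cone_of_def by blast
    show "x \<in> conic hull (convex hull S)"
    proof (cases "sum d S = 0")
      case True
      then have "x = 0" using d assms(1) by (simp add: sum_nonneg_eq_0_iff)
      moreover obtain y where "y \<in> convex hull S" using assms(2) hull_subset[of S convex] by blast
      ultimately show ?thesis unfolding conic_hull_explicit by (intro CollectI exI[of _ 0] exI[of _ y]) auto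
    next
      case False
      define D where "D = sum d S"
      have D: "D > 0" using False d by (simp add: D_def less_le sum_nonneg)
      have "(\<Sum>s\<in>S. (d s / D) *\<^sub>R s) \<in> convex hull S" unfolding convex_hull_finite[OF assms(1)]
        using D d by (intro CollectI exI[of _ "\<lambda>s. d s / D"]) (auto simp: D_def simp flip: sum_divide_distrib)
      moreover have "x = D *\<^sub>R (\<Sum>s\<in>S. (d s / D) *\<^sub>R s)" using D d by (simp add: scaleR_sum_right)
      ultimately show ?thesis unfolding conic_hull_explicit using D by (intro CollectI exI[of _ D]) auto
    qed
  qed
qed

lemma conic_hull_singleton: "conic hull {v} = cone_of {v}"
  using conic_convex_hull[of "{v}"] by simp

lemma cone_of_singleton: "cone_of {v} = {c *\<^sub>R v | c. 0 \<le> c}"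
  unfolding cone_of_def by auto

lemma strictly_positive_functional:
  fixes S :: "'a::euclidean_space set"
  assumes "finite S" "0 \<notin> convex hull S"
  obtains a where "\<And>s. s \<in> S \<Longrightarrow> a \<bullet> s > 0"
proof -
  have "closed (convex hull S)" using assms(1) by (simp add: compact_imp_closed finite_imp_compact_convex_hull)
  then obtain a b where "0 < b" "\<forall>x\<in>convex hull S. a \<bullet> x > b"
    using separating_hyperplane_closed_0[OF convex_convex_hull] assms(2) by blast
  then show ?thesis using that[of a] hull_inc[of _ S convex] by force
qed

text \<open>If the coefficient of \<open>s\<close> were positive, the rest of the sum would place
  the negative of a positive multiple of \<open>s\<close> in the cone.\<close>

lemma pointed_positive_combination:
  assumes "finite S" "0 \<notin> S" "strongly_convex (cone_of S)" "\<forall>s\<in>S. 0 \<le> u s" "(\<Sum>s\<in>S. u s *\<^sub>R s) = 0" "s \<in> S"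
  shows "u s = 0"
proof (rule ccontr)
  assume "u s \<noteq> 0"
  then have us: "u s > 0" using assms by force
  have "(\<Sum>t\<in>S - {s}. u t *\<^sub>R t) \<in> cone_of S"
    using assms by (intro cone_of_sum cone_of_scale cone_of_base) auto
  moreover have "(\<Sum>t\<in>S - {s}. u t *\<^sub>R t) = - (u s *\<^sub>R s)"
    using assms(1,5,6) by (simp add: sum.remove eq_neg_iff_add_eq_0 add.commute)
  moreover have "u s *\<^sub>R s \<in> cone_of S" using assms us by (intro cone_of_scale cone_of_base) auto
  ultimately have "u s *\<^sub>R s = 0" using assms(3) unfolding strongly_convex_def by auto
  then show False using us assms by auto
qed

text \<open>After projecting along \<open>s\<close>, the other generators still lie in an open half space.\<close>

lemma exposed_ray:
  fixes S :: "'a::euclidean_space set"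
  assumes fin: "finite S" and z: "0 \<notin> S" and sc: "strongly_convex (cone_of S)" and s: "s \<in> S"
    and irr: "s \<notin> cone_of (S - {s})"
  shows "cone_face (conic hull {s}) (cone_of S)"
proof -
  define T where "T = S - {s}"
  have finT: "finite T" using fin by (simp add: T_def)
  define pr where "pr t = t - ((t \<bullet> s) / (s \<bullet> s)) *\<^sub>R s" for t
  have ss: "s \<bullet> s > 0" using s z by auto
  have lin: "linear pr" unfolding pr_def
    by (rule linearI) (auto simp: inner_add_left add_divide_distrib scaleR_add_left scaleR_diff_right)
  have "0 \<notin> convex hull (pr ` T)"
  proof
    assume "0 \<in> convex hull (pr ` T)"
    then obtain y where y: "y \<in> convex hull T" "pr y = 0"
      unfolding convex_hull_linear_image[OF lin, symmetric] by auto
    then obtain u where u: "\<forall>x\<in>T. 0 \<le> u x" "sum u T = 1" "(\<Sum>x\<in>T. u x *\<^sub>R x) = y"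
      unfolding convex_hull_finite[OF finT] by auto
    have yT: "y \<in> cone_of T" unfolding cone_of_def using u by blast
    define \<mu> where "\<mu> = (y \<bullet> s) / (s \<bullet> s)"
    have ymu: "y = \<mu> *\<^sub>R s" using y(2) by (simp add: pr_def \<mu>_def)
    show False
    \<comment> \<open>For positive \<mu> the vector \<open>s\<close> is a combination of the other
      generators, against \<open>irr\<close>. Otherwise \<open>y - \<mu> *\<^sub>R s = 0\<close> is
      a nontrivial relation with nonnegative coefficients, against pointedness.\<close>
    proof (cases "\<mu> > 0")
      case True
      then have "s = (1 / \<mu>) *\<^sub>R y" using ymu by simp
      then show False using irr cone_of_scale[OF yT, of "1 / \<mu>"] True by (simp add: T_def)
    next
      case False
      have "(\<Sum>x\<in>S. (if x = s then - \<mu> else u x) *\<^sub>R x) = (- \<mu>) *\<^sub>R s + (\<Sum>x\<in>T. u x *\<^sub>R x)"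
        using fin s by (subst sum.remove[of _ s]) (auto simp: T_def intro!: sum.cong)
      then have "(\<Sum>x\<in>S. (if x = s then - \<mu> else u x) *\<^sub>R x) = 0" using u ymu by simp
      then have "(if t = s then - \<mu> else u t) = 0" if "t \<in> S" for t
        by (rule pointed_positive_combination[OF fin z sc, rotated]) (use u False that in \<open>auto simp: T_def\<close>)
      then have "u t = 0" if "t \<in> T" for t using that by (metis T_def DiffD1 DiffD2 singletonI)
      then show False using u(2) by simp
    qed
  qed
  then obtain a where "\<And>s. s \<in> pr ` T \<Longrightarrow> a \<bullet> s > 0"
    using strictly_positive_functional[OF finite_imageI[OF finT]] by blast
  then have a: "\<And>t. t \<in> T \<Longrightarrow> a \<bullet> pr t > 0" by blast
  \<comment> \<open>Pairing with \<open>u\<close> is pairing with \<open>a\<close> after the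
    projection \<open>pr\<close>, so \<open>u\<close> kills \<open>s\<close> and is positive on the
    other generators.\<close>
  define u where "u = a - ((a \<bullet> s) / (s \<bullet> s)) *\<^sub>R s"
  have us: "u \<bullet> s = 0" using ss by (simp add: u_def inner_diff_left)
  have ut: "u \<bullet> t > 0" if "t \<in> T" for t
    using a[OF that] by (simp add: u_def pr_def inner_diff_left inner_diff_right inner_commute mult.commute)
  have un: "u \<bullet> t \<ge> 0" if "t \<in> S" for t using us ut[of t] that by (cases "t = s") (auto simp: T_def)
  have 1: "u \<bullet> v = (\<Sum>t\<in>S. c t * (u \<bullet> t))" if "v = (\<Sum>t\<in>S. c t *\<^sub>R t)" for v c
    using that by (simp add: inner_sum_right)
  show ?thesis unfolding cone_face_def
  proof (intro exI[of _ u] conjI ballI)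
    fix v assume "v \<in> cone_of S"
    then obtain c where c: "v = (\<Sum>t\<in>S. c t *\<^sub>R t)" "\<forall>t\<in>S. 0 \<le> c t" unfolding cone_of_def by blast
    show "0 \<le> u \<bullet> v" unfolding 1[OF c(1)] using c un by (intro sum_nonneg) auto
  next
    show "conic hull {s} = {v \<in> cone_of S. u \<bullet> v = 0}"
    proof
      show "conic hull {s} \<subseteq> {v \<in> cone_of S. u \<bullet> v = 0}"
        unfolding conic_hull_singleton cone_of_singleton using us cone_of_scale[OF cone_of_base[OF fin s]] by auto
      show "{v \<in> cone_of S. u \<bullet> v = 0} \<subseteq> conic hull {s}"
      proof
        fix v assume v: "v \<in> {v \<in> cone_of S. u \<bullet> v = 0}"
        then obtain c where c: "v = (\<Sum>t\<in>S. c t *\<^sub>R t)" "\<forall>t\<in>S. 0 \<le> c t" unfolding cone_of_def by blast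
        have "(\<Sum>t\<in>S. c t * (u \<bullet> t)) = 0" using 1[OF c(1)] v by simp
        then have "\<forall>t\<in>S. c t * (u \<bullet> t) = 0"
          by (subst (asm) sum_nonneg_eq_0_iff[OF fin]) (use c un in auto)
        then have "c t = 0" if "t \<in> T" for t using ut[OF that] that by (auto simp: T_def)
        then have "v = c s *\<^sub>R s" using c(1) fin s by (subst (asm) sum.remove[of _ s]) (auto simp: T_def)
        then show "v \<in> conic hull {s}" unfolding conic_hull_singleton cone_of_singleton using c s by blast
      qed
    qed
  qed
qed

lemma cone_gens_subset: "cone_gens N \<sigma> \<subseteq> \<sigma>" "cone_gens N \<sigma> \<subseteq> N"
proof -
  have "v \<in> conic hull {v}" for v :: 'a by (simp add: hull_inc)
  then show "cone_gens N \<sigma> \<subseteq> \<sigma>" by (auto simp: cone_gens_def cone_face_def)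
  show "cone_gens N \<sigma> \<subseteq> N" by (auto simp: cone_gens_def primitive_def)
qed

text \<open>In a generating set of least cardinality no element is redundant, so each spans an
  exposed ray and may be replaced by the primitive vector on it. A functional positive on all
  generators, which pointedness provides, exposes the face \<open>{0}\<close>.\<close>

lemma rational_cone_generators:
  fixes N :: "'a::euclidean_space set"
  assumes lat: "is_lattice N" and rat: "rational_cone N \<sigma>" and sc: "strongly_convex \<sigma>"
  obtains A where "finite A" "A \<subseteq> cone_gens N \<sigma>" "\<sigma> = cone_of A" "cone_face {0} \<sigma>"
proof -
  define K where "K = {S. finite S \<and> S \<subseteq> N \<and> cone_of S = \<sigma>}"
  obtain S0 where "S0 \<in> K" using rat conic_convex_hull unfolding rational_cone_def K_def by blast
  then obtain S where S: "S \<in> K" "\<And>S'. S' \<in> K \<Longrightarrow> card S \<le> card S'"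
    using ex_has_least_nat[of "\<lambda>S. S \<in> K" S0 card] by blast
  then have SN: "finite S" "S \<subseteq> N" "cone_of S = \<sigma>" by (auto simp: K_def)
  have irr: "s \<notin> cone_of (S - {s})" if s: "s \<in> S" for s
  proof
    assume "s \<in> cone_of (S - {s})"
    then have "S \<subseteq> cone_of (S - {s})" using cone_of_base[of "S - {s}"] SN(1) by blast
    then have "cone_of S \<subseteq> cone_of (S - {s})" by (rule cone_of_least)
    moreover have "cone_of (S - {s}) \<subseteq> cone_of S" using cone_of_base[OF SN(1)] by (intro cone_of_least) auto
    ultimately have "S - {s} \<in> K" using SN by (auto simp: K_def)
    then have "card S \<le> card (S - {s})" by (rule S(2))
    then show False using card_Diff1_less[OF SN(1) s] by simp
  qed
  have z: "0 \<notin> S" using irr[of 0] cone_of_zero by blast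
  have sc': "strongly_convex (cone_of S)" using sc SN by simp
  have "\<forall>s\<in>S. \<exists>v. primitive N v \<and> (\<exists>k. k > (0::nat) \<and> s = of_nat k *\<^sub>R v)"
    using primitive_on_ray[OF lat] SN z by (metis subsetD)
  then obtain v where v: "\<And>s. s \<in> S \<Longrightarrow> primitive N (v s) \<and> (\<exists>k. k > (0::nat) \<and> s = of_nat k *\<^sub>R v s)"
    by metis
  have ray: "conic hull {s} = conic hull {v s}" if s: "s \<in> S" for s
  proof -
    obtain k where k: "k > (0::nat)" "s = of_nat k *\<^sub>R v s" using v[OF s] by blast
    have "v s = (1 / of_nat k) *\<^sub>R (of_nat k *\<^sub>R v s)" using k(1) by simp
    then have "v s = (1 / of_nat k) *\<^sub>R s" using k(2) by metis
    then have "v s \<in> cone_of {s}" unfolding cone_of_singleton by (intro CollectI exI[of _ "1 / of_nat k"]) auto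
    moreover have "s \<in> cone_of {v s}" using k unfolding cone_of_singleton
      by (intro CollectI exI[of _ "of_nat k"]) auto
    ultimately show ?thesis unfolding conic_hull_singleton by (intro subset_antisym cone_of_least) auto
  qed
  define A where "A = v ` S"
  have finA: "finite A" using SN by (simp add: A_def)
  have "A \<subseteq> cone_gens N \<sigma>"
    using v ray exposed_ray[OF SN(1) z sc' _ irr] SN(3) by (auto simp: A_def cone_gens_def)
  moreover have "\<sigma> = cone_of A"
  proof
    show "cone_of A \<subseteq> \<sigma>" unfolding SN(3)[symmetric]
    proof (rule cone_of_least)
      show "A \<subseteq> cone_of S"
        using calculation cone_gens_subset(1)[of N \<sigma>] SN(3) by auto
    qed
    show "\<sigma> \<subseteq> cone_of A" unfolding SN(3)[symmetric]
    proof (intro cone_of_least subsetI)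
      fix s assume s: "s \<in> S"
      then obtain k where k: "k > (0::nat)" "s = of_nat k *\<^sub>R v s" using v by blast
      have "v s \<in> cone_of A" using s finA by (intro cone_of_base) (auto simp: A_def)
      then have "of_nat k *\<^sub>R v s \<in> cone_of A" by (intro cone_of_scale) auto
      then show "s \<in> cone_of A" using k(2) by simp
    qed
  qed
  moreover have "cone_face {0} \<sigma>"
  proof -
    have "0 \<notin> convex hull S"
    proof
      assume "0 \<in> convex hull S"
      then obtain u where u: "\<forall>x\<in>S. 0 \<le> u x" "sum u S = 1" "(\<Sum>x\<in>S. u x *\<^sub>R x) = 0"
        unfolding convex_hull_finite[OF SN(1)] by auto
      then have "\<forall>s\<in>S. u s = 0" using pointed_positive_combination[OF SN(1) z sc'] by blast
      then show False using u(2) by simp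
    qed
    then obtain a where a: "\<And>s. s \<in> S \<Longrightarrow> a \<bullet> s > 0" using strictly_positive_functional[OF SN(1)] by blast
    have 1: "0 \<le> a \<bullet> v \<and> (a \<bullet> v = 0 \<longrightarrow> v = 0)" if v: "v \<in> cone_of S" for v
    proof -
      obtain c where c: "v = (\<Sum>t\<in>S. c t *\<^sub>R t)" "\<forall>t\<in>S. 0 \<le> c t" using v unfolding cone_of_def by blast
      have e: "a \<bullet> v = (\<Sum>t\<in>S. c t * (a \<bullet> t))" unfolding c(1) by (simp add: inner_sum_right)
      have nn: "\<And>t. t \<in> S \<Longrightarrow> 0 \<le> c t * (a \<bullet> t)" using c a by (simp add: less_imp_le)
      have "v = 0" if "a \<bullet> v = 0"
      proof -
        have "\<forall>t\<in>S. c t * (a \<bullet> t) = 0"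
          using that sum_nonneg_eq_0_iff[OF SN(1), of "\<lambda>t. c t * (a \<bullet> t)"] nn unfolding e by blast
        then have "\<forall>t\<in>S. c t = 0" using a by (metis less_irrefl mult_eq_0_iff)
        then show ?thesis using c by simp
      qed
      then show ?thesis unfolding e using nn by (auto intro: sum_nonneg)
    qed
    show ?thesis unfolding cone_face_def using 1 SN(3) cone_of_zero[of S] by (intro exI[of _ a]) auto
  qed
  ultimately show ?thesis using that finA by blast
qed

section \<open>Simplicial fans\<close>

lemma cone_of_pairing:
  assumes "finite A" "\<And>a. a \<in> A \<Longrightarrow> 0 \<le> u \<bullet> a" "\<forall>a\<in>A. 0 \<le> c a"
  shows "0 \<le> u \<bullet> (\<Sum>a\<in>A. c a *\<^sub>R a)"
    "u \<bullet> (\<Sum>a\<in>A. c a *\<^sub>R a) = 0 \<longleftrightarrow> (\<forall>a\<in>A. c a = 0 \<or> u \<bullet> a = 0)"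
proof -
  have e: "u \<bullet> (\<Sum>a\<in>A. c a *\<^sub>R a) = (\<Sum>a\<in>A. c a * (u \<bullet> a))" by (simp add: inner_sum_right)
  have nn: "\<And>a. a \<in> A \<Longrightarrow> 0 \<le> c a * (u \<bullet> a)" using assms by simp
  show "0 \<le> u \<bullet> (\<Sum>a\<in>A. c a *\<^sub>R a)" unfolding e using nn by (rule sum_nonneg)
  show "u \<bullet> (\<Sum>a\<in>A. c a *\<^sub>R a) = 0 \<longleftrightarrow> (\<forall>a\<in>A. c a = 0 \<or> u \<bullet> a = 0)"
    unfolding e by (subst sum_nonneg_eq_0_iff[OF assms(1) nn]) auto
qed

locale toric_fan =
  fixes N :: "'a::euclidean_space set" and \<Sigma> :: "'a set set"
  assumes lat: "is_lattice N" and fan: "is_fan N \<Sigma>" and simp: "simplicial_fan N \<Sigma>"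
begin

abbreviation "M \<equiv> dual_lattice N"
abbreviation "S \<sigma> \<equiv> dual_semigroup N \<sigma>"
abbreviation "R \<sigma> \<equiv> cone_gens N \<sigma>"
abbreviation "rays \<equiv> ray_gens N \<Sigma>"

lemma cone_props:
  assumes "\<sigma> \<in> \<Sigma>" shows "rational_cone N \<sigma>" "strongly_convex \<sigma>"
  using fan assms by (auto simp: is_fan_def)

lemma face_in: "\<sigma> \<in> \<Sigma> \<Longrightarrow> cone_face \<tau> \<sigma> \<Longrightarrow> \<tau> \<in> \<Sigma>"
  using fan by (auto simp: is_fan_def)

lemma inter_face: "\<sigma> \<in> \<Sigma> \<Longrightarrow> \<tau> \<in> \<Sigma> \<Longrightarrow> cone_face (\<sigma> \<inter> \<tau>) \<sigma>"
  using fan unfolding is_fan_def by blast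

lemma inter_in: "\<sigma> \<in> \<Sigma> \<Longrightarrow> \<tau> \<in> \<Sigma> \<Longrightarrow> \<sigma> \<inter> \<tau> \<in> \<Sigma>"
  using inter_face face_in by blast

lemma gens_independent: "\<sigma> \<in> \<Sigma> \<Longrightarrow> independent (R \<sigma>)"
  using simp by (auto simp: simplicial_fan_def)

lemma finite_gens: "\<sigma> \<in> \<Sigma> \<Longrightarrow> finite (R \<sigma>)"
  using gens_independent finiteI_independent by blast

lemma cone_eq:
  assumes "\<sigma> \<in> \<Sigma>" shows "cone_of (R \<sigma>) = \<sigma>"
proof -
  obtain A where A: "finite A" "A \<subseteq> R \<sigma>" "\<sigma> = cone_of A"
    using rational_cone_generators[OF lat cone_props[OF assms]] by metis
  have "cone_of (R \<sigma>) \<subseteq> cone_of A" using cone_gens_subset(1)[of N \<sigma>] A by (intro cone_of_least) auto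
  moreover have "cone_of A \<subseteq> cone_of (R \<sigma>)"
    using A(2) cone_of_base[OF finite_gens[OF assms]] by (intro cone_of_least) auto
  ultimately show ?thesis using A by auto
qed

lemma zero_in: "{0} \<in> \<Sigma>"
proof -
  obtain \<sigma> where s: "\<sigma> \<in> \<Sigma>" using fan by (auto simp: is_fan_def)
  then have "cone_face {0} \<sigma>" using rational_cone_generators[OF lat cone_props[OF s]] by metis
  then show ?thesis using face_in s by blast
qed

lemma zero_mem: "\<sigma> \<in> \<Sigma> \<Longrightarrow> 0 \<in> \<sigma>"
  using cone_eq cone_of_zero by metis

text \<open>Cones of a fan meet in common faces, so a ray of the fan that lies inside
  \<open>\<sigma>\<close> is a face of \<open>\<sigma>\<close>.\<close>

lemma gens_eq: "\<sigma> \<in> \<Sigma> \<Longrightarrow> R \<sigma> = rays \<inter> \<sigma>"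
proof (intro equalityI subsetI IntI)
  fix v assume s: "\<sigma> \<in> \<Sigma>" and v: "v \<in> R \<sigma>"
  then show "v \<in> rays" using face_in by (auto simp: cone_gens_def ray_gens_def)
  show "v \<in> \<sigma>" using v cone_gens_subset(1) by blast
next
  fix v assume s: "\<sigma> \<in> \<Sigma>" and v: "v \<in> rays \<inter> \<sigma>"
  then have c: "conic hull {v} \<in> \<Sigma>" "primitive N v" by (auto simp: ray_gens_def)
  have "cone_of {v} \<subseteq> cone_of (R \<sigma>)" by (rule cone_of_least) (use v cone_eq[OF s] in auto)
  then have "\<sigma> \<inter> conic hull {v} = conic hull {v}" using cone_eq[OF s] conic_hull_singleton by blast
  then show "v \<in> R \<sigma>" using inter_face[OF s c(1)] c(2) by (auto simp: cone_gens_def)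
qed

lemma rays_subset: "rays \<subseteq> N" "rays \<subseteq> (\<Union>\<sigma>\<in>\<Sigma>. R \<sigma>)"
proof -
  show "rays \<subseteq> N" by (auto simp: ray_gens_def primitive_def)
  show "rays \<subseteq> (\<Union>\<sigma>\<in>\<Sigma>. R \<sigma>)"
  proof
    fix v assume v: "v \<in> rays"
    then have c: "conic hull {v} \<in> \<Sigma>" by (auto simp: ray_gens_def)
    moreover have "v \<in> conic hull {v}" by (simp add: hull_inc)
    ultimately have "v \<in> R (conic hull {v})" using gens_eq[OF c] v by blast
    then show "v \<in> (\<Union>\<sigma>\<in>\<Sigma>. R \<sigma>)" using c by blast
  qed
qed

lemma finite_rays: "finite rays"
proof -
  have "finite \<Sigma>" using fan by (auto simp: is_fan_def)
  then have "finite (\<Union>\<sigma>\<in>\<Sigma>. R \<sigma>)" using finite_gens by auto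
  then show ?thesis using rays_subset(2) finite_subset by blast
qed

lemma semigroup_iff:
  assumes "\<sigma> \<in> \<Sigma>" shows "u \<in> S \<sigma> \<longleftrightarrow> u \<in> M \<and> (\<forall>v\<in>R \<sigma>. 0 \<le> u \<bullet> v)"
proof
  assume "u \<in> S \<sigma>"
  then show "u \<in> M \<and> (\<forall>v\<in>R \<sigma>. 0 \<le> u \<bullet> v)" using cone_gens_subset(1) by (auto simp: dual_semigroup_def)
next
  assume u: "u \<in> M \<and> (\<forall>v\<in>R \<sigma>. 0 \<le> u \<bullet> v)"
  have "0 \<le> u \<bullet> v" if "v \<in> \<sigma>" for v
  proof -
    have "v \<in> cone_of (R \<sigma>)" using that cone_eq[OF assms] by simp
    then show ?thesis unfolding cone_of_def using cone_of_pairing(1)[OF finite_gens[OF assms]] u by blast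
  qed
  then show "u \<in> S \<sigma>" using u by (auto simp: dual_semigroup_def)
qed

lemma semigroup_closed:
  "0 \<in> S \<sigma>" "u \<in> S \<sigma> \<Longrightarrow> u' \<in> S \<sigma> \<Longrightarrow> u + u' \<in> S \<sigma>" "u \<in> S \<sigma> \<Longrightarrow> of_nat k *\<^sub>R u \<in> S \<sigma>"
  using dual_closed[OF lat] by (auto simp: dual_semigroup_def inner_add_left)

lemma semigroup_mono: "\<tau> \<subseteq> \<sigma> \<Longrightarrow> S \<sigma> \<subseteq> S \<tau>"
  by (auto simp: dual_semigroup_def)

lemma semigroup_dual: "S \<sigma> \<subseteq> M"
  by (auto simp: dual_semigroup_def)

lemma semigroup_zero: "S {0} = M"
  by (auto simp: dual_semigroup_def)

lemma adapted_basis: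
  assumes "\<sigma> \<in> \<Sigma>"
  obtains A w where "R \<sigma> \<subseteq> A" "A \<subseteq> N" "independent A" "span A = span N"
    "\<And>a. a \<in> A \<Longrightarrow> w a \<in> M" "\<And>a. a \<in> A \<Longrightarrow> w a \<bullet> a > 0"
    "\<And>a a'. a \<in> A \<Longrightarrow> a' \<in> A \<Longrightarrow> a \<noteq> a' \<Longrightarrow> w a \<bullet> a' = 0"
  using rational_dual_basis[OF lat cone_gens_subset(2) gens_independent[OF assms]] by metis

text \<open>Expand \<open>e\<close> in a basis extending the generators of the cone. Outside the
  cone, either some generator has a negative coefficient or some further basis vector has a nonzero
  one; the corresponding dual vector, up to sign in the second case, separates.\<close>

lemma separate_from_cone:
  assumes "\<sigma> \<in> \<Sigma>" "e \<in> span N" "e \<notin> \<sigma>"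
  obtains u where "u \<in> S \<sigma>" "u \<bullet> e < 0"
proof -
  obtain A w where A: "R \<sigma> \<subseteq> A" "A \<subseteq> N" "independent A" "span A = span N"
    "\<And>a. a \<in> A \<Longrightarrow> w a \<in> M" "\<And>a. a \<in> A \<Longrightarrow> w a \<bullet> a > 0"
    "\<And>a a'. a \<in> A \<Longrightarrow> a' \<in> A \<Longrightarrow> a \<noteq> a' \<Longrightarrow> w a \<bullet> a' = 0"
    using adapted_basis[OF assms(1)] by metis
  have fin: "finite A" using A(3) by (rule finiteI_independent)
  obtain c where c: "e = (\<Sum>a\<in>A. c a *\<^sub>R a)" using assms(2) A(4) span_finite[OF fin] by auto
  have wc: "w a \<bullet> e = c a * (w a \<bullet> a)" if a: "a \<in> A" for a
  proof -
    have "w a \<bullet> e = (\<Sum>b\<in>A. if b = a then c a * (w a \<bullet> a) else 0)"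
      unfolding c inner_sum_right using A(7) a by (intro sum.cong) auto
    then show ?thesis using fin a by simp
  qed
  consider a where "a \<in> R \<sigma>" "c a < 0" | a where "a \<in> A" "a \<notin> R \<sigma>" "c a \<noteq> 0"
  proof (rule ccontr)
    assume "\<not> thesis"
    with that have "\<forall>a\<in>R \<sigma>. 0 \<le> c a" "\<forall>a\<in>A - R \<sigma>. c a = 0" by force+
    moreover have "e = (\<Sum>a\<in>R \<sigma>. c a *\<^sub>R a)" unfolding c
      by (rule sum.mono_neutral_right) (use fin A calculation in auto)
    ultimately have "e \<in> cone_of (R \<sigma>)" unfolding cone_of_def by blast
    then show False using assms cone_eq by simp
  qed
  then show ?thesis
  proof cases
    case 1
    then have a: "a \<in> A" using A by blast
    have "0 \<le> w a \<bullet> v" if "v \<in> R \<sigma>" for v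
      using A(6)[OF a] A(7)[OF a, of v] A(1) that by (cases "a = v") auto
    then have "w a \<in> S \<sigma>" using semigroup_iff[OF assms(1)] A(5)[OF a] by blast
    moreover have "w a \<bullet> e < 0" unfolding wc[OF a] using 1 A(6)[OF a] by (simp add: mult_less_0_iff)
    ultimately show ?thesis using that by blast
  next
    case 2
    have z: "w a \<bullet> v = 0" if "v \<in> R \<sigma>" for v using A(7)[of a v] A(1) that 2 by auto
    have "w a \<in> S \<sigma>" "- w a \<in> S \<sigma>"
      using semigroup_iff[OF assms(1)] A(5)[OF 2(1)] z dual_closed(3)[OF lat] by auto
    moreover have "w a \<bullet> e \<noteq> 0" unfolding wc[OF 2(1)] using 2 A(6)[OF 2(1)] by simp
    ultimately show ?thesis using that[of "w a"] that[of "- w a"] by (cases "w a \<bullet> e < 0") auto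
  qed
qed

text \<open>Take the sum of the dual vectors of the generators outside \<open>A\<close>. Such
  vectors exist because the generators are independent, so every subset of the generators spans a
  face.\<close>

lemma face_functional:
  assumes "\<sigma> \<in> \<Sigma>" "A \<subseteq> R \<sigma>"
  obtains m where "m \<in> S \<sigma>" "\<And>v. v \<in> R \<sigma> \<Longrightarrow> m \<bullet> v = 0 \<longleftrightarrow> v \<in> A"
    "\<And>v. v \<in> \<sigma> \<Longrightarrow> m \<bullet> v = 0 \<longleftrightarrow> v \<in> cone_of A"
proof -
  obtain A' w where A': "R \<sigma> \<subseteq> A'" "A' \<subseteq> N" "independent A'" "span A' = span N"
    "\<And>a. a \<in> A' \<Longrightarrow> w a \<in> M" "\<And>a. a \<in> A' \<Longrightarrow> w a \<bullet> a > 0"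
    "\<And>a a'. a \<in> A' \<Longrightarrow> a' \<in> A' \<Longrightarrow> a \<noteq> a' \<Longrightarrow> w a \<bullet> a' = 0"
    using adapted_basis[OF assms(1)] by metis
  have fin: "finite (R \<sigma>)" using finite_gens[OF assms(1)] .
  define m where "m = (\<Sum>b\<in>R \<sigma> - A. w b)"
  have mv: "m \<bullet> v = (if v \<in> A then 0 else w v \<bullet> v)" if v: "v \<in> R \<sigma>" for v
  proof -
    have "m \<bullet> v = (\<Sum>b\<in>R \<sigma> - A. if b = v then w v \<bullet> v else 0)"
      unfolding m_def inner_sum_left using A'(1,7) v by (intro sum.cong) auto
    then show ?thesis using fin v by (simp add: sum.delta')
  qed
  have pos: "w v \<bullet> v > 0" if "v \<in> R \<sigma>" for v using A'(1,6) that by blast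
  have 1: "m \<bullet> v = 0 \<longleftrightarrow> v \<in> A" "0 \<le> m \<bullet> v" if "v \<in> R \<sigma>" for v
    using mv[OF that] pos[OF that] by auto
  have "m \<in> M" unfolding m_def using A'(1,5) by (intro dual_sum[OF lat]) auto
  then have mS: "m \<in> S \<sigma>" using semigroup_iff[OF assms(1)] 1 by blast
  have 2: "m \<bullet> v = 0 \<longleftrightarrow> v \<in> cone_of A" if "v \<in> \<sigma>" for v
  proof
    have "v \<in> cone_of (R \<sigma>)" using that cone_eq[OF assms(1)] by simp
    then obtain c where c: "v = (\<Sum>a\<in>R \<sigma>. c a *\<^sub>R a)" "\<forall>a\<in>R \<sigma>. 0 \<le> c a" unfolding cone_of_def by blast
    assume "m \<bullet> v = 0"
    then have "\<forall>a\<in>R \<sigma>. c a = 0 \<or> a \<in> A"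
      using cone_of_pairing(2)[OF fin 1(2) c(2)] 1(1) unfolding c(1) by blast
    then have "v = (\<Sum>a\<in>A. c a *\<^sub>R a)" unfolding c(1)
      by (intro sum.mono_neutral_right) (use fin assms in auto)
    then show "v \<in> cone_of A" unfolding cone_of_def using c(2) assms(2) by blast
  next
    assume "v \<in> cone_of A"
    then obtain c where c: "v = (\<Sum>a\<in>A. c a *\<^sub>R a)" unfolding cone_of_def by blast
    show "m \<bullet> v = 0" unfolding c inner_sum_right using 1(1) assms(2) by (intro sum.neutral) auto
  qed
  show ?thesis using that[OF mS 1(1) 2] by blast
qed

lemma subcone_in:
  assumes "\<sigma> \<in> \<Sigma>" "A \<subseteq> R \<sigma>"
  shows "cone_of A \<in> \<Sigma>" "R (cone_of A) = A"
proof -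
  obtain m where m: "m \<in> S \<sigma>" "\<And>v. v \<in> R \<sigma> \<Longrightarrow> m \<bullet> v = 0 \<longleftrightarrow> v \<in> A"
    "\<And>v. v \<in> \<sigma> \<Longrightarrow> m \<bullet> v = 0 \<longleftrightarrow> v \<in> cone_of A" using face_functional[OF assms] by metis
  have finA: "finite A" using finite_gens[OF assms(1)] assms(2) finite_subset by blast
  have sub: "cone_of A \<subseteq> \<sigma>"
    using cone_of_least[of A "R \<sigma>"] cone_of_base[OF finite_gens[OF assms(1)]] assms(2) cone_eq[OF assms(1)] by auto
  have "cone_face (cone_of A) \<sigma>" unfolding cone_face_def
    using m(1,3) sub by (intro exI[of _ m]) (auto simp: dual_semigroup_def)
  then show in1: "cone_of A \<in> \<Sigma>" using face_in assms(1) by blast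
  show "R (cone_of A) = A"
  proof
    show "A \<subseteq> R (cone_of A)" using gens_eq[OF in1] gens_eq[OF assms(1)] assms(2) cone_of_base[OF finA] by blast
    show "R (cone_of A) \<subseteq> A"
    proof
      fix v assume "v \<in> R (cone_of A)"
      then have v: "v \<in> rays" "v \<in> cone_of A" using gens_eq[OF in1] by auto
      then have "v \<in> R \<sigma>" "m \<bullet> v = 0" using gens_eq[OF assms(1)] sub m(3) by auto
      then show "v \<in> A" using m(2) by blast
    qed
  qed
qed

text \<open>Inverting the character of this \<open>m\<close> cuts the chart of
  \<open>\<sigma> \<inter> \<tau>\<close> out of the chart of \<open>\<sigma>\<close>.\<close>

lemma common_face:
  assumes "\<sigma> \<in> \<Sigma>" "\<tau> \<in> \<Sigma>"
  obtains m where "m \<in> S \<sigma>" "- m \<in> S (\<sigma> \<inter> \<tau>)" "\<And>v. v \<in> \<sigma> \<Longrightarrow> m \<bullet> v = 0 \<longleftrightarrow> v \<in> \<tau>"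
proof -
  have i: "\<sigma> \<inter> \<tau> \<in> \<Sigma>" using inter_in assms by blast
  have "R (\<sigma> \<inter> \<tau>) \<subseteq> R \<sigma>" using gens_eq[OF i] gens_eq[OF assms(1)] by blast
  then obtain m where m: "m \<in> S \<sigma>" "\<And>v. v \<in> \<sigma> \<Longrightarrow> m \<bullet> v = 0 \<longleftrightarrow> v \<in> cone_of (R (\<sigma> \<inter> \<tau>))"
    using face_functional[OF assms(1)] by metis
  then have 1: "\<And>v. v \<in> \<sigma> \<Longrightarrow> m \<bullet> v = 0 \<longleftrightarrow> v \<in> \<tau>" using cone_eq[OF i] by auto
  have "- m \<in> S (\<sigma> \<inter> \<tau>)" using m(1) 1 dual_closed(3)[OF lat] by (auto simp: dual_semigroup_def)
  then show ?thesis using that m(1) 1 by blast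
qed

text \<open>Every character regular on the smaller chart becomes regular on the larger one after
  multiplication by a power of the character of \<open>m\<close>.\<close>

lemma localization:
  assumes "\<sigma> \<in> \<Sigma>" "u \<in> S \<tau>" "m \<in> S \<sigma>" "\<And>v. v \<in> \<sigma> \<Longrightarrow> m \<bullet> v = 0 \<Longrightarrow> v \<in> \<tau>"
  obtains k where "u + of_nat k *\<^sub>R m \<in> S \<sigma>"
proof -
  have fin: "finite (R \<sigma>)" using finite_gens[OF assms(1)] .
  \<comment> \<open>At each generator with \<open>m \<bullet> v > 0\<close>, this many copies of
    \<open>m\<close> outweigh a negative value of \<open>u\<close>; the entry 0 covers an empty set
    of generators.\<close>
  define k where "k = Max (insert 0 ((\<lambda>v. nat \<lceil>- (u \<bullet> v) / (m \<bullet> v)\<rceil>) ` R \<sigma>))"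
  have "0 \<le> (u + of_nat k *\<^sub>R m) \<bullet> v" if v: "v \<in> R \<sigma>" for v
  proof (cases "m \<bullet> v = 0")
    case True
    then have "v \<in> \<tau>" using assms(4) v cone_gens_subset(1) by blast
    then have "0 \<le> u \<bullet> v" using assms(2) by (auto simp: dual_semigroup_def)
    then show ?thesis using True by (simp add: inner_add_left)
  next
    case False
    then have p: "m \<bullet> v > 0" using assms(1,3) v semigroup_iff[of \<sigma> m] by force
    have "nat \<lceil>- (u \<bullet> v) / (m \<bullet> v)\<rceil> \<le> k" unfolding k_def using fin v by (intro Max_ge) auto
    then have "- (u \<bullet> v) / (m \<bullet> v) \<le> of_nat k" by linarith
    then show ?thesis using p by (simp add: inner_add_left field_simps)
  qed
  moreover have "u + of_nat k *\<^sub>R m \<in> M"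
    using assms(2,3) semigroup_dual dual_closed[OF lat] by (meson subsetD)
  ultimately show ?thesis using that semigroup_iff[OF assms(1)] by blast
qed

section \<open>Gluing the charts\<close>

lemma chartD:
  assumes "\<gamma> \<in> chart N \<sigma>"
  shows "\<gamma> \<in> extensional (S \<sigma>)" "\<gamma> 0 = 1"
    "u \<in> S \<sigma> \<Longrightarrow> u' \<in> S \<sigma> \<Longrightarrow> \<gamma> (u + u') = \<gamma> u * \<gamma> u'"
  using assms by (auto simp: chart_def)

lemma chart_scale:
  assumes "\<gamma> \<in> chart N \<sigma>" "m \<in> S \<sigma>"
  shows "\<gamma> (of_nat k *\<^sub>R m) = \<gamma> m ^ k"
proof (induction k)
  case (Suc k)
  have "of_nat (Suc k) *\<^sub>R m = m + of_nat k *\<^sub>R m" by (simp add: scaleR_add_left)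
  then show ?case using Suc chartD(3)[OF assms(1)] assms(2) semigroup_closed(3)[of m \<sigma> k] by simp
qed (simp add: chartD[OF assms(1)])

lemma chart_unit:
  assumes "\<gamma> \<in> chart N \<sigma>" "u \<in> S \<sigma>" "- u \<in> S \<sigma>"
  shows "\<gamma> u \<noteq> 0"
  using chartD(2,3)[OF assms(1)] assms(2,3) by (metis add.right_inverse mult_zero_left zero_neq_one)

lemma chart_restrict:
  assumes "\<delta> \<in> chart N \<tau>" "S \<sigma> \<subseteq> S \<tau>"
  shows "restrict \<delta> (S \<sigma>) \<in> chart N \<sigma>"
  unfolding chart_def using chartD[OF assms(1)] semigroup_closed assms(2) by (auto simp: subset_iff)

text \<open>A point at which the character of \<open>m\<close> is nonzero extends to the
  localization by the value of \<open>u + k m\<close> divided by the k-th power of the value of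
  \<open>m\<close>; comparing two exponents shows that k does not matter.\<close>

lemma chart_extend:
  assumes g: "\<gamma> \<in> chart N \<sigma>" and sub: "S \<sigma> \<subseteq> S \<tau>" and m: "m \<in> S \<sigma>" "\<gamma> m \<noteq> 0"
    and loc: "\<And>u. u \<in> S \<tau> \<Longrightarrow> \<exists>k. u + of_nat k *\<^sub>R m \<in> S \<sigma>"
  obtains \<delta> where "\<delta> \<in> chart N \<tau>" "restrict \<delta> (S \<sigma>) = \<gamma>"
proof -
  define K where "K u = (SOME k. u + of_nat k *\<^sub>R m \<in> S \<sigma>)" for u
  have K: "u + of_nat (K u) *\<^sub>R m \<in> S \<sigma>" if "u \<in> S \<tau>" for u
    unfolding K_def using loc[OF that] by (rule someI_ex)
  define \<delta> where "\<delta> = (\<lambda>u\<in>S \<tau>. \<gamma> (u + of_nat (K u) *\<^sub>R m) / \<gamma> m ^ K u)"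
  have val: "\<delta> u = \<gamma> (u + of_nat k *\<^sub>R m) / \<gamma> m ^ k" if u: "u \<in> S \<tau>" and k: "u + of_nat k *\<^sub>R m \<in> S \<sigma>" for u k
  proof -
    have "\<gamma> (u + of_nat k *\<^sub>R m) * \<gamma> m ^ K u = \<gamma> ((u + of_nat k *\<^sub>R m) + of_nat (K u) *\<^sub>R m)"
      using chartD(3)[OF g k] chart_scale[OF g m(1)] semigroup_closed(3)[OF m(1)] by simp
    also have "(u + of_nat k *\<^sub>R m) + of_nat (K u) *\<^sub>R m = (u + of_nat (K u) *\<^sub>R m) + of_nat k *\<^sub>R m"
      by (simp add: ac_simps)
    also have "\<gamma> \<dots> = \<gamma> (u + of_nat (K u) *\<^sub>R m) * \<gamma> m ^ k"
      using chartD(3)[OF g K[OF u]] chart_scale[OF g m(1)] semigroup_closed(3)[OF m(1)] by simp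
    finally show ?thesis using m(2) u by (simp add: \<delta>_def field_simps)
  qed
  have "\<delta> \<in> chart N \<tau>" unfolding chart_def
  proof (intro CollectI conjI ballI)
    show "\<delta> \<in> extensional (S \<tau>)" by (simp add: \<delta>_def)
    show "\<delta> 0 = 1" using val[of 0 0] semigroup_closed(1) chartD(2)[OF g] by simp
    fix u u' assume u: "u \<in> S \<tau>" "u' \<in> S \<tau>"
    have e: "(u + u') + of_nat (K u + K u') *\<^sub>R m = (u + of_nat (K u) *\<^sub>R m) + (u' + of_nat (K u') *\<^sub>R m)"
      by (simp add: scaleR_add_left ac_simps)
    have "\<delta> (u + u') = \<gamma> ((u + u') + of_nat (K u + K u') *\<^sub>R m) / \<gamma> m ^ (K u + K u')"
      by (rule val) (use u K semigroup_closed(2) in \<open>simp_all only: e\<close>)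
    also have "\<dots> = \<delta> u * \<delta> u'" unfolding e
      using chartD(3)[OF g K K] u by (simp add: \<delta>_def power_add)
    finally show "\<delta> (u + u') = \<delta> u * \<delta> u'" .
  qed
  moreover have "restrict \<delta> (S \<sigma>) = \<gamma>"
    by (rule extensionalityI[OF restrict_extensional chartD(1)[OF g]])
      (use val[of _ 0] sub in auto)
  ultimately show ?thesis using that by blast
qed

lemma chart_unique:
  assumes "\<delta> \<in> chart N \<tau>" "\<delta>' \<in> chart N \<tau>'" "S \<sigma> \<subseteq> S \<tau>" "S \<sigma> \<subseteq> S \<tau>'"
    and "restrict \<delta> (S \<sigma>) = restrict \<delta>' (S \<sigma>)"
    and "u \<in> S \<tau>" "u \<in> S \<tau>'" "m \<in> S \<sigma>" "\<delta> m \<noteq> 0" "u + of_nat k *\<^sub>R m \<in> S \<sigma>"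
  shows "\<delta> u = \<delta>' u"
proof -
  have r: "\<delta> v = \<delta>' v" if "v \<in> S \<sigma>" for v using assms(5) that by (metis restrict_apply')
  have 1: "\<delta> (u + of_nat k *\<^sub>R m) = \<delta> u * \<delta> m ^ k"
    using chartD(3)[OF assms(1,6)] chart_scale[OF assms(1)] semigroup_closed(3)[of m \<tau> k] assms(3,8)
    by (simp add: subset_iff)
  have 2: "\<delta>' (u + of_nat k *\<^sub>R m) = \<delta>' u * \<delta>' m ^ k"
    using chartD(3)[OF assms(2,7)] chart_scale[OF assms(2)] semigroup_closed(3)[of m \<tau>' k] assms(4,8)
    by (simp add: subset_iff)
  show ?thesis using 1 2 r[OF assms(8)] r[OF assms(10)] assms(9) by simp
qed

lemma glue_iff: "((\<sigma>, \<gamma>), (\<tau>, \<beta>)) \<in> glue N \<Sigma> \<longleftrightarrow> \<sigma> \<in> \<Sigma> \<and> \<tau> \<in> \<Sigma> \<and> (\<exists>\<delta>\<in>chart N (\<sigma> \<inter> \<tau>).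
     \<gamma> = restrict \<delta> (S \<sigma>) \<and> \<beta> = restrict \<delta> (S \<tau>))"
  by (auto simp: glue_def)

lemma glue_refl: "\<sigma> \<in> \<Sigma> \<Longrightarrow> \<gamma> \<in> chart N \<sigma> \<Longrightarrow> ((\<sigma>, \<gamma>), (\<sigma>, \<gamma>)) \<in> glue N \<Sigma>"
  using chartD(1)[of \<gamma> \<sigma>] by (auto simp: glue_iff extensional_restrict intro!: bexI[of _ \<gamma>])

lemma glue_sym: "((\<sigma>, \<gamma>), (\<tau>, \<beta>)) \<in> glue N \<Sigma> \<Longrightarrow> ((\<tau>, \<beta>), (\<sigma>, \<gamma>)) \<in> glue N \<Sigma>"
  by (auto simp: glue_iff Int_commute)

lemma glue_chart: "((\<sigma>, \<gamma>), (\<tau>, \<beta>)) \<in> glue N \<Sigma> \<Longrightarrow> \<gamma> \<in> chart N \<sigma> \<and> \<beta> \<in> chart N \<tau>"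
  using chart_restrict semigroup_mono[of "\<sigma> \<inter> \<tau>" \<sigma>] semigroup_mono[of "\<sigma> \<inter> \<tau>" \<tau>]
  by (auto simp: glue_iff)

text \<open>The common point in the middle chart is nonzero on the characters cutting out both
  overlaps, so it extends to the triple intersection. This extension agrees with
  \<open>\<delta>1\<close> on \<open>S \<sigma>\<close> and with \<open>\<delta>2\<close> on
  \<open>S \<kappa>\<close>, and its restriction to \<open>\<sigma> \<inter> \<kappa>\<close> is the
  required gluing.\<close>

lemma glue_trans:
  assumes "((\<sigma>, \<gamma>), (\<tau>, \<beta>)) \<in> glue N \<Sigma>" "((\<tau>, \<beta>), (\<kappa>, \<alpha>)) \<in> glue N \<Sigma>"
  shows "((\<sigma>, \<gamma>), (\<kappa>, \<alpha>)) \<in> glue N \<Sigma>"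
proof -
  obtain \<delta>1 where d1: "\<delta>1 \<in> chart N (\<sigma> \<inter> \<tau>)" "\<gamma> = restrict \<delta>1 (S \<sigma>)" "\<beta> = restrict \<delta>1 (S \<tau>)"
    using assms(1) by (auto simp: glue_iff)
  obtain \<delta>2 where d2: "\<delta>2 \<in> chart N (\<tau> \<inter> \<kappa>)" "\<beta> = restrict \<delta>2 (S \<tau>)" "\<alpha> = restrict \<delta>2 (S \<kappa>)"
    using assms(2) by (auto simp: glue_iff)
  have c: "\<sigma> \<in> \<Sigma>" "\<tau> \<in> \<Sigma>" "\<kappa> \<in> \<Sigma>" using assms by (auto simp: glue_iff)
  have b: "\<beta> \<in> chart N \<tau>" using glue_chart[OF assms(1)] by blast
  define \<rho> where "\<rho> = \<sigma> \<inter> \<tau> \<inter> \<kappa>"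
  obtain m1 where m1: "m1 \<in> S \<tau>" "- m1 \<in> S (\<tau> \<inter> \<sigma>)" "\<And>v. v \<in> \<tau> \<Longrightarrow> m1 \<bullet> v = 0 \<longleftrightarrow> v \<in> \<sigma>"
    using common_face[OF c(2,1)] by metis
  obtain m2 where m2: "m2 \<in> S \<tau>" "- m2 \<in> S (\<tau> \<inter> \<kappa>)" "\<And>v. v \<in> \<tau> \<Longrightarrow> m2 \<bullet> v = 0 \<longleftrightarrow> v \<in> \<kappa>"
    using common_face[OF c(2,3)] by metis
  have sub: "S \<tau> \<subseteq> S (\<sigma> \<inter> \<tau>)" "S \<tau> \<subseteq> S (\<tau> \<inter> \<kappa>)" "S \<tau> \<subseteq> S \<rho>" "S \<sigma> \<subseteq> S \<rho>" "S \<kappa> \<subseteq> S \<rho>"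
    "S \<sigma> \<subseteq> S (\<sigma> \<inter> \<tau>)" "S \<kappa> \<subseteq> S (\<tau> \<inter> \<kappa>)" "S (\<sigma> \<inter> \<kappa>) \<subseteq> S \<rho>" "S \<sigma> \<subseteq> S (\<sigma> \<inter> \<kappa>)" "S \<kappa> \<subseteq> S (\<sigma> \<inter> \<kappa>)"
    by (intro semigroup_mono; auto simp: \<rho>_def)+
  have b1: "\<beta> m1 \<noteq> 0" using chart_unit[OF d1(1), of m1] m1 sub(1) d1(3) by (auto simp: Int_commute)
  have b2: "\<beta> m2 \<noteq> 0" using chart_unit[OF d2(1), of m2] m2 sub(2) d2(2) by auto
  have m: "m1 + m2 \<in> S \<tau>" "\<beta> (m1 + m2) \<noteq> 0"
    using semigroup_closed(2) m1(1) m2(1) chartD(3)[OF b] b1 b2 by auto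
  have pos: "0 \<le> m1 \<bullet> v" "0 \<le> m2 \<bullet> v" if "v \<in> \<tau>" for v
    using m1(1) m2(1) that by (auto simp: dual_semigroup_def)
  have "\<exists>k. u + of_nat k *\<^sub>R (m1 + m2) \<in> S \<tau>" if "u \<in> S \<rho>" for u
  proof (rule localization[OF c(2) that m(1)])
    fix v assume v: "v \<in> \<tau>" "(m1 + m2) \<bullet> v = 0"
    then have "m1 \<bullet> v = 0" "m2 \<bullet> v = 0" using pos[OF v(1)] by (auto simp: inner_add_left)
    then show "v \<in> \<rho>" using m1(3) m2(3) v by (auto simp: \<rho>_def)
  qed blast
  then obtain \<delta> where d: "\<delta> \<in> chart N \<rho>" "restrict \<delta> (S \<tau>) = \<beta>"
    using chart_extend[OF b sub(3) m] by metis
  have dm: "\<delta> m1 \<noteq> 0" "\<delta> m2 \<noteq> 0" using d(2) m1(1) m2(1) b1 b2 by (metis restrict_apply')+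
  have "\<delta> u = \<delta>1 u" if u: "u \<in> S \<sigma>" for u
  proof -
    have u': "u \<in> S \<rho>" "u \<in> S (\<sigma> \<inter> \<tau>)" using u sub by auto
    obtain k where "u + of_nat k *\<^sub>R m1 \<in> S \<tau>"
      by (rule localization[OF c(2) u'(2) m1(1)]) (use m1(3) in auto)
    then show ?thesis
      by (intro chart_unique[OF d(1) d1(1) sub(3,1) _ u' m1(1)]) (use d(2) d1(3) dm in auto)
  qed
  moreover have "\<delta> u = \<delta>2 u" if u: "u \<in> S \<kappa>" for u
  proof -
    have u': "u \<in> S \<rho>" "u \<in> S (\<tau> \<inter> \<kappa>)" using u sub by auto
    obtain k where "u + of_nat k *\<^sub>R m2 \<in> S \<tau>"
      by (rule localization[OF c(2) u'(2) m2(1)]) (use m2(3) in auto)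
    then show ?thesis
      by (intro chart_unique[OF d(1) d2(1) sub(3,2) _ u' m2(1)]) (use d(2) d2(2) dm in auto)
  qed
  ultimately have "\<gamma> = restrict (restrict \<delta> (S (\<sigma> \<inter> \<kappa>))) (S \<sigma>)" "\<alpha> = restrict (restrict \<delta> (S (\<sigma> \<inter> \<kappa>))) (S \<kappa>)"
    using d1(2) d2(3) sub(9,10) by (auto simp: restrict_def fun_eq_iff)
  then show ?thesis unfolding glue_iff using c chart_restrict[OF d(1) sub(8)] by blast
qed

lemma toric_pt_eq_iff:
  assumes "\<sigma> \<in> \<Sigma>" "\<gamma> \<in> chart N \<sigma>" "\<tau> \<in> \<Sigma>" "\<beta> \<in> chart N \<tau>"
  shows "toric_pt N \<Sigma> \<sigma> \<gamma> = toric_pt N \<Sigma> \<tau> \<beta> \<longleftrightarrow> ((\<sigma>, \<gamma>), (\<tau>, \<beta>)) \<in> glue N \<Sigma>"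
proof
  assume "toric_pt N \<Sigma> \<sigma> \<gamma> = toric_pt N \<Sigma> \<tau> \<beta>"
  moreover have "(\<tau>, \<beta>) \<in> toric_pt N \<Sigma> \<tau> \<beta>" using glue_refl[OF assms(3,4)] by (simp add: toric_pt_def)
  ultimately have "(\<tau>, \<beta>) \<in> toric_pt N \<Sigma> \<sigma> \<gamma>" by simp
  then show "((\<sigma>, \<gamma>), (\<tau>, \<beta>)) \<in> glue N \<Sigma>" by (simp add: toric_pt_def)
next
  assume "((\<sigma>, \<gamma>), (\<tau>, \<beta>)) \<in> glue N \<Sigma>"
  then have "((\<sigma>, \<gamma>), x) \<in> glue N \<Sigma> \<longleftrightarrow> ((\<tau>, \<beta>), x) \<in> glue N \<Sigma>" for x
    using glue_trans glue_sym by (cases x) blast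
  then show "toric_pt N \<Sigma> \<sigma> \<gamma> = toric_pt N \<Sigma> \<tau> \<beta>" unfolding toric_pt_def by blast
qed

lemma toric_pt_inj:
  assumes "\<sigma> \<in> \<Sigma>" "\<gamma> \<in> chart N \<sigma>" "\<beta> \<in> chart N \<sigma>" "toric_pt N \<Sigma> \<sigma> \<gamma> = toric_pt N \<Sigma> \<sigma> \<beta>"
  shows "\<gamma> = \<beta>"
  using toric_pt_eq_iff[OF assms(1,2,1,3)] assms(4) by (auto simp: glue_iff)

lemma toric_pt_torus:
  assumes "\<sigma> \<in> \<Sigma>" "\<gamma> \<in> chart N \<sigma>" "\<beta> \<in> chart N {0}" "toric_pt N \<Sigma> \<sigma> \<gamma> = toric_pt N \<Sigma> {0} \<beta>"
  shows "\<gamma> = restrict \<beta> (S \<sigma>)"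
proof -
  obtain \<delta> where d: "\<gamma> = restrict \<delta> (S \<sigma>)" "\<beta> = restrict \<delta> (S {0})"
    using toric_pt_eq_iff[OF assms(1,2) zero_in assms(3)] assms(4) by (auto simp: glue_iff)
  then show ?thesis using semigroup_dual[of \<sigma>] semigroup_zero by (auto simp: restrict_def fun_eq_iff)
qed

lemma toric_pt_restrict:
  assumes "\<sigma> \<in> \<Sigma>" "\<tau> \<in> \<Sigma>" "\<delta> \<in> chart N (\<sigma> \<inter> \<tau>)"
  shows "toric_pt N \<Sigma> \<sigma> (restrict \<delta> (S \<sigma>)) = toric_pt N \<Sigma> \<tau> (restrict \<delta> (S \<tau>))"
proof -
  have "((\<sigma>, restrict \<delta> (S \<sigma>)), (\<tau>, restrict \<delta> (S \<tau>))) \<in> glue N \<Sigma>"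
    using assms by (auto simp: glue_iff)
  then show ?thesis using toric_pt_eq_iff[OF assms(1) _ assms(2)] glue_chart by blast
qed

section \<open>Complete fans\<close>

lemma prod_eval_diff:
  "prod_eval (Poly_Mapping.single (u, m) 1 - Poly_Mapping.single (u', m') 1) \<gamma> y =
     \<gamma> u * mono_eval m y - \<gamma> u' * mono_eval m' y"
proof -
  let ?f = "Poly_Mapping.single (u, m) 1 - Poly_Mapping.single (u', m') (1::complex)"
  have "Poly_Mapping.keys ?f \<subseteq> {(u, m), (u', m')}"
    by (auto simp: in_keys_iff lookup_minus lookup_single when_def split: if_splits)
  then have "prod_eval ?f \<gamma> y =
      (\<Sum>(u, m)\<in>{(u, m), (u', m')}. Poly_Mapping.lookup ?f (u, m) * \<gamma> u * mono_eval m y)"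
    unfolding prod_eval_def by (intro sum.mono_neutral_left) (auto simp: in_keys_iff)
  also have "\<dots> = \<gamma> u * mono_eval m y - \<gamma> u' * mono_eval m' y"
    by (cases "(u, m) = (u', m')") (auto simp: lookup_minus lookup_single when_def)
  finally show ?thesis .
qed

lemma torus_chart:
  assumes "e \<in> N" "t \<noteq> 0"
  shows "(\<lambda>u\<in>M. t powi \<lfloor>u \<bullet> e\<rfloor>) \<in> chart N {0}"
proof -
  have "\<lfloor>(u + u') \<bullet> e\<rfloor> = \<lfloor>u \<bullet> e\<rfloor> + \<lfloor>u' \<bullet> e\<rfloor>" if "u \<in> M" "u' \<in> M" for u u'
    using dual_Ints[OF lat that(1) assms(1)] by (auto simp: inner_add_left elim!: Ints_cases)
  then show ?thesis unfolding chart_def semigroup_zero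
    using assms(2) dual_closed[OF lat] by (auto simp: power_int_add)
qed

text \<open>If no cone contains \<open>e\<close>, the curve $t \mapsto (\lambda^e(t), t)$ is closed in the product of
  the variety with the affine line, but its projection misses exactly the origin.\<close>

lemma complete_support:
  assumes comp: "complete_variety N \<Sigma>" and e: "e \<in> N"
  shows "\<exists>\<sigma>\<in>\<Sigma>. e \<in> \<sigma>"
proof (rule ccontr)
  assume no: "\<not> ?thesis"
  define crv where "crv t = (\<lambda>u\<in>M. t powi \<lfloor>u \<bullet> e\<rfloor>)" for t :: complex
  define y where "y t = (\<lambda>i::nat. if i = 0 then t else 0)" for t :: complex
  define C where "C = {(toric_pt N \<Sigma> {0} (crv t), y t) | t. t \<noteq> 0}"
  define Op where "Op \<sigma> f = {(toric_pt N \<Sigma> \<sigma> \<gamma>, y) | \<gamma> y.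
         \<gamma> \<in> chart N \<sigma> \<and> y \<in> affine_space {..<1::nat} \<and> prod_eval f \<gamma> y \<noteq> 0}" for \<sigma> f
  let ?T = "zariski_prod N \<Sigma> 1"
  have T: "?T = topology_generated_by {Op \<sigma> f | \<sigma> f. \<sigma> \<in> \<Sigma> \<and> f \<in> prod_ring N \<sigma> 1}"
    unfolding zariski_prod_def Op_def by simp
  have opn: "openin ?T (Op \<sigma> f)" if "\<sigma> \<in> \<Sigma>" "f \<in> prod_ring N \<sigma> 1" for \<sigma> f
    unfolding T by (rule topology_generated_by_Basis) (use that in blast)
  have top: "topspace ?T = \<Union>{Op \<sigma> f | \<sigma> f. \<sigma> \<in> \<Sigma> \<and> f \<in> prod_ring N \<sigma> 1}"
    unfolding T by (rule topology_generated_by_topspace)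
  have lam: "crv t \<in> chart N {0}" if "t \<noteq> 0" for t using torus_chart[OF e that] by (simp add: crv_def)
  have yaff: "y t \<in> affine_space {..<1}" for t by (auto simp: y_def affine_space_def)
  have affy: "x = y (x 0)" if "x \<in> affine_space {..<1}" for x :: "nat \<Rightarrow> complex"
    using that by (auto simp: y_def affine_space_def fun_eq_iff)
  define X where "X k = Poly_Mapping.single (0::nat) (k::nat)" for k
  have mX: "mono_eval (X k) (y t) = t ^ k" for k t
    by (cases "k = 0") (auto simp: X_def mono_eval_def y_def)
  define pe where "pe u = nat \<lfloor>u \<bullet> e\<rfloor>" for u
  define ne where "ne u = nat (- \<lfloor>u \<bullet> e\<rfloor>)" for u
  \<comment> \<open>This is the equation \<gamma>(u) = t^<u, e> with the negative power of t moved
    to the left. In the chart of a cone these equations, for all u of its semigroup, cut out the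
    curve.\<close>
  define f where "f u = Poly_Mapping.single (u, X (ne u)) 1 - Poly_Mapping.single (0, X (pe u)) (1::complex)" for u
  have fr: "f u \<in> prod_ring N \<sigma> 1" if "u \<in> S \<sigma>" for u \<sigma>
  proof -
    have "Poly_Mapping.keys (f u) \<subseteq> {(u, X (ne u)), (0, X (pe u))}"
      unfolding f_def by (auto simp: in_keys_iff lookup_minus lookup_single when_def split: if_splits)
    then show ?thesis using that semigroup_closed(1) by (auto simp: prod_ring_def X_def split: if_splits)
  qed
  have fe: "prod_eval (f u) \<gamma> (y t) = \<gamma> u * t ^ ne u - t ^ pe u" if "\<gamma> \<in> chart N \<sigma>" for u \<gamma> t \<sigma>
    unfolding f_def prod_eval_diff mX using chartD(2)[OF that] by simp
  have pn: "t powi \<lfloor>u \<bullet> e\<rfloor> * t ^ ne u = t ^ pe u" if "t \<noteq> 0" for t :: complex and u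
    using that by (auto simp: power_int_def pe_def ne_def simp flip: power_mult_distrib)
  have zS: "{0} \<inter> \<sigma> = {0}" if "\<sigma> \<in> \<Sigma>" for \<sigma> using zero_mem[OF that] by auto
  have "\<exists>U. openin ?T U \<and> x \<in> U \<and> U \<inter> C = {}" if x: "x \<in> topspace ?T" "x \<notin> C" for x
  proof -
    obtain \<sigma> \<gamma> t where s: "\<sigma> \<in> \<Sigma>" and g: "\<gamma> \<in> chart N \<sigma>" and xe: "x = (toric_pt N \<Sigma> \<sigma> \<gamma>, y t)"
      using x(1) affy unfolding top Op_def by blast
    have "\<exists>u\<in>S \<sigma>. prod_eval (f u) \<gamma> (y t) \<noteq> 0"
    proof (rule ccontr)
      assume "\<not> ?thesis"
      then have eq: "\<gamma> u * t ^ ne u = t ^ pe u" if "u \<in> S \<sigma>" for u using fe[OF g] that by auto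
      obtain u1 where u1: "u1 \<in> S \<sigma>" "u1 \<bullet> e < 0"
        using separate_from_cone[OF s span_base[OF e]] no s by blast
      \<comment> \<open>For a character negative on \<open>e\<close> the equation says that
        \<gamma>(u1) times a positive power of t is 1, which excludes t = 0. Existence of such a
        character is where the absence of a cone containing \<open>e\<close> is used.\<close>
      have "pe u1 = 0" "ne u1 \<noteq> 0" using u1(2) by (auto simp: pe_def ne_def) 
      then have t0: "t \<noteq> 0" using eq[OF u1(1)] by (auto simp: zero_power)
      have "\<gamma> u = t powi \<lfloor>u \<bullet> e\<rfloor>" if "u \<in> S \<sigma>" for u
        using eq[OF that] pn[OF t0, of u] t0 by (metis mult_right_cancel power_not_zero)
      then have "\<gamma> = restrict (crv t) (S \<sigma>)"
        using chartD(1)[OF g] semigroup_dual[of \<sigma>]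
        by (auto simp: crv_def restrict_def fun_eq_iff extensional_def subset_iff)
      moreover have "crv t = restrict (crv t) (S {0})" unfolding crv_def semigroup_zero by simp
      ultimately have "toric_pt N \<Sigma> \<sigma> \<gamma> = toric_pt N \<Sigma> {0} (crv t)"
        using toric_pt_restrict[OF s zero_in, of "crv t"] lam[OF t0] zS[OF s] by (simp add: Int_commute)
      then have "x \<in> C" unfolding C_def xe using t0 by blast
      then show False using x by blast
    qed
    then obtain u where u: "u \<in> S \<sigma>" "prod_eval (f u) \<gamma> (y t) \<noteq> 0" by blast
    have "Op \<sigma> (f u) \<inter> C = {}"
    proof (rule ccontr)
      assume "Op \<sigma> (f u) \<inter> C \<noteq> {}"
      then obtain \<gamma>' t' where *: "\<gamma>' \<in> chart N \<sigma>" "prod_eval (f u) \<gamma>' (y t') \<noteq> 0" "t' \<noteq> 0"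
        "toric_pt N \<Sigma> \<sigma> \<gamma>' = toric_pt N \<Sigma> {0} (crv t')" unfolding Op_def C_def by blast
      have "\<gamma>' = restrict (crv t') (S \<sigma>)" by (rule toric_pt_torus[OF s *(1) lam[OF *(3)] *(4)])
      then have "\<gamma>' u = t' powi \<lfloor>u \<bullet> e\<rfloor>" using u(1) semigroup_dual by (auto simp: crv_def)
      then show False using *(2) fe[OF *(1)] pn[OF *(3), of u] by simp
    qed
    moreover have "x \<in> Op \<sigma> (f u)" unfolding Op_def xe using g yaff u by blast
    ultimately show ?thesis using opn[OF s fr[OF u(1)]] by blast
  qed
  then have nb: "\<exists>U. openin ?T U \<and> x \<in> U \<and> U \<inter> C = {}" if "x \<in> topspace ?T - C" for x using that by blast
  have "openin ?T (topspace ?T - C)"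
  proof (subst openin_subopen, intro ballI)
    fix x assume "x \<in> topspace ?T - C"
    then obtain U where "openin ?T U" "x \<in> U" "U \<inter> C = {}" using nb by blast
    then show "\<exists>U. openin ?T U \<and> x \<in> U \<and> U \<subseteq> topspace ?T - C" using openin_subset by blast
  qed
  moreover have "C \<subseteq> topspace ?T"
  proof
    fix x assume "x \<in> C"
    then obtain t where t: "t \<noteq> 0" "x = (toric_pt N \<Sigma> {0} (crv t), y t)" unfolding C_def by blast
    define g where "g = Poly_Mapping.single ((0::'a), (0::nat \<Rightarrow>\<^sub>0 nat)) (1::complex)"
    have "g \<in> prod_ring N {0} 1" using semigroup_closed(1) by (auto simp: g_def prod_ring_def)
    moreover have "prod_eval g (crv t) (y t) \<noteq> 0"
      using chartD(2)[OF lam[OF t(1)]] by (simp add: g_def prod_eval_def)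
    then have "x \<in> Op {0} g" unfolding Op_def t(2) using lam[OF t(1)] yaff by blast
    ultimately show "x \<in> topspace ?T" unfolding top using zero_in by blast
  qed
  ultimately have "closedin ?T C" by (simp add: closedin_def)
  then have "closedin (zariski_affine {..<1::nat}) (snd ` C)"
    using comp unfolding complete_variety_def closed_map_def by blast
  then have op: "openin (zariski_affine {..<1::nat}) (topspace (zariski_affine {..<1::nat}) - snd ` C)"
    by (rule openin_diff[OF openin_topspace])
  have sndC: "snd ` C = y ` {t. t \<noteq> 0}" unfolding C_def by force
  have tops: "topspace (zariski_affine {..<1::nat}) = affine_space {..<1}"
  proof -
    have "affine_space {..<1::nat} = {x \<in> affine_space {..<1}. poly_eval 1 x \<noteq> 0}" by simp
    then have "affine_space {..<1::nat} \<in> {{x \<in> affine_space {..<1}. poly_eval p x \<noteq> 0} | p. p \<in> polys {..<1}}"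
      using subring_ofD(2)[OF polys_subring] by blast
    then show ?thesis unfolding zariski_affine_def topology_generated_by_topspace by auto
  qed
  have "y 0 \<in> affine_space {..<1::nat} - y ` {t. t \<noteq> 0}"
  proof -
    have "y 0 0 \<noteq> y t 0" if "t \<noteq> 0" for t using that by (simp add: y_def)
    then have "y 0 \<noteq> y t" if "t \<noteq> 0" for t using that by metis
    then show ?thesis using yaff by blast
  qed
  then obtain p where p: "p \<in> polys {..<1::nat}" "poly_eval p (y 0) \<noteq> 0"
    "{x \<in> affine_space {..<1}. poly_eval p x \<noteq> 0} \<subseteq> affine_space {..<1::nat} - y ` {t. t \<noteq> 0}"
    using zariski_affine_nbhd[OF op, of "y 0"] unfolding sndC tops by blast
  \<comment> \<open>The basic neighbourhood given by \<open>p\<close> avoids all points with nonzero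
    coordinate, so \<open>p\<close> vanishes there and hence identically, although it is nonzero at
    the origin.\<close>
  have "p * poly_var 0 = 0"
  proof (rule poly_eval_eq_0_imp[of "{..<1}"])
    show "p * poly_var 0 \<in> polys {..<1}"
      using p(1) subring_ofD(4)[OF polys_subring] poly_var_in_polys[of 0 "{..<1::nat}"] by auto
    fix x :: "nat \<Rightarrow> complex" assume x: "x \<in> affine_space {..<1}"
    show "poly_eval (p * poly_var 0) x = 0"
    proof (cases "x 0 = 0")
      case False
      then have "x \<in> y ` {t. t \<noteq> 0}" using affy[OF x] by blast
      then have "poly_eval p x = 0" using p(3) x by blast
      then show ?thesis by (simp add: poly_eval_mult)
    qed (simp add: poly_eval_mult)
  qed simp
  moreover have "poly_var (0::nat) \<noteq> 0" 
    using poly_eval_poly_var[of "0::nat" "\<lambda>_. 1"] poly_eval_zero[of "\<lambda>_. 1"] by (metis zero_neq_one)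
  ultimately have "p = 0" by simp
  then show False using p by simp
qed

text \<open>This is what later allows the constants of the map to be absorbed into the components of
  the lifting.\<close>

lemma span_rays:
  assumes "complete_variety N \<Sigma>" shows "span N = span rays"
proof
  show "span rays \<subseteq> span N" using rays_subset by (intro span_mono)
  have "N \<subseteq> span rays"
  proof
    fix e assume "e \<in> N"
    then obtain \<sigma> where s: "\<sigma> \<in> \<Sigma>" "e \<in> \<sigma>" using complete_support[OF assms] by blast
    then have "e \<in> cone_of (R \<sigma>)" using cone_eq by simp
    then show "e \<in> span rays" using cone_of_subset_span span_mono[of "R \<sigma>" rays] gens_eq[OF s(1)] by blast
  qed
  then show "span N \<subseteq> span rays" by (metis span_mono span_span)
qed

end

section \<open>Nonsingular orbits\<close>

text \<open>The scaling is the one in \<open>complex_dim\<close>, so that \<open>cfun.dim\<close> is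
  the tangent space dimension of the definition.\<close>

interpretation cfun: vector_space "\<lambda>(c::complex) D (u::'a). c * D u"
  by unfold_locales (auto simp: fun_eq_iff algebra_simps)

lemma sum_fun_apply: "(\<Sum>i\<in>I. f i) x = (\<Sum>i\<in>I. f i x :: 'b::comm_monoid_add)"
  by (induction I rule: infinite_finite_induct) auto

text \<open>Evaluation at the points \<open>pt j\<close> has a diagonal matrix, so the vectors
  \<open>D i\<close> are independent. Positivity of the dimension ensures a finite basis, since
  \<open>dim\<close> is 0 on spaces without one.\<close>

lemma diagonal_card_le_dim:
  fixes D :: "'i \<Rightarrow> 'a \<Rightarrow> complex"
  assumes I: "finite I" and D: "\<And>i. i \<in> I \<Longrightarrow> D i \<in> T"
    and diag: "\<And>i j. i \<in> I \<Longrightarrow> j \<in> I \<Longrightarrow> D i (pt j) \<noteq> 0 \<longleftrightarrow> i = j"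
    and dim: "complex_dim T > 0"
  shows "card I \<le> complex_dim T"
proof -
  have inj: "inj_on D I" by (rule inj_onI) (use diag in metis)
  have "cfun.independent (D ` I)"
    unfolding cfun.dependent_finite[OF finite_imageI[OF I]]
  proof (intro notI, elim exE conjE bexE)
    fix c F assume c: "(\<Sum>v\<in>D ` I. (\<lambda>u. c v * v u)) = 0" "F \<in> D ` I" "c F \<noteq> 0"
    then obtain j where j: "j \<in> I" "F = D j" by blast
    have "0 = (\<Sum>v\<in>D ` I. (\<lambda>u. c v * v u)) (pt j)" using c(1) by simp
    also have "\<dots> = (\<Sum>i\<in>I. c (D i) * D i (pt j))"
      unfolding sum_fun_apply by (simp add: sum.reindex[OF inj])
    also have "\<dots> = (\<Sum>i\<in>I. if i = j then c (D j) * D j (pt j) else 0)"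
      by (rule sum.cong) (use diag j in auto)
    also have "\<dots> = c (D j) * D j (pt j)" using I j by simp
    finally show False using diag[of j j] j c by auto
  qed
  moreover obtain B where B: "B \<subseteq> T" "cfun.independent B" "T \<subseteq> cfun.span B" "card B = cfun.dim T"
    using cfun.basis_exists by blast
  moreover from this have "finite B" using dim unfolding complex_dim_def by (metis card_gt_0_iff)
  ultimately have "card (D ` I) \<le> card B"
    using cfun.independent_span_bound[of B "D ` I"] D by blast
  then show ?thesis using B(4) card_image[OF inj] unfolding complex_dim_def by simp
qed

context toric_fan
begin

section \<open>The tangent space at a nonsingular point of the orbit of a cone\<close>

context
  fixes \<tau> \<gamma>
  assumes t: "\<tau> \<in> \<Sigma>" and g: "\<gamma> \<in> chart N \<tau>"
    and orbit: "\<And>u. u \<in> S \<tau> \<Longrightarrow> \<gamma> u \<noteq> 0 \<longleftrightarrow> (\<forall>v\<in>R \<tau>. u \<bullet> v = 0)"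
    and dim: "complex_dim (tangent_space N \<tau> \<gamma>) = dim N"
begin

text \<open>These are the invertible elements of the semigroup \<open>S \<tau>\<close>.\<close>

definition units :: "'a set" where
  "units = {u \<in> M. \<forall>v\<in>R \<tau>. u \<bullet> v = 0}"

definition irred :: "'a \<Rightarrow> bool" where
  "irred u \<longleftrightarrow> u \<in> S \<tau> \<and> u \<notin> units \<and> (\<forall>a\<in>S \<tau>. \<forall>b\<in>S \<tau>. u = a + b \<longrightarrow> a \<in> units \<or> b \<in> units)"

lemma units_S: "units \<subseteq> S \<tau>"
  using semigroup_iff[OF t] by (auto simp: units_def)

lemma units_closed: "u \<in> units \<Longrightarrow> u' \<in> units \<Longrightarrow> u + u' \<in> units" "u \<in> units \<Longrightarrow> - u \<in> units"
  "u \<in> units \<Longrightarrow> u' \<in> units \<Longrightarrow> u - u' \<in> units" "0 \<in> units"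
  using dual_closed[OF lat] by (auto simp: units_def inner_add_left inner_diff_left)

lemma units_add_iff:
  assumes "u \<in> S \<tau>" "u' \<in> S \<tau>" shows "u + u' \<in> units \<longleftrightarrow> u \<in> units \<and> u' \<in> units"
proof
  assume "u + u' \<in> units"
  then have "\<forall>v\<in>R \<tau>. u \<bullet> v + u' \<bullet> v = 0" by (auto simp: units_def inner_add_left)
  moreover have "\<forall>v\<in>R \<tau>. 0 \<le> u \<bullet> v \<and> 0 \<le> u' \<bullet> v" using assms semigroup_iff[OF t] by blast
  ultimately have "\<forall>v\<in>R \<tau>. u \<bullet> v = 0 \<and> u' \<bullet> v = 0" by (metis add_nonneg_eq_0_iff)
  then show "u \<in> units \<and> u' \<in> units" using assms semigroup_dual by (auto simp: units_def)
qed (auto simp: units_closed)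

lemma units_iff: "u \<in> S \<tau> \<Longrightarrow> u \<in> units \<longleftrightarrow> \<gamma> u \<noteq> 0"
  using orbit semigroup_dual by (auto simp: units_def)

text \<open>This is differentiation along the orbit in the direction \<open>y\<close>. On nonunits
  \<gamma> vanishes, and a sum is a unit only if both summands are, so the Leibniz rule holds there
  too.\<close>

lemma unit_derivation:
  "(\<lambda>u. if u \<in> units then \<gamma> u * of_real (u \<bullet> y) else 0) \<in> tangent_space N \<tau> \<gamma>"
  unfolding tangent_space_def
  using units_S units_iff units_add_iff chartD(3)[OF g]
  by (auto simp: inner_add_left algebra_simps)

text \<open>This tangent vector is dual to the class of \<open>r\<close> in the quotient of the
  maximal ideal by its square: a sum of two nonunits never differs from the indecomposable
  \<open>r\<close> by a unit, and adding a unit only multiplies by its value under \<gamma>.\<close>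

lemma irred_derivation:
  assumes r: "irred r"
  shows "(\<lambda>u. if u - r \<in> units then \<gamma> (u - r) else 0) \<in> tangent_space N \<tau> \<gamma>" (is "?D \<in> _")
  unfolding tangent_space_def
proof (intro CollectI conjI allI impI ballI)
  have rS: "r \<in> S \<tau>" "r \<notin> units" using r by (auto simp: irred_def)
  fix u assume "u \<notin> S \<tau>"
  then have "u - r \<notin> units" using semigroup_closed(2)[OF rS(1), of "u - r"] units_S by auto
  then show "?D u = 0" by simp
next
  have rS: "r \<in> S \<tau>" "r \<notin> units" using r by (auto simp: irred_def)
  fix u u' assume u: "u \<in> S \<tau>" "u' \<in> S \<tau>"
  have key: "?D (a + b) = \<gamma> a * ?D b + \<gamma> b * ?D a" if ab: "a \<in> S \<tau>" "b \<in> S \<tau>" "a \<in> units" for a b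
  proof -
    have e: "a + b - r \<in> units \<longleftrightarrow> b - r \<in> units"
      using units_closed(1)[OF ab(3), of "b - r"] units_closed(3)[of "a + b - r" a] ab(3)
      by (auto simp: algebra_simps)
    have z: "\<gamma> b * ?D a = 0"
    proof (cases "a - r \<in> units")
      case True
      then have "r \<in> units" using units_closed(3)[OF ab(3) True] by simp
      then show ?thesis using rS by blast
    qed simp
    have "\<gamma> (a + b - r) = \<gamma> a * \<gamma> (b - r)" if "b - r \<in> units"
      using chartD(3)[OF g ab(1), of "b - r"] that units_S by (auto simp: algebra_simps)
    then show ?thesis using z e by auto
  qed
  consider "u \<in> units" | "u' \<in> units" | "u \<notin> units" "u' \<notin> units" by blast
  then show "?D (u + u') = \<gamma> u * ?D u' + \<gamma> u' * ?D u"
  proof cases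
    case 1
    then show ?thesis using key u by blast
  next
    case 2
    show ?thesis using key[OF u(2,1) 2] by (simp only: add.commute)
  next
    case 3
    have "u + u' - r \<notin> units"
    proof
      assume l: "u + u' - r \<in> units"
      define l where "l = u + u' - r"
      have lu: "l \<in> units" using l by (simp add: l_def)
      then have lu': "- l \<in> units" by (rule units_closed(2))
      have "u + (- l) \<in> S \<tau>" using semigroup_closed(2)[OF u(1)] lu' units_S by blast
      moreover have "r = (u + (- l)) + u'" by (simp add: l_def)
      ultimately have "u + (- l) \<in> units \<or> u' \<in> units" using r u unfolding irred_def by blast
      then have "u \<in> units" using 3 units_closed(1)[OF _ lu, of "u + (- l)"] by auto
      then show False using 3 by blast
    qed
    moreover have "\<gamma> u = 0" "\<gamma> u' = 0" using 3 units_iff u by auto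
    ultimately show ?thesis by simp
  qed
qed

text \<open>A basis of the directions along the orbit has \<open>card (A - R \<tau>)\<close>
  elements, and each class of irreducible elements modulo units adds one independent tangent vector.
  The total is bounded by the rank \<open>card A\<close>, so the classes of the \<open>r v\<close>
  are the only ones.\<close>

lemma few_irreducibles:
  assumes r: "\<And>v. v \<in> R \<tau> \<Longrightarrow> irred (r v)"
    "\<And>v v'. v \<in> R \<tau> \<Longrightarrow> v' \<in> R \<tau> \<Longrightarrow> v \<noteq> v' \<Longrightarrow> r v \<bullet> v' = 0"
    and u0: "irred u0"
  shows "\<exists>v\<in>R \<tau>. u0 - r v \<in> units"
proof (rule ccontr)
  assume no: "\<not> ?thesis"
  obtain A w where A: "R \<tau> \<subseteq> A" "A \<subseteq> N" "independent A" "span A = span N"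
    "\<And>a. a \<in> A \<Longrightarrow> w a \<in> M" "\<And>a. a \<in> A \<Longrightarrow> w a \<bullet> a > 0"
    "\<And>a a'. a \<in> A \<Longrightarrow> a' \<in> A \<Longrightarrow> a \<noteq> a' \<Longrightarrow> w a \<bullet> a' = 0"
    using adapted_basis[OF t] by metis
  have finA: "finite A" using A(3) by (rule finiteI_independent)
  have dimN: "dim N = card A" using A(3,4) by (metis dim_eq_card_independent dim_span)
  have rn: "r v \<bullet> v \<noteq> 0" if "v \<in> R \<tau>" for v
    using r[OF that] r(2)[OF that] semigroup_dual unfolding irred_def units_def by blast
  have rr: "v = v'" if "v \<in> R \<tau>" "v' \<in> R \<tau>" "r v - r v' \<in> units" for v v'
  proof (rule ccontr)
    assume "v \<noteq> v'"
    then have "(r v - r v') \<bullet> v \<noteq> 0" using rn r(2)[of v' v] that by (simp add: inner_diff_left)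
    then show False using that by (auto simp: units_def)
  qed
  have injr: "inj_on r (R \<tau>)" by (rule inj_onI) (use rr units_closed(4) in auto)
  define Q where "Q = insert u0 (r ` R \<tau>)"
  have finQ: "finite Q" using finite_gens[OF t] by (simp add: Q_def)
  have QI: "irred q" if "q \<in> Q" for q using that r u0 by (auto simp: Q_def)
  have Qd: "q = q'" if "q \<in> Q" "q' \<in> Q" "q - q' \<in> units" for q q'
  proof -
    have "q' - q \<in> units" using units_closed(2)[OF that(3)] by simp
    then show ?thesis using that no rr by (auto simp: Q_def)
  qed
  have "u0 \<notin> r ` R \<tau>" using no units_closed(4) by auto
  then have cQ: "card Q = Suc (card (R \<tau>))" using finite_gens[OF t] injr by (simp add: Q_def card_image)
  \<comment> \<open>The left summand indexes derivations along the orbit, the right one those dual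
    to irreducible classes. With the hypothetical extra class there is one more than the
    rank.\<close>
  define I where "I = Inl ` (A - R \<tau>) \<union> Inr ` Q"
  have finI: "finite I" using finA finQ by (simp add: I_def)
  have "card I = card (A - R \<tau>) + card Q" unfolding I_def
    using finA finQ by (subst card_Un_disjoint) (auto simp: card_image)
  also have "\<dots> = Suc (card A)" using cQ finA A(1) by (simp add: card_Diff_subset finite_subset card_mono)
  finally have cI: "card I = Suc (dim N)" using dimN by simp
  \<comment> \<open>\<open>diagonal_card_le_dim\<close> asks for positive dimension; in rank 0 every
    element is a unit and \<open>u0\<close> could not be irreducible.\<close>
  have "dim N > 0"
  proof (rule ccontr)
    assume "\<not> ?thesis"
    then have "A = {}" using dimN finA by simp
    then have "units = M" using A(1) by (auto simp: units_def)
    then show False using u0 semigroup_dual unfolding irred_def by blast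
  qed
  define D where "D i = (case i of Inl y \<Rightarrow> (\<lambda>u. if u \<in> units then \<gamma> u * of_real (u \<bullet> y) else 0)
    | Inr q \<Rightarrow> (\<lambda>u. if u - q \<in> units then \<gamma> (u - q) else 0))" for i
  define pt where "pt i = (case i of Inl y \<Rightarrow> w y | Inr q \<Rightarrow> q)" for i
  have wy: "w y \<in> units" if "y \<in> A - R \<tau>" for y
    using that A(1,5,7) by (auto simp: units_def)
  have gw: "\<gamma> u \<noteq> 0" if "u \<in> units" for u using that units_iff units_S by blast
  have nq: "u - q \<notin> units" "q \<notin> units" if "q \<in> Q" "u \<in> units" for u q
    using QI[OF that(1)] units_closed(3)[OF that(2), of "u - q"] by (auto simp: irred_def)
  have "card I \<le> complex_dim (tangent_space N \<tau> \<gamma>)"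
  proof (rule diagonal_card_le_dim[OF finI, of D _ pt])
    show "D i \<in> tangent_space N \<tau> \<gamma>" if "i \<in> I" for i
      using that unit_derivation irred_derivation QI by (auto simp: I_def D_def)
    fix i j assume "i \<in> I" "j \<in> I"
    then consider (1) y y' where "i = Inl y" "j = Inl y'" "y \<in> A - R \<tau>" "y' \<in> A - R \<tau>"
      | (2) y q where "i = Inl y" "j = Inr q" "y \<in> A - R \<tau>" "q \<in> Q"
      | (3) q y where "i = Inr q" "j = Inl y" "y \<in> A - R \<tau>" "q \<in> Q"
      | (4) q q' where "i = Inr q" "j = Inr q'" "q \<in> Q" "q' \<in> Q" unfolding I_def by blast
    then show "D i (pt j) \<noteq> 0 \<longleftrightarrow> i = j"
    proof cases
      case 1
      have "w y' \<bullet> y \<noteq> 0 \<longleftrightarrow> y = y'" using A(6)[of y] A(7)[of y' y] 1 by fastforce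
      then show ?thesis using 1 wy gw by (auto simp: D_def pt_def)
    next
      case 2
      then show ?thesis using nq(2)[OF 2(4) units_closed(4)] by (simp add: D_def pt_def)
    next
      case 3
      then show ?thesis using nq(1)[OF 3(4) wy[OF 3(3)]] by (simp add: D_def pt_def)
    next
      case 4
      have "q' - q \<in> units \<longleftrightarrow> q = q'" using Qd[of q' q] 4 units_closed(4) by auto
      then show ?thesis using 4 chartD(2)[OF g] by (auto simp: D_def pt_def)
    qed
  qed (use dim \<open>dim N > 0\<close> in simp)
  then show False using cI dim by simp
qed

text \<open>Choose for each generator an irreducible element \<open>r v\<close> dual to it up to
  scale. By the count above these generate \<open>S \<tau>\<close> modulo units, so all pairings of
  \<open>M\<close> with \<open>v\<close> are multiples of \<open>r v \<bullet> v\<close>. As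
  \<open>v\<close> is primitive this number is 1, and \<open>c v\<close> is the integral pairing of
  \<open>e\<close> with \<open>r v\<close>.\<close>

lemma nonsingular_coefficients:
  assumes e: "e \<in> N" "e = (\<Sum>v\<in>R \<tau>. c v *\<^sub>R v)" and v: "v \<in> R \<tau>"
  shows "c v \<in> \<int>"
proof -
  have fin: "finite (R \<tau>)" using finite_gens[OF t] .
  have RN: "R \<tau> \<subseteq> N" by (rule cone_gens_subset)
  have Z: "u \<bullet> v \<in> \<int>" if "u \<in> S \<tau>" "v \<in> R \<tau>" for u v
    using dual_Ints[OF lat] that semigroup_dual RN by blast
  have P: "0 \<le> u \<bullet> v" if "u \<in> S \<tau>" "v \<in> R \<tau>" for u v using that semigroup_iff[OF t] by blast
  \<comment> \<open>These elements see only the generator \<open>v\<close>. One with the least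
    positive value at \<open>v\<close> is irreducible, since a nontrivial decomposition would give a
    smaller value.\<close>
  define K where "K v = {u \<in> S \<tau>. (\<forall>v'\<in>R \<tau> - {v}. u \<bullet> v' = 0) \<and> u \<bullet> v > 0}" for v
  have "\<exists>r. r \<in> K v \<and> (\<forall>u\<in>K v. r \<bullet> v \<le> u \<bullet> v)" if v: "v \<in> R \<tau>" for v
  proof -
    obtain A w where A: "R \<tau> \<subseteq> A" "\<And>a. a \<in> A \<Longrightarrow> w a \<in> M" "\<And>a. a \<in> A \<Longrightarrow> w a \<bullet> a > 0"
      "\<And>a a'. a \<in> A \<Longrightarrow> a' \<in> A \<Longrightarrow> a \<noteq> a' \<Longrightarrow> w a \<bullet> a' = 0"
      using adapted_basis[OF t] by metis
    have wv: "w v \<bullet> v > 0" "w v \<in> M" "\<And>v'. v' \<in> R \<tau> \<Longrightarrow> v' \<noteq> v \<Longrightarrow> w v \<bullet> v' = 0"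
      using A v by (blast, blast, metis subsetD)
    then have "0 \<le> w v \<bullet> v'" if "v' \<in> R \<tau>" for v' using that by (cases "v' = v") auto
    then have "w v \<in> K v" unfolding K_def using semigroup_iff[OF t] wv by auto
    then obtain r where r: "r \<in> K v" "\<And>u. u \<in> K v \<Longrightarrow> nat \<lfloor>r \<bullet> v\<rfloor> \<le> nat \<lfloor>u \<bullet> v\<rfloor>"
      using ex_has_least_nat[of "\<lambda>u. u \<in> K v" "w v" "\<lambda>u. nat \<lfloor>u \<bullet> v\<rfloor>"] by blast
    have "r \<bullet> v \<le> u \<bullet> v" if u: "u \<in> K v" for u
    proof -
      have "r \<bullet> v = of_int \<lfloor>r \<bullet> v\<rfloor>" "u \<bullet> v = of_int \<lfloor>u \<bullet> v\<rfloor>"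
        using Ints_floor Z v r(1) u by (simp_all add: K_def)
      moreover have "\<lfloor>r \<bullet> v\<rfloor> \<le> \<lfloor>u \<bullet> v\<rfloor>" using r(2)[OF u] u by (auto simp: K_def nat_le_eq_zle)
      ultimately show ?thesis by linarith
    qed
    then show ?thesis using r(1) by blast
  qed
  then obtain r where r: "\<And>v. v \<in> R \<tau> \<Longrightarrow> r v \<in> K v" "\<And>v u. v \<in> R \<tau> \<Longrightarrow> u \<in> K v \<Longrightarrow> r v \<bullet> v \<le> u \<bullet> v"
    by metis
  have rK: "r v \<in> S \<tau>" "\<And>v'. v' \<in> R \<tau> \<Longrightarrow> v \<noteq> v' \<Longrightarrow> r v \<bullet> v' = 0" "r v \<bullet> v > 0" if "v \<in> R \<tau>" for v
    using r(1)[OF that] by (auto simp: K_def)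
  have rirr: "irred (r v)" if v: "v \<in> R \<tau>" for v
    unfolding irred_def
  proof (intro conjI ballI impI)
    show "r v \<in> S \<tau>" using rK[OF v] by blast
    show "r v \<notin> units" using rK(3)[OF v] v unfolding units_def by force
    fix a b assume ab: "a \<in> S \<tau>" "b \<in> S \<tau>" "r v = a + b"
    show "a \<in> units \<or> b \<in> units"
    proof (rule ccontr)
      assume n: "\<not> ?thesis"
      have z: "a \<bullet> v' = 0 \<and> b \<bullet> v' = 0" if "v' \<in> R \<tau>" "v' \<noteq> v" for v'
        using rK(2)[OF v that(1)] that P[OF ab(1) that(1)] P[OF ab(2) that(1)] ab(3)
        by (auto simp: inner_add_left)
      have "a \<bullet> v \<noteq> 0" "b \<bullet> v \<noteq> 0" using n z ab semigroup_dual unfolding units_def by blast+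
      then have p: "a \<bullet> v > 0" "b \<bullet> v > 0" using P[OF ab(1) v] P[OF ab(2) v] by auto
      then have "a \<in> K v" using z ab by (auto simp: K_def)
      then have "r v \<bullet> v \<le> a \<bullet> v" using r(2) v by blast
      then show False using p ab by (simp add: inner_add_left)
    qed
  qed
  \<comment> \<open>The induction is on the sum of the pairings with all generators, a natural
    number that a nonunit summand makes strictly larger. Irreducible elements are covered by
    \<open>few_irreducibles\<close>.\<close>
  have gen: "\<exists>n::'a \<Rightarrow> nat. u - (\<Sum>v\<in>R \<tau>. of_nat (n v) *\<^sub>R r v) \<in> units" if "u \<in> S \<tau>" for u
    using that
  proof (induction "nat \<lfloor>\<Sum>v\<in>R \<tau>. u \<bullet> v\<rfloor>" arbitrary: u rule: less_induct)
    case less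
    consider "u \<in> units" | "irred u" | a b where "u = a + b" "a \<in> S \<tau>" "b \<in> S \<tau>" "a \<notin> units" "b \<notin> units"
      using less.prems unfolding irred_def by blast
    then show ?case
    proof cases
      case 1
      then show ?thesis by (intro exI[of _ "\<lambda>_. 0"]) auto
    next
      case 2
      obtain v where v: "v \<in> R \<tau>" "u - r v \<in> units"
        using few_irreducibles[of r u] rirr rK(2) 2 by blast
      have "(\<Sum>v'\<in>R \<tau>. of_nat (if v' = v then 1 else 0) *\<^sub>R r v') = (\<Sum>v'\<in>R \<tau>. if v' = v then r v' else 0)"
        by (intro sum.cong) auto
      also have "\<dots> = r v" using fin v by simp
      finally show ?thesis using v by (intro exI[of _ "\<lambda>v'. if v' = v then 1 else 0"]) simp
    next
      case 3
      have ge: "nat \<lfloor>\<Sum>v\<in>R \<tau>. x \<bullet> v\<rfloor> < nat \<lfloor>\<Sum>v\<in>R \<tau>. (x + y) \<bullet> v\<rfloor>"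
        if xy: "x \<in> S \<tau>" "y \<in> S \<tau>" "y \<notin> units" for x y
      proof -
        have "\<exists>v\<in>R \<tau>. y \<bullet> v \<noteq> 0" using xy semigroup_dual by (auto simp: units_def)
        then have "(\<Sum>v\<in>R \<tau>. y \<bullet> v) > 0"
          using P[OF xy(2)] fin by (metis (no_types, lifting) order_le_less sum_nonneg sum_nonneg_eq_0_iff)
        moreover have "(\<Sum>v\<in>R \<tau>. x \<bullet> v) \<ge> 0" using P[OF xy(1)] by (intro sum_nonneg)
        moreover have "(\<Sum>v\<in>R \<tau>. y \<bullet> v) \<in> \<int>" "(\<Sum>v\<in>R \<tau>. x \<bullet> v) \<in> \<int>"
          using Z xy by (auto intro: Ints_sum)
        ultimately show ?thesis by (auto simp: inner_add_left sum.distrib elim!: Ints_cases)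
      qed
      obtain n :: "'a \<Rightarrow> nat" where n: "a - (\<Sum>v\<in>R \<tau>. of_nat (n v) *\<^sub>R r v) \<in> units"
        using less.hyps[of a] ge[OF 3(2,3,5)] 3 by blast
      obtain n' :: "'a \<Rightarrow> nat" where n': "b - (\<Sum>v\<in>R \<tau>. of_nat (n' v) *\<^sub>R r v) \<in> units"
        using less.hyps[of b] ge[OF 3(3,2,4)] 3 by (metis add.commute)
      have "u - (\<Sum>v\<in>R \<tau>. of_nat (n v + n' v) *\<^sub>R r v) =
        (a - (\<Sum>v\<in>R \<tau>. of_nat (n v) *\<^sub>R r v)) + (b - (\<Sum>v\<in>R \<tau>. of_nat (n' v) *\<^sub>R r v))"
        by (simp add: 3 scaleR_add_left sum.distrib)
      then show ?thesis using units_closed(1)[OF n n'] by (intro exI[of _ "\<lambda>v. n v + n' v"]) simp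
    qed
  qed
  define d where "d = r v \<bullet> v"
  have d: "d > 0" "d \<in> \<int>" using rK[OF v] Z v by (auto simp: d_def)
  have Sd: "\<exists>n::nat. u \<bullet> v = of_nat n * d" if u: "u \<in> S \<tau>" for u
  proof -
    obtain n :: "'a \<Rightarrow> nat" where "u - (\<Sum>v\<in>R \<tau>. of_nat (n v) *\<^sub>R r v) \<in> units" using gen[OF u] by blast
    then have "u \<bullet> v = (\<Sum>v'\<in>R \<tau>. of_nat (n v') *\<^sub>R r v') \<bullet> v" using v by (simp add: units_def inner_diff_left)
    also have "\<dots> = (\<Sum>v'\<in>R \<tau>. if v' = v then of_nat (n v) * d else 0)"
      unfolding inner_sum_left d_def using rK(2)[OF _ v] by (intro sum.cong) auto
    also have "\<dots> = of_nat (n v) * d" using fin v by simp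
    finally show ?thesis by blast
  qed
  \<comment> \<open>Divisibility by \<open>d\<close> is known on \<open>S \<tau>\<close>. An element
    \<open>m\<close> that vanishes on the cone only at 0 moves any \<open>u\<close> of
    \<open>M\<close> into \<open>S \<tau>\<close> after adding enough copies, so it holds on all of
    \<open>M\<close>.\<close>
  have Md: "u \<bullet> ((1 / d) *\<^sub>R v) \<in> \<int>" if u: "u \<in> M" for u
  proof -
    obtain m where m: "m \<in> S \<tau>" "\<And>v. v \<in> \<tau> \<Longrightarrow> m \<bullet> v = 0 \<longleftrightarrow> v \<in> cone_of {}"
      using face_functional[OF t empty_subsetI] by metis
    have uz: "u \<in> S {0}" using u semigroup_zero by simp
    obtain k where k: "u + of_nat k *\<^sub>R m \<in> S \<tau>"
      by (rule localization[OF t uz m(1)]) (use m(2) in \<open>auto simp: cone_of_def\<close>)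
    obtain n1 n2 :: nat where n: "(u + of_nat k *\<^sub>R m) \<bullet> v = of_nat n1 * d" "m \<bullet> v = of_nat n2 * d"
      using Sd[OF k] Sd[OF m(1)] by blast
    have "u \<bullet> v = of_nat n1 * d - of_nat k * (of_nat n2 * d)" using n by (simp add: inner_add_left)
    then have "u \<bullet> ((1 / d) *\<^sub>R v) = of_nat n1 - of_nat k * of_nat n2" using d by (simp add: field_simps)
    then show ?thesis by simp
  qed
  have pv: "primitive N v" using v by (simp add: cone_gens_def)
  then have vN: "v \<in> N" by (simp add: primitive_def)
  \<comment> \<open>Pairing integrally with all of \<open>M\<close> places this vector in the
    lattice, and primitivity of \<open>v\<close> then forces \<open>d = 1\<close>.\<close>
  have "(1 / d) *\<^sub>R v \<in> N" 
    by (rule in_latticeI[OF lat span_mul[OF span_base[OF vN]] Md])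
  moreover obtain j :: int where j: "d = of_int j" using d by (auto elim: Ints_cases)
  moreover have "v = of_int j *\<^sub>R ((1 / d) *\<^sub>R v)" using d j by simp
  ultimately have "\<bar>j\<bar> = 1" using pv unfolding primitive_def by blast
  then have d1: "d = 1" using d j by auto
  have "r v \<bullet> e = (\<Sum>v'\<in>R \<tau>. if v' = v then c v * d else 0)"
    unfolding e(2) inner_sum_right d_def using rK(2)[OF v] by (intro sum.cong) auto
  also have "\<dots> = c v" using fin v d1 by simp
  finally have "c v = r v \<bullet> e" by simp
  then show ?thesis using dual_Ints[OF lat _ e(1)] rK(1)[OF v] semigroup_dual by force
qed

end

end

section \<open>Characters as regular functions\<close>

text \<open>The product of \<open>q\<close>, \<open>w\<close> and a coordinate vanishes everywhere,
  the coordinate taking care of the origin, and the other two factors are nonzero.\<close>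

lemma vanishing_on_open:
  assumes q: "q \<in> polys {..n::nat}" and w: "w \<in> polys {..n}" "w \<noteq> 0"
    and z: "\<And>x. x \<in> punctured_space n \<Longrightarrow> poly_eval w x \<noteq> 0 \<Longrightarrow> poly_eval q x = 0"
  shows "q = 0"
proof -
  have "q * w * poly_var 0 = 0"
  proof (rule poly_eval_eq_0_imp[of "{..n}"])
    show "q * w * poly_var 0 \<in> polys {..n}"
      using q w poly_var_in_polys[of 0 "{..n}"] by (intro subring_ofD(4)[OF polys_subring]) auto
    fix x :: "nat \<Rightarrow> complex" assume x: "x \<in> affine_space {..n}"
    show "poly_eval (q * w * poly_var 0) x = 0"
    proof (cases "x \<in> punctured_space n")
      case True
      then show ?thesis using z[OF True] by (auto simp: poly_eval_mult)
    next
      case False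
      then have "x = (\<lambda>_. 0)" using x by (auto simp: punctured_space_def)
      then show ?thesis by (simp add: poly_eval_mult)
    qed
  qed simp
  moreover have "poly_var (0::nat) \<noteq> 0"
    using poly_eval_poly_var[of "0::nat" "\<lambda>_. 1"] poly_eval_zero[of "\<lambda>_. 1"] by (metis zero_neq_one)
  ultimately show ?thesis using w(2) by simp
qed

context toric_fan
begin

lemma one_in_chart_ring: "1 \<in> chart_ring N \<sigma>"
  "\<gamma> \<in> chart N \<sigma> \<Longrightarrow> chart_eval 1 \<gamma> = 1"
  using semigroup_closed(1) chartD(2) by (auto simp: chart_ring_def chart_eval_def)

text \<open>This is the character of \<open>u\<close> as a function on the variety; it is meaningful
  on the image of the chart of \<open>\<sigma>\<close>, where the representative is unique.\<close>

definition character_value :: "'a set \<Rightarrow> 'a \<Rightarrow> 'a toric_pt \<Rightarrow> complex" where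
  "character_value \<sigma> u z = (THE \<gamma>. \<gamma> \<in> chart N \<sigma> \<and> toric_pt N \<Sigma> \<sigma> \<gamma> = z) u"

lemma character_value_eq:
  assumes "\<sigma> \<in> \<Sigma>" "\<gamma> \<in> chart N \<sigma>"
  shows "character_value \<sigma> u (toric_pt N \<Sigma> \<sigma> \<gamma>) = \<gamma> u"
proof -
  have "(THE \<beta>. \<beta> \<in> chart N \<sigma> \<and> toric_pt N \<Sigma> \<sigma> \<beta> = toric_pt N \<Sigma> \<sigma> \<gamma>) = \<gamma>"
    using toric_pt_inj[OF assms(1)] assms(2) by (intro the_equality) auto
  then show ?thesis by (simp add: character_value_def)
qed

lemma chart_open:
  assumes "\<sigma> \<in> \<Sigma>" shows "openin (zariski_toric N \<Sigma>) (toric_pt N \<Sigma> \<sigma> ` chart N \<sigma>)"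
proof -
  have "{\<gamma> \<in> chart N \<sigma>. chart_eval 1 \<gamma> \<noteq> 0} = chart N \<sigma>"
    using one_in_chart_ring(2) by auto
  then show ?thesis unfolding zariski_toric_def
    by (intro topology_generated_by_Basis CollectI exI[of _ \<sigma>] exI[of _ "1"])
      (use assms one_in_chart_ring(1) in auto)
qed

lemma topspace_zariski_toric: "topspace (zariski_toric N \<Sigma>) = (\<Union>\<sigma>\<in>\<Sigma>. toric_pt N \<Sigma> \<sigma> ` chart N \<sigma>)"
proof
  show "topspace (zariski_toric N \<Sigma>) \<subseteq> (\<Union>\<sigma>\<in>\<Sigma>. toric_pt N \<Sigma> \<sigma> ` chart N \<sigma>)"
    unfolding zariski_toric_def topology_generated_by_topspace by blast
  show "(\<Union>\<sigma>\<in>\<Sigma>. toric_pt N \<Sigma> \<sigma> ` chart N \<sigma>) \<subseteq> topspace (zariski_toric N \<Sigma>)"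
    using openin_subset[OF chart_open] by blast
qed

lemma character_value_regular:
  assumes s: "\<sigma> \<in> \<Sigma>" and u: "u \<in> S \<sigma>"
  shows "regular_fun_toric N \<Sigma> (toric_pt N \<Sigma> \<sigma> ` chart N \<sigma>) (character_value \<sigma> u)"
  unfolding regular_fun_toric_def
proof (intro conjI ballI chart_open[OF s])
  fix z assume z: "z \<in> toric_pt N \<Sigma> \<sigma> ` chart N \<sigma>"
  have a: "Poly_Mapping.single u 1 \<in> chart_ring N \<sigma>" using u by (auto simp: chart_ring_def)
  have ev: "chart_eval (Poly_Mapping.single u 1) \<gamma> = \<gamma> u" for \<gamma> by (simp add: chart_eval_def)
  show "\<exists>W. \<exists>\<tau>\<in>\<Sigma>. \<exists>a\<in>chart_ring N \<tau>. \<exists>b\<in>chart_ring N \<tau>.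
        openin (zariski_toric N \<Sigma>) W \<and> z \<in> W \<and> W \<subseteq> toric_pt N \<Sigma> \<sigma> ` chart N \<sigma> \<and> W \<subseteq> toric_pt N \<Sigma> \<tau> ` chart N \<tau> \<and>
        (\<forall>\<gamma>\<in>chart N \<tau>. toric_pt N \<Sigma> \<tau> \<gamma> \<in> W \<longrightarrow> chart_eval b \<gamma> \<noteq> 0 \<and>
           character_value \<sigma> u (toric_pt N \<Sigma> \<tau> \<gamma>) = chart_eval a \<gamma> / chart_eval b \<gamma>)"
    by (rule exI[of _ "toric_pt N \<Sigma> \<sigma> ` chart N \<sigma>"], rule bexI[of _ \<sigma>],
        rule bexI[of _ "Poly_Mapping.single u 1"], rule bexI[of _ "1"],
        intro conjI ballI impI z chart_open[OF s] order_refl)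
      (simp_all add: one_in_chart_ring ev character_value_eq[OF s] a s)
qed

text \<open>Regularity of the pullback is applied to one character at a time; shrinking the
  neighbourhood to a principal open set makes every condition a statement about values of
  polynomials.\<close>

lemma morphism_character:
  assumes mor: "morphism n N \<Sigma> U f" and s: "\<sigma> \<in> \<Sigma>" and u: "u \<in> S \<sigma>"
    and x: "x \<in> punctured_space n" "proj_pt x \<in> U" "f (proj_pt x) \<in> toric_pt N \<Sigma> \<sigma> ` chart N \<sigma>"
  obtains w a b k where "w \<in> hom_polys n" "poly_eval w x \<noteq> 0" "a \<in> polys {..n}" "b \<in> polys {..n}"
    "homogeneous k a" "homogeneous k b"
    "\<And>y. y \<in> punctured_space n \<Longrightarrow> poly_eval w y \<noteq> 0 \<Longrightarrow> proj_pt y \<in> U \<and>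
      f (proj_pt y) \<in> toric_pt N \<Sigma> \<sigma> ` chart N \<sigma> \<and> poly_eval b y \<noteq> 0 \<and>
      character_value \<sigma> u (f (proj_pt y)) = poly_eval a y / poly_eval b y"
proof -
  let ?V = "toric_pt N \<Sigma> \<sigma> ` chart N \<sigma>"
  have "regular_fun_proj n {P \<in> U. f P \<in> ?V} (character_value \<sigma> u \<circ> f)"
    using mor character_value_regular[OF s u] unfolding morphism_def by blast
  from bspec[OF conjunct2[OF this[unfolded regular_fun_proj_def]], of "proj_pt x"]
  obtain W a b k where W: "openin (zariski_proj n) W" "proj_pt x \<in> W" "W \<subseteq> {P \<in> U. f P \<in> ?V}"
    "a \<in> polys {..n}" "b \<in> polys {..n}" "homogeneous k a" "homogeneous k b"
    "\<forall>x\<in>punctured_space n. proj_pt x \<in> W \<longrightarrow>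
           poly_eval b x \<noteq> 0 \<and> (character_value \<sigma> u \<circ> f) (proj_pt x) = poly_eval a x / poly_eval b x"
    using x by auto
  obtain w where w: "w \<in> hom_polys n" "poly_eval w x \<noteq> 0"
    "\<forall>y\<in>punctured_space n. poly_eval w y \<noteq> 0 \<longrightarrow> proj_pt y \<in> W"
    using W(1,2) x(1) unfolding openin_zariski_proj by blast
  show ?thesis
  proof (rule that[OF w(1,2) W(4-7)])
    fix y assume y: "y \<in> punctured_space n" "poly_eval w y \<noteq> 0"
    then have "proj_pt y \<in> W" using w(3) by blast
    then show "proj_pt y \<in> U \<and> f (proj_pt y) \<in> ?V \<and> poly_eval b y \<noteq> 0 \<and>
      character_value \<sigma> u (f (proj_pt y)) = poly_eval a y / poly_eval b y"
      using W(3,8) y(1) by auto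
  qed
qed

text \<open>Additivity reduces equality to multiples of the \<open>w b\<close>; negative multiples
  are covered because on the torus the value at \<open>- w b\<close> is the inverse of that at
  \<open>w b\<close>.\<close>

lemma torus_chart_eqI:
  assumes B: "finite B" "\<And>b. b \<in> B \<Longrightarrow> w b \<in> M" "\<And>u. u \<in> M \<Longrightarrow> u = (\<Sum>b\<in>B. (u \<bullet> b) *\<^sub>R w b)" "B \<subseteq> N"
    and g: "\<gamma> \<in> chart N {0}" "\<gamma>' \<in> chart N {0}" "\<And>b. b \<in> B \<Longrightarrow> \<gamma> (w b) = \<gamma>' (w b)"
  shows "\<gamma> = \<gamma>'"
proof -
  have int: "\<gamma> (of_int k *\<^sub>R w b) = \<gamma>' (of_int k *\<^sub>R w b)" if b: "b \<in> B" for b and k :: int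
  proof -
    have wM: "w b \<in> S {0}" "- w b \<in> S {0}" using B(2)[OF b] dual_closed(3)[OF lat] by (auto simp: semigroup_zero)
    have neg: "\<beta> (- w b) = inverse (\<beta> (w b))" if "\<beta> \<in> chart N {0}" for \<beta>
      using chartD(3)[OF that wM] chartD(2)[OF that] by (simp add: inverse_unique)
    show ?thesis
    proof (cases "k \<ge> 0")
      case True
      then obtain l where "k = int l" using nonneg_int_cases by blast
      then show ?thesis using chart_scale[OF g(1) wM(1)] chart_scale[OF g(2) wM(1)] g(3)[OF b] by simp
    next
      case False
      define l where "l = nat (- k)"
      have "of_int k *\<^sub>R w b = of_nat l *\<^sub>R (- w b)" using False by (simp add: l_def)
      then show ?thesis 
        using chart_scale[OF g(1) wM(2)] chart_scale[OF g(2) wM(2)] g(3)[OF b] neg[OF g(1)] neg[OF g(2)] by simp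
    qed
  qed
  have sum: "\<gamma> (\<Sum>b\<in>C. of_int (k b) *\<^sub>R w b) = \<gamma>' (\<Sum>b\<in>C. of_int (k b) *\<^sub>R w b)" if "C \<subseteq> B" for k :: "'a \<Rightarrow> int" and C
    using finite_subset[OF that B(1)] that
  proof (induction C rule: finite_induct)
    case (insert b C)
    have "of_int (k b) *\<^sub>R w b \<in> S {0}" "(\<Sum>b\<in>C. of_int (k b) *\<^sub>R w b) \<in> S {0}"
      using insert B(2) dual_closed(4)[OF lat] unfolding semigroup_zero by (auto intro!: dual_sum[OF lat])
    then show ?case using chartD(3)[OF g(1)] chartD(3)[OF g(2)] int insert by simp
  qed (simp add: chartD(2)[OF g(1)] chartD(2)[OF g(2)])
  have "\<gamma> u = \<gamma>' u" if u: "u \<in> M" for u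
  proof -
    have "u = (\<Sum>b\<in>B. of_int \<lfloor>u \<bullet> b\<rfloor> *\<^sub>R w b)"
      using B(3)[OF u] Ints_floor dual_Ints[OF lat u] B(4) by (simp add: subset_iff)
    then show ?thesis using sum[of B "\<lambda>b. \<lfloor>u \<bullet> b\<rfloor>"] by simp
  qed
  then show ?thesis using chartD(1) g semigroup_zero by (metis extensionalityI)
qed

end

section \<open>Maps given by valuations\<close>

definition hom_deg :: "'i mpoly \<Rightarrow> nat" where
  "hom_deg p = (SOME k. homogeneous k p)"

lemma homogeneous_hom_deg: "\<exists>k. homogeneous k p \<Longrightarrow> homogeneous (hom_deg p) p"
  unfolding hom_deg_def by (rule someI_ex)

lemma power_int_prod_const:
  fixes c :: complex
  assumes "c \<noteq> 0"
  shows "(\<Prod>p\<in>P. (c ^ d p) powi a p) = c powi (\<Sum>p\<in>P. int (d p) * a p)"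
proof (induction P rule: infinite_finite_induct)
  case (insert p P)
  have "(c ^ d p) powi a p = c powi (int (d p) * a p)" by (simp add: power_int_mult)
  then show ?case using insert assms by (simp add: power_int_add)
qed auto

lemma power_int_eq_divide: "x powi a = x ^ nat a / x ^ nat (- a)" for x :: complex
  by (cases "a \<ge> 0") (auto simp: power_int_def divide_inverse power_inverse)

text \<open>The pullback of the character \<open>u\<close> along a dominant map is
  \<open>exp (u \<bullet> y1 + \<i> (u \<bullet> y2)) * (\<Prod>p\<in>P. p powi (u \<bullet> e p))\<close>: the vector \<open>e p\<close> in the lattice
  records the valuations of all characters along the hypersurface \<open>p = 0\<close>.\<close>

locale valuation_data = toric_fan +
  fixes n :: nat and P :: "nat mpoly set" and e :: "nat mpoly \<Rightarrow> 'a" and y1 y2 :: 'a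
  assumes finP: "finite P"
    and prime: "\<And>p. p \<in> P \<Longrightarrow> prime_in (polys {..n}) p"
    and hom: "\<And>p. p \<in> P \<Longrightarrow> \<exists>k. homogeneous k p"
    and nonassoc: "\<And>p q. p \<in> P \<Longrightarrow> q \<in> P \<Longrightarrow> dvd_in (polys {..n}) p q \<Longrightarrow> p = q"
    and eN: "\<And>p. p \<in> P \<Longrightarrow> e p \<in> N"
    and supp: "\<And>p. p \<in> P \<Longrightarrow> \<exists>\<sigma>\<in>\<Sigma>. e p \<in> \<sigma>"
    and deg: "\<And>u. u \<in> M \<Longrightarrow> (\<Sum>p\<in>P. of_nat (hom_deg p) * (u \<bullet> e p)) = 0"
begin

definition gam :: "(nat \<Rightarrow> complex) \<Rightarrow> 'a \<Rightarrow> complex" where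
  "gam x u = exp (Complex (u \<bullet> y1) (u \<bullet> y2)) * (\<Prod>p\<in>P. poly_eval p x powi \<lfloor>u \<bullet> e p\<rfloor>)"

text \<open>At such points only forms whose vector lies in \<open>\<sigma>\<close> vanish, so a
  character in \<open>S \<sigma>\<close> has no pole there. This set turns out to be the preimage of
  the chart of \<open>\<sigma>\<close>.\<close>

definition G :: "'a set \<Rightarrow> (nat \<Rightarrow> complex) set" where
  "G \<sigma> = {x \<in> punctured_space n. \<forall>p\<in>P. poly_eval p x = 0 \<longrightarrow> e p \<in> \<sigma>}"

definition pt :: "'a set \<Rightarrow> (nat \<Rightarrow> complex) \<Rightarrow> 'a toric_pt" where
  "pt \<sigma> x = toric_pt N \<Sigma> \<sigma> (restrict (gam x) (S \<sigma>))"

lemma hdeg: "p \<in> P \<Longrightarrow> homogeneous (hom_deg p) p"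
  using hom homogeneous_hom_deg by blast

lemma P_props: "p \<in> P \<Longrightarrow> p \<in> polys {..n}" "p \<in> P \<Longrightarrow> p \<noteq> 0" "p \<in> P \<Longrightarrow> p \<in> hom_polys n"
  "p \<in> P \<Longrightarrow> hom_deg p > 0"
  using prime hom prime_homogeneous_pos[OF prime hdeg] by (auto simp: prime_in_def hom_polys_def)

lemma pairing_int: "p \<in> P \<Longrightarrow> u \<in> M \<Longrightarrow> of_int \<lfloor>u \<bullet> e p\<rfloor> = u \<bullet> e p"
  using Ints_floor dual_Ints[OF lat] eN by simp

lemma floor_add: "p \<in> P \<Longrightarrow> u \<in> M \<Longrightarrow> u' \<in> M \<Longrightarrow> \<lfloor>(u + u') \<bullet> e p\<rfloor> = \<lfloor>u \<bullet> e p\<rfloor> + \<lfloor>u' \<bullet> e p\<rfloor>"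
  using dual_Ints[OF lat _ eN] by (auto simp: inner_add_left elim!: Ints_cases)

lemma floor_deg: "u \<in> M \<Longrightarrow> (\<Sum>p\<in>P. int (hom_deg p) * \<lfloor>u \<bullet> e p\<rfloor>) = 0"
proof -
  assume u: "u \<in> M"
  have "of_int (\<Sum>p\<in>P. int (hom_deg p) * \<lfloor>u \<bullet> e p\<rfloor>) = (\<Sum>p\<in>P. of_nat (hom_deg p) * (u \<bullet> e p))"
    by (simp add: pairing_int u)
  then show ?thesis using deg[OF u] by (metis of_int_eq_0_iff)
qed

lemma semigroup_pairing: "e p \<in> \<sigma> \<Longrightarrow> u \<in> S \<sigma> \<Longrightarrow> 0 \<le> \<lfloor>u \<bullet> e p\<rfloor>"
  by (auto simp: dual_semigroup_def)

text \<open>The danger is a power of 0, which is additive in the exponent only for nonnegative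
  exponents; membership in \<open>G \<sigma>\<close> guarantees these wherever a prime
  vanishes.\<close>

lemma gam_chart:
  assumes "\<sigma> \<in> \<Sigma>" "x \<in> G \<sigma>"
  shows "restrict (gam x) (S \<sigma>) \<in> chart N \<sigma>"
  unfolding chart_def
proof (intro CollectI conjI ballI)
  show "restrict (gam x) (S \<sigma>) 0 = 1"
    using semigroup_closed(1) by (simp add: gam_def flip: zero_complex.code)
  fix u u' assume u: "u \<in> S \<sigma>" "u' \<in> S \<sigma>"
  then have uM: "u \<in> M" "u' \<in> M" using semigroup_dual by auto
  have "poly_eval p x powi \<lfloor>(u + u') \<bullet> e p\<rfloor> = poly_eval p x powi \<lfloor>u \<bullet> e p\<rfloor> * poly_eval p x powi \<lfloor>u' \<bullet> e p\<rfloor>"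
    if p: "p \<in> P" for p
  proof (cases "poly_eval p x = 0")
    case True
    then have "e p \<in> \<sigma>" using assms(2) p by (auto simp: G_def)
    then have "0 \<le> \<lfloor>u \<bullet> e p\<rfloor>" "0 \<le> \<lfloor>u' \<bullet> e p\<rfloor>" using u semigroup_pairing by auto
    then show ?thesis unfolding floor_add[OF p uM]
      by (simp add: power_int_def nat_add_distrib power_add)
  qed (simp add: floor_add[OF p uM] power_int_add)
  moreover have "exp (Complex ((u + u') \<bullet> y1) ((u + u') \<bullet> y2)) =
      exp (Complex (u \<bullet> y1) (u \<bullet> y2)) * exp (Complex (u' \<bullet> y1) (u' \<bullet> y2))"
    unfolding exp_add[symmetric] by (rule arg_cong[where f = exp]) (simp add: complex_eq_iff inner_add_left)
  ultimately have "gam x (u + u') = gam x u * gam x u'"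
    by (simp add: gam_def prod.distrib)
  then show "restrict (gam x) (S \<sigma>) (u + u') = restrict (gam x) (S \<sigma>) u * restrict (gam x) (S \<sigma>) u'"
    using u semigroup_closed(2)[OF u] by simp
qed simp

lemma gam_nonzero_iff:
  assumes "u \<in> M"
  shows "gam x u \<noteq> 0 \<longleftrightarrow> (\<forall>p\<in>P. poly_eval p x = 0 \<longrightarrow> u \<bullet> e p = 0)"
proof -
  have "\<lfloor>u \<bullet> e p\<rfloor> = 0 \<longleftrightarrow> u \<bullet> e p = 0" if "p \<in> P" for p
    using pairing_int[OF that assms] by (metis of_int_0 floor_zero)
  then show ?thesis using finP by (auto simp: gam_def)
qed

text \<open>Rescaling x multiplies the product by a power of the scale factor whose exponent is the
  total degree, which is 0 by \<open>deg\<close>.\<close>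

lemma gam_cong:
  assumes "proj_pt x = proj_pt y" "u \<in> M"
  shows "gam x u = gam y u"
proof -
  obtain c where c: "c \<noteq> 0" "x = (\<lambda>i. c * y i)" using assms(1) by (auto simp: proj_pt_eq_iff)
  have "(\<Prod>p\<in>P. poly_eval p x powi \<lfloor>u \<bullet> e p\<rfloor>) =
      (\<Prod>p\<in>P. (c ^ hom_deg p) powi \<lfloor>u \<bullet> e p\<rfloor> * poly_eval p y powi \<lfloor>u \<bullet> e p\<rfloor>)"
    unfolding c(2) using poly_eval_homogeneous_scale[OF hdeg]
    by (intro prod.cong) (auto simp: power_int_mult_distrib)
  also have "\<dots> = (\<Prod>p\<in>P. poly_eval p y powi \<lfloor>u \<bullet> e p\<rfloor>)"
    unfolding prod.distrib power_int_prod_const[OF c(1)] floor_deg[OF assms(2)] by simp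
  finally show ?thesis by (simp add: gam_def)
qed

lemma G_cong:
  assumes "proj_pt x = proj_pt y" "y \<in> punctured_space n" "x \<in> G \<sigma>" shows "y \<in> G \<sigma>"
  using assms poly_eval_proj_pt_cong[OF hdeg assms(1)] by (auto simp: G_def)

lemma G_punctured: "x \<in> G \<sigma> \<Longrightarrow> x \<in> punctured_space n"
  by (simp add: G_def)

lemma pt_cong:
  assumes "proj_pt x = proj_pt y" shows "pt \<sigma> x = pt \<sigma> y"
proof -
  have "restrict (gam x) (S \<sigma>) = restrict (gam y) (S \<sigma>)"
    using gam_cong[OF assms] semigroup_dual by (intro restrict_ext) blast
  then show ?thesis by (simp add: pt_def)
qed

lemma pt_indep:
  assumes "\<sigma> \<in> \<Sigma>" "\<tau> \<in> \<Sigma>" "x \<in> G \<sigma>" "x \<in> G \<tau>" shows "pt \<sigma> x = pt \<tau> x"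
proof -
  have "x \<in> G (\<sigma> \<inter> \<tau>)" using assms by (auto simp: G_def)
  then have "restrict (gam x) (S (\<sigma> \<inter> \<tau>)) \<in> chart N (\<sigma> \<inter> \<tau>)" using gam_chart inter_in assms by blast
  from toric_pt_restrict[OF assms(1,2) this] show ?thesis
    using semigroup_mono[of "\<sigma> \<inter> \<tau>" \<sigma>] semigroup_mono[of "\<sigma> \<inter> \<tau>" \<tau>]
    by (simp add: pt_def Int_absorb1)
qed

text \<open>A point of the chart of \<open>\<tau>\<close> that also lies in the chart of
  \<open>\<sigma>\<close> is nonzero on the character \<open>m\<close> exposing the common face.
  Hence every \<open>e p\<close> with \<open>p\<close> vanishing there lies on that face, and so in
  \<open>\<sigma>\<close>.\<close>

lemma pt_in_chart:
  assumes s: "\<sigma> \<in> \<Sigma>" "\<tau> \<in> \<Sigma>" and x: "x \<in> G \<tau>" and g: "\<gamma> \<in> chart N \<sigma>"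
    and eq: "pt \<tau> x = toric_pt N \<Sigma> \<sigma> \<gamma>"
  shows "x \<in> G \<sigma>" "\<gamma> = restrict (gam x) (S \<sigma>)"
proof -
  obtain \<delta> where d: "\<delta> \<in> chart N (\<tau> \<inter> \<sigma>)" "restrict (gam x) (S \<tau>) = restrict \<delta> (S \<tau>)"
    using toric_pt_eq_iff[OF s(2) gam_chart[OF s(2) x] s(1) g] eq unfolding pt_def glue_iff by blast
  obtain m where m: "m \<in> S \<tau>" "- m \<in> S (\<tau> \<inter> \<sigma>)" "\<And>v. v \<in> \<tau> \<Longrightarrow> m \<bullet> v = 0 \<longleftrightarrow> v \<in> \<sigma>"
    using common_face[OF s(2,1)] by metis
  have "m \<in> S (\<tau> \<inter> \<sigma>)" using m(1) semigroup_mono[of "\<tau> \<inter> \<sigma>" \<tau>] by blast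
  then have "\<delta> m \<noteq> 0" using chart_unit[OF d(1)] m(2) by blast
  then have "gam x m \<noteq> 0" using d(2) m(1) by (metis restrict_apply')
  then show xs: "x \<in> G \<sigma>"
    using gam_nonzero_iff[of m x] m semigroup_dual[of \<tau>] x by (auto simp: G_def)
  have "toric_pt N \<Sigma> \<sigma> \<gamma> = toric_pt N \<Sigma> \<sigma> (restrict (gam x) (S \<sigma>))"
    using eq pt_indep[OF s xs x] by (simp add: pt_def)
  then show "\<gamma> = restrict (gam x) (S \<sigma>)" using toric_pt_inj[OF s(1) g gam_chart[OF s(1) xs]] by blast
qed

definition Dom :: "(nat \<Rightarrow> complex) set set" where
  "Dom = proj_pt ` (\<Union>\<sigma>\<in>\<Sigma>. G \<sigma>)"

definition fmap :: "(nat \<Rightarrow> complex) set \<Rightarrow> 'a toric_pt" where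
  "fmap Q = (SOME z. \<exists>\<sigma> x. \<sigma> \<in> \<Sigma> \<and> x \<in> G \<sigma> \<and> proj_pt x = Q \<and> z = pt \<sigma> x)"

lemma fmap_eq:
  assumes "\<sigma> \<in> \<Sigma>" "x \<in> G \<sigma>" shows "fmap (proj_pt x) = pt \<sigma> x"
proof -
  have "\<exists>\<tau> y. \<tau> \<in> \<Sigma> \<and> y \<in> G \<tau> \<and> proj_pt y = proj_pt x \<and> fmap (proj_pt x) = pt \<tau> y"
    unfolding fmap_def by (rule someI_ex) (use assms in blast)
  then obtain \<tau> y where t: "\<tau> \<in> \<Sigma>" "y \<in> G \<tau>" "proj_pt y = proj_pt x" "fmap (proj_pt x) = pt \<tau> y" by blast
  then have "x \<in> G \<tau>" using G_cong assms(2) G_punctured by blast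
  then show ?thesis using pt_cong[OF t(3)] pt_indep[OF assms(1) t(1) assms(2)] t(4) by simp
qed

lemma Dom_iff: "x \<in> punctured_space n \<Longrightarrow> proj_pt x \<in> Dom \<longleftrightarrow> (\<exists>\<sigma>\<in>\<Sigma>. x \<in> G \<sigma>)"
proof
  assume x: "x \<in> punctured_space n" "proj_pt x \<in> Dom"
  then obtain \<sigma> y where "\<sigma> \<in> \<Sigma>" "y \<in> G \<sigma>" "proj_pt y = proj_pt x" unfolding Dom_def by auto
  then show "\<exists>\<sigma>\<in>\<Sigma>. x \<in> G \<sigma>" using G_cong x(1) by blast
qed (auto simp: Dom_def)

definition H :: "'a set \<Rightarrow> nat mpoly" where
  "H \<sigma> = (\<Prod>p\<in>{p \<in> P. e p \<notin> \<sigma>}. p)"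

lemma H_props: "H \<sigma> \<in> polys {..n}" "homogeneous (\<Sum>p\<in>{p \<in> P. e p \<notin> \<sigma>}. hom_deg p) (H \<sigma>)"
  unfolding H_def
  by (intro subring_of_prod polys_subring, use P_props in blast)
    (intro homogeneous_prod, use hdeg in blast)

lemma H_hom: "H \<sigma> \<in> hom_polys n"
  using H_props by (auto simp: hom_polys_def)

lemma G_iff: "x \<in> punctured_space n \<Longrightarrow> x \<in> G \<sigma> \<longleftrightarrow> poly_eval (H \<sigma>) x \<noteq> 0"
  using finP by (auto simp: G_def H_def poly_eval_prod)

text \<open>\<open>A\<close> is the pullback of \<open>f\<close> with its poles cleared by the K-th
  power of \<open>H \<sigma>\<close>. The prescribed degree is that of this power, so the quotient
  is a function on projective space.\<close>

definition cleared :: "'a set \<Rightarrow> ('a \<Rightarrow>\<^sub>0 complex) \<Rightarrow> nat \<Rightarrow> nat mpoly \<Rightarrow> bool" where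
  "cleared \<sigma> f K A \<longleftrightarrow> A \<in> polys {..n} \<and> homogeneous (K * (\<Sum>p\<in>{p \<in> P. e p \<notin> \<sigma>}. hom_deg p)) A \<and>
    (\<forall>x\<in>G \<sigma>. poly_eval A x = chart_eval f (restrict (gam x) (S \<sigma>)) * poly_eval (H \<sigma>) x ^ K)"

text \<open>On \<open>G \<sigma>\<close>, only the primes dividing \<open>H \<sigma>\<close> occur with negative exponents.\<close>

lemma clear_denominators:
  assumes s: "\<sigma> \<in> \<Sigma>" and f: "f \<in> chart_ring N \<sigma>"
  shows "\<exists>K0. \<forall>K\<ge>K0. \<exists>A. cleared \<sigma> f K A"
proof -
  have fS: "u \<in> S \<sigma>" if "u \<in> Poly_Mapping.keys f" for u using f that by (auto simp: chart_ring_def)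
  \<comment> \<open>A bound for the pole orders of all characters in \<open>f\<close> along all
    primes. Every larger K works too, so two functions can be cleared with the same power.\<close>
  define K0 where "K0 = Max (insert 0 ((\<lambda>(u, p). nat (- \<lfloor>u \<bullet> e p\<rfloor>)) ` (Poly_Mapping.keys f \<times> P)))"
  have K0: "- \<lfloor>u \<bullet> e p\<rfloor> \<le> int K0" if "u \<in> Poly_Mapping.keys f" "p \<in> P" for u p
  proof -
    have "nat (- \<lfloor>u \<bullet> e p\<rfloor>) \<le> K0" unfolding K0_def
      by (rule Max_ge) (use finP that in \<open>auto intro!: image_eqI[of _ _ "(u, p)"]\<close>)
    then show ?thesis by linarith
  qed
  have "\<exists>A. cleared \<sigma> f K A" if K: "K \<ge> K0" for K
  proof -
    \<comment> \<open>The exponent of \<open>p\<close> in the pullback of \<open>u\<close> after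
      multiplication by the K-th power of \<open>H \<sigma>\<close>; both ways of being nonnegative
      are collected in \<open>nn\<close> below.\<close>
    define ex where "ex u p = nat (\<lfloor>u \<bullet> e p\<rfloor> + (if e p \<in> \<sigma> then 0 else int K))" for u p
    define co where "co u = Poly_Mapping.lookup f u * exp (Complex (u \<bullet> y1) (u \<bullet> y2))" for u
    define A where "A = (\<Sum>u\<in>Poly_Mapping.keys f. const_poly (co u) * (\<Prod>p\<in>P. p ^ ex u p))"
    have nn: "0 \<le> \<lfloor>u \<bullet> e p\<rfloor> + (if e p \<in> \<sigma> then 0 else int K)"
      if "u \<in> Poly_Mapping.keys f" "p \<in> P" for u p
      using K0[OF that] K semigroup_pairing[OF _ fS[OF that(1)], of p] by auto
    have "A \<in> polys {..n}" unfolding A_def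
      by (intro subring_of_sum subring_ofD(4) subring_of_prod subring_of_power polys_subring const_in_polys P_props)
    moreover have "homogeneous (K * (\<Sum>p\<in>{p \<in> P. e p \<notin> \<sigma>}. hom_deg p)) A" unfolding A_def
    proof (intro homogeneous_sum homogeneous_const_mult)
      fix u assume u: "u \<in> Poly_Mapping.keys f"
      have "int (\<Sum>p\<in>P. ex u p * hom_deg p) =
          (\<Sum>p\<in>P. int (hom_deg p) * \<lfloor>u \<bullet> e p\<rfloor> + (if e p \<notin> \<sigma> then int K * int (hom_deg p) else 0))"
        unfolding of_nat_sum ex_def using nn[OF u] by (intro sum.cong) (auto simp: algebra_simps)
      also have "\<dots> = (\<Sum>p\<in>P. if e p \<notin> \<sigma> then int K * int (hom_deg p) else 0)"
        unfolding sum.distrib using floor_deg fS[OF u] semigroup_dual by (simp add: subset_iff)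
      also have "\<dots> = int (K * (\<Sum>p\<in>{p \<in> P. e p \<notin> \<sigma>}. hom_deg p))"
        using finP by (auto simp: sum.inter_filter sum_distrib_left intro!: sum.cong)
      finally have "(\<Sum>p\<in>P. ex u p * hom_deg p) = K * (\<Sum>p\<in>{p \<in> P. e p \<notin> \<sigma>}. hom_deg p)"
        by linarith
      moreover have "homogeneous (\<Sum>p\<in>P. ex u p * hom_deg p) (\<Prod>p\<in>P. p ^ ex u p)"
        by (intro homogeneous_prod homogeneous_power hdeg)
      ultimately show "homogeneous (K * (\<Sum>p\<in>{p \<in> P. e p \<notin> \<sigma>}. hom_deg p)) (\<Prod>p\<in>P. p ^ ex u p)" by simp
    qed
    moreover have "poly_eval A x = chart_eval f (restrict (gam x) (S \<sigma>)) * poly_eval (H \<sigma>) x ^ K"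
      if x: "x \<in> G \<sigma>" for x
    proof -
      have Hx: "poly_eval (H \<sigma>) x ^ K = (\<Prod>p\<in>P. if e p \<notin> \<sigma> then poly_eval p x ^ K else 1)"
        unfolding H_def poly_eval_prod using finP
        by (auto simp: prod.inter_filter prod_power_distrib intro!: prod.cong)
      have "(\<Prod>p\<in>P. poly_eval p x ^ ex u p) = (\<Prod>p\<in>P. poly_eval p x powi \<lfloor>u \<bullet> e p\<rfloor>) * poly_eval (H \<sigma>) x ^ K"
        if u: "u \<in> Poly_Mapping.keys f" for u
        unfolding Hx prod.distrib[symmetric]
      proof (intro prod.cong refl)
        fix p assume p: "p \<in> P"
        show "poly_eval p x ^ ex u p = poly_eval p x powi \<lfloor>u \<bullet> e p\<rfloor> * (if e p \<notin> \<sigma> then poly_eval p x ^ K else 1)"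
        proof (cases "e p \<in> \<sigma>")
          case True
          then show ?thesis using semigroup_pairing[OF True fS[OF u]] by (simp add: ex_def power_int_def)
        next
          case False
          then have nz: "poly_eval p x \<noteq> 0" using x p by (auto simp: G_def)
          have "poly_eval p x ^ ex u p = poly_eval p x powi (\<lfloor>u \<bullet> e p\<rfloor> + int K)"
            using nn[OF u p] False by (simp add: ex_def power_int_def)
          also have "\<dots> = poly_eval p x powi \<lfloor>u \<bullet> e p\<rfloor> * poly_eval p x ^ K"
            using nz by (simp add: power_int_add)
          finally show ?thesis using False by simp
        qed
      qed
      then show ?thesis using fS
        by (simp add: A_def poly_eval_simps chart_eval_def gam_def co_def sum_distrib_right mult.assoc)
    qed
    ultimately show ?thesis unfolding cleared_def by blast
  qed
  then show ?thesis by blast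
qed

lemma open_locus:
  assumes s: "\<sigma> \<in> \<Sigma>" and f: "f \<in> chart_ring N \<sigma>"
  shows "openin (zariski_proj n) (proj_pt ` {x \<in> G \<sigma>. chart_eval f (restrict (gam x) (S \<sigma>)) \<noteq> 0})"
    (is "openin _ ?U")
proof -
  obtain K A where "cleared \<sigma> f K A" using clear_denominators[OF s f] by blast
  then have A: "A \<in> hom_polys n"
    "\<forall>x\<in>G \<sigma>. poly_eval A x = chart_eval f (restrict (gam x) (S \<sigma>)) * poly_eval (H \<sigma>) x ^ K"
    unfolding cleared_def hom_polys_def by blast+
  have iff: "proj_pt x \<in> ?U \<longleftrightarrow> poly_eval (A * H \<sigma>) x \<noteq> 0" if x: "x \<in> punctured_space n" for x
  proof
    assume "proj_pt x \<in> ?U"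
    then obtain y where y: "y \<in> G \<sigma>" "chart_eval f (restrict (gam y) (S \<sigma>)) \<noteq> 0" "proj_pt y = proj_pt x" by auto
    then have "poly_eval (A * H \<sigma>) y \<noteq> 0" using A(2) G_iff[OF G_punctured[OF y(1)]] by (simp add: poly_eval_mult)
    moreover obtain k where "homogeneous k (A * H \<sigma>)" using hom_polys_mult[OF A(1) H_hom] by (auto simp: hom_polys_def)
    ultimately show "poly_eval (A * H \<sigma>) x \<noteq> 0" using poly_eval_proj_pt_cong y(3) by metis
  next
    assume "poly_eval (A * H \<sigma>) x \<noteq> 0"
    then have "x \<in> G \<sigma>" "poly_eval A x \<noteq> 0" using G_iff[OF x] by (auto simp: poly_eval_mult)
    then show "proj_pt x \<in> ?U" using A(2) by auto
  qed
  show ?thesis unfolding openin_zariski_proj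
  proof (intro conjI ballI impI)
    show "?U \<subseteq> proj_space n" using G_punctured by (auto simp: proj_space_def)
    fix x assume "x \<in> punctured_space n" "proj_pt x \<in> ?U"
    then show "\<exists>p\<in>hom_polys n. poly_eval p x \<noteq> 0 \<and> (\<forall>y\<in>punctured_space n. poly_eval p y \<noteq> 0 \<longrightarrow> proj_pt y \<in> ?U)"
      using iff hom_polys_mult[OF A(1) H_hom] by blast
  qed
qed

lemma open_G: "\<sigma> \<in> \<Sigma> \<Longrightarrow> openin (zariski_proj n) (proj_pt ` G \<sigma>)"
proof -
  assume s: "\<sigma> \<in> \<Sigma>"
  have "{x \<in> G \<sigma>. chart_eval 1 (restrict (gam x) (S \<sigma>)) \<noteq> 0} = G \<sigma>"
    using one_in_chart_ring(2)[OF gam_chart[OF s]] by auto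
  then show ?thesis using open_locus[OF s one_in_chart_ring(1)] by simp
qed

lemma open_Dom: "openin (zariski_proj n) Dom"
  unfolding Dom_def image_UN using open_G by blast

lemma fmap_in_chart_iff:
  assumes s: "\<sigma> \<in> \<Sigma>" and A: "A \<subseteq> chart N \<sigma>" and x: "x \<in> punctured_space n" "proj_pt x \<in> Dom"
  shows "fmap (proj_pt x) \<in> toric_pt N \<Sigma> \<sigma> ` A \<longleftrightarrow> x \<in> G \<sigma> \<and> restrict (gam x) (S \<sigma>) \<in> A"
proof
  obtain \<tau> where t: "\<tau> \<in> \<Sigma>" "x \<in> G \<tau>" using Dom_iff[OF x(1)] x(2) by blast
  assume "fmap (proj_pt x) \<in> toric_pt N \<Sigma> \<sigma> ` A"
  then obtain \<gamma> where "\<gamma> \<in> A" "pt \<tau> x = toric_pt N \<Sigma> \<sigma> \<gamma>" using fmap_eq[OF t] by auto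
  then show "x \<in> G \<sigma> \<and> restrict (gam x) (S \<sigma>) \<in> A" using pt_in_chart[OF s t(1,2)] A by blast
next
  assume "x \<in> G \<sigma> \<and> restrict (gam x) (S \<sigma>) \<in> A"
  then show "fmap (proj_pt x) \<in> toric_pt N \<Sigma> \<sigma> ` A" using fmap_eq[OF s] by (auto simp: pt_def)
qed

lemma fmap_continuous: "continuous_map (subtopology (zariski_proj n) Dom) (zariski_toric N \<Sigma>) fmap"
proof -
  have top: "topspace (subtopology (zariski_proj n) Dom) = Dom"
    using openin_subset[OF open_Dom] by auto
  show ?thesis unfolding zariski_toric_def
  proof (rule continuous_on_generated_topo, goal_cases)
    case (1 U)
    then obtain \<sigma> f where s: "\<sigma> \<in> \<Sigma>" "f \<in> chart_ring N \<sigma>"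
      "U = toric_pt N \<Sigma> \<sigma> ` {\<gamma> \<in> chart N \<sigma>. chart_eval f \<gamma> \<noteq> 0}" by blast
    let ?V = "proj_pt ` {x \<in> G \<sigma>. chart_eval f (restrict (gam x) (S \<sigma>)) \<noteq> 0}"
    have "fmap -` U \<inter> Dom = ?V"
    proof (intro equalityI subsetI)
      fix Q assume Q: "Q \<in> fmap -` U \<inter> Dom"
      then obtain x \<tau> where x: "\<tau> \<in> \<Sigma>" "x \<in> G \<tau>" "Q = proj_pt x" unfolding Dom_def by blast
      then show "Q \<in> ?V"
        using fmap_in_chart_iff[OF s(1), of "{\<gamma> \<in> chart N \<sigma>. chart_eval f \<gamma> \<noteq> 0}" x] G_punctured Q s(3) by auto
    next
      fix Q assume "Q \<in> ?V"
      then obtain x where x: "x \<in> G \<sigma>" "chart_eval f (restrict (gam x) (S \<sigma>)) \<noteq> 0" "Q = proj_pt x" by blast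
      then have D: "Q \<in> Dom" using s(1) by (auto simp: Dom_def)
      then show "Q \<in> fmap -` U \<inter> Dom"
        using fmap_in_chart_iff[OF s(1), of "{\<gamma> \<in> chart N \<sigma>. chart_eval f \<gamma> \<noteq> 0}" x] x G_punctured[OF x(1)]
          gam_chart[OF s(1) x(1)] s(3) by auto
    qed
    moreover have "?V \<subseteq> Dom" using s(1) by (auto simp: Dom_def)
    ultimately show ?case unfolding top
      using open_locus[OF s(1,2)] open_Dom by (simp add: openin_open_subtopology)
  next
    case 2
    show ?case unfolding top
    proof
      fix z assume "z \<in> fmap ` Dom"
      then obtain \<sigma> x where x: "\<sigma> \<in> \<Sigma>" "x \<in> G \<sigma>" "z = pt \<sigma> x" using fmap_eq unfolding Dom_def by auto
      then have "z \<in> toric_pt N \<Sigma> \<sigma> ` {\<gamma> \<in> chart N \<sigma>. chart_eval 1 \<gamma> \<noteq> 0}"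
        using gam_chart[OF x(1,2)] one_in_chart_ring(2) by (auto simp: pt_def)
      then show "z \<in> \<Union> {toric_pt N \<Sigma> \<sigma> ` {\<gamma> \<in> chart N \<sigma>. chart_eval f \<gamma> \<noteq> 0} | \<sigma> f. \<sigma> \<in> \<Sigma> \<and> f \<in> chart_ring N \<sigma>}"
        using x(1) one_in_chart_ring(1) by blast
    qed
  qed
qed

lemma fmap_preimage_open:
  assumes "openin (zariski_toric N \<Sigma>) V" shows "openin (zariski_proj n) {Q \<in> Dom. fmap Q \<in> V}"
proof -
  have "openin (subtopology (zariski_proj n) Dom) {Q \<in> topspace (subtopology (zariski_proj n) Dom). fmap Q \<in> V}"
    using fmap_continuous assms by (auto simp: continuous_map_def)
  moreover have top: "topspace (subtopology (zariski_proj n) Dom) = Dom" using openin_subset[OF open_Dom] by auto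
  ultimately show ?thesis by (simp only: top openin_open_subtopology[OF open_Dom])
qed

lemma fmap_morphism: "morphism n N \<Sigma> Dom fmap"
  unfolding morphism_def
proof (intro conjI allI impI open_Dom fmap_continuous)
  fix V g assume reg: "regular_fun_toric N \<Sigma> V g"
  show "regular_fun_proj n {Q \<in> Dom. fmap Q \<in> V} (g \<circ> fmap)" unfolding regular_fun_proj_def
  proof (intro conjI ballI)
    show "openin (zariski_proj n) {Q \<in> Dom. fmap Q \<in> V}"
      using reg fmap_preimage_open by (auto simp: regular_fun_toric_def)
    fix Q assume Q: "Q \<in> {Q \<in> Dom. fmap Q \<in> V}"
    then have "fmap Q \<in> V" by simp
    from bspec[OF conjunct2[OF reg[unfolded regular_fun_toric_def]] this]
    obtain W \<sigma> a b where W: "\<sigma> \<in> \<Sigma>" "a \<in> chart_ring N \<sigma>" "b \<in> chart_ring N \<sigma>"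
      "openin (zariski_toric N \<Sigma>) W" "fmap Q \<in> W" "W \<subseteq> V" "W \<subseteq> toric_pt N \<Sigma> \<sigma> ` chart N \<sigma>"
      "\<forall>\<gamma>\<in>chart N \<sigma>. toric_pt N \<Sigma> \<sigma> \<gamma> \<in> W \<longrightarrow>
           chart_eval b \<gamma> \<noteq> 0 \<and> g (toric_pt N \<Sigma> \<sigma> \<gamma>) = chart_eval a \<gamma> / chart_eval b \<gamma>"
      by (elim exE bexE conjE) (rule that)
    obtain Ka where Ka: "\<forall>K\<ge>Ka. \<exists>A. cleared \<sigma> a K A" using clear_denominators[OF W(1,2)] by blast
    obtain Kb where Kb: "\<forall>K\<ge>Kb. \<exists>A. cleared \<sigma> b K A" using clear_denominators[OF W(1,3)] by blast
    \<comment> \<open>A common power makes the cleared numerator and denominator forms of the same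
      degree.\<close>
    define K where "K = max Ka Kb"
    define k where "k = K * (\<Sum>p\<in>{p \<in> P. e p \<notin> \<sigma>}. hom_deg p)"
    have "Ka \<le> K" "Kb \<le> K" by (auto simp: K_def)
    then obtain A B where "cleared \<sigma> a K A" "cleared \<sigma> b K B" using Ka Kb by blast
    then have A: "A \<in> polys {..n}" "homogeneous k A"
      "\<And>x. x \<in> G \<sigma> \<Longrightarrow> poly_eval A x = chart_eval a (restrict (gam x) (S \<sigma>)) * poly_eval (H \<sigma>) x ^ K"
      and B: "B \<in> polys {..n}" "homogeneous k B"
      "\<And>x. x \<in> G \<sigma> \<Longrightarrow> poly_eval B x = chart_eval b (restrict (gam x) (S \<sigma>)) * poly_eval (H \<sigma>) x ^ K"
      unfolding cleared_def k_def by auto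
    have val: "poly_eval B x \<noteq> 0 \<and> (g \<circ> fmap) (proj_pt x) = poly_eval A x / poly_eval B x"
      if x: "x \<in> punctured_space n" "proj_pt x \<in> {Q \<in> Dom. fmap Q \<in> W}" for x
    proof -
      have "fmap (proj_pt x) \<in> toric_pt N \<Sigma> \<sigma> ` chart N \<sigma>" using x(2) W(7) by blast
      then have xG: "x \<in> G \<sigma>" using fmap_in_chart_iff[OF W(1) order_refl x(1)] x(2) by blast
      have fx: "fmap (proj_pt x) = toric_pt N \<Sigma> \<sigma> (restrict (gam x) (S \<sigma>))"
        using fmap_eq[OF W(1) xG] by (simp add: pt_def)
      have "poly_eval (H \<sigma>) x \<noteq> 0" using G_iff[OF x(1)] xG by blast
      then show ?thesis using bspec[OF W(8) gam_chart[OF W(1) xG]] x(2) A(3)[OF xG] B(3)[OF xG] fx by simp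
    qed
    show "\<exists>W a b k. openin (zariski_proj n) W \<and> Q \<in> W \<and> W \<subseteq> {Q \<in> Dom. fmap Q \<in> V} \<and>
        a \<in> polys {..n} \<and> b \<in> polys {..n} \<and> homogeneous k a \<and> homogeneous k b \<and>
        (\<forall>x\<in>punctured_space n. proj_pt x \<in> W \<longrightarrow>
           poly_eval b x \<noteq> 0 \<and> (g \<circ> fmap) (proj_pt x) = poly_eval a x / poly_eval b x)"
    proof (rule exI[of _ "{Q \<in> Dom. fmap Q \<in> W}"], rule exI[of _ A], rule exI[of _ B],
        rule exI[of _ k], intro conjI)
      show "openin (zariski_proj n) {Q \<in> Dom. fmap Q \<in> W}" by (rule fmap_preimage_open[OF W(4)])
      show "Q \<in> {Q \<in> Dom. fmap Q \<in> W}" using Q W(5) by simp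
      show "{Q \<in> Dom. fmap Q \<in> W} \<subseteq> {Q \<in> Dom. fmap Q \<in> V}" using W(6) by blast
    qed (use A(1,2) B(1,2) val in auto)
  qed
qed

end

section \<open>Codimension of hypersurfaces\<close>

lemma dvd_in_poly_eval: "dvd_in A p q \<Longrightarrow> poly_eval p x = 0 \<Longrightarrow> poly_eval q x = 0"
  for p q :: "'i::linorder mpoly"
  by (auto simp: dvd_in_def poly_eval_mult)

lemma hom_polys_eval_cong: "p \<in> hom_polys n \<Longrightarrow> proj_pt x = proj_pt y \<Longrightarrow> poly_eval p x = 0 \<longleftrightarrow> poly_eval p y = 0"
proof -
  assume p: "p \<in> hom_polys n" "proj_pt x = proj_pt y"
  then obtain k where "homogeneous k p" by (auto simp: hom_polys_def)
  from poly_eval_proj_pt_cong[OF this p(2)] show ?thesis .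
qed

definition hypersurface :: "nat \<Rightarrow> nat mpoly \<Rightarrow> (nat \<Rightarrow> complex) set set" where
  "hypersurface n p = proj_pt ` {x \<in> punctured_space n. poly_eval p x = 0}"

lemma mem_hypersurface:
  assumes "p \<in> hom_polys n" "x \<in> punctured_space n"
  shows "proj_pt x \<in> hypersurface n p \<longleftrightarrow> poly_eval p x = 0"
proof
  assume "proj_pt x \<in> hypersurface n p"
  then obtain y where "proj_pt x = proj_pt y" "poly_eval p y = 0" unfolding hypersurface_def by blast
  then show "poly_eval p x = 0" using hom_polys_eval_cong[OF assms(1)] by blast
qed (use assms(2) in \<open>auto simp: hypersurface_def\<close>)

lemma hypersurface_subset: "hypersurface n p \<subseteq> proj_space n"
  by (auto simp: hypersurface_def proj_space_def)

lemma closedin_hypersurface: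
  assumes p: "p \<in> hom_polys n" shows "closedin (zariski_proj n) (hypersurface n p)"
  unfolding closedin_def topspace_zariski_proj
proof (intro conjI hypersurface_subset)
  have "proj_pt y \<in> proj_space n" if "y \<in> punctured_space n" for y using that by (auto simp: proj_space_def)
  then show "openin (zariski_proj n) (proj_space n - hypersurface n p)"
    unfolding openin_zariski_proj using mem_hypersurface[OF p] p by auto
qed

lemma outside_closed:
  assumes "closedin (zariski_proj n) C" "x \<in> punctured_space n" "proj_pt x \<notin> C"
  obtains w where "w \<in> hom_polys n" "poly_eval w x \<noteq> 0" "C \<subseteq> hypersurface n w"
proof -
  have op: "openin (zariski_proj n) (proj_space n - C)" and sub: "C \<subseteq> proj_space n"
    using assms(1) unfolding closedin_def topspace_zariski_proj by auto
  have "proj_pt x \<in> proj_space n - C" using assms by (auto simp: proj_space_def)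
  then obtain w where w: "w \<in> hom_polys n" "poly_eval w x \<noteq> 0"
    "\<forall>y\<in>punctured_space n. poly_eval w y \<noteq> 0 \<longrightarrow> proj_pt y \<in> proj_space n - C"
    using op assms(2) unfolding openin_zariski_proj by blast
  have "C \<subseteq> hypersurface n w"
  proof
    fix Q assume Q: "Q \<in> C"
    then obtain y where y: "y \<in> punctured_space n" "Q = proj_pt y" using sub by (auto simp: proj_space_def)
    then show "Q \<in> hypersurface n w" using w(3) Q mem_hypersurface[OF w(1) y(1)] by blast
  qed
  then show ?thesis using that w by blast
qed

lemma irreducible_subset_hypersurface_mult:
  assumes "irreducible_closed (zariski_proj n) C" "p \<in> hom_polys n" "q \<in> hom_polys n"
    and "C \<subseteq> hypersurface n (p * q)"
  shows "C \<subseteq> hypersurface n p \<or> C \<subseteq> hypersurface n q"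
proof -
  have cl: "closedin (zariski_proj n) C" using assms(1) by (simp add: irreducible_closed_def)
  have "C = (C \<inter> hypersurface n p) \<union> (C \<inter> hypersurface n q)"
  proof
    show "C \<subseteq> (C \<inter> hypersurface n p) \<union> (C \<inter> hypersurface n q)"
      using assms(4) by (auto simp: hypersurface_def poly_eval_mult)
  qed auto
  moreover have "closedin (zariski_proj n) (C \<inter> hypersurface n p)" "closedin (zariski_proj n) (C \<inter> hypersurface n q)"
    using cl closedin_hypersurface assms by auto
  ultimately have "C = C \<inter> hypersurface n p \<or> C = C \<inter> hypersurface n q"
    using assms(1) unfolding irreducible_closed_def by blast
  then show ?thesis by blast
qed

lemma irreducible_subset_hypersurface_prod:
  assumes C: "irreducible_closed (zariski_proj n) C" and "finite S" "\<And>p. p \<in> S \<Longrightarrow> p \<in> hom_polys n"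
    and "C \<subseteq> hypersurface n (\<Prod>p\<in>S. p ^ m p)"
  shows "\<exists>p\<in>S. C \<subseteq> hypersurface n p"
  using assms(2-)
proof (induction S rule: finite_induct)
  case empty
  then have "C = {}" by (auto simp: hypersurface_def)
  then show ?case using C by (simp add: irreducible_closed_def)
next
  case (insert p S)
  have hp: "p ^ k \<in> hom_polys n" for k
    using hom_polys_prod[of "{..<k}" "\<lambda>_. p"] insert.prems by simp
  have hS: "(\<Prod>p\<in>S. p ^ m p) \<in> hom_polys n"
  proof (rule hom_polys_prod)
    fix q assume "q \<in> S"
    then show "q ^ m q \<in> hom_polys n" using hom_polys_prod[of "{..<m q}" "\<lambda>_. q"] insert.prems by simp
  qed
  have "C \<subseteq> hypersurface n (p ^ m p * (\<Prod>p\<in>S. p ^ m p))" using insert by simp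
  then have "C \<subseteq> hypersurface n (p ^ m p) \<or> C \<subseteq> hypersurface n (\<Prod>p\<in>S. p ^ m p)"
    by (rule irreducible_subset_hypersurface_mult[OF C hp hS])
  moreover have "hypersurface n (p ^ m p) \<subseteq> hypersurface n p" by (auto simp: hypersurface_def poly_eval_power)
  ultimately show ?case using insert by auto
qed

context
  fixes n :: nat and p q :: "nat mpoly"
  assumes p: "prime_in (polys {..n}) p" "p \<in> hom_polys n"
    and q: "q \<in> hom_polys n" "poly_eval q (\<lambda>_. 0) = 0" "\<not> dvd_in (polys {..n}) p q"
begin

text \<open>The factor \<open>q\<close> keeps the zero provided by the affine Nullstellensatz away from the origin.\<close>

lemma hypersurface_point:
  assumes r: "r \<in> polys {..n}" "\<not> dvd_in (polys {..n}) p r"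
  obtains x where "x \<in> punctured_space n" "poly_eval p x = 0" "poly_eval r x \<noteq> 0"
proof -
  have qA: "q \<in> polys {..n}" using q by (simp add: hom_polys_def)
  have "\<not> dvd_in (polys {..n}) p (r * q)" using p(1) r q(3) qA unfolding prime_in_def by blast
  moreover have "r * q \<in> polys {..n}" using r(1) qA subring_ofD(4)[OF polys_subring] by blast
  ultimately obtain x where x: "x \<in> affine_space {..n}" "poly_eval p x = 0" "poly_eval (r * q) x \<noteq> 0"
    using hypersurface_nullstellensatz[OF _ p(1)] by (metis finite_atMost)
  then have "x \<noteq> (\<lambda>_. 0)" using q(2) by (auto simp: poly_eval_mult)
  then show ?thesis using that x by (auto simp: punctured_space_def poly_eval_mult)
qed

lemma hypersurface_subset_dvd:
  assumes "r \<in> hom_polys n" "hypersurface n p \<subseteq> hypersurface n r"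
  shows "dvd_in (polys {..n}) p r"
proof (rule ccontr)
  assume nd: "\<not> ?thesis"
  have rA: "r \<in> polys {..n}" using assms by (simp add: hom_polys_def)
  obtain x where "x \<in> punctured_space n" "poly_eval p x = 0" "poly_eval r x \<noteq> 0"
    using hypersurface_point[OF rA nd] by blast
  then show False using assms mem_hypersurface[OF p(2)] mem_hypersurface[OF assms(1)] by blast
qed

lemma not_dvd_mult:
  assumes "r \<in> hom_polys n" "s \<in> hom_polys n" "\<not> dvd_in (polys {..n}) p r" "\<not> dvd_in (polys {..n}) p s"
  shows "\<not> dvd_in (polys {..n}) p (r * s)"
  using p(1) assms unfolding prime_in_def hom_polys_def by blast

text \<open>A proper closed subset of the hypersurface lies in the zero set of a form not divisible
  by \<open>p\<close>. If two such subsets covered it, \<open>p\<close> would divide the product of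
  the two forms.\<close>

lemma irreducible_hypersurface: "irreducible_closed (zariski_proj n) (hypersurface n p)"
  unfolding irreducible_closed_def
proof (intro conjI allI impI closedin_hypersurface p(2))
  have "q \<in> polys {..n}" using q by (simp add: hom_polys_def)
  then show "hypersurface n p \<noteq> {}" using hypersurface_point[OF _ q(3)] by (auto simp: hypersurface_def)
  fix A B assume AB: "closedin (zariski_proj n) A \<and> closedin (zariski_proj n) B \<and> hypersurface n p = A \<union> B"
  show "hypersurface n p = A \<or> hypersurface n p = B"
  proof (rule ccontr)
    assume n: "\<not> ?thesis"
    have *: "\<exists>w. w \<in> hom_polys n \<and> \<not> dvd_in (polys {..n}) p w \<and> C \<subseteq> hypersurface n w"
      if C: "closedin (zariski_proj n) C" "C \<subseteq> hypersurface n p" "C \<noteq> hypersurface n p" for C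
    proof -
      obtain x where x: "x \<in> punctured_space n" "poly_eval p x = 0" "proj_pt x \<notin> C"
        using C by (auto simp: hypersurface_def)
      then obtain w where "w \<in> hom_polys n" "poly_eval w x \<noteq> 0" "C \<subseteq> hypersurface n w"
        using outside_closed[OF C(1)] by blast
      then show ?thesis using dvd_in_poly_eval x(2) by blast
    qed
    obtain w1 where w1: "w1 \<in> hom_polys n" "\<not> dvd_in (polys {..n}) p w1" "A \<subseteq> hypersurface n w1"
      using *[of A] AB n by blast
    obtain w2 where w2: "w2 \<in> hom_polys n" "\<not> dvd_in (polys {..n}) p w2" "B \<subseteq> hypersurface n w2"
      using *[of B] AB n by blast
    have "hypersurface n p \<subseteq> hypersurface n (w1 * w2)"
      using AB w1(3) w2(3) by (auto simp: hypersurface_def poly_eval_mult)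
    then have "dvd_in (polys {..n}) p (w1 * w2)"
      using hypersurface_subset_dvd[OF hom_polys_mult[OF w1(1) w2(1)]] by blast
    then show False using not_dvd_mult w1 w2 by blast
  qed
qed

text \<open>A proper closed \<open>C\<close> lies in some hypersurface, and being irreducible in
  that of one of its prime factors \<open>r\<close>. As C contains the zeros of \<open>p\<close>,
  the prime \<open>p\<close> divides \<open>r\<close>, so the two are associated.\<close>

lemma no_irreducible_between:
  assumes C: "irreducible_closed (zariski_proj n) C" "hypersurface n p \<subseteq> C" "C \<noteq> proj_space n"
  shows "C = hypersurface n p"
proof -
  have cl: "closedin (zariski_proj n) C" using C(1) by (simp add: irreducible_closed_def)
  then have "C \<subseteq> proj_space n" using closedin_subset topspace_zariski_proj by blast
  then obtain x where x: "x \<in> punctured_space n" "proj_pt x \<notin> C"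
    using C(3) by (auto simp: proj_space_def)
  then obtain w where w: "w \<in> hom_polys n" "poly_eval w x \<noteq> 0" "C \<subseteq> hypersurface n w"
    using outside_closed[OF cl] by blast
  have w0: "w \<noteq> 0" using w(2) by auto
  obtain P c m where P: "finite P" "\<And>r. r \<in> P \<Longrightarrow> prime_in (polys {..n}) r \<and> (\<exists>k. homogeneous k r)"
    "\<And>s. s \<in> {()} \<Longrightarrow> c s \<noteq> 0 \<and> w = const_poly (c s) * (\<Prod>r\<in>P. r ^ m s r)"
    by (rule homogeneous_factorization[of "{..n}" "{()}" "\<lambda>_. w"]) (use w w0 in \<open>auto simp: hom_polys_def\<close>)
  have PH: "r \<in> hom_polys n" if "r \<in> P" for r using P(2)[OF that] by (simp add: hom_polys_def prime_in_def)
  have "hypersurface n w = hypersurface n (\<Prod>r\<in>P. r ^ m () r)"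
    using P(3)[of "()"] by (simp add: hypersurface_def poly_eval_mult poly_eval_single)
  then obtain r where r: "r \<in> P" "C \<subseteq> hypersurface n r"
    using irreducible_subset_hypersurface_prod[OF C(1) P(1) PH] w(3) by metis
  have "dvd_in (polys {..n}) p r" using hypersurface_subset_dvd[OF PH[OF r(1)]] C(2) r(2) by blast
  then have "dvd_in (polys {..n}) r p" using prime_in_dvd_prime[OF polys_subring p(1)] P(2) r(1) by blast
  then have "hypersurface n r \<subseteq> hypersurface n p" using dvd_in_poly_eval
    unfolding hypersurface_def by blast
  then show ?thesis using C(2) r(2) by blast
qed

lemma codim_irreducible_hypersurface: "codim_irreducible (zariski_proj n) (hypersurface n p) \<le> 1"
  unfolding codim_irreducible_def
proof (rule SUP_least)
  fix k assume "k \<in> {k. \<exists>C :: nat \<Rightarrow> (nat \<Rightarrow> complex) set set. C 0 = hypersurface n p \<and>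
     (\<forall>i\<le>k. irreducible_closed (zariski_proj n) (C i)) \<and> (\<forall>i<k. C i \<subset> C (Suc i))}"
  then obtain C where C: "C 0 = hypersurface n p" "\<And>i. i \<le> k \<Longrightarrow> irreducible_closed (zariski_proj n) (C i)"
    "\<And>i. i < k \<Longrightarrow> C i \<subset> C (Suc i)" by blast
  have "k \<le> 1"
  proof (rule ccontr)
    assume "\<not> ?thesis"
    then have k: "0 < k" "1 < k" "2 \<le> k" by auto
    have "closedin (zariski_proj n) (C 2)" using C(2)[OF k(3)] by (simp add: irreducible_closed_def)
    from closedin_subset[OF this] have "C 2 \<subseteq> proj_space n" by (simp add: topspace_zariski_proj)
    then have "C 1 \<noteq> proj_space n" using C(3)[OF k(2)] by (auto simp: numeral_2_eq_2)
    then have "C 1 = hypersurface n p"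
      using no_irreducible_between[OF C(2)[of 1]] C(3)[OF k(1)] C(1) k by auto
    then show False using C(3)[OF k(1)] C(1) by auto
  qed
  then show "enat k \<le> 1" by (simp add: one_enat_def)
qed

text \<open>The points of the hypersurface off the zeros of \<open>h\<close> are dense in it: an
  open set meeting it contains the nonzero locus of a form that \<open>p\<close> does not divide,
  and \<open>p\<close> does not divide the product of that form with \<open>h\<close>.\<close>

lemma codim_le_1:
  assumes h: "h \<in> hom_polys n" "\<not> dvd_in (polys {..n}) p h"
    and A: "\<And>x. x \<in> punctured_space n \<Longrightarrow> poly_eval p x = 0 \<Longrightarrow> poly_eval h x \<noteq> 0 \<Longrightarrow> proj_pt x \<in> A"
  shows "codim (zariski_proj n) A \<le> 1"
proof -
  have "hypersurface n p \<subseteq> zariski_proj n closure_of A"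
  proof
    fix Q assume "Q \<in> hypersurface n p"
    then obtain x where x: "x \<in> punctured_space n" "poly_eval p x = 0" "Q = proj_pt x" by (auto simp: hypersurface_def)
    show "Q \<in> zariski_proj n closure_of A" unfolding in_closure_of topspace_zariski_proj
    proof (intro conjI allI impI)
      show "Q \<in> proj_space n" using x by (auto simp: proj_space_def)
      fix T assume T: "Q \<in> T \<and> openin (zariski_proj n) T"
      then obtain w where w: "w \<in> hom_polys n" "poly_eval w x \<noteq> 0"
        "\<forall>y\<in>punctured_space n. poly_eval w y \<noteq> 0 \<longrightarrow> proj_pt y \<in> T"
        using x unfolding openin_zariski_proj by blast
      have "\<not> dvd_in (polys {..n}) p w" using dvd_in_poly_eval w(2) x(2) by blast
      then have nd: "\<not> dvd_in (polys {..n}) p (w * h)" using not_dvd_mult w(1) h by blast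
      have "w * h \<in> polys {..n}" using hom_polys_mult[OF w(1) h(1)] by (simp add: hom_polys_def)
      then obtain y where "y \<in> punctured_space n" "poly_eval p y = 0" "poly_eval (w * h) y \<noteq> 0"
        using hypersurface_point[OF _ nd] by blast
      then show "\<exists>y. y \<in> A \<and> y \<in> T" using A w(3) by (auto simp: poly_eval_mult)
    qed
  qed
  then have "codim (zariski_proj n) A \<le> codim_irreducible (zariski_proj n) (hypersurface n p)"
    unfolding codim_def using irreducible_hypersurface by (intro INF_lower) blast
  then show ?thesis using codim_irreducible_hypersurface by (rule order_trans)
qed

end

section \<open>The regular locus\<close>

lemma nonempty_open_hom_poly:
  assumes "openin (zariski_proj n) U" "U \<noteq> {}"
  shows "\<exists>w\<in>hom_polys n. w \<noteq> 0 \<and> (\<forall>x\<in>punctured_space n. poly_eval w x \<noteq> 0 \<longrightarrow> proj_pt x \<in> U)"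
proof -
  obtain Q where "Q \<in> U" using assms(2) by blast
  then obtain x where x: "x \<in> punctured_space n" "proj_pt x \<in> U"
    using assms(1) unfolding openin_zariski_proj proj_space_def by blast
  then obtain w where w: "w \<in> hom_polys n" "poly_eval w x \<noteq> 0"
    "\<forall>y\<in>punctured_space n. poly_eval w y \<noteq> 0 \<longrightarrow> proj_pt y \<in> U"
    using assms(1) unfolding openin_zariski_proj by blast
  then have "w \<noteq> 0" by auto
  then show ?thesis using w by blast
qed

context valuation_data
begin

text \<open>The representative is given by the valuation data on the nonzero locus of some nonzero
  form. The condition \<open>x \<in> G {0}\<close> ensures that the value there lies in the
  torus.\<close>

definition agrees_generically :: "(nat \<Rightarrow> complex) set set \<Rightarrow> ((nat \<Rightarrow> complex) set \<Rightarrow> 'a toric_pt) \<Rightarrow> bool" where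
  "agrees_generically U f \<longleftrightarrow> (\<exists>h\<in>hom_polys n. h \<noteq> 0 \<and> (\<forall>x\<in>punctured_space n. poly_eval h x \<noteq> 0 \<longrightarrow>
     proj_pt x \<in> U \<and> x \<in> G {0} \<and> f (proj_pt x) = pt {0} x))"

lemma monomial_in_polys: "Q \<subseteq> P \<Longrightarrow> (\<Prod>p\<in>Q. p ^ k p) \<in> polys {..n}"
  by (rule subring_of_prod[OF polys_subring], rule subring_of_power[OF polys_subring], rule P_props(1)) blast

lemma pairing_nonneg_imp_mem:
  assumes "\<sigma> \<in> \<Sigma>" "p \<in> P" "\<And>u. u \<in> S \<sigma> \<Longrightarrow> 0 \<le> u \<bullet> e p"
  shows "e p \<in> \<sigma>"
proof (rule ccontr)
  assume "e p \<notin> \<sigma>"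
  then obtain u where "u \<in> S \<sigma>" "u \<bullet> e p < 0"
    using separate_from_cone[OF assms(1) span_base[OF eN[OF assms(2)]]] by blast
  then show False using assms(3) by force
qed

text \<open>Cross-multiplying with separate positive and negative parts of the exponents gives an
  identity of polynomials. It is tested where neither \<open>w\<close> nor any prime
  vanishes.\<close>

lemma fraction_identity:
  assumes u: "u \<in> M" and ab: "a \<in> polys {..n}" "b \<in> polys {..n}"
    and w: "w \<in> polys {..n}" "w \<noteq> 0"
    and eq: "\<And>y. y \<in> punctured_space n \<Longrightarrow> poly_eval w y \<noteq> 0 \<Longrightarrow> poly_eval b y \<noteq> 0 \<and>
      gam y u = poly_eval a y / poly_eval b y"
  shows "a * (\<Prod>p\<in>P. p ^ nat (- \<lfloor>u \<bullet> e p\<rfloor>)) =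
    const_poly (exp (Complex (u \<bullet> y1) (u \<bullet> y2))) * b * (\<Prod>p\<in>P. p ^ nat \<lfloor>u \<bullet> e p\<rfloor>)"
proof -
  let ?c = "exp (Complex (u \<bullet> y1) (u \<bullet> y2))"
  let ?N = "\<Prod>p\<in>P. p ^ nat (- \<lfloor>u \<bullet> e p\<rfloor>)" and ?Q = "\<Prod>p\<in>P. p ^ nat \<lfloor>u \<bullet> e p\<rfloor>"
  have PA: "prod f P \<in> polys {..n}" if "\<And>p. p \<in> P \<Longrightarrow> f p \<in> polys {..n}" for f
    using that by (rule subring_of_prod[OF polys_subring])
  have NQ: "?N \<in> polys {..n}" "?Q \<in> polys {..n}"
    by (rule monomial_in_polys[OF order_refl])+
  have W: "w * \<Prod>P \<in> polys {..n}" "w * \<Prod>P \<noteq> 0"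
    using w PA[of "\<lambda>p. p"] P_props finP subring_ofD(4)[OF polys_subring] by auto
  have D: "a * ?N - const_poly ?c * b * ?Q \<in> polys {..n}"
    by (intro subring_ofD(6)[OF polys_subring] subring_ofD(4)[OF polys_subring] ab NQ const_in_polys)
  have "a * ?N - const_poly ?c * b * ?Q = 0"
  proof (rule vanishing_on_open[OF D W])
    fix x assume x: "x \<in> punctured_space n" "poly_eval (w * \<Prod>P) x \<noteq> 0"
    then have nz: "poly_eval p x \<noteq> 0" if "p \<in> P" for p
      using that finP by (auto simp: poly_eval_mult poly_eval_prod)
    have wx: "poly_eval w x \<noteq> 0" using x by (auto simp: poly_eval_mult)
    have ab: "poly_eval b x \<noteq> 0" "gam x u = poly_eval a x / poly_eval b x" using eq[OF x(1) wx] by auto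
    have "gam x u = ?c * (poly_eval ?Q x / poly_eval ?N x)"
      by (simp add: gam_def poly_eval_simps power_int_eq_divide prod_dividef)
    moreover have "poly_eval ?N x \<noteq> 0" using nz finP by (simp add: poly_eval_simps)
    ultimately have "poly_eval a x * poly_eval ?N x = ?c * poly_eval ?Q x * poly_eval b x"
      using ab by (simp add: field_simps)
    then show "poly_eval (a * ?N - const_poly ?c * b * ?Q) x = 0"
      by (simp add: poly_eval_diff poly_eval_mult poly_eval_single ac_simps)
  qed
  then show ?thesis by simp
qed

lemma prime_not_dvd_prod:
  assumes p: "p \<in> P" and k: "k p = 0"
  shows "\<not> dvd_in (polys {..n}) p (\<Prod>q\<in>P. q ^ k q)"
proof
  assume "dvd_in (polys {..n}) p (\<Prod>q\<in>P. q ^ k q)"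
  then have "\<exists>q\<in>P. dvd_in (polys {..n}) p (q ^ k q)"
    by (rule prime_in_prod[OF polys_subring prime[OF p] finP, rotated])
      (rule subring_of_power[OF polys_subring P_props(1)])
  then obtain q where q: "q \<in> P" "dvd_in (polys {..n}) p (q ^ k q)" by blast
  then have "p = q"
    using prime_in_power[OF polys_subring prime[OF p] P_props(1)] nonassoc[OF p] by blast
  then show False using q k prime[OF p] by (simp add: prime_in_def)
qed

text \<open>If a prime \<open>p\<close> vanishing at x had a negative exponent, it would divide the
  left side of the polynomial identity but not the product with the positive exponents. Hence it
  would divide the denominator, which is nonzero at x.\<close>

lemma fraction_at_point:
  assumes u: "u \<in> M" and ab: "a \<in> polys {..n}" "b \<in> polys {..n}"
    and w: "w \<in> polys {..n}" "w \<noteq> 0"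
    and eq: "\<And>y. y \<in> punctured_space n \<Longrightarrow> poly_eval w y \<noteq> 0 \<Longrightarrow> poly_eval b y \<noteq> 0 \<and>
      gam y u = poly_eval a y / poly_eval b y"
    and bx: "poly_eval b x \<noteq> 0"
  shows "\<And>p. p \<in> P \<Longrightarrow> poly_eval p x = 0 \<Longrightarrow> 0 \<le> u \<bullet> e p"
    and "gam x u = poly_eval a x / poly_eval b x"
proof -
  let ?c = "exp (Complex (u \<bullet> y1) (u \<bullet> y2))"
  let ?N = "\<Prod>p\<in>P. p ^ nat (- \<lfloor>u \<bullet> e p\<rfloor>)" and ?Q = "\<Prod>p\<in>P. p ^ nat \<lfloor>u \<bullet> e p\<rfloor>"
  have ident: "a * ?N = const_poly ?c * b * ?Q" by (rule fraction_identity[OF u ab w eq])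
  have QA: "?Q \<in> polys {..n}" "?N \<in> polys {..n}"
    by (rule monomial_in_polys[OF order_refl])+
  show 1: "0 \<le> u \<bullet> e p" if p: "p \<in> P" "poly_eval p x = 0" for p
  proof (rule ccontr)
    assume neg: "\<not> ?thesis"
    then have fl: "\<lfloor>u \<bullet> e p\<rfloor> < 0" by simp
    then obtain k where k: "nat (- \<lfloor>u \<bullet> e p\<rfloor>) = Suc k" by (metis gr0_implies_Suc neg_0_less_iff_less zero_less_nat_eq)
    have "?N = p ^ nat (- \<lfloor>u \<bullet> e p\<rfloor>) * (\<Prod>q\<in>P - {p}. q ^ nat (- \<lfloor>u \<bullet> e q\<rfloor>))"
      using finP p by (subst prod.remove[of _ p]) auto
    then have "a * ?N = p * (a * (p ^ k * (\<Prod>q\<in>P - {p}. q ^ nat (- \<lfloor>u \<bullet> e q\<rfloor>))))"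
      unfolding k by (simp only: power_Suc ac_simps)
    moreover have "a * (p ^ k * (\<Prod>q\<in>P - {p}. q ^ nat (- \<lfloor>u \<bullet> e q\<rfloor>))) \<in> polys {..n}"
      using ab(1) monomial_in_polys[of "P - {p}"] subring_of_power[OF polys_subring P_props(1)[OF p(1)]]
      by (intro subring_ofD(4)[OF polys_subring]) auto
    ultimately have "dvd_in (polys {..n}) p (a * ?N)" unfolding dvd_in_def by blast
    then have "dvd_in (polys {..n}) p (const_poly ?c * b * ?Q)" by (simp only: ident)
    moreover have "const_poly ?c * b \<in> polys {..n}" using ab const_in_polys subring_ofD(4)[OF polys_subring] by blast
    moreover have "\<not> dvd_in (polys {..n}) p ?Q" using prime_not_dvd_prod[OF p(1), of "\<lambda>q. nat \<lfloor>u \<bullet> e q\<rfloor>"] fl by simp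
    ultimately have "dvd_in (polys {..n}) p (const_poly ?c * b)"
      using prime[OF p(1)] QA unfolding prime_in_def by blast
    then have "poly_eval (const_poly ?c * b) x = 0" using dvd_in_poly_eval p(2) by blast
    then show False using bx by (simp add: poly_eval_mult poly_eval_single)
  qed
  have "poly_eval p x ^ nat (- \<lfloor>u \<bullet> e p\<rfloor>) \<noteq> 0" if "p \<in> P" for p
    using 1[OF that] by (cases "poly_eval p x = 0") auto
  then have N0: "poly_eval ?N x \<noteq> 0" using finP by (simp add: poly_eval_simps)
  have "gam x u = ?c * (poly_eval ?Q x / poly_eval ?N x)"
    by (simp add: gam_def poly_eval_simps power_int_eq_divide prod_dividef)
  moreover have "poly_eval (a * ?N) x = poly_eval (const_poly ?c * b * ?Q) x" by (simp only: ident)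
  then have "poly_eval a x * poly_eval ?N x = ?c * poly_eval b x * poly_eval ?Q x"
    by (simp add: poly_eval_mult poly_eval_single)
  ultimately have "(gam x u * poly_eval b x) * poly_eval ?N x = poly_eval a x * poly_eval ?N x"
    using N0 by simp
  then have "gam x u * poly_eval b x = poly_eval a x" by (simp only: mult_right_cancel[OF N0])
  then show "gam x u = poly_eval a x / poly_eval b x" using bx by (simp add: eq_divide_eq)
qed

text \<open>In a chart around the value at x, every character of the chart pulls back to a fraction
  with nonzero denominator at x. Then all \<open>e p\<close> with \<open>p\<close> vanishing at x
  pair nonnegatively with \<open>S \<sigma>\<close>, so they lie in \<open>\<sigma>\<close>, and the
  values agree.\<close>

lemma representative_value:
  assumes mor: "morphism n N \<Sigma> U f" and ag: "agrees_generically U f"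
    and x: "x \<in> punctured_space n" "proj_pt x \<in> U"
  shows "\<exists>\<sigma>\<in>\<Sigma>. x \<in> G \<sigma> \<and> f (proj_pt x) = pt \<sigma> x"
proof -
  have opU: "openin (zariski_proj n) U" and cont: "continuous_map (subtopology (zariski_proj n) U) (zariski_toric N \<Sigma>) f"
    using mor by (auto simp: morphism_def)
  have "U = topspace (subtopology (zariski_proj n) U)" using openin_subset[OF opU] by auto
  then have "f (proj_pt x) \<in> topspace (zariski_toric N \<Sigma>)"
    using continuous_map_image_subset_topspace[OF cont] x(2) by blast
  then obtain \<sigma> \<gamma> where s: "\<sigma> \<in> \<Sigma>" and g: "\<gamma> \<in> chart N \<sigma>" "f (proj_pt x) = toric_pt N \<Sigma> \<sigma> \<gamma>"
    unfolding topspace_zariski_toric by blast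
  obtain h where h: "h \<in> hom_polys n" "h \<noteq> 0" "\<And>y. y \<in> punctured_space n \<Longrightarrow> poly_eval h y \<noteq> 0 \<Longrightarrow>
     proj_pt y \<in> U \<and> y \<in> G {0} \<and> f (proj_pt y) = pt {0} y" using ag unfolding agrees_generically_def by blast
  have key: "(\<forall>p\<in>P. poly_eval p x = 0 \<longrightarrow> 0 \<le> u \<bullet> e p) \<and> \<gamma> u = gam x u" if u: "u \<in> S \<sigma>" for u
  proof -
    obtain w a b k where w: "w \<in> hom_polys n" "poly_eval w x \<noteq> 0" and ab: "a \<in> polys {..n}" "b \<in> polys {..n}"
      "homogeneous k a" "homogeneous k b" and
      v: "\<And>y. y \<in> punctured_space n \<Longrightarrow> poly_eval w y \<noteq> 0 \<Longrightarrow> proj_pt y \<in> U \<and>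
        f (proj_pt y) \<in> toric_pt N \<Sigma> \<sigma> ` chart N \<sigma> \<and> poly_eval b y \<noteq> 0 \<and>
        character_value \<sigma> u (f (proj_pt y)) = poly_eval a y / poly_eval b y"
      using morphism_character[OF mor s u x] g by blast
    have wh: "w * h \<in> polys {..n}" "w * h \<noteq> 0"
      using hom_polys_mult[OF w(1) h(1)] w(2) h(2) by (auto simp: hom_polys_def)
    have "poly_eval b y \<noteq> 0 \<and> gam y u = poly_eval a y / poly_eval b y"
      if y: "y \<in> punctured_space n" "poly_eval (w * h) y \<noteq> 0" for y
    proof -
      have nz: "poly_eval w y \<noteq> 0" "poly_eval h y \<noteq> 0" using y(2) by (auto simp: poly_eval_mult)
      note vy = v[OF y(1) nz(1)] and hy = h(3)[OF y(1) nz(2)]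
      have c0: "restrict (gam y) (S {0}) \<in> chart N {0}" using gam_chart[OF zero_in] hy by blast
      obtain \<beta> where b: "\<beta> \<in> chart N \<sigma>" "f (proj_pt y) = toric_pt N \<Sigma> \<sigma> \<beta>" using vy by blast
      have "\<beta> = restrict (restrict (gam y) (S {0})) (S \<sigma>)"
        by (rule toric_pt_torus[OF s b(1) c0]) (use b(2) hy in \<open>simp add: pt_def\<close>)
      then have "\<beta> u = gam y u" using u semigroup_dual[of \<sigma>] semigroup_zero by auto
      then show ?thesis using vy b character_value_eq[OF s b(1)] by simp
    qed
    note fr = fraction_at_point[OF _ ab(1,2) wh this, where x = x]
    have uM: "u \<in> M" using u semigroup_dual by blast
    have bx: "poly_eval b x \<noteq> 0" and "\<gamma> u = poly_eval a x / poly_eval b x"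
      using v[OF x(1) w(2)] g character_value_eq[OF s g(1)] by auto
    then show ?thesis using fr uM by auto
  qed
  have xG: "x \<in> G \<sigma>" unfolding G_def using x(1) key pairing_nonneg_imp_mem[OF s] by blast
  have "\<gamma> = restrict (gam x) (S \<sigma>)"
    by (rule extensionalityI[OF chartD(1)[OF g(1)] restrict_extensional]) (use key in auto)
  then show ?thesis using s xG g(2) by (auto simp: pt_def)
qed

context
  fixes \<phi> :: "'a map_rep set" and U0 f0
  assumes base: "(U0, f0) \<in> map_reps n N \<Sigma>" "agrees_generically U0 f0"
    and phi: "\<phi> = map_equiv n N \<Sigma> `` {(U0, f0)}"
begin

lemma representatives:
  assumes "(U, f) \<in> \<phi>"
  shows "morphism n N \<Sigma> U f" "agrees_generically U f"
proof -
  have *: "(U, f) \<in> map_reps n N \<Sigma>" "\<forall>Q\<in>U0 \<inter> U. f0 Q = f Q"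
    using assms unfolding phi by (auto simp: map_equiv_def)
  then show mor: "morphism n N \<Sigma> U f" by (auto simp: map_reps_def)
  have op: "openin (zariski_proj n) U" "U \<noteq> {}" using * by (auto simp: map_reps_def morphism_def)
  obtain w where w: "w \<in> hom_polys n" "w \<noteq> 0"
    "\<And>x. x \<in> punctured_space n \<Longrightarrow> poly_eval w x \<noteq> 0 \<Longrightarrow> proj_pt x \<in> U"
    using nonempty_open_hom_poly[OF op] by blast
  obtain h where h: "h \<in> hom_polys n" "h \<noteq> 0" "\<And>y. y \<in> punctured_space n \<Longrightarrow> poly_eval h y \<noteq> 0 \<Longrightarrow>
     proj_pt y \<in> U0 \<and> y \<in> G {0} \<and> f0 (proj_pt y) = pt {0} y" using base(2) unfolding agrees_generically_def by blast
  show "agrees_generically U f" unfolding agrees_generically_def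
  proof (rule bexI[OF _ hom_polys_mult[OF w(1) h(1)]], intro conjI ballI impI)
    show "w * h \<noteq> 0" using w h by simp
    fix x assume x: "x \<in> punctured_space n" "poly_eval (w * h) x \<noteq> 0"
    then have "poly_eval w x \<noteq> 0" "poly_eval h x \<noteq> 0" by (auto simp: poly_eval_mult)
    note a = w(3)[OF x(1) this(1)] h(3)[OF x(1) this(2)]
    then show "proj_pt x \<in> U" "x \<in> G {0}" by auto
    have "f0 (proj_pt x) = f (proj_pt x)" using a *(2) by blast
    then show "f (proj_pt x) = pt {0} x" using a by simp
  qed
qed

lemma representative_domain:
  assumes "(U, f) \<in> \<phi>" "Q \<in> U" shows "Q \<in> Dom" "f Q = fmap Q"
proof -
  have "openin (zariski_proj n) U" using representatives(1)[OF assms(1)] by (simp add: morphism_def)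
  then have "Q \<in> proj_space n" using openin_subset topspace_zariski_proj assms(2) by blast
  then obtain x where x: "x \<in> punctured_space n" "Q = proj_pt x" by (auto simp: proj_space_def)
  obtain \<sigma> where "\<sigma> \<in> \<Sigma>" "x \<in> G \<sigma>" "f Q = pt \<sigma> x"
    using representative_value[OF representatives[OF assms(1)] x(1)] assms(2) x(2) by blast
  then show "Q \<in> Dom" "f Q = fmap Q" using fmap_eq x by (auto simp: Dom_def)
qed

lemma base_in: "(U0, f0) \<in> \<phi>"
  using base unfolding phi map_equiv_def by auto

lemma fmap_in: "(Dom, fmap) \<in> \<phi>"
proof -
  have "U0 \<noteq> {}" using base by (auto simp: map_reps_def)
  then have "Dom \<noteq> {}" using representative_domain(1)[OF base_in] by blast
  then have "(Dom, fmap) \<in> map_reps n N \<Sigma>" using fmap_morphism by (auto simp: map_reps_def)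
  then show ?thesis using base representative_domain(2)[OF base_in] unfolding phi map_equiv_def by auto
qed

lemma Reg_eq: "Reg \<phi> = Dom"
  unfolding Reg_def using representative_domain(1) fmap_in by fast

end

end

section \<open>Nonsingularity in codimension one\<close>

context valuation_data
begin

context
  fixes \<phi> :: "'a map_rep set" and U0 f0
  assumes base: "(U0, f0) \<in> map_reps n N \<Sigma>" "agrees_generically U0 f0"
    and phi: "\<phi> = map_equiv n N \<Sigma> `` {(U0, f0)}"
    and codim: "codim (zariski_proj n) (rat_preimage \<phi> (singular_locus N \<Sigma>)) \<ge> 2"
begin

text \<open>The generic point of the hypersurface \<open>p = 0\<close> is mapped into the orbit of the cone whose relative
  interior contains \<open>e p\<close>.\<close>

lemma integral_coefficients:
  assumes p: "p \<in> P" "e p \<noteq> 0" and t: "\<tau> \<in> \<Sigma>"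
    and c: "e p = (\<Sum>v\<in>R \<tau>. c v *\<^sub>R v)" "\<And>v. v \<in> R \<tau> \<Longrightarrow> c v > 0" and v: "v \<in> R \<tau>"
  shows "c v \<in> \<int>"
proof -
  \<comment> \<open>A second prime supplies the form that keeps zeros away from the origin in the
    hypersurface lemmas. If \<open>p\<close> were alone, the degree condition would give
    \<open>e p = 0\<close>.\<close>
  have "\<exists>q\<in>P. q \<noteq> p"
  proof (rule ccontr)
    assume "\<not> ?thesis"
    then have "P = {p}" using p(1) by blast
    moreover obtain u where u: "u \<in> S {0}" "u \<bullet> e p < 0"
      using separate_from_cone[OF zero_in span_base[OF eN[OF p(1)]]] p(2) by blast
    ultimately have "of_nat (hom_deg p) * (u \<bullet> e p) = 0" using deg[of u] semigroup_zero by simp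
    then show False using u(2) P_props(4)[OF p(1)] by simp
  qed
  then obtain q where q: "q \<in> P" "q \<noteq> p" by blast
  have q0: "poly_eval q (\<lambda>_. 0) = 0"
    using poly_eval_homogeneous_zero[OF hdeg[OF q(1)] P_props(4)[OF q(1)]] .
  have nq: "\<not> dvd_in (polys {..n}) p q" using nonassoc[OF p(1) q(1)] q(2) by blast
  \<comment> \<open>Where \<open>h\<close> is nonzero, \<open>p\<close> is the only prime that can
    vanish, so \<open>e p\<close> alone decides the orbit.\<close>
  define h where "h = (\<Prod>r\<in>P. r ^ (if r = p then 0 else 1))"
  have nh: "\<not> dvd_in (polys {..n}) p h"
    unfolding h_def using prime_not_dvd_prod[OF p(1), of "\<lambda>r. if r = p then 0 else 1"] by simp
  have hH: "h \<in> hom_polys n" unfolding h_def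
    by (rule hom_polys_prod) (use P_props(3) hom_polys_1 in auto)
  have pos: "\<forall>v\<in>R \<tau>. 0 \<le> c v" using c(2) by (simp add: less_imp_le)
  have "e p \<in> cone_of (R \<tau>)" unfolding cone_of_def c(1) using pos by blast
  then have ep: "e p \<in> \<tau>" using cone_eq[OF t] by simp
  have pts: "x \<in> G \<tau> \<and> (\<forall>u\<in>S \<tau>. restrict (gam x) (S \<tau>) u \<noteq> 0 \<longleftrightarrow> (\<forall>v\<in>R \<tau>. u \<bullet> v = 0))"
    if x: "x \<in> punctured_space n" "poly_eval p x = 0" "poly_eval h x \<noteq> 0" for x
  proof -
    have nz: "poly_eval r x \<noteq> 0" if "r \<in> P" "r \<noteq> p" for r
      using x(3) that finP by (auto simp: h_def poly_eval_prod poly_eval_power split: if_splits)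
    have "x \<in> G \<tau>" unfolding G_def using x(1) nz ep by blast
    moreover have "restrict (gam x) (S \<tau>) u \<noteq> 0 \<longleftrightarrow> (\<forall>v\<in>R \<tau>. u \<bullet> v = 0)" if u: "u \<in> S \<tau>" for u
    proof -
      have "restrict (gam x) (S \<tau>) u \<noteq> 0 \<longleftrightarrow> u \<bullet> e p = 0"
        using gam_nonzero_iff[of u x] semigroup_dual[of \<tau>] u nz p(1) x(2) by auto
      also have "\<dots> \<longleftrightarrow> (\<forall>v\<in>R \<tau>. c v = 0 \<or> u \<bullet> v = 0)"
        unfolding c(1) using cone_of_pairing(2)[OF finite_gens[OF t] _ pos] u semigroup_iff[OF t] by blast
      also have "\<dots> \<longleftrightarrow> (\<forall>v\<in>R \<tau>. u \<bullet> v = 0)" using c(2) by (metis less_irrefl)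
      finally show ?thesis .
    qed
    ultimately show ?thesis by blast
  qed
  show ?thesis
  \<comment> \<open>Either one of these points has a nonsingular image, and the tangent space count
    applies, or all of them map to the singular locus. Then the preimage of that locus would have
    codimension at most 1.\<close>
  proof (cases "\<exists>x\<in>punctured_space n. poly_eval p x = 0 \<and> poly_eval h x \<noteq> 0 \<and>
      complex_dim (tangent_space N \<tau> (restrict (gam x) (S \<tau>))) = dim N")
    case True
    then obtain x where x: "x \<in> punctured_space n" "poly_eval p x = 0" "poly_eval h x \<noteq> 0"
      "complex_dim (tangent_space N \<tau> (restrict (gam x) (S \<tau>))) = dim N" by blast
    have "x \<in> G \<tau>" and orb: "\<And>u. u \<in> S \<tau> \<Longrightarrow> restrict (gam x) (S \<tau>) u \<noteq> 0 \<longleftrightarrow> (\<forall>v\<in>R \<tau>. u \<bullet> v = 0)"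
      using pts[OF x(1-3)] by blast+
    from nonsingular_coefficients[OF t gam_chart[OF t this(1)] orb x(4) eN[OF p(1)] c(1) v]
    show ?thesis .
  next
    case False
    have "proj_pt x \<in> rat_preimage \<phi> (singular_locus N \<Sigma>)"
      if x: "x \<in> punctured_space n" "poly_eval p x = 0" "poly_eval h x \<noteq> 0" for x
    proof -
      have xG: "x \<in> G \<tau>" using pts[OF x] by blast
      have "complex_dim (tangent_space N \<tau> (restrict (gam x) (S \<tau>))) \<noteq> dim N" using False x by blast
      then have "fmap (proj_pt x) \<in> singular_locus N \<Sigma>"
        unfolding fmap_eq[OF t xG] pt_def singular_locus_def using t gam_chart[OF t xG] by blast
      moreover have "proj_pt x \<in> Dom" using t xG by (auto simp: Dom_def)
      ultimately show ?thesis using fmap_in[OF base phi] by (auto simp: rat_preimage_def)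
    qed
    then have "codim (zariski_proj n) (rat_preimage \<phi> (singular_locus N \<Sigma>)) \<le> 1"
      by (rule codim_le_1[OF prime[OF p(1)] P_props(3)[OF p(1)] P_props(3)[OF q(1)] q0 nq hH nh])
    then have "(2::enat) \<le> 1" using codim by (rule order_trans[rotated])
    then show ?thesis by (simp add: numeral_eq_enat one_enat_def)
  qed
qed

text \<open>The generators with positive coefficient span the smallest cone containing
  \<open>e p\<close>, to which integrality applies. Another cone contains \<open>e p\<close> exactly
  if it contains all these generators, because it meets the smallest cone in a face.\<close>

lemma ray_multiplicities:
  assumes p: "p \<in> P"
  shows "\<exists>a::'a \<Rightarrow> nat. e p = (\<Sum>v\<in>rays. of_nat (a v) *\<^sub>R v) \<and>
    (\<forall>\<sigma>\<in>\<Sigma>. e p \<in> \<sigma> \<longleftrightarrow> (\<forall>v\<in>rays. a v \<noteq> 0 \<longrightarrow> v \<in> \<sigma>))"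
proof (cases "e p = 0")
  case True
  then show ?thesis using zero_mem by (intro exI[of _ "\<lambda>_. 0"]) auto
next
  case False
  obtain \<sigma> where s: "\<sigma> \<in> \<Sigma>" "e p \<in> \<sigma>" using supp[OF p] by blast
  then have "e p \<in> cone_of (R \<sigma>)" using cone_eq by simp
  then obtain c where c: "e p = (\<Sum>v\<in>R \<sigma>. c v *\<^sub>R v)" "\<forall>v\<in>R \<sigma>. 0 \<le> c v" unfolding cone_of_def by blast
  define A where "A = {v \<in> R \<sigma>. c v > 0}"
  define \<tau> where "\<tau> = cone_of A"
  have t: "\<tau> \<in> \<Sigma>" and Rt: "R \<tau> = A"
    unfolding \<tau>_def by (rule subcone_in[OF s(1)], force simp: A_def)+
  have cA: "e p = (\<Sum>v\<in>R \<tau>. c v *\<^sub>R v)" unfolding c(1) Rt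
    by (rule sum.mono_neutral_right) (use finite_gens[OF s(1)] c(2) in \<open>force simp: A_def\<close>)+
  have cpos: "\<And>v. v \<in> R \<tau> \<Longrightarrow> c v > 0" unfolding Rt by (simp add: A_def)
  have cnn: "\<forall>v\<in>R \<tau>. 0 \<le> c v" using cpos by (simp add: less_imp_le)
  have cint: "of_int \<lfloor>c v\<rfloor> = c v" if "v \<in> R \<tau>" for v
    using integral_coefficients[OF p False t cA cpos that] by (rule Ints_floor)
  define a where "a v = (if v \<in> R \<tau> then nat \<lfloor>c v\<rfloor> else 0)" for v
  have av: "of_nat (a v) = c v" if "v \<in> R \<tau>" for v
    using cint[OF that] cpos[OF that] that by (simp add: a_def)
  have Rr: "R \<tau> \<subseteq> rays" using gens_eq[OF t] by blast
  have "e p = (\<Sum>v\<in>R \<tau>. of_nat (a v) *\<^sub>R v)" unfolding cA using av by (intro sum.cong) auto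
  also have "\<dots> = (\<Sum>v\<in>rays. of_nat (a v) *\<^sub>R v)"
    by (rule sum.mono_neutral_left) (use finite_rays Rr in \<open>auto simp: a_def\<close>)
  finally have 1: "e p = (\<Sum>v\<in>rays. of_nat (a v) *\<^sub>R v)" .
  have ep: "e p \<in> \<tau>"
  proof -
    have "e p \<in> cone_of (R \<tau>)" unfolding cone_of_def cA using cnn by blast
    then show ?thesis using cone_eq[OF t] by simp
  qed
  have az: "a v \<noteq> 0 \<longleftrightarrow> v \<in> R \<tau>" for v
    using av[of v] cpos[of v] by (auto simp: a_def split: if_splits)
  have 2: "e p \<in> \<kappa> \<longleftrightarrow> (\<forall>v\<in>rays. a v \<noteq> 0 \<longrightarrow> v \<in> \<kappa>)" if k: "\<kappa> \<in> \<Sigma>" for \<kappa>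
  proof -
    obtain m where m: "m \<in> S \<tau>" "\<And>v. v \<in> \<tau> \<Longrightarrow> m \<bullet> v = 0 \<longleftrightarrow> v \<in> \<kappa>"
      using common_face[OF t k] by metis
    have "e p \<in> \<kappa> \<longleftrightarrow> m \<bullet> e p = 0" using m(2)[OF ep] by simp
    also have "\<dots> \<longleftrightarrow> (\<forall>v\<in>R \<tau>. c v = 0 \<or> m \<bullet> v = 0)"
      unfolding cA using cone_of_pairing(2)[OF finite_gens[OF t] _ cnn] m(1) semigroup_iff[OF t] by blast
    also have "\<dots> \<longleftrightarrow> (\<forall>v\<in>R \<tau>. v \<in> \<kappa>)"
      using cpos m(2) cone_gens_subset(1)[of N \<tau>] by (metis less_irrefl subsetD)
    also have "\<dots> \<longleftrightarrow> (\<forall>v\<in>rays. a v \<noteq> 0 \<longrightarrow> v \<in> \<kappa>)" using az Rr by blast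
    finally show ?thesis .
  qed
  show ?thesis using 1 2 by blast
qed

section \<open>The lifting\<close>

context
  fixes a :: "nat mpoly \<Rightarrow> 'a \<Rightarrow> nat" and s1 s2 :: "'a \<Rightarrow> real"
  assumes a_sum: "\<And>p. p \<in> P \<Longrightarrow> e p = (\<Sum>v\<in>rays. of_nat (a p v) *\<^sub>R v)"
    and a_mem: "\<And>p \<sigma>. p \<in> P \<Longrightarrow> \<sigma> \<in> \<Sigma> \<Longrightarrow> e p \<in> \<sigma> \<longleftrightarrow> (\<forall>v\<in>rays. a p v \<noteq> 0 \<longrightarrow> v \<in> \<sigma>)"
    and s1: "y1 = (\<Sum>v\<in>rays. s1 v *\<^sub>R v)" and s2: "y2 = (\<Sum>v\<in>rays. s2 v *\<^sub>R v)"
begin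

text \<open>The constants are chosen so that the product of their powers with exponents
  \<open>u \<bullet> v\<close> over the rays is the constant of the pullback of \<open>u\<close>;
  this is why \<open>y1\<close> and \<open>y2\<close> are expanded in the rays.\<close>

definition F :: "'a \<Rightarrow> nat mpoly" where
  "F v = const_poly (exp (Complex (s1 v) (s2 v))) * (\<Prod>p\<in>P. p ^ a p v)"

lemma F_polys: "F v \<in> polys {..n}" "\<exists>k. homogeneous k (F v)"
proof -
  show "F v \<in> polys {..n}" unfolding F_def
    by (intro subring_ofD(4)[OF polys_subring] const_in_polys monomial_in_polys order_refl)
  have "homogeneous (\<Sum>p\<in>P. a p v * hom_deg p) (F v)" unfolding F_def
    by (intro homogeneous_const_mult homogeneous_prod homogeneous_power hdeg)
  then show "\<exists>k. homogeneous k (F v)" by blast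
qed

lemma F_eval: "poly_eval (F v) x = exp (Complex (s1 v) (s2 v)) * (\<Prod>p\<in>P. poly_eval p x ^ a p v)"
  by (simp add: F_def poly_eval_simps)

lemma F_nonzero_iff: "poly_eval (F v) x \<noteq> 0 \<longleftrightarrow> (\<forall>p\<in>P. poly_eval p x = 0 \<longrightarrow> a p v = 0)"
  unfolding F_eval using finP by auto

text \<open>\<open>F v\<close> vanishes at x exactly if \<open>a p v\<close> is nonzero for some
  \<open>p\<close> vanishing there. Excluding this for all rays outside \<open>\<sigma>\<close>
  means, by \<open>a_mem\<close>, that each such \<open>e p\<close> lies in
  \<open>\<sigma>\<close>.\<close>

lemma G_iff_F:
  assumes x: "x \<in> punctured_space n" and s: "\<sigma> \<in> \<Sigma>"
  shows "x \<in> G \<sigma> \<longleftrightarrow> (\<forall>v\<in>rays - R \<sigma>. poly_eval (F v) x \<noteq> 0)"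
proof -
  have "x \<in> G \<sigma> \<longleftrightarrow> (\<forall>p\<in>P. poly_eval p x = 0 \<longrightarrow> (\<forall>v\<in>rays. a p v \<noteq> 0 \<longrightarrow> v \<in> \<sigma>))"
    using x a_mem[OF _ s] by (simp add: G_def)
  also have "\<dots> \<longleftrightarrow> (\<forall>v\<in>rays - R \<sigma>. poly_eval (F v) x \<noteq> 0)"
  proof -
    have d: "rays - R \<sigma> = rays - \<sigma>" using gens_eq[OF s] by blast
    show ?thesis unfolding F_nonzero_iff d
    proof (intro iffI ballI impI)
      fix v p assume L: "\<forall>p\<in>P. poly_eval p x = 0 \<longrightarrow> (\<forall>v\<in>rays. a p v \<noteq> 0 \<longrightarrow> v \<in> \<sigma>)"
        and vp: "v \<in> rays - \<sigma>" "p \<in> P" "poly_eval p x = 0"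
      have "\<forall>v\<in>rays. a p v \<noteq> 0 \<longrightarrow> v \<in> \<sigma>" using L vp(2,3) by simp
      then show "a p v = 0" using vp(1) by auto
    next
      fix p v assume L: "\<forall>v\<in>rays - \<sigma>. \<forall>p\<in>P. poly_eval p x = 0 \<longrightarrow> a p v = 0"
        and vp: "p \<in> P" "poly_eval p x = 0" "v \<in> rays" "a p v \<noteq> 0"
      show "v \<in> \<sigma>"
      proof (rule ccontr)
        assume "v \<notin> \<sigma>"
        then have "a p v = 0" using L vp(1-3) by simp
        then show False using vp(4) by simp
      qed
    qed
  qed
  finally show ?thesis .
qed

text \<open>Expanding \<open>e p\<close> in the rays, the exponents of \<open>p\<close> coming from
  the components of the lifting add up to \<open>u \<bullet> e p\<close>, and the constants combine
  in the same way.\<close>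

lemma gam_eq_F:
  assumes s: "\<sigma> \<in> \<Sigma>" and x: "x \<in> G \<sigma>" and u: "u \<in> S \<sigma>"
  shows "(\<Prod>v\<in>rays. poly_eval (F v) x powi \<lfloor>u \<bullet> v\<rfloor>) = gam x u"
proof -
  have uM: "u \<in> M" using u semigroup_dual by blast
  have fl: "of_int \<lfloor>u \<bullet> v\<rfloor> = u \<bullet> v" if "v \<in> rays" for v
    using dual_Ints[OF lat uM] that rays_subset(1) by (intro Ints_floor) blast
  have "(\<Prod>v\<in>rays. exp (Complex (s1 v) (s2 v)) powi \<lfloor>u \<bullet> v\<rfloor>) =
      exp (\<Sum>v\<in>rays. of_int \<lfloor>u \<bullet> v\<rfloor> * Complex (s1 v) (s2 v))"
    unfolding exp_sum[OF finite_rays] by (simp add: exp_power_int)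
  also have "(\<Sum>v\<in>rays. of_int \<lfloor>u \<bullet> v\<rfloor> * Complex (s1 v) (s2 v)) = Complex (u \<bullet> y1) (u \<bullet> y2)"
    unfolding s1 s2 by (simp add: complex_eq_iff inner_sum_right fl mult.commute)
  finally have c: "(\<Prod>v\<in>rays. exp (Complex (s1 v) (s2 v)) powi \<lfloor>u \<bullet> v\<rfloor>) = exp (Complex (u \<bullet> y1) (u \<bullet> y2))" .
  have "(\<Prod>v\<in>rays. (poly_eval p x ^ a p v) powi \<lfloor>u \<bullet> v\<rfloor>) = poly_eval p x powi \<lfloor>u \<bullet> e p\<rfloor>"
    if p: "p \<in> P" for p
  proof -
    have "of_int (\<Sum>v\<in>rays. int (a p v) * \<lfloor>u \<bullet> v\<rfloor>) = u \<bullet> e p"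
      unfolding a_sum[OF p] by (simp add: inner_sum_right fl)
    then have ep: "\<lfloor>u \<bullet> e p\<rfloor> = (\<Sum>v\<in>rays. int (a p v) * \<lfloor>u \<bullet> v\<rfloor>)" by (metis floor_of_int)
    show ?thesis
    proof (cases "poly_eval p x = 0")
      case False
      show ?thesis unfolding ep using power_int_prod_const[OF False] .
    next
      \<comment> \<open>Exponents of 0 may not be added freely. Here every contributing ray lies in
        \<open>\<sigma>\<close>, so each exponent is nonnegative and the computation can be done in
        the naturals.\<close>
      case True
      then have "e p \<in> \<sigma>" using x p by (auto simp: G_def)
      then have nn: "0 \<le> int (a p v) * \<lfloor>u \<bullet> v\<rfloor>" if "v \<in> rays" for v
        using a_mem[OF p s] u that by (cases "a p v = 0") (auto simp: dual_semigroup_def)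
      have "(poly_eval p x ^ a p v) powi \<lfloor>u \<bullet> v\<rfloor> = poly_eval p x ^ nat (int (a p v) * \<lfloor>u \<bullet> v\<rfloor>)" if "v \<in> rays" for v
      proof -
        have "(poly_eval p x ^ a p v) powi \<lfloor>u \<bullet> v\<rfloor> = poly_eval p x powi (int (a p v) * \<lfloor>u \<bullet> v\<rfloor>)"
          by (simp add: power_int_mult)
        then show ?thesis using nn[OF that] by (simp add: power_int_def)
      qed
      then have "(\<Prod>v\<in>rays. (poly_eval p x ^ a p v) powi \<lfloor>u \<bullet> v\<rfloor>) =
          poly_eval p x ^ (\<Sum>v\<in>rays. nat (int (a p v) * \<lfloor>u \<bullet> v\<rfloor>))"
        unfolding power_sum by (intro prod.cong) auto
      also have "(\<Sum>v\<in>rays. nat (int (a p v) * \<lfloor>u \<bullet> v\<rfloor>)) = nat \<lfloor>u \<bullet> e p\<rfloor>"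
      proof -
        have "int (\<Sum>v\<in>rays. nat (int (a p v) * \<lfloor>u \<bullet> v\<rfloor>)) = \<lfloor>u \<bullet> e p\<rfloor>" unfolding ep using nn by simp
        then show ?thesis by linarith
      qed
      also have "poly_eval p x ^ nat \<lfloor>u \<bullet> e p\<rfloor> = poly_eval p x powi \<lfloor>u \<bullet> e p\<rfloor>"
        unfolding ep using nn by (simp add: power_int_def sum_nonneg)
      finally show ?thesis .
    qed
  qed
  then have "(\<Prod>v\<in>rays. \<Prod>p\<in>P. (poly_eval p x ^ a p v) powi \<lfloor>u \<bullet> v\<rfloor>) =
      (\<Prod>p\<in>P. poly_eval p x powi \<lfloor>u \<bullet> e p\<rfloor>)" by (subst prod.swap) simp
  moreover have "(\<Prod>p\<in>P. y p) powi k = (\<Prod>p\<in>P. y p powi k)" for y :: "nat mpoly \<Rightarrow> complex" and k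
    by (induction P rule: infinite_finite_induct) (auto simp: power_int_mult_distrib)
  ultimately show ?thesis
    unfolding F_eval power_int_mult_distrib prod.distrib c gam_def by simp
qed

lemma tuple_eval_F: "v \<in> rays \<Longrightarrow> tuple_eval N \<Sigma> F x v = poly_eval (F v) x"
  by (simp add: tuple_eval_def)

text \<open>All elements of the ideal vanish at z exactly if its generating monomials do; choosing
  coefficient 1 for one cone and 0 for the others isolates a generator.\<close>

lemma exceptional_iff:
  assumes z: "z \<in> affine_space rays"
  shows "z \<in> exceptional_set N \<Sigma> \<longleftrightarrow> \<not> (\<exists>\<sigma>\<in>\<Sigma>. \<forall>v\<in>rays - R \<sigma>. z v \<noteq> 0)"
proof
  assume ez: "z \<in> exceptional_set N \<Sigma>"
  show "\<not> (\<exists>\<sigma>\<in>\<Sigma>. \<forall>v\<in>rays - R \<sigma>. z v \<noteq> 0)"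
  proof
    assume "\<exists>\<sigma>\<in>\<Sigma>. \<forall>v\<in>rays - R \<sigma>. z v \<noteq> 0"
    then obtain \<sigma> where s: "\<sigma> \<in> \<Sigma>" "\<forall>v\<in>rays - R \<sigma>. z v \<noteq> 0" by blast
    define q where "q \<tau> = (if \<tau> = \<sigma> then 1 else 0 :: 'a mpoly)" for \<tau>
    have finS: "finite \<Sigma>" using fan by (auto simp: is_fan_def)
    have "(\<Sum>\<tau>\<in>\<Sigma>. q \<tau> * (\<Prod>v\<in>rays - R \<tau>. poly_var v)) \<in> irrelevant_ideal N \<Sigma>"
      unfolding irrelevant_ideal_def by (intro CollectI exI[of _ q]) (auto simp: q_def polys_def)
    then have "poly_eval (\<Sum>\<tau>\<in>\<Sigma>. q \<tau> * (\<Prod>v\<in>rays - R \<tau>. poly_var v)) z = 0"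
      using ez by (simp add: exceptional_set_def)
    moreover have "(\<Sum>\<tau>\<in>\<Sigma>. q \<tau> * (\<Prod>v\<in>rays - R \<tau>. poly_var v)) =
        (\<Sum>\<tau>\<in>\<Sigma>. if \<tau> = \<sigma> then \<Prod>v\<in>rays - R \<sigma>. poly_var v else 0)"
      by (intro sum.cong) (auto simp: q_def)
    ultimately have "poly_eval (\<Prod>v\<in>rays - R \<sigma>. poly_var v) z = 0" using finS s(1) by simp
    then show False using s(2) finite_rays by (auto simp: poly_eval_prod)
  qed
next
  assume "\<not> (\<exists>\<sigma>\<in>\<Sigma>. \<forall>v\<in>rays - R \<sigma>. z v \<noteq> 0)"
  then have *: "(\<Prod>v\<in>rays - R \<sigma>. z v) = 0" if "\<sigma> \<in> \<Sigma>" for \<sigma>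
    using that finite_rays by (auto intro: prod_zero)
  show "z \<in> exceptional_set N \<Sigma>" unfolding exceptional_set_def
  proof (intro CollectI conjI z ballI)
    fix r assume "r \<in> irrelevant_ideal N \<Sigma>"
    then obtain q where "r = (\<Sum>\<sigma>\<in>\<Sigma>. q \<sigma> * (\<Prod>v\<in>rays - R \<sigma>. poly_var v))"
      unfolding irrelevant_ideal_def by blast
    then show "poly_eval r z = 0" using * by (simp add: poly_eval_sum poly_eval_mult poly_eval_prod)
  qed
qed

lemma lifting_exceptional_iff:
  assumes "x \<in> punctured_space n"
  shows "tuple_eval N \<Sigma> F x \<notin> exceptional_set N \<Sigma> \<longleftrightarrow> (\<exists>\<sigma>\<in>\<Sigma>. x \<in> G \<sigma>)"
proof -
  have "tuple_eval N \<Sigma> F x \<in> affine_space rays" by (auto simp: affine_space_def tuple_eval_def)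
  then show ?thesis using exceptional_iff G_iff_F[OF assms] tuple_eval_F by auto
qed

text \<open>Whichever cone the choice in \<open>cox_quotient\<close> selects, x lies in its
  \<open>G\<close>, and \<open>pt_indep\<close> identifies the resulting points.\<close>

lemma cox_quotient_lifting:
  assumes s: "\<sigma> \<in> \<Sigma>" and x: "x \<in> G \<sigma>"
  shows "cox_quotient N \<Sigma> (tuple_eval N \<Sigma> F x) = pt \<sigma> x"
proof -
  let ?z = "tuple_eval N \<Sigma> F x"
  define \<tau> where "\<tau> = (SOME \<sigma>. \<sigma> \<in> \<Sigma> \<and> (\<forall>v\<in>rays - R \<sigma>. ?z v \<noteq> 0))"
  have xp: "x \<in> punctured_space n" using x by (rule G_punctured)
  have "\<tau> \<in> \<Sigma> \<and> (\<forall>v\<in>rays - R \<tau>. ?z v \<noteq> 0)"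
    unfolding \<tau>_def by (rule someI[of _ \<sigma>]) (use s x G_iff_F[OF xp s] tuple_eval_F in auto)
  then have t: "\<tau> \<in> \<Sigma>" "x \<in> G \<tau>" using G_iff_F[OF xp] tuple_eval_F by auto
  have "(\<lambda>u\<in>S \<tau>. \<Prod>v\<in>rays. ?z v powi \<lfloor>u \<bullet> v\<rfloor>) = restrict (gam x) (S \<tau>)"
    by (rule restrict_ext) (use gam_eq_F[OF t] tuple_eval_F in simp)
  then have "cox_quotient N \<Sigma> ?z = pt \<tau> x" unfolding cox_quotient_def Let_def \<tau>_def[symmetric] pt_def by simp
  then show ?thesis using pt_indep[OF s t(1) x t(2)] by simp
qed

lemma complete_lifting_F: "complete_lifting n N \<Sigma> \<phi> F"
  unfolding complete_lifting_def
proof (intro conjI ballI F_polys)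
  fix r assume r: "r \<in> \<phi>"
  obtain U f where Uf: "r = (U, f)" by (cases r)
  note rep = representatives[OF base phi r[unfolded Uf]]
  obtain h where h: "h \<in> hom_polys n" "h \<noteq> 0" "\<And>y. y \<in> punctured_space n \<Longrightarrow> poly_eval h y \<noteq> 0 \<Longrightarrow>
     proj_pt y \<in> U \<and> y \<in> G {0} \<and> f (proj_pt y) = pt {0} y" using rep(2) unfolding agrees_generically_def by blast
  \<comment> \<open>The coordinate factor removes the origin from this affine open set, so that its
    points have images in projective space.\<close>
  define W where "W = {x \<in> affine_space {..n}. poly_eval (h * poly_var 0) x \<noteq> 0}"
  have hA: "h * poly_var 0 \<in> polys {..n}"
    using h(1) poly_var_in_polys[of 0 "{..n}"] subring_ofD(4)[OF polys_subring] by (auto simp: hom_polys_def)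
  have "poly_var (0::nat) \<noteq> 0"
    using poly_eval_poly_var[of "0::nat" "\<lambda>_. 1"] poly_eval_zero[of "\<lambda>_. 1"] by (metis zero_neq_one)
  then obtain x0 where "x0 \<in> W" using nonzero_point[OF _ hA] h(2) unfolding W_def by auto
  moreover have "openin (zariski_affine {..n}) W"
    unfolding W_def zariski_affine_def using hA by (intro topology_generated_by_Basis) blast
  moreover have Wp: "x \<in> punctured_space n \<and> poly_eval h x \<noteq> 0" if "x \<in> W" for x
    using that by (auto simp: W_def punctured_space_def poly_eval_mult)
  moreover have "tuple_eval N \<Sigma> F x \<notin> exceptional_set N \<Sigma> \<and> proj_pt x \<in> U \<and>
      cox_quotient N \<Sigma> (tuple_eval N \<Sigma> F x) = f (proj_pt x)" if x: "x \<in> W" for x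
    using h(3)[of x] Wp[OF x] lifting_exceptional_iff[of x] zero_in cox_quotient_lifting[OF zero_in] by auto
  ultimately show "case r of (U, f) \<Rightarrow> \<exists>W. openin (zariski_affine {..n}) W \<and> W \<noteq> {} \<and> W \<subseteq> punctured_space n \<and>
        (\<forall>x\<in>W. tuple_eval N \<Sigma> F x \<notin> exceptional_set N \<Sigma> \<and> proj_pt x \<in> U \<and>
           cox_quotient N \<Sigma> (tuple_eval N \<Sigma> F x) = f (proj_pt x))"
    unfolding Uf by auto
next
  have "proj_pt x \<in> Dom \<longleftrightarrow> tuple_eval N \<Sigma> F x \<notin> exceptional_set N \<Sigma>" if "x \<in> punctured_space n" for x
    using Dom_iff[OF that] lifting_exceptional_iff[OF that] by simp
  moreover have "Dom \<subseteq> proj_space n" using openin_subset[OF open_Dom] topspace_zariski_proj by simp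
  ultimately show "Reg \<phi> = proj_space n - proj_pt ` {x \<in> punctured_space n. tuple_eval N \<Sigma> F x \<in> exceptional_set N \<Sigma>}"
    unfolding Reg_eq[OF base phi] by (auto simp: proj_space_def)
qed

end

lemma complete_lifting_exists:
  assumes "y1 \<in> span rays" "y2 \<in> span rays"
  shows "\<exists>F. complete_lifting n N \<Sigma> \<phi> F"
proof -
  have "\<forall>p\<in>P. \<exists>a::'a \<Rightarrow> nat. e p = (\<Sum>v\<in>rays. of_nat (a v) *\<^sub>R v) \<and>
    (\<forall>\<sigma>\<in>\<Sigma>. e p \<in> \<sigma> \<longleftrightarrow> (\<forall>v\<in>rays. a v \<noteq> 0 \<longrightarrow> v \<in> \<sigma>))"
    using ray_multiplicities by blast
  from bchoice[OF this] obtain a where a: "\<forall>p\<in>P. e p = (\<Sum>v\<in>rays. of_nat (a p v :: nat) *\<^sub>R v) \<and>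
    (\<forall>\<sigma>\<in>\<Sigma>. e p \<in> \<sigma> \<longleftrightarrow> (\<forall>v\<in>rays. a p v \<noteq> 0 \<longrightarrow> v \<in> \<sigma>))" by (elim exE)
  obtain s1 where s1: "y1 = (\<Sum>v\<in>rays. s1 v *\<^sub>R v)" using assms(1) unfolding span_finite[OF finite_rays] by blast
  obtain s2 where s2: "y2 = (\<Sum>v\<in>rays. s2 v *\<^sub>R v)" using assms(2) unfolding span_finite[OF finite_rays] by blast
  show ?thesis by (rule exI, rule complete_lifting_F[of a s1 s2]) (use a s1 s2 in auto)
qed

end

end

section \<open>Valuations of a dominant map\<close>

context toric_fan
begin

lemma hom_poly_point:
  assumes "w \<in> polys {..n}" "w \<noteq> 0"
  obtains x where "x \<in> punctured_space n" "poly_eval w x \<noteq> 0"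
  using vanishing_on_open[of w n 1] assms subring_ofD(2)[OF polys_subring] by auto

lemma morphism_preimage_open:
  assumes "morphism n N \<Sigma> U f" "openin (zariski_toric N \<Sigma>) V"
  shows "openin (zariski_proj n) {Q \<in> U. f Q \<in> V}"
proof -
  have U: "openin (zariski_proj n) U" and c: "continuous_map (subtopology (zariski_proj n) U) (zariski_toric N \<Sigma>) f"
    using assms(1) by (auto simp: morphism_def)
  have "openin (subtopology (zariski_proj n) U) {Q \<in> topspace (subtopology (zariski_proj n) U). f Q \<in> V}"
    using c assms(2) by (auto simp: continuous_map_def)
  moreover have top: "topspace (subtopology (zariski_proj n) U) = U" using openin_subset[OF U] by auto
  ultimately show ?thesis by (simp only: top openin_open_subtopology[OF U])
qed

text \<open>The torus is a nonempty open set, so a dense image meets it and its preimage is a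
  nonempty open set. This preimage meets the domain of the chosen representative because a product
  of nonzero polynomials is nonzero.\<close>

lemma dominant_torus_point:
  assumes base: "(U0, f0) \<in> map_reps n N \<Sigma>" and phi: "\<phi> = map_equiv n N \<Sigma> `` {(U0, f0)}"
    and dom: "dominant N \<Sigma> \<phi>"
  obtains x where "x \<in> punctured_space n" "proj_pt x \<in> U0" "f0 (proj_pt x) \<in> toric_pt N \<Sigma> {0} ` chart N {0}"
proof -
  let ?V = "toric_pt N \<Sigma> {0} ` chart N {0}"
  obtain U f where U: "(U, f) \<in> \<phi>" "zariski_toric N \<Sigma> closure_of (f ` U) = toric_variety N \<Sigma>"
    using dom unfolding dominant_def by blast
  have rep: "(U, f) \<in> map_reps n N \<Sigma>" "\<forall>Q\<in>U0 \<inter> U. f0 Q = f Q"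
    using U(1) unfolding phi by (auto simp: map_equiv_def)
  have one: "restrict (\<lambda>_. 1) M \<in> chart N {0}"
    using dual_closed[OF lat] by (auto simp: chart_def semigroup_zero)
  define T where "T = toric_pt N \<Sigma> {0} (restrict (\<lambda>_. 1) M)"
  have "T \<in> toric_variety N \<Sigma>"
    unfolding T_def toric_variety_def toric_pt_def by (rule quotientI) (use zero_in one in auto)
  then have "T \<in> zariski_toric N \<Sigma> closure_of (f ` U)" using U(2) by simp
  then have cl: "\<And>W. T \<in> W \<and> openin (zariski_toric N \<Sigma>) W \<Longrightarrow> \<exists>z. z \<in> f ` U \<and> z \<in> W"
    unfolding in_closure_of by simp
  have "T \<in> ?V" unfolding T_def using one by blast
  then obtain z where "z \<in> f ` U" "z \<in> ?V" using cl[of ?V] chart_open[OF zero_in] by blast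
  then have ne: "{Q \<in> U. f Q \<in> ?V} \<noteq> {}" by blast
  have op: "openin (zariski_proj n) {Q \<in> U. f Q \<in> ?V}"
    using rep(1) morphism_preimage_open chart_open[OF zero_in] by (auto simp: map_reps_def)
  obtain w1 where w1: "w1 \<in> hom_polys n" "w1 \<noteq> 0"
    "\<forall>x\<in>punctured_space n. poly_eval w1 x \<noteq> 0 \<longrightarrow> proj_pt x \<in> {Q \<in> U. f Q \<in> ?V}"
    using nonempty_open_hom_poly[OF op ne] by blast
  have "openin (zariski_proj n) U0" "U0 \<noteq> {}" using base by (auto simp: map_reps_def morphism_def)
  from nonempty_open_hom_poly[OF this] obtain w2 where w2: "w2 \<in> hom_polys n" "w2 \<noteq> 0"
    "\<forall>x\<in>punctured_space n. poly_eval w2 x \<noteq> 0 \<longrightarrow> proj_pt x \<in> U0" by blast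
  have "w1 * w2 \<in> polys {..n}" "w1 * w2 \<noteq> 0"
    using hom_polys_mult[OF w1(1) w2(1)] w1(2) w2(2) by (auto simp: hom_polys_def)
  then obtain x where x: "x \<in> punctured_space n" "poly_eval (w1 * w2) x \<noteq> 0" by (rule hom_poly_point)
  then have "poly_eval w1 x \<noteq> 0" "poly_eval w2 x \<noteq> 0" by (auto simp: poly_eval_mult)
  then have "proj_pt x \<in> {Q \<in> U. f Q \<in> ?V}" "proj_pt x \<in> U0" using w1(3) w2(3) x(1) by blast+
  then show ?thesis using that[OF x(1)] rep(2) by auto
qed

lemma complete_lifting_exists:
  assumes comp: "complete_variety N \<Sigma>"
    and base: "(U0, f0) \<in> map_reps n N \<Sigma>" and phi: "\<phi> = map_equiv n N \<Sigma> `` {(U0, f0)}"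
    and dom: "dominant N \<Sigma> \<phi>"
    and codim: "codim (zariski_proj n) (rat_preimage \<phi> (singular_locus N \<Sigma>)) \<ge> 2"
  shows "\<exists>F. complete_lifting n N \<Sigma> \<phi> F"
proof -
  let ?V = "toric_pt N \<Sigma> {0} ` chart N {0}"
  have mor: "morphism n N \<Sigma> U0 f0" using base by (auto simp: map_reps_def)
  obtain x0 where x0: "x0 \<in> punctured_space n" "proj_pt x0 \<in> U0" "f0 (proj_pt x0) \<in> ?V"
    using dominant_torus_point[OF base phi dom] by blast
  obtain B w where B: "independent B" "finite B" "B \<subseteq> N" "span N = span B"
    "\<And>v. v \<in> N \<longleftrightarrow> v \<in> span N \<and> (\<forall>b\<in>B. w b \<bullet> v \<in> \<int>)"
    "\<And>b. b \<in> B \<Longrightarrow> w b \<in> dual_lattice N"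
    "\<And>b b'. b \<in> B \<Longrightarrow> b' \<in> B \<Longrightarrow> w b \<bullet> b' = (if b = b' then 1 else 0)"
    "\<And>x. x \<in> span N \<Longrightarrow> x = (\<Sum>b\<in>B. (x \<bullet> b) *\<^sub>R w b)"
    "\<And>x. x \<in> span N \<Longrightarrow> x = (\<Sum>b\<in>B. (w b \<bullet> x) *\<^sub>R b)"
    by (rule lattice_basis[OF lat]) blast
  have "\<exists>h num den k. h \<in> hom_polys n \<and> poly_eval h x0 \<noteq> 0 \<and> num \<in> polys {..n} \<and> den \<in> polys {..n} \<and>
    homogeneous k num \<and> homogeneous k den \<and>
    (\<forall>y\<in>punctured_space n. poly_eval h y \<noteq> 0 \<longrightarrow> proj_pt y \<in> U0 \<and> f0 (proj_pt y) \<in> ?V \<and> poly_eval den y \<noteq> 0 \<and>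
      character_value {0} u (f0 (proj_pt y)) = poly_eval num y / poly_eval den y)" if "u \<in> M" for u
    using morphism_character[OF mor zero_in _ x0, of u] that semigroup_zero by metis
  then obtain h num den k where hnd: "\<And>u. u \<in> M \<Longrightarrow> h u \<in> hom_polys n \<and> poly_eval (h u) x0 \<noteq> 0 \<and>
    num u \<in> polys {..n} \<and> den u \<in> polys {..n} \<and> homogeneous (k u) (num u) \<and> homogeneous (k u) (den u) \<and>
    (\<forall>y\<in>punctured_space n. poly_eval (h u) y \<noteq> 0 \<longrightarrow> proj_pt y \<in> U0 \<and> f0 (proj_pt y) \<in> ?V \<and> poly_eval (den u) y \<noteq> 0 \<and>
      character_value {0} u (f0 (proj_pt y)) = poly_eval (num u) y / poly_eval (den u) y)"
    by metis
  have zM: "0 \<in> M" using dual_closed(1)[OF lat] .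
  have val: "\<exists>\<gamma>\<in>chart N {0}. f0 (proj_pt y) = toric_pt N \<Sigma> {0} \<gamma>" if "y \<in> punctured_space n" "poly_eval (h 0) y \<noteq> 0" for y
    using hnd[OF zM] that by blast
  have ratio: "\<gamma> u = poly_eval (num u) y / poly_eval (den u) y \<and> poly_eval (num u) y \<noteq> 0 \<and> poly_eval (den u) y \<noteq> 0"
    if u: "u \<in> M" and y: "y \<in> punctured_space n" "poly_eval (h u) y \<noteq> 0"
      and g: "\<gamma> \<in> chart N {0}" "f0 (proj_pt y) = toric_pt N \<Sigma> {0} \<gamma>" for u y \<gamma>
  proof -
    have "\<gamma> u = poly_eval (num u) y / poly_eval (den u) y" "poly_eval (den u) y \<noteq> 0"
      using hnd[OF u] y g(2) character_value_eq[OF zero_in g(1)] by auto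
    moreover have "\<gamma> u \<noteq> 0"
      using chart_unit[OF g(1)] u dual_closed(3)[OF lat u] by (simp add: semigroup_zero)
    ultimately show ?thesis by auto
  qed
  obtain \<gamma>0 where g0: "\<gamma>0 \<in> chart N {0}" "f0 (proj_pt x0) = toric_pt N \<Sigma> {0} \<gamma>0"
    using x0(3) by blast
  have nz: "num u \<noteq> 0" "den u \<noteq> 0" if "u \<in> M" for u
    using ratio[OF that x0(1) _ g0] hnd[OF that] by auto
  \<comment> \<open>Numerators and denominators of the pullbacks of a basis of \<open>M\<close> are
    factored together, so that all of them use the same primes.\<close>
  define A where "A s = (if snd s then num (w (fst s)) else den (w (fst s)))" for s :: "'a \<times> bool"
  obtain P c m where P: "finite P" "\<And>p. p \<in> P \<Longrightarrow> prime_in (polys {..n}) p \<and> (\<exists>k. homogeneous k p)"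
    "\<And>p q. p \<in> P \<Longrightarrow> q \<in> P \<Longrightarrow> dvd_in (polys {..n}) p q \<Longrightarrow> p = q"
    "\<And>s. s \<in> B \<times> UNIV \<Longrightarrow> c s \<noteq> 0 \<and> A s = const_poly (c s) * (\<Prod>p\<in>P. p ^ m s p)"
  proof (rule homogeneous_factorization[of "{..n}" "B \<times> (UNIV :: bool set)" A])
    show "finite (B \<times> (UNIV :: bool set))" using B(2) by simp
    fix s assume "s \<in> B \<times> (UNIV :: bool set)"
    then have "w (fst s) \<in> M" using B(6) by auto
    then show "A s \<in> polys {..n} \<and> A s \<noteq> 0 \<and> (\<exists>k. homogeneous k (A s))"
      using hnd[of "w (fst s)"] nz[of "w (fst s)"] unfolding A_def by auto
  qed (blast+)
  \<comment> \<open>A logarithm makes the constants additive: real and imaginary parts become the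
    coordinates of \<open>y1\<close> and \<open>y2\<close>, whatever branch is taken.\<close>
  define z where "z b = Ln (c (b, True) / c (b, False))" for b
  define y1 where "y1 = (\<Sum>b\<in>B. Re (z b) *\<^sub>R b)"
  define y2 where "y2 = (\<Sum>b\<in>B. Im (z b) *\<^sub>R b)"
  \<comment> \<open>The coordinate of \<open>e p\<close> along \<open>b\<close> is the order of the
    pullback of the basis character \<open>w b\<close> along \<open>p\<close>.\<close>
  define e where "e p = (\<Sum>b\<in>B. (of_nat (m (b, True) p) - of_nat (m (b, False) p)) *\<^sub>R b)" for p
  have coord: "w b \<bullet> (\<Sum>b'\<in>B. f b' *\<^sub>R b') = f b" if "b \<in> B" for b f
  proof -
    have "w b \<bullet> (\<Sum>b'\<in>B. f b' *\<^sub>R b') = (\<Sum>b'\<in>B. if b' = b then f b' else 0)"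
      unfolding inner_sum_right using B(7) that by (intro sum.cong) auto
    then show ?thesis using B(2) that by simp
  qed
  have we: "w b \<bullet> e p = of_int (int (m (b, True) p) - int (m (b, False) p))" if "b \<in> B" for b p
    unfolding e_def using coord[OF that, of "\<lambda>b. of_nat (m (b, True) p) - of_nat (m (b, False) p)"] by simp
  have espan: "e p \<in> span N" for p unfolding e_def using B(3) by (intro span_sum span_mul span_base) auto
  have eN: "e p \<in> N" for p unfolding B(5)[of "e p"] using espan we by auto
  have hdegs: "homogeneous (hom_deg p) p" if "p \<in> P" for p using P(2)[OF that] homogeneous_hom_deg by blast
  \<comment> \<open>Numerator and denominator have the same degree, and this makes the weighted sum
    of orders vanish for each basis character, hence for every character.\<close>
  have degree: "(\<Sum>p\<in>P. m (b, t) p * hom_deg p) = k (w b)" if b: "b \<in> B" for b t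
  proof -
    have s: "(b, t) \<in> B \<times> UNIV" using b by simp
    have "homogeneous (\<Sum>p\<in>P. m (b, t) p * hom_deg p) (A (b, t))"
      using P(4)[OF s] homogeneous_const_mult homogeneous_prod homogeneous_power hdegs by (metis (no_types, lifting))
    moreover have "homogeneous (k (w b)) (A (b, t))" "A (b, t) \<noteq> 0"
      using hnd[OF B(6)[OF b]] nz[OF B(6)[OF b]] by (auto simp: A_def)
    ultimately show ?thesis using homogeneous_unique by blast
  qed
  have deg: "(\<Sum>p\<in>P. of_nat (hom_deg p) * (u \<bullet> e p)) = 0" if u: "u \<in> M" for u
  proof -
    have us: "u \<in> span N" using u by (simp add: dual_lattice_def)
    have "(\<Sum>p\<in>P. of_nat (hom_deg p) * (w b \<bullet> e p)) = 0" if b: "b \<in> B" for b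
    proof -
      have "(\<Sum>p\<in>P. of_nat (hom_deg p) * (w b \<bullet> e p)) =
          of_nat (\<Sum>p\<in>P. m (b, True) p * hom_deg p) - of_nat (\<Sum>p\<in>P. m (b, False) p * hom_deg p)"
        by (simp add: we[OF b] right_diff_distrib sum_subtractf mult.commute)
      then show ?thesis unfolding degree[OF b] by simp
    qed
    moreover have "u \<bullet> e p = (\<Sum>b\<in>B. (u \<bullet> b) * (w b \<bullet> e p))" for p
      by (subst B(8)[OF us]) (simp add: inner_sum_left)
    then have "(\<Sum>p\<in>P. of_nat (hom_deg p) * (u \<bullet> e p)) =
        (\<Sum>b\<in>B. (u \<bullet> b) * (\<Sum>p\<in>P. of_nat (hom_deg p) * (w b \<bullet> e p)))"
      unfolding sum_distrib_left by (subst sum.swap) (simp add: sum_distrib_left mult.left_commute)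
    ultimately show ?thesis by simp
  qed
  interpret V: valuation_data N \<Sigma> n P e y1 y2
    by unfold_locales (use P eN deg complete_support[OF comp] in auto)
  \<comment> \<open>Off the zeros of \<open>H\<close> the representative has values in the torus,
    the fractions for all basis characters are valid, and no prime vanishes.\<close>
  define H where "H = h 0 * (\<Prod>b\<in>B. h (w b)) * \<Prod>P"
  have hb: "h (w b) \<in> hom_polys n" if "b \<in> B" for b using hnd[OF B(6)[OF that]] by blast
  have HH: "H \<in> hom_polys n" unfolding H_def
    using hnd[OF zM] hb V.P_props(3) by (intro hom_polys_mult hom_polys_prod) auto
  have "h u \<noteq> 0" if "u \<in> M" for u using hnd[OF that] by auto
  then have H0: "H \<noteq> 0" unfolding H_def using zM B(2,6) P(1) V.P_props(2) by auto
  have "V.agrees_generically U0 f0" unfolding V.agrees_generically_def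
  proof (rule bexI[OF _ HH], intro conjI ballI impI H0)
    fix y assume y: "y \<in> punctured_space n" "poly_eval H y \<noteq> 0"
    then have h0: "poly_eval (h 0) y \<noteq> 0" and hw: "\<And>b. b \<in> B \<Longrightarrow> poly_eval (h (w b)) y \<noteq> 0"
      and pn: "\<And>p. p \<in> P \<Longrightarrow> poly_eval p y \<noteq> 0"
      using B(2) P(1) by (auto simp: H_def poly_eval_mult poly_eval_prod)
    show "proj_pt y \<in> U0" using hnd[OF zM] y(1) h0 by blast
    show yG: "y \<in> V.G {0}" using y(1) pn by (auto simp: V.G_def)
    obtain \<gamma> where g: "\<gamma> \<in> chart N {0}" "f0 (proj_pt y) = toric_pt N \<Sigma> {0} \<gamma>" using val[OF y(1) h0] by blast
    \<comment> \<open>A torus point is determined by its values on a basis of \<open>M\<close>, so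
      only the characters \<open>w b\<close> used in the construction have to be compared.\<close>
    have "\<gamma> = restrict (V.gam y) (S {0})"
    proof (rule torus_chart_eqI[OF B(2,6) _ B(3) g(1) V.gam_chart[OF zero_in yG]])
      show "u = (\<Sum>b\<in>B. (u \<bullet> b) *\<^sub>R w b)" if "u \<in> M" for u using B(8) that by (simp add: dual_lattice_def)
      fix b assume b: "b \<in> B"
      have ev: "poly_eval (A (b, t)) y = c (b, t) * (\<Prod>p\<in>P. poly_eval p y ^ m (b, t) p)" for t
        using P(4)[of "(b, t)"] b by (simp add: poly_eval_simps)
      have "\<gamma> (w b) = poly_eval (A (b, True)) y / poly_eval (A (b, False)) y"
        using ratio[OF B(6)[OF b] y(1) hw[OF b] g] by (simp add: A_def)
      also have "\<dots> = (c (b, True) / c (b, False)) * (\<Prod>p\<in>P. poly_eval p y ^ m (b, True) p / poly_eval p y ^ m (b, False) p)"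
        unfolding ev prod_dividef by simp
      also have "(\<Prod>p\<in>P. poly_eval p y ^ m (b, True) p / poly_eval p y ^ m (b, False) p) =
          (\<Prod>p\<in>P. poly_eval p y powi \<lfloor>w b \<bullet> e p\<rfloor>)"
        by (intro prod.cong refl) (simp add: we[OF b] power_int_diff pn del: of_int_diff)
      also have "c (b, True) / c (b, False) = exp (z b)"
        using P(4)[of "(b, True)"] P(4)[of "(b, False)"] b by (simp add: z_def)
      also have "z b = Complex (w b \<bullet> y1) (w b \<bullet> y2)"
        unfolding y1_def y2_def coord[OF b] by (simp add: complex_eq_iff)
      finally show "\<gamma> (w b) = restrict (V.gam y) (S {0}) (w b)"
        using B(6)[OF b] by (simp add: V.gam_def semigroup_zero)
    qed
    then show "f0 (proj_pt y) = V.pt {0} y" using g(2) by (simp add: V.pt_def)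
  qed
  moreover have "b \<in> span rays" if "b \<in> B" for b
    using span_base[of b N] span_rays[OF comp] B(3) that by blast
  then have "y1 \<in> span rays" "y2 \<in> span rays" unfolding y1_def y2_def by (intro span_sum span_mul; blast)+
  ultimately show ?thesis using V.complete_lifting_exists[OF base _ phi codim] by blast
qed

end

theorem proposition2p12:
  fixes N :: "'a::euclidean_space set"
    and \<Sigma> :: "'a set set"
    and n :: nat
    and \<phi> :: "'a map_rep set"
  assumes "is_lattice N"
    and "is_fan N \<Sigma>"
    and "complete_variety N \<Sigma>"
    and "simplicial_fan N \<Sigma>"
    and "\<phi> \<in> rational_maps n N \<Sigma>"
    and "dominant N \<Sigma> \<phi>"
    and "codim (zariski_proj n) (rat_preimage \<phi> (singular_locus N \<Sigma>)) \<ge> 2"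
  shows "\<exists>F. complete_lifting n N \<Sigma> \<phi> F"
proof -
  interpret toric_fan N \<Sigma> by unfold_locales (use assms in auto)
  obtain r where r: "r \<in> map_reps n N \<Sigma>" "\<phi> = map_equiv n N \<Sigma> `` {r}"
    using assms(5) unfolding rational_maps_def by (rule quotientE)
  obtain U0 f0 where "r = (U0, f0)" by (cases r)
  then show ?thesis using complete_lifting_exists[OF assms(3) _ _ assms(6,7)] r by blast
qed

end
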